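(* Let $n\ge1$, let $S_1,\dots,S_n\subset\partial\mathbb D$ be nonempty closed sets and $S=\prod_{k=1}^nS_k\subset(\partial\mathbb D)^n$. Let $M_S$ be the maximal ideal space of the algebra $H^\infty(\mathbb D^n)\cap SAP^n(S)$ and let $M_{S_k}$ be the maximal ideal space of the algebra $H^\infty(\mathbb D)\cap SAP(S_k)$, $1\le k\le n$. Then $M_S$ is homeomorphic to $M_{S_1}\times\cdots\times M_{S_n}$. Moreover, the Corona Theorem is valid for $H^\infty(\mathbb D^n)\cap SAP^n(S)$, i.e., $\mathbb D^n$ (identified with the set of evaluation functionals at points of $\mathbb D^n$) is dense in $M_S$ in the Gelfand topology.
   Context: $\mathbb D\subset\mathbb C$ is the open unit disk, $\partial\mathbb D$ the unit circle. $H^\infty(\mathbb D^n)$ is the algebra of bounded holomorphic functions on $\mathbb D^n$ with sup-norm; its elements are identified with their boundary values in $L^\infty((\partial\mathbb D)^n)$. The maximal ideal space of a commutative unital Banach algebra is the set of its nonzero continuous complex characters with the Gelfand (weak$^*$) topology. A bounded continuous function $f:\mathbb R\to\mathbb C$ is almost periodic, $f\in AP(\mathbb R)$, if the family of its shifts $\{f(\cdot+\tau)\}_{\tau\in\mathbb R}$ is relatively compact in the space of bounded continuous functions on $\mathbb R$ with the sup-norm. For $t_0\in\mathbb R$, $0<s<2\pi$ and $k\in\{-1,1\}$ let $\gamma_{t_0}^k(s):=\{e^{i(t_0+kt)}:\ 0<t<s\}$. A function $f\in L^\infty(\partial\mathbb D)$ is semi-almost periodic on $\partial\mathbb D$ if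 for any $t_0\in[0,2\pi)$ and any $\varepsilon>0$ there exist $s=s(t_0,\varepsilon)\in(0,\pi)$ and functions $f_k:\gamma_{t_0}^k(s)\to\mathbb C$, $k\in\{-1,1\}$, such that the functions $t\mapsto f_k(e^{i(t_0+kse^t)})$, $-\infty<t<0$, $k\in\{-1,1\}$, are restrictions of some functions from $AP(\mathbb R)$ and $\sup_{z\in\gamma_{t_0}^k(s)}|f(z)-f_k(z)|<\varepsilon$ for $k\in\{-1,1\}$ (suprema of $L^\infty$ functions are essential suprema). For a closed set $S_0\subset\partial\mathbb D$, $SAP(S_0)$ is the Banach algebra (sup-norm) of semi-almost periodic functions on $\partial\mathbb D$ that are continuous on $\partial\mathbb D\setminus S_0$. $SAP^n(S):=\bigotimes_{k=1}^nSAP(S_k)$ is the uniform closure of the algebra of complex polynomials in variables $f_1(z_1),\dots,f_n(z_n)$, $z=(z_1,\dots,z_n)\in(\partial\mathbb D)^n$, with $f_k\in SAP(S_k)$, $1\le k\le n$. *)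

theory Defs
  imports "HOL-Analysis.Analysis"
begin

section \<open>Almost periodic and semi-almost periodic functions\<close>

definition almost_periodic :: "(real \<Rightarrow> complex) set" where
  "almost_periodic =
     {f \<in> bcontfun. compact (closure (range (\<lambda>\<tau>. Bcontfun (\<lambda>t. f (t + \<tau>)))))}"

text \<open>
  Arc length on the unit circle, as a measure on the Borel sets of the circle, and its product
  on the torus. The index type of the coordinates plays the role of the set \<open>{1, \<dots>, n}\<close>;
  points of complex n-space are functions on it.
\<close>

definition circle :: "complex measure" where
  "circle = distr (restrict_space lborel {0..<2 * pi}) (restrict_space borel (sphere 0 1)) cis"

definition torus :: "('n::finite \<Rightarrow> complex) measure" where
  "torus = (\<Pi>\<^sub>M k\<in>UNIV. circle)"

text \<open>
  Elements of the essentially bounded function spaces are represented by Borel functions. All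
  conditions imposed on them below are invariant under changes on null sets, so classes modulo
  null sets need not be formed.
\<close>

definition ess_bounded :: "'a measure \<Rightarrow> ('a \<Rightarrow> complex) set" where
  "ess_bounded M = {f \<in> borel_measurable M. \<exists>C. AE z in M. norm (f z) \<le> C}"

definition circle_arc :: "real \<Rightarrow> real \<Rightarrow> real \<Rightarrow> complex set" where
  "circle_arc t0 k s = {cis (t0 + k * t) |t. 0 < t \<and> t < s}"

text \<open>The last conjunct says that the essential supremum of \<open>|f - fk|\<close> over the arc is
  less than \<open>\<epsilon>\<close>.\<close>

definition semi_almost_periodic :: "(complex \<Rightarrow> complex) \<Rightarrow> bool" where
  "semi_almost_periodic f \<longleftrightarrow>
     f \<in> ess_bounded circle \<and>
     (\<forall>t0\<in>{0..<2 * pi}. \<forall>\<epsilon>>0. \<exists>s\<in>{0<..<pi}. \<forall>k\<in>{-1, 1}. \<exists>fk :: complex \<Rightarrow> complex.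
        (\<exists>g\<in>almost_periodic. \<forall>t<0. fk (cis (t0 + k * s * exp t)) = g t) \<and>
        (\<exists>\<delta><\<epsilon>. AE z in circle. z \<in> circle_arc t0 k s \<longrightarrow> norm (f z - fk z) \<le> \<delta>))"

text \<open>As for any class of functions modulo null sets, continuity on a set means having a
  representative that is continuous there.\<close>

definition SAP :: "complex set \<Rightarrow> (complex \<Rightarrow> complex) set" where
  "SAP S0 = {f. semi_almost_periodic f \<and>
     (\<exists>g. continuous_on (sphere 0 1 - S0) g \<and>
          (AE z in circle. z \<in> sphere 0 1 - S0 \<longrightarrow> f z = g z))}"

inductive_set SAP_poly :: "('n::finite \<Rightarrow> complex set) \<Rightarrow> (('n \<Rightarrow> complex) \<Rightarrow> complex) set"
  for S :: "'n::finite \<Rightarrow> complex set" where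
  var: "f \<in> SAP (S k) \<Longrightarrow> (\<lambda>z. f (z k)) \<in> SAP_poly S"
| const: "(\<lambda>z. c) \<in> SAP_poly S"
| add: "p \<in> SAP_poly S \<Longrightarrow> q \<in> SAP_poly S \<Longrightarrow> (\<lambda>z. p z + q z) \<in> SAP_poly S"
| mult: "p \<in> SAP_poly S \<Longrightarrow> q \<in> SAP_poly S \<Longrightarrow> (\<lambda>z. p z * q z) \<in> SAP_poly S"

definition SAPn :: "('n::finite \<Rightarrow> complex set) \<Rightarrow> (('n \<Rightarrow> complex) \<Rightarrow> complex) set" where
  "SAPn S = {F \<in> ess_bounded torus.
     \<forall>\<epsilon>>0. \<exists>p\<in>SAP_poly S. AE z in torus. norm (F z - p z) \<le> \<epsilon>}"

section \<open>Bounded holomorphic functions and their boundary values\<close>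

definition polydisc :: "('n::finite \<Rightarrow> complex) set" where
  "polydisc = {z. \<forall>k. norm (z k) < 1}"

text \<open>
  Functions on the disc or polydisc are normalised to vanish outside their domain, so that
  equality of functions on the domain is equality in HOL and pointwise operations stay within the
  algebra. Holomorphic in several variables means continuous and holomorphic in each variable
  separately; \<open>'n \<Rightarrow> complex\<close> carries the product topology.
\<close>

definition Hinf :: "(complex \<Rightarrow> complex) set" where
  "Hinf = {f. f holomorphic_on ball 0 1 \<and> bounded (f ` ball 0 1) \<and> (\<forall>z. z \<notin> ball 0 1 \<longrightarrow> f z = 0)}"

definition Hinf_n :: "(('n::finite \<Rightarrow> complex) \<Rightarrow> complex) set" where
  "Hinf_n = {f. continuous_on polydisc f \<and>
     (\<forall>z\<in>polydisc. \<forall>k. (\<lambda>w. f (z(k := w))) holomorphic_on ball 0 1) \<and>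
     bounded (f ` polydisc) \<and> (\<forall>z. z \<notin> polydisc \<longrightarrow> f z = 0)}"

text \<open>A bounded holomorphic function is identified with its almost everywhere existing radial
  limits.\<close>

definition Hinf_SAP :: "complex set \<Rightarrow> (complex \<Rightarrow> complex) set" where
  "Hinf_SAP S0 = {f \<in> Hinf. \<exists>F\<in>SAP S0. AE z in circle.
     ((\<lambda>r. f (complex_of_real r * z)) \<longlongrightarrow> F z) (at_left 1)}"

definition Hinf_SAPn :: "('n::finite \<Rightarrow> complex set) \<Rightarrow> (('n \<Rightarrow> complex) \<Rightarrow> complex) set" where
  "Hinf_SAPn S = {f \<in> Hinf_n. \<exists>F\<in>SAPn S. AE z in torus.
     ((\<lambda>r. f (\<lambda>k. complex_of_real r * z k)) \<longlongrightarrow> F z) (at_left 1)}"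

section \<open>Maximal ideal spaces of function algebras\<close>

text \<open>
  \<open>A\<close> is an algebra of bounded functions on \<open>D\<close>, normed by the supremum over \<open>D\<close>.
  Characters are extensional functions on \<open>A\<close>; continuity of these linear functionals is
  expressed as boundedness.
\<close>

definition characters :: "'a set \<Rightarrow> ('a \<Rightarrow> complex) set \<Rightarrow> (('a \<Rightarrow> complex) \<Rightarrow> complex) set" where
  "characters D A = {\<phi> \<in> A \<rightarrow>\<^sub>E UNIV.
     (\<forall>f\<in>A. \<forall>g\<in>A. \<phi> (\<lambda>z. f z + g z) = \<phi> f + \<phi> g) \<and>
     (\<forall>c. \<forall>f\<in>A. \<phi> (\<lambda>z. c * f z) = c * \<phi> f) \<and>
     (\<forall>f\<in>A. \<forall>g\<in>A. \<phi> (\<lambda>z. f z * g z) = \<phi> f * \<phi> g) \<and>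
     (\<exists>f\<in>A. \<phi> f \<noteq> 0) \<and>
     (\<exists>C. \<forall>f\<in>A. norm (\<phi> f) \<le> C * (SUP z\<in>D. norm (f z)))}"

text \<open>The topology of pointwise convergence on \<open>A\<close>, i.e. the Gelfand (weak*) topology.\<close>

definition max_ideal_space ::
    "'a set \<Rightarrow> ('a \<Rightarrow> complex) set \<Rightarrow> (('a \<Rightarrow> complex) \<Rightarrow> complex) topology" where
  "max_ideal_space D A = subtopology (product_topology (\<lambda>f. euclidean) A) (characters D A)"

definition point_eval :: "('a \<Rightarrow> complex) set \<Rightarrow> 'a \<Rightarrow> ('a \<Rightarrow> complex) \<Rightarrow> complex" where
  "point_eval A z = (\<lambda>f\<in>A. f z)"

end

theory Submission
  imports Defs "HOL-Complex_Analysis.Complex_Analysis" "HOL-Real_Asymp.Real_Asymp"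
begin

text \<open>
  Restricting a character along the coordinates gives a continuous map from \<open>M_S\<close> to the product of
  the \<open>M_{S_k}\<close>. It suffices that this map is injective and that the disc is dense in each
  \<open>M_{S_k}\<close>: the image of the closure of the polydisc is then compact and dense, hence everything.

  Both facts rest on a local description: near a point \<open>\<zeta>\<close> of the closed polydisc every function of
  the algebra is uniformly close to a finite sum of products of the functions
  \<open>exp (i l Ln (1 - cnj (\<zeta> k) z k))\<close>. It is obtained from Bohr's approximation theorem on the boundary,
  from Poisson integrals, and from averaging along the contractions towards \<open>\<zeta> k\<close> against Fejer kernels
  of Folner sets. A character whose value at the coordinates is \<open>\<zeta>\<close> sees only this local behaviour:
  one divides by \<open>z k - \<zeta> k\<close> in the interior directions and uses peak functions in the others.
  On one disc, the values of a character at the powers form a homomorphism from the reals, which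
  Kronecker's theorem approximates by evaluations at points of the disc.
\<close>

section \<open>Bohr's approximation theorem on a half-line\<close>

text \<open>The factors of the polynomials behind \<open>SAPn\<close> need not be boundary values of
  holomorphic functions, so a function of the algebra is at first approximated only by tensors of
  harmonic functions, on which characters say nothing. The way back to holomorphic approximants uses
  a symmetry: moving \<open>z k\<close> towards \<open>\<zeta> k\<close> by the factor
  \<open>exp (- x)\<close> shifts \<open>Ln (1 - cnj (\<zeta> k) * z k)\<close> by
  \<open>- x\<close>, and near \<open>\<zeta>\<close> the tensors are almost periodic in
  \<open>x\<close>. Means over \<open>x\<close> of the function itself stay holomorphic; their
  limits are multiplied by \<open>cis (- l * x)\<close> under the motion, and a holomorphic function
  with this behaviour is a power times a function of the other coordinates. These powers do belong
  to the algebra when \<open>\<zeta> k\<close> lies in \<open>S k\<close>. On one disc, the values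
  \<open>h l\<close> of a character at the powers are bounded by
  \<open>exp (\<bar>l\<bar> * (pi / 2))\<close>, because the argument of
  \<open>1 - cnj \<zeta> * z\<close> stays between \<open>- pi / 2\<close> and
  \<open>pi / 2\<close>. The modulus of \<open>h\<close> then encodes a direction of approach to
  \<open>\<zeta>\<close>, its phase a generalised limit of the logarithmic distance to
  \<open>\<zeta>\<close>.\<close>

lemma sum_roots_of_unity:
  fixes d :: int
  assumes "m > 0"
  shows "(\<Sum>r<m. cis (2 * pi * real r * real_of_int d / real m))
           = (if int m dvd d then of_nat m else 0)"
proof -
  let ?x = "cis (2 * pi * real_of_int d / real m)"
  have pow: "cis (2 * pi * real r * real_of_int d / real m) = ?x ^ r" for r
    by (simp add: Complex.DeMoivre algebra_simps)
  have xm: "?x ^ m = 1"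
  proof -
    have "?x ^ m = cis (2 * pi * real_of_int d)"
      using assms by (simp add: Complex.DeMoivre algebra_simps)
    then show ?thesis by (simp add: cis_multiple_2pi)
  qed
  have x1: "?x = 1 \<longleftrightarrow> int m dvd d"
  proof
    assume "?x = 1"
    then have "cos (2 * pi * real_of_int d / real m) = 1"
      by (metis cis.simps(1) one_complex.simps(1))
    then obtain n :: int where "2 * pi * real_of_int d / real m = of_int n * 2 * pi"
      by (auto simp: cos_one_2pi_int)
    then have "real_of_int d = of_int n * real m" using assms by (simp add: field_simps)
    then have "d = n * int m" by (metis of_int_eq_iff of_int_mult of_int_of_nat_eq)
    then show "int m dvd d" by simp
  next
    assume "int m dvd d"
    then obtain n where "d = int m * n" by blast
    then show "?x = 1" using assms cis_multiple_2pi[of "of_int n"] by (simp add: mult.assoc)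
  qed
  show ?thesis
  proof (cases "int m dvd d")
    case True
    then show ?thesis using x1 by (simp add: pow)
  next
    case False
    then have "?x \<noteq> 1" using x1 by simp
    then show ?thesis using False xm by (simp add: pow geometric_sum)
  qed
qed

text \<open>Expand the squared modulus into a double sum; orthogonality of the characters of the
  cyclic group leaves the diagonal.\<close>

lemma finite_Parseval:
  fixes x :: "nat \<Rightarrow> complex"
  assumes "m > 0"
  shows "(\<Sum>r<m. (norm (\<Sum>j<m. x j * cis (- (2 * pi * real r * real j / real m))))\<^sup>2)
           = real m * (\<Sum>j<m. (norm (x j))\<^sup>2)"
proof -
  have "complex_of_real (\<Sum>r<m. (norm (\<Sum>j<m. x j * cis (- (2 * pi * real r * real j / real m))))\<^sup>2)
     = (\<Sum>r<m. (\<Sum>j<m. x j * cis (- (2 * pi * real r * real j / real m)))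
          * cnj (\<Sum>j<m. x j * cis (- (2 * pi * real r * real j / real m))))"
    by (simp only: of_real_sum complex_norm_square)
  also have "\<dots> = (\<Sum>r<m. \<Sum>j<m. \<Sum>k<m. x j * cnj (x k) *
      cis (2 * pi * real r * real_of_int (int k - int j) / real m))"
    by (simp add: sum_product cis_cnj mult_ac cis_mult[symmetric] diff_divide_distrib right_diff_distrib
        cis_divide[symmetric] divide_inverse cis_inverse)
  also have "\<dots> = (\<Sum>j<m. \<Sum>k<m. x j * cnj (x k) *
      (\<Sum>r<m. cis (2 * pi * real r * real_of_int (int k - int j) / real m)))"
    by (subst sum.swap, rule sum.cong[OF refl], subst sum.swap) (simp add: sum_distrib_left)
  also have "\<dots> = (\<Sum>j<m. \<Sum>k<m. if k = j then of_nat m * (x j * cnj (x j)) else 0)"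
  proof (intro sum.cong refl)
    fix j k assume jk: "j \<in> {..<m}" "k \<in> {..<m}"
    have "int m dvd int k - int j \<longleftrightarrow> k = j"
    proof
      assume "int m dvd int k - int j"
      then have "int k mod int m = int j mod int m" by (simp add: mod_eq_dvd_iff)
      then show "k = j" using jk by auto
    qed auto
    then show "x j * cnj (x k) * (\<Sum>r<m. cis (2 * pi * real r * real_of_int (int k - int j) / real m))
        = (if k = j then of_nat m * (x j * cnj (x j)) else 0)"
      by (subst sum_roots_of_unity[OF assms]) auto
  qed
  also have "\<dots> = complex_of_real (real m * (\<Sum>j<m. (norm (x j))\<^sup>2))"
    by (simp add: sum_distrib_left of_real_sum complex_norm_square[symmetric] del: of_real_power)
  finally show ?thesis by (simp only: of_real_eq_iff)
qed

lemma periodic_int_mod: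
  fixes f :: "int \<Rightarrow> 'a"
  assumes "\<And>j. f (j + int m) = f j"
  shows "f (j mod int m) = f j"
proof -
  have nat: "f (i + int m * int n) = f i" for i n
  proof (induction n)
    case (Suc n)
    have "f (i + int m * int (Suc n)) = f (i + int m * int n + int m)" by (simp add: algebra_simps)
    then show ?case using Suc assms by simp
  qed simp
  have all: "f (i + int m * n) = f i" for i n
  proof (cases "n \<ge> 0")
    case True then show ?thesis using nat[of i "nat n"] by simp
  next
    case False
    then show ?thesis using nat[of "i + int m * n" "nat (- n)"] by (simp add: algebra_simps)
  qed
  show ?thesis using all[of "j mod int m" "j div int m"] by (simp add: add.commute)
qed

text \<open>Averaging \<open>f\<close> over the differences of \<open>E\<close> changes it by at most \<open>\<epsilon>\<close> and multiplies its Fourier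
  coefficients by \<open>|\<kappa>|\<^sup>2\<close>; by Parseval few of the \<open>\<kappa> r\<close> are large, with a bound independent of
  the order of the group.\<close>

lemma cyclic_group_approximation:
  fixes f :: "int \<Rightarrow> complex" and m :: nat
  assumes m: "m > 0" and per: "\<And>j. f (j + int m) = f j" and bd: "\<And>j. norm (f j) \<le> C"
    and E: "E \<subseteq> {..<m}" "E \<noteq> {}"
    and close: "\<And>\<tau> \<sigma> j. \<tau> \<in> E \<Longrightarrow> \<sigma> \<in> E \<Longrightarrow> norm (f (j + int \<tau>) - f (j + int \<sigma>)) \<le> \<epsilon>"
    and N: "real m \<le> N * real (card E)" and d: "d > 0"
  shows "\<exists>R c. R \<subseteq> {..<m} \<and> real (card R) * d\<^sup>2 \<le> N \<and> (\<forall>r. norm (c r) \<le> C) \<and>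
     (\<forall>j. norm (f j - (\<Sum>r\<in>R. c r * cis (2 * pi * real r * real_of_int j / real m)))
            \<le> \<epsilon> + d * (C\<^sup>2 + N) / 2)"
proof -
  have C0: "C \<ge> 0" using bd[of 0] norm_ge_zero order_trans by blast
  have finE: "finite E" using E finite_subset by blast
  have cE: "card E > 0" using E finE by (simp add: card_gt_0_iff)
  define e where "e r j = cis (2 * pi * real r * real_of_int j / real m)" for r :: nat and j :: int
  have e_add: "e r (i + j) = e r i * e r j" for r i j
    by (simp add: e_def cis_mult add_divide_distrib ring_distribs)
  have e_neg: "e r (- j) = cnj (e r j)" for r j by (simp add: e_def cis_cnj)
  have ne: "norm (e r j) = 1" for r j by (simp add: e_def)
  \<comment> \<open>\<open>F\<close> holds the Fourier coefficients of \<open>f\<close> on the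
    cyclic group of order \<open>m\<close>, and \<open>\<kappa>\<close> is the transform of the
    uniform distribution on \<open>E\<close>; averaging over differences of points of
    \<open>E\<close> multiplies \<open>F r\<close> by \<open>\<kappa> r\<close> and by its
    conjugate.\<close>
  define F where "F r = (\<Sum>k<m. f (int k) / of_nat m * cis (- (2 * pi * real r * real k / real m)))" for r
  define \<kappa> where "\<kappa> r = (\<Sum>\<tau>\<in>E. e r (int \<tau>)) / of_nat (card E)" for r
  have F_inv: "f j = (\<Sum>r<m. F r * e r j)" for j
  proof -
    have "(\<Sum>r<m. F r * e r j) = (\<Sum>r<m. \<Sum>k<m. f (int k) / of_nat m * e r (j - int k))"
    proof (rule sum.cong[OF refl])
      fix r
      have "cis (- (2 * pi * real r * real k / real m)) * e r j = e r (j - int k)" for k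
        by (simp add: e_def cis_mult diff_divide_distrib right_diff_distrib)
      then show "F r * e r j = (\<Sum>k<m. f (int k) / of_nat m * e r (j - int k))"
        by (simp add: F_def sum_distrib_right mult.assoc)
    qed
    also have "\<dots> = (\<Sum>k<m. f (int k) / of_nat m * (\<Sum>r<m. e r (j - int k)))"
      by (subst sum.swap) (simp add: sum_distrib_left)
    also have "\<dots> = (\<Sum>k<m. if k = nat (j mod int m) then f (int k) else 0)"
    proof (intro sum.cong refl)
      fix k assume k: "k \<in> {..<m}"
      have "int m dvd j - int k \<longleftrightarrow> k = nat (j mod int m)"
      proof -
        have "int m dvd j - int k \<longleftrightarrow> j mod int m = int k mod int m" by (simp add: mod_eq_dvd_iff)
        also have "int k mod int m = int k" using k by simp
        finally show ?thesis using m by auto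
      qed
      then show "f (int k) / of_nat m * (\<Sum>r<m. e r (j - int k))
          = (if k = nat (j mod int m) then f (int k) else 0)"
        unfolding e_def using m by (subst sum_roots_of_unity[OF m]) auto
    qed
    also have "\<dots> = f (j mod int m)" using m by (simp add: sum.delta nat_less_iff)
    also have "\<dots> = f j" by (rule periodic_int_mod) (rule per)
    finally show ?thesis by simp
  qed
  have sumF: "(\<Sum>r<m. (norm (F r))\<^sup>2) \<le> C\<^sup>2"
  proof -
    have "(\<Sum>r<m. (norm (F r))\<^sup>2) = real m * (\<Sum>j<m. (norm (f (int j) / of_nat m))\<^sup>2)"
      unfolding F_def by (rule finite_Parseval[OF m])
    also have "\<dots> \<le> real m * (\<Sum>j<m. (C / real m)\<^sup>2)"
      by (intro mult_left_mono sum_mono power_mono) (auto simp: norm_divide bd divide_right_mono)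
    also have "\<dots> = C\<^sup>2" using m by (simp add: power2_eq_square)
    finally show ?thesis .
  qed
  \<comment> \<open>Parseval gives \<open>m / card E\<close>, that is, one over the density of
    \<open>E\<close>; this is where a bound free of \<open>m\<close> arises.\<close>
  have sum\<kappa>: "(\<Sum>r<m. (norm (\<kappa> r))\<^sup>2) \<le> N"
  proof -
    define x :: "nat \<Rightarrow> complex" where "x j = (if j \<in> E then 1 / of_nat (card E) else 0)" for j
    have "norm (\<kappa> r) = norm (\<Sum>j<m. x j * cis (- (2 * pi * real r * real j / real m)))" for r
    proof -
      have "(\<Sum>j<m. x j * cis (- (2 * pi * real r * real j / real m)))
          = (\<Sum>j\<in>E. 1 / of_nat (card E) * cis (- (2 * pi * real r * real j / real m)))"
        unfolding x_def using E by (intro sum.mono_neutral_cong_right) auto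
      also have "\<dots> = cnj (\<kappa> r)"
        by (simp add: \<kappa>_def sum_divide_distrib e_def cis_cnj)
      finally show ?thesis by simp
    qed
    then have "(\<Sum>r<m. (norm (\<kappa> r))\<^sup>2) = real m * (\<Sum>j<m. (norm (x j))\<^sup>2)"
      by (simp add: finite_Parseval[OF m])
    also have "(\<Sum>j<m. (norm (x j))\<^sup>2) = (\<Sum>j\<in>E. (1 / real (card E))\<^sup>2)"
      unfolding x_def using E by (intro sum.mono_neutral_cong_right) (auto simp: norm_divide)
    also have "real m * \<dots> = real m / real (card E)" using cE by (simp add: power2_eq_square)
    also have "\<dots> \<le> N" using N cE by (simp add: field_simps)
    finally show ?thesis .
  qed
  have \<kappa>1: "norm (\<kappa> r) \<le> 1" for r
  proof -
    have "norm (\<Sum>\<tau>\<in>E. e r (int \<tau>)) \<le> (\<Sum>\<tau>\<in>E. 1)" by (intro sum_norm_le) (simp add: ne)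
    then show ?thesis using cE by (simp add: \<kappa>_def norm_divide)
  qed
  have F_le: "norm (F r) \<le> C" for r
  proof -
    have "norm (F r) \<le> (\<Sum>k<m. C / real m)" unfolding F_def
      by (intro sum_norm_le) (auto simp: norm_mult norm_divide bd divide_right_mono)
    then show ?thesis using m by simp
  qed
  define c where "c r = F r * of_real ((norm (\<kappa> r))\<^sup>2)" for r
  define R where "R = {r\<in>{..<m}. norm (\<kappa> r) \<ge> d}"
  have avg: "(\<Sum>\<tau>\<in>E. \<Sum>\<sigma>\<in>E. f (j + int \<tau> - int \<sigma>)) = of_nat ((card E)\<^sup>2) * (\<Sum>r<m. c r * e r j)" for j
  proof -
    have "(\<Sum>\<tau>\<in>E. \<Sum>\<sigma>\<in>E. f (j + int \<tau> - int \<sigma>))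
        = (\<Sum>\<tau>\<in>E. \<Sum>\<sigma>\<in>E. \<Sum>r<m. F r * e r j * (e r (int \<tau>) * cnj (e r (int \<sigma>))))"
      by (subst F_inv) (simp add: e_add e_neg mult_ac diff_conv_add_uminus del: add_uminus_conv_diff)
    also have "\<dots> = (\<Sum>r<m. F r * e r j * ((\<Sum>\<tau>\<in>E. e r (int \<tau>)) * cnj (\<Sum>\<sigma>\<in>E. e r (int \<sigma>))))"
    proof -
      have "(\<Sum>\<tau>\<in>E. \<Sum>\<sigma>\<in>E. \<Sum>r<m. F r * e r j * (e r (int \<tau>) * cnj (e r (int \<sigma>))))
         = (\<Sum>\<tau>\<in>E. \<Sum>r<m. \<Sum>\<sigma>\<in>E. F r * e r j * (e r (int \<tau>) * cnj (e r (int \<sigma>))))"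
        by (intro sum.cong refl sum.swap)
      also have "\<dots> = (\<Sum>r<m. \<Sum>\<tau>\<in>E. \<Sum>\<sigma>\<in>E. F r * e r j * (e r (int \<tau>) * cnj (e r (int \<sigma>))))"
        by (rule sum.swap)
      also have "\<dots> = (\<Sum>r<m. F r * e r j * ((\<Sum>\<tau>\<in>E. e r (int \<tau>)) * cnj (\<Sum>\<sigma>\<in>E. e r (int \<sigma>))))"
      proof (rule sum.cong[OF refl])
        fix r
        have dist: "(\<Sum>i\<in>E. \<Sum>j\<in>E. g * (a i * b j)) = g * (sum a E * sum b E)" for g :: complex and a b
          by (subst sum_product, subst sum_distrib_left, rule sum.cong[OF refl], subst sum_distrib_left, rule refl)
        show "(\<Sum>\<tau>\<in>E. \<Sum>\<sigma>\<in>E. F r * e r j * (e r (int \<tau>) * cnj (e r (int \<sigma>))))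
            = F r * e r j * ((\<Sum>\<tau>\<in>E. e r (int \<tau>)) * cnj (\<Sum>\<sigma>\<in>E. e r (int \<sigma>)))"
          unfolding cnj_sum by (rule dist)
      qed
      finally show ?thesis .
    qed
    also have "\<dots> = (\<Sum>r<m. F r * e r j * (of_nat (card E) * \<kappa> r * cnj (of_nat (card E) * \<kappa> r)))"
    proof -
      have "(\<Sum>\<tau>\<in>E. e r (int \<tau>)) = of_nat (card E) * \<kappa> r" for r using cE by (simp add: \<kappa>_def)
      then show ?thesis by presburger
    qed
    also have "\<dots> = (\<Sum>r<m. of_nat ((card E)\<^sup>2) * (c r * e r j))"
    proof (rule sum.cong[OF refl])
      fix r
      have "c r = F r * (\<kappa> r * cnj (\<kappa> r))" unfolding c_def complex_norm_square ..
      then show "F r * e r j * (of_nat (card E) * \<kappa> r * cnj (of_nat (card E) * \<kappa> r)) = of_nat ((card E)\<^sup>2) * (c r * e r j)"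
        by (simp add: power2_eq_square)
    qed
    also have "\<dots> = of_nat ((card E)\<^sup>2) * (\<Sum>r<m. c r * e r j)" by (simp only: sum_distrib_left)
    finally show ?thesis .
  qed
  have "norm (f j - (\<Sum>r<m. c r * e r j)) \<le> \<epsilon>" for j
  proof -
    let ?n = "of_nat ((card E)\<^sup>2) :: complex"
    have "?n * (f j - (\<Sum>r<m. c r * e r j)) = (\<Sum>\<tau>\<in>E. \<Sum>\<sigma>\<in>E. f j - f (j + int \<tau> - int \<sigma>))"
      unfolding right_diff_distrib avg[symmetric] by (simp add: sum_subtractf power2_eq_square)
    then have "norm (?n * (f j - (\<Sum>r<m. c r * e r j))) = norm (\<Sum>\<tau>\<in>E. \<Sum>\<sigma>\<in>E. f j - f (j + int \<tau> - int \<sigma>))"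
      by simp
    also have "\<dots> \<le> (\<Sum>\<tau>\<in>E. \<Sum>\<sigma>\<in>E. \<epsilon>)"
    proof (intro sum_norm_le)
      fix \<tau> \<sigma> assume "\<tau> \<in> E" "\<sigma> \<in> E"
      then show "norm (f j - f (j + int \<tau> - int \<sigma>)) \<le> \<epsilon>"
        using close[of \<sigma> \<tau> "j - int \<sigma>"] by (simp add: algebra_simps)
    qed
    also have "\<dots> = real ((card E)\<^sup>2) * \<epsilon>" by (simp add: power2_eq_square)
    finally have "real ((card E)\<^sup>2) * norm (f j - (\<Sum>r<m. c r * e r j)) \<le> real ((card E)\<^sup>2) * \<epsilon>"
      by (simp add: norm_mult norm_power)
    then show ?thesis using cE by simp
  qed
  moreover have "norm ((\<Sum>r<m. c r * e r j) - (\<Sum>r\<in>R. c r * e r j)) \<le> d * (C\<^sup>2 + N) / 2" for j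
  proof -
    have "(\<Sum>r<m. c r * e r j) - (\<Sum>r\<in>R. c r * e r j) = (\<Sum>r\<in>{..<m} - R. c r * e r j)"
      by (subst sum_diff) (auto simp: R_def)
    \<comment> \<open>One factor \<open>\<kappa>\<close> is spent on the threshold \<open>d\<close>;
      the other is paired with \<open>F\<close> by the inequality between the geometric and the
      arithmetic mean, since both sums of squares are under control.\<close>
    also have "norm \<dots> \<le> (\<Sum>r\<in>{..<m} - R. d * (((norm (F r))\<^sup>2 + (norm (\<kappa> r))\<^sup>2) / 2))"
    proof (intro sum_norm_le)
      fix r assume "r \<in> {..<m} - R"
      then have k: "norm (\<kappa> r) \<le> d" by (auto simp: R_def)
      have "norm (c r * e r j) = norm (\<kappa> r) * (norm (F r) * norm (\<kappa> r))"
        by (simp add: c_def norm_mult ne power2_eq_square)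
      also have "\<dots> \<le> d * (norm (F r) * norm (\<kappa> r))" using k by (intro mult_right_mono) auto
      also have "\<dots> \<le> d * (((norm (F r))\<^sup>2 + (norm (\<kappa> r))\<^sup>2) / 2)"
        using d sum_squares_bound[of "norm (F r)" "norm (\<kappa> r)"] by (intro mult_left_mono) auto
      finally show "norm (c r * e r j) \<le> d * (((norm (F r))\<^sup>2 + (norm (\<kappa> r))\<^sup>2) / 2)" .
    qed
    also have "\<dots> \<le> (\<Sum>r<m. d * (((norm (F r))\<^sup>2 + (norm (\<kappa> r))\<^sup>2) / 2))"
      using d by (intro sum_mono2) auto
    also have "\<dots> = d * ((\<Sum>r<m. (norm (F r))\<^sup>2) + (\<Sum>r<m. (norm (\<kappa> r))\<^sup>2)) / 2"
      by (simp add: sum.distrib flip: sum_distrib_left sum_divide_distrib)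
    also have "\<dots> \<le> d * (C\<^sup>2 + N) / 2"
      using sumF sum\<kappa> d by (intro divide_right_mono mult_left_mono) auto
    finally show ?thesis .
  qed
  ultimately have "norm (f j - (\<Sum>r\<in>R. c r * e r j)) \<le> \<epsilon> + d * (C\<^sup>2 + N) / 2" for j
    using norm_diff_triangle_le by blast
  moreover have "real (card R) * d\<^sup>2 \<le> N"
  proof -
    have "real (card R) * d\<^sup>2 = (\<Sum>r\<in>R. d\<^sup>2)" by simp
    also have "\<dots> \<le> (\<Sum>r\<in>R. (norm (\<kappa> r))\<^sup>2)"
      using d by (intro sum_mono power_mono) (auto simp: R_def)
    also have "\<dots> \<le> (\<Sum>r<m. (norm (\<kappa> r))\<^sup>2)" by (intro sum_mono2) (auto simp: R_def)
    finally show ?thesis using sum\<kappa> by simp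
  qed
  moreover have "norm (c r) \<le> C" for r
  proof -
    have "norm (c r) = norm (F r) * (norm (\<kappa> r))\<^sup>2" by (simp add: c_def norm_mult norm_power)
    also have "\<dots> \<le> C * 1" using F_le \<kappa>1 C0 by (intro mult_mono) (auto simp: power_le_one)
    finally show ?thesis by simp
  qed
  moreover have "R \<subseteq> {..<m}" by (auto simp: R_def)
  ultimately show ?thesis unfolding e_def by blast
qed

section \<open>Finite nets of translates and exponential sums on sample points\<close>

lemma almost_periodic_bcontfun_translate:
  assumes "f \<in> bcontfun"
  shows "(\<lambda>t::real. f (t + \<tau>)) \<in> bcontfun"
  using assms unfolding bcontfun_def
  by (auto intro!: continuous_intros continuous_on_compose2[of UNIV f] simp: bounded_def)

text \<open>The closure of the orbit is totally bounded. A ball of radius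
  \<open>\<epsilon> / 2\<close> that meets the orbit is recentred at a translate inside it, so that
  the net consists of translates.\<close>

lemma almost_periodic_net:
  assumes f: "f \<in> almost_periodic" and "\<epsilon> > 0"
  shows "\<exists>T. finite T \<and> (\<forall>\<tau>. \<exists>\<sigma>\<in>T. \<forall>t. norm (f (t + \<tau>) - f (t + \<sigma>)) \<le> \<epsilon>)"
proof -
  define G where "G \<tau> = Bcontfun (\<lambda>t. f (t + \<tau>))" for \<tau> :: real
  have G: "apply_bcontfun (G \<tau>) t = f (t + \<tau>)" for \<tau> t
    using f unfolding G_def almost_periodic_def
    by (simp add: Bcontfun_inverse almost_periodic_bcontfun_translate)
  have "compact (closure (range G))" using f by (simp add: almost_periodic_def G_def)
  then have "\<forall>e>0. \<exists>k. finite k \<and> closure (range G) \<subseteq> (\<Union>x\<in>k. ball x e)"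
    unfolding compact_eq_totally_bounded by (rule conjunct2)
  then have "\<exists>k. finite k \<and> closure (range G) \<subseteq> (\<Union>x\<in>k. ball x (\<epsilon>/2))"
    using assms(2) by simp
  then obtain K where K': "finite K \<and> closure (range G) \<subseteq> (\<Union>x\<in>K. ball x (\<epsilon>/2))" ..
  note K = conjunct1[OF K'] conjunct2[OF K']
  define h where "h x = (SOME \<sigma>. dist x (G \<sigma>) < \<epsilon>/2)" for x
  have "\<exists>\<sigma>\<in>h ` K. \<forall>t. norm (f (t + \<tau>) - f (t + \<sigma>)) \<le> \<epsilon>" for \<tau>
  proof -
    have "G \<tau> \<in> closure (range G)" by (rule subsetD[OF closure_subset]) simp
    then obtain x where x: "x \<in> K" "dist x (G \<tau>) < \<epsilon>/2" using K(2) by auto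
    then have "dist x (G (h x)) < \<epsilon>/2" unfolding h_def by (rule_tac someI)
    then have "dist (G \<tau>) (G (h x)) \<le> \<epsilon>" using x(2) dist_triangle_half_r by fastforce
    then have "\<forall>t. norm (f (t + \<tau>) - f (t + h x)) \<le> \<epsilon>"
      by (metis G dist_bounded dist_norm order_trans)
    then show ?thesis using x(1) by blast
  qed
  then show ?thesis using K(1) by blast
qed

text \<open>Up to \<open>e / 3\<close>, \<open>f\<close> near \<open>t\<close> looks like
  \<open>f\<close> near one of finitely many points of the net, where ordinary continuity provides a
  common \<open>d\<close>.\<close>

lemma almost_periodic_uniformly_continuous:
  assumes f: "f \<in> almost_periodic" and e: "e > 0"
  shows "\<exists>d>0. \<forall>t s. \<bar>s\<bar> < d \<longrightarrow> norm (f (t + s) - f t) \<le> e"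
proof -
  obtain T where T: "finite T" "\<And>\<tau>. \<exists>\<sigma>\<in>T. \<forall>t. norm (f (t + \<tau>) - f (t + \<sigma>)) \<le> e/3"
    using almost_periodic_net[OF f, of "e/3"] e by auto
  have cont: "continuous_on UNIV f" using f by (auto simp: almost_periodic_def bcontfun_def)
  have "\<exists>d>0. \<forall>s. \<bar>s\<bar> < d \<longrightarrow> norm (f (\<sigma> + s) - f \<sigma>) \<le> e/3" for \<sigma>
  proof -
    have "isCont f \<sigma>" using cont by (simp add: continuous_on_eq_continuous_at)
    then obtain d where "d > 0" "\<And>x. dist x \<sigma> < d \<Longrightarrow> dist (f x) (f \<sigma>) < e/3"
      using e unfolding continuous_at_eps_delta by (metis divide_pos_pos zero_less_numeral)
    then show ?thesis by (intro exI[of _ d]) (auto simp: dist_norm intro!: less_imp_le)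
  qed
  then obtain d where d: "\<And>\<sigma>. d \<sigma> > 0" "\<And>\<sigma> s. \<bar>s\<bar> < d \<sigma> \<Longrightarrow> norm (f (\<sigma> + s) - f \<sigma>) \<le> e/3"
    by metis
  have "T \<noteq> {}" using T(2) by blast
  show ?thesis
  proof (intro exI[of _ "Min (d ` T)"] conjI allI impI)
    show "Min (d ` T) > 0" using T(1) \<open>T \<noteq> {}\<close> d(1) by auto
    fix t s assume s: "\<bar>s\<bar> < Min (d ` T)"
    have s': "\<bar>s\<bar> < d \<sigma>" if "\<sigma> \<in> T" for \<sigma> using s Min_le[OF finite_imageI[OF T(1)] imageI[OF that], of d] by linarith
    obtain \<sigma> where \<sigma>: "\<sigma> \<in> T" "\<And>x. norm (f (x + t) - f (x + \<sigma>)) \<le> e/3" using T(2) by blast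
    have "norm (f (\<sigma> + s) - f \<sigma>) \<le> e/3" using s'[OF \<sigma>(1)] by (rule d(2))
    moreover have "norm (f (t + s) - f (\<sigma> + s)) \<le> e/3" using \<sigma>(2)[of s] by (simp add: add.commute)
    moreover have "norm (f t - f \<sigma>) \<le> e/3" using \<sigma>(2)[of 0] by simp
    ultimately show "norm (f (t + s) - f t) \<le> e" by norm
  qed
qed

text \<open>The samples are wrapped around a cyclic group whose order \<open>m\<close> exceeds
  \<open>B\<close> and is such that \<open>h * m\<close> is an almost period; there the
  approximation on finite groups applies. The decisive point is the order of quantifiers:
  \<open>n\<close> depends on \<open>C\<close>, \<open>T\<close> and \<open>e\<close>, but not on
  \<open>B\<close> or \<open>m\<close>, so that a compactness argument can remove
  \<open>B\<close>.\<close>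

lemma net_exponential_sum_finite_range:
  fixes f :: "real \<Rightarrow> complex"
  assumes bd: "\<And>t. norm (f t) \<le> C"
    and T: "finite T" "\<And>\<tau>. \<exists>\<sigma>\<in>T. \<forall>t. norm (f (t + \<tau>) - f (t + \<sigma>)) \<le> e" and e: "e > 0"
  shows "\<exists>n. \<forall>B. \<exists>c \<theta>. (\<forall>i::nat. norm (c i) \<le> C \<and> 0 \<le> \<theta> i \<and> \<theta> i \<le> 2 * pi) \<and>
     (\<forall>j<B. norm (f (h * real j) - (\<Sum>i<n. c i * cis (\<theta> i * real j))) \<le> 7 * e)"
proof -
  have C0: "C \<ge> 0" using bd[of 0] norm_ge_zero order_trans by blast
  have "T \<noteq> {}" using T(2) by blast
  define N where "N = real (card T)"
  have N: "N > 0" using T(1) \<open>T \<noteq> {}\<close> by (simp add: N_def card_gt_0_iff)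
  \<comment> \<open>The threshold that makes the tail \<open>\<delta> * (C\<^sup>2 + N) / 2\<close>
    of the approximation on the cyclic group equal to \<open>e\<close>; with the
    \<open>6 * e\<close> from the differences below this gives \<open>7 * e\<close>.\<close>
  define \<delta> where "\<delta> = 2 * e / (C\<^sup>2 + N)"
  have CN: "C\<^sup>2 + N > 0" using N by (simp add: add_nonneg_pos)
  have \<delta>: "\<delta> > 0" using e CN by (simp add: \<delta>_def)
  define n where "n = nat \<lceil>N / \<delta>\<^sup>2\<rceil>"
  obtain q where q: "\<And>\<tau>. q \<tau> \<in> T" "\<And>\<tau> t. norm (f (t + \<tau>) - f (t + q \<tau>)) \<le> e" using T(2) by metis
  have "\<exists>c \<theta>. (\<forall>i::nat. norm (c i) \<le> C \<and> 0 \<le> \<theta> i \<and> \<theta> i \<le> 2 * pi) \<and>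
     (\<forall>j<B. norm (f (h * real j) - (\<Sum>i<n. c i * cis (\<theta> i * real j))) \<le> 7 * e)" for B
  proof -
    \<comment> \<open>There are infinitely many multiples of \<open>Suc B\<close> steps and finitely
      many net points. Two multiples that share a net point differ by an almost period, up to
      \<open>2 * e\<close>, of more than \<open>B\<close> steps.\<close>
    have "\<not> inj (\<lambda>i::nat. q (real i * (real (Suc B) * h)))"
    proof
      assume "inj (\<lambda>i::nat. q (real i * (real (Suc B) * h)))"
      moreover have "range (\<lambda>i::nat. q (real i * (real (Suc B) * h))) \<subseteq> T" using q(1) by auto
      ultimately show False using T(1) finite_subset infinite_UNIV_nat finite_imageD by blast
    qed
    then obtain i i' :: nat where ii: "i < i'"
        "q (real i * (real (Suc B) * h)) = q (real i' * (real (Suc B) * h))"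
      unfolding inj_def by (metis linorder_neqE_nat)
    define m where "m = (i' - i) * Suc B"
    have mB: "m \<ge> Suc B" using ii(1) mult_le_mono1[of 1 "i' - i" "Suc B"] unfolding m_def by simp
    then have m: "m > 0" by simp
    have mh: "norm (f (t + h * real m) - f t) \<le> 2 * e" for t
    proof -
      let ?a = "real i * (real (Suc B) * h)" and ?b = "real i' * (real (Suc B) * h)"
      have ab: "t + h * real m = (t - ?a) + ?b"
      proof -
        have "real m = (real i' - real i) * real (Suc B)" using ii(1) by (simp only: m_def of_nat_mult of_nat_diff less_imp_le)
        then show ?thesis by (simp only:) (simp add: algebra_simps)
      qed
      have "norm (f ((t - ?a) + ?b) - f ((t - ?a) + q ?b)) \<le> e" by (rule q(2))
      moreover have "norm (f ((t - ?a) + ?a) - f ((t - ?a) + q ?b)) \<le> e"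
        using q(2)[of "t - ?a" ?a] ii(2) by simp
      ultimately show ?thesis unfolding ab by simp norm
    qed
    define g where "g j = f (h * real_of_int (j mod int m))" for j
    \<comment> \<open>A shift by fewer than \<open>m\<close> steps crosses the seam at most once,
      and one crossing costs the defect \<open>2 * e\<close> of the almost period.\<close>
    have wrap: "norm (g (j + int \<tau>) - f (h * real_of_int (j mod int m) + h * real \<tau>)) \<le> 2 * e"
      if "\<tau> < m" for j \<tau>
    proof -
      let ?a = "j mod int m + int \<tau>"
      have a: "(j + int \<tau>) mod int m = ?a mod int m" by (simp add: mod_simps)
      have "0 \<le> j mod int m" "j mod int m < int m" "int \<tau> < int m" using m that by simp_all
      then have a0: "0 \<le> ?a" "?a < 2 * int m" by linarith+
      show ?thesis
      proof (cases "?a < int m")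
        case True
        then have "(j + int \<tau>) mod int m = ?a" using a a0 by simp
        then show ?thesis using e by (simp add: g_def distrib_left)
      next
        case False
        then have "(j + int \<tau>) mod int m = ?a - int m"
          unfolding a using a0 by (intro int_mod_pos_eq[where q = 1]) auto
        then have "g (j + int \<tau>) = f (h * (real_of_int ?a - real m))" by (simp add: g_def)
        moreover have "h * real_of_int (j mod int m) + h * real \<tau> = h * (real_of_int ?a - real m) + h * real m"
          by (simp add: algebra_simps)
        ultimately show ?thesis using mh[of "h * (real_of_int ?a - real m)"]
          by (simp add: norm_minus_commute)
      qed
    qed
    \<comment> \<open>The most frequent net point is shared by at least \<open>m / N\<close> of the
      shifts. Two such shifts differ by \<open>2 * e\<close> on \<open>f\<close>, and by
      \<open>6 * e\<close> on the wrapped function after one seam for each.\<close>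
    have "\<exists>\<sigma>\<in>T. real m \<le> N * real (card {\<tau>\<in>{..<m}. q (h * real \<tau>) = \<sigma>})"
    proof (rule ccontr)
      assume "\<not> ?thesis"
      then have *: "\<And>\<sigma>. \<sigma> \<in> T \<Longrightarrow> real (card {\<tau>\<in>{..<m}. q (h * real \<tau>) = \<sigma>}) < real m / N"
        using N by (auto simp: field_simps not_le)
      have "real m = real (card {..<m})" by simp
      also have "{..<m} = (\<Union>\<sigma>\<in>T. {\<tau>\<in>{..<m}. q (h * real \<tau>) = \<sigma>})" using q(1) by auto
      also have "real (card \<dots>) \<le> (\<Sum>\<sigma>\<in>T. real (card {\<tau>\<in>{..<m}. q (h * real \<tau>) = \<sigma>}))"
        unfolding of_nat_sum[symmetric] of_nat_le_iff by (rule card_UN_le[OF T(1)])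
      also have "\<dots> < (\<Sum>\<sigma>\<in>T. real m / N)" using * T(1) \<open>T \<noteq> {}\<close> by (intro sum_strict_mono) auto
      also have "\<dots> = real m" using N by (simp add: N_def)
      finally show False by simp
    qed
    then obtain \<sigma> where \<sigma>: "real m \<le> N * real (card {\<tau>\<in>{..<m}. q (h * real \<tau>) = \<sigma>})" by blast
    define E where "E = {\<tau>\<in>{..<m}. q (h * real \<tau>) = \<sigma>}"
    have close: "norm (g (j + int \<tau>) - g (j + int \<tau>')) \<le> 6 * e" if "\<tau> \<in> E" "\<tau>' \<in> E" for \<tau> \<tau>' j
    proof -
      let ?x = "h * real_of_int (j mod int m)"
      have "norm (f (?x + h * real \<tau>) - f (?x + \<sigma>)) \<le> e"
        using q(2)[of ?x "h * real \<tau>"] that by (simp add: E_def)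
      moreover have "norm (f (?x + h * real \<tau>') - f (?x + \<sigma>)) \<le> e"
        using q(2)[of ?x "h * real \<tau>'"] that by (simp add: E_def)
      moreover have "norm (g (j + int \<tau>) - f (?x + h * real \<tau>)) \<le> 2 * e"
        "norm (g (j + int \<tau>') - f (?x + h * real \<tau>')) \<le> 2 * e"
        using wrap that by (auto simp: E_def)
      ultimately show ?thesis by norm
    qed
    have "\<exists>R c. R \<subseteq> {..<m} \<and> real (card R) * \<delta>\<^sup>2 \<le> N \<and> (\<forall>r. norm (c r) \<le> C) \<and>
     (\<forall>j. norm (g j - (\<Sum>r\<in>R. c r * cis (2 * pi * real r * real_of_int j / real m)))
            \<le> 6 * e + \<delta> * (C\<^sup>2 + N) / 2)"
    proof (rule cyclic_group_approximation)
      show "E \<noteq> {}"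
      proof
        assume "E = {}"
        then show False using \<sigma> m unfolding E_def[symmetric] by simp
      qed
      show "real m \<le> N * real (card E)" using \<sigma> by (simp add: E_def)
    qed (use m bd \<delta> close in \<open>auto simp: g_def E_def\<close>)
    then obtain R c where R: "R \<subseteq> {..<m}" "real (card R) * \<delta>\<^sup>2 \<le> N" "\<And>r. norm (c r) \<le> C"
      and ap: "\<And>j. norm (g j - (\<Sum>r\<in>R. c r * cis (2 * pi * real r * real_of_int j / real m)))
            \<le> 6 * e + \<delta> * (C\<^sup>2 + N) / 2" by blast
    have finR: "finite R" using R(1) finite_subset by blast
    have "real (card R) \<le> N / \<delta>\<^sup>2" using R(2) \<delta> by (simp add: field_simps)
    then have cR: "card R \<le> n" unfolding n_def by linarith
    obtain b where b: "bij_betw b {..<card R} R"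
      using ex_bij_betw_nat_finite[OF finR] by (auto simp: atLeast0LessThan)
    define c' where "c' i = (if i < card R then c (b i) else 0)" for i
    define \<theta> where "\<theta> i = (if i < card R then 2 * pi * real (b i) / real m else 0)" for i
    have "norm (c' i) \<le> C \<and> 0 \<le> \<theta> i \<and> \<theta> i \<le> 2 * pi" for i
    proof -
      have "real (b i) \<le> real m" if "i < card R"
      proof -
        have "b i \<in> R" using that b by (auto simp: bij_betw_def)
        then show ?thesis using R(1) by (auto intro: less_imp_le)
      qed
      then show ?thesis using R(3) C0 m by (auto simp: c'_def \<theta>_def field_simps)
    qed
    moreover have "norm (f (h * real j) - (\<Sum>i<n. c' i * cis (\<theta> i * real j))) \<le> 7 * e" if "j < B" for j
    proof -
      have "(\<Sum>i<n. c' i * cis (\<theta> i * real j)) = (\<Sum>i<card R. c' i * cis (\<theta> i * real j))"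
        using cR by (intro sum.mono_neutral_right) (auto simp: c'_def)
      also have "\<dots> = (\<Sum>i<card R. c (b i) * cis (2 * pi * real (b i) * real_of_int (int j) / real m))"
        by (intro sum.cong) (auto simp: c'_def \<theta>_def)
      also have "\<dots> = (\<Sum>r\<in>R. c r * cis (2 * pi * real r * real_of_int (int j) / real m))"
        by (rule sum.reindex_bij_betw[OF b])
      finally have "(\<Sum>i<n. c' i * cis (\<theta> i * real j)) = \<dots>" .
      moreover have "g (int j) = f (h * real j)" using that mB by (simp add: g_def)
      moreover have "\<delta> * (C\<^sup>2 + N) / 2 = e" using CN by (simp add: \<delta>_def)
      ultimately show ?thesis using ap[of "int j"] by simp
    qed
    ultimately show ?thesis by blast
  qed
  then show ?thesis by blast
qed

text \<open>Coefficients range over a closed disc, angles over a closed interval, and the number of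
  terms is the same for every finite range. By Tychonoff's theorem and the finite intersection
  property one choice serves all \<open>j\<close>.\<close>

lemma net_exponential_sum:
  fixes f :: "real \<Rightarrow> complex"
  assumes bd: "\<And>t. norm (f t) \<le> C"
    and T: "finite T" "\<And>\<tau>. \<exists>\<sigma>\<in>T. \<forall>t. norm (f (t + \<tau>) - f (t + \<sigma>)) \<le> e" and e: "e > 0"
  shows "\<exists>(n::nat) c \<theta>. \<forall>j. norm (f (h * real j) - (\<Sum>i<n. c i * cis (\<theta> i * real j))) \<le> 7 * e"
proof -
  obtain n where n: "\<And>B. \<exists>c \<theta>. (\<forall>i::nat. norm (c i) \<le> C \<and> 0 \<le> \<theta> i \<and> \<theta> i \<le> 2 * pi) \<and>
     (\<forall>j<B. norm (f (h * real j) - (\<Sum>i<n. c i * cis (\<theta> i * real j))) \<le> 7 * e)"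
    using net_exponential_sum_finite_range[OF bd T e] by blast
  define K :: "(nat \<Rightarrow> complex \<times> real) set" where "K = (\<Pi>\<^sub>E i\<in>UNIV. cball 0 C \<times> {0..2*pi})"
  define P where "P j = {x :: nat \<Rightarrow> complex \<times> real.
     norm (f (h * real j) - (\<Sum>i<n. fst (x i) * cis (snd (x i) * real j))) \<le> 7 * e}" for j
  have cK: "compact K"
    unfolding K_def compactin_euclidean_iff[symmetric] euclidean_product_topology[symmetric]
    by (subst compactin_PiE) (auto simp: compact_Times)
  have cP: "closed (P j)" for j
    unfolding P_def
    by (intro closed_Collect_le continuous_intros continuous_on_cis
        continuous_on_compose2[OF continuous_on_fst[OF continuous_on_id]]
        continuous_on_compose2[OF continuous_on_snd[OF continuous_on_id]] continuous_on_product_coordinates)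
       auto
  have fip: "K \<inter> \<Inter> (P ` I) \<noteq> {}" if "finite I" for I
  proof -
    have "\<exists>B. \<forall>j\<in>I. j < B" using that unfolding finite_nat_set_iff_bounded .
    then obtain B where "\<forall>j\<in>I. j < B" ..
    from n[of B] show ?thesis
    proof (elim exE conjE)
      fix c \<theta>
      assume "\<forall>i::nat. norm (c i) \<le> C \<and> 0 \<le> \<theta> i \<and> \<theta> i \<le> 2 * pi"
        "\<forall>j<B. norm (f (h * real j) - (\<Sum>i<n. c i * cis (\<theta> i * real j))) \<le> 7 * e"
      then have "(\<lambda>i. (c i, \<theta> i)) \<in> K \<inter> \<Inter> (P ` I)"
        using \<open>\<forall>j\<in>I. j < B\<close> by (auto simp: K_def P_def)
      then show ?thesis by blast
    qed
  qed
  have "K \<inter> \<Inter> (P ` UNIV) \<noteq> {}" by (rule compact_imp_fip_image[OF cK cP fip])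
  then obtain x where "x \<in> K \<inter> \<Inter> (P ` UNIV)" by blast
  then have *: "norm (f (h * real j) - (\<Sum>i<n. fst (x i) * cis (snd (x i) * real j))) \<le> 7 * e" for j
    by (simp add: P_def)
  show ?thesis
    by (rule exI[of _ n], rule exI[of _ "\<lambda>i. fst (x i)"], rule exI[of _ "\<lambda>i. snd (x i)"], rule allI, rule *)
qed

section \<open>Trigonometric polynomials with arbitrary real frequencies\<close>

inductive_set exp_sums :: "(real \<Rightarrow> complex) set" where
  mono: "(\<lambda>t. c * cis (\<nu> * t)) \<in> exp_sums"
| add: "p \<in> exp_sums \<Longrightarrow> q \<in> exp_sums \<Longrightarrow> (\<lambda>t. p t + q t) \<in> exp_sums"

lemma exp_sums_const: "(\<lambda>t. c) \<in> exp_sums"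
  using exp_sums.mono[of c 0] by simp

lemma exp_sums_sum: "(\<And>i. i \<in> A \<Longrightarrow> p i \<in> exp_sums) \<Longrightarrow> (\<lambda>t. \<Sum>i\<in>A. p i t) \<in> exp_sums"
proof (induction A rule: infinite_finite_induct)
  case (insert x F)
  then show ?case using exp_sums.add[of "p x"] by simp
qed (use exp_sums_const[of 0] in simp_all)

lemma exp_sums_mult:
  assumes "p \<in> exp_sums" "q \<in> exp_sums"
  shows "(\<lambda>t. p t * q t) \<in> exp_sums"
  using assms(1)
proof induction
  case (mono c \<nu>)
  from assms(2) show ?case
  proof induction
    case (mono d \<mu>)
    have "(\<lambda>t. c * cis (\<nu> * t) * (d * cis (\<mu> * t))) = (\<lambda>t. (c * d) * cis ((\<nu> + \<mu>) * t))"
      by (simp add: fun_eq_iff distrib_right cis_mult[symmetric])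
    then show ?case using exp_sums.mono[of "c * d" "\<nu> + \<mu>"] by simp
  next
    case (add p q)
    then show ?case using exp_sums.add[OF add.IH] by (simp add: distrib_left)
  qed
next
  case (add p q)
  then show ?case using exp_sums.add[OF add.IH] by (simp add: distrib_right)
qed

lemma exp_sums_scale: "p \<in> exp_sums \<Longrightarrow> (\<lambda>t. p (a * t + b)) \<in> exp_sums"
proof (induction rule: exp_sums.induct)
  case (mono c \<nu>)
  have "(\<lambda>t. c * cis (\<nu> * (a * t + b))) = (\<lambda>t. (c * cis (\<nu> * b)) * cis ((\<nu> * a) * t))"
    by (simp add: fun_eq_iff distrib_left cis_mult[symmetric] mult_ac)
  then show ?case using exp_sums.mono by simp
qed (auto intro: exp_sums.add)

lemma exp_sums_bounded: "p \<in> exp_sums \<Longrightarrow> \<exists>C. \<forall>t. norm (p t) \<le> C"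
proof (induction rule: exp_sums.induct)
  case (add p q)
  then obtain C D where "\<And>t. norm (p t) \<le> C" "\<And>t. norm (q t) \<le> D" by blast
  then show ?case by (intro exI[of _ "C + D"]) (meson add_mono norm_triangle_ineq order_trans)
qed (auto simp: norm_mult)

lemma exp_sums_continuous: "p \<in> exp_sums \<Longrightarrow> continuous_on A p"
  by (induction rule: exp_sums.induct) (auto intro!: continuous_intros continuous_on_cis)

text \<open>The function descends to the circle, where Stone-Weierstrass supplies a polynomial in
  the two real coordinates; along \<open>cis (2 * pi * t)\<close> every real linear form is a
  combination of two exponentials.\<close>

lemma periodic_exp_sums:
  fixes \<psi> :: "real \<Rightarrow> complex"
  assumes cont: "continuous_on {0..1} \<psi>" and eq: "\<psi> 0 = \<psi> 1" and e: "e > 0"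
  shows "\<exists>p\<in>exp_sums. \<forall>t. norm (\<psi> (frac t) - p t) \<le> e"
proof -
  define \<Psi> where "\<Psi> z = \<psi> (Arg2pi z / (2 * pi))" for z
  have circ: "cis (2 * pi * x) \<in> sphere 0 1" for x by simp
  have val: "\<Psi> (cis (2 * pi * x)) = \<psi> x" if "x \<in> {0..1}" for x
  proof (cases "x = 1")
    case True
    moreover have "Arg2pi 1 = 0" by (rule Arg2pi_unique[of 1]) auto
    ultimately show ?thesis using eq by (simp add: \<Psi>_def)
  next
    case False
    then have "Arg2pi (cis (2 * pi * x)) = 2 * pi * x"
      using that by (intro Arg2pi_unique[of 1]) (auto simp: cis_conv_exp mult.commute)
    then show ?thesis by (simp add: \<Psi>_def)
  qed
  have im: "(\<lambda>x. cis (2 * pi * x)) ` {0..1} = sphere 0 1"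
  proof (intro equalityI subsetI)
    fix z :: complex assume z: "z \<in> sphere 0 1"
    have "z = cis (2 * pi * (Arg2pi z / (2 * pi)))"
      using Arg2pi_eq[of z] z by (simp add: cis_conv_exp mult.commute)
    moreover have "Arg2pi z / (2 * pi) \<in> {0..1}" using Arg2pi[of z] by (auto simp: field_simps)
    ultimately show "z \<in> (\<lambda>x. cis (2 * pi * x)) ` {0..1}" by blast
  qed auto
  \<comment> \<open>\<open>Arg2pi\<close> jumps at 1, so continuity comes from the quotient map
    instead: the preimage of a closed set is the image of a compact subset of the interval.\<close>
  have "continuous_on (sphere 0 1) \<Psi>"
  proof (subst continuous_on_closed_vimage[OF closed_sphere], intro allI impI)
    fix B :: "complex set" assume B: "closed B"
    have "\<Psi> -` B \<inter> sphere 0 1 = (\<lambda>x. cis (2 * pi * x)) ` (\<psi> -` B \<inter> {0..1})"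
      unfolding im[symmetric] using val by auto
    moreover have "closed (\<psi> -` B \<inter> {0..1})"
      using cont B by (simp add: continuous_on_closed_vimage)
    then have "compact (\<psi> -` B \<inter> {0..1})"
      using compact_Icc[of 0 "1::real"] by (metis closed_Int_compact inf.right_idem)
    ultimately show "closed (\<Psi> -` B \<inter> sphere 0 1)"
      by (simp only:) (intro compact_imp_closed compact_continuous_image continuous_on_cis continuous_intros)
  qed
  then obtain g where g: "polynomial_function g" "\<And>z. z \<in> sphere 0 1 \<Longrightarrow> norm (\<Psi> z - g z) < e"
    using Stone_Weierstrass_polynomial_function[of "sphere (0::complex) 1" \<Psi> e] e by auto
  have poly: "(\<lambda>t. complex_of_real (r (cis (2 * pi * t)))) \<in> exp_sums"
    if "real_polynomial_function r" for r :: "complex \<Rightarrow> real"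
    using that
  proof induction
    case (linear r)
    then interpret bounded_linear r .
    have "complex_of_real (r (cis (2 * pi * t))) =
       (of_real (r 1) - \<i> * of_real (r \<i>)) / 2 * cis (2 * pi * t) +
       (of_real (r 1) + \<i> * of_real (r \<i>)) / 2 * cis (- (2 * pi) * t)" for t
    proof -
      have "cis (2 * pi * t) = cos (2 * pi * t) *\<^sub>R 1 + sin (2 * pi * t) *\<^sub>R \<i>"
        by (simp add: complex_eq_iff)
      then have "r (cis (2 * pi * t)) = cos (2 * pi * t) * r 1 + sin (2 * pi * t) * r \<i>"
        by (simp only: add scaleR) simp
      then show ?thesis by (simp add: complex_eq_iff field_simps)
    qed
    then show ?case by (simp only:) (intro exp_sums.add exp_sums.mono)
  next
    case (const c)
    show ?case by (rule exp_sums_const)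
  next
    case (add f g)
    then show ?case using exp_sums.add by simp
  next
    case (mult f g)
    then show ?case using exp_sums_mult by simp
  qed
  define p where "p t = complex_of_real (Re (g (cis (2 * pi * t)))) + \<i> * complex_of_real (Im (g (cis (2 * pi * t))))" for t
  have "p \<in> exp_sums"
  proof -
    have "real_polynomial_function (Re \<circ> g)" "real_polynomial_function (Im \<circ> g)"
      using g(1) bounded_linear_Re bounded_linear_Im unfolding polynomial_function_def by blast+
    then have "(\<lambda>t. complex_of_real (Re (g (cis (2 * pi * t))))) \<in> exp_sums"
       "(\<lambda>t. complex_of_real (Im (g (cis (2 * pi * t))))) \<in> exp_sums"
      using poly by fastforce+
    then show ?thesis unfolding p_def by (intro exp_sums.add exp_sums_mult[OF exp_sums_const])
  qed
  moreover have "norm (\<psi> (frac t) - p t) \<le> e" for t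
  proof -
    have "cis (2 * pi * t) = cis (2 * pi * frac t)"
    proof -
      have "cis (2 * pi * t) = cis (2 * pi * frac t) * cis (2 * pi * of_int \<lfloor>t\<rfloor>)"
        by (simp add: cis_mult frac_def algebra_simps)
      also have "cis (2 * pi * of_int \<lfloor>t\<rfloor>) = 1" by (rule cis_multiple_2pi) simp
      finally show ?thesis by simp
    qed
    moreover have "p t = g (cis (2 * pi * t))" by (simp add: p_def complex_eq_iff)
    moreover have "\<Psi> (cis (2 * pi * frac t)) = \<psi> (frac t)"
      by (rule val) (simp add: frac_ge_0 less_imp_le[OF frac_lt_1])
    ultimately show ?thesis using g(2)[OF circ[of "frac t"]] by simp
  qed
  ultimately show ?thesis by blast
qed

text \<open>Sampling at step \<open>h\<close> and interpolating linearly turns each \<open>cis (\<theta> * j)\<close> into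
  \<open>cis (\<theta> * x)\<close> times a 1-periodic function of \<open>x = t / h\<close>.\<close>

theorem almost_periodic_approximation:
  assumes f: "f \<in> almost_periodic" and e: "e > 0"
  shows "\<exists>p\<in>exp_sums. \<forall>t\<le>0. norm (f t - p t) \<le> e"
proof -
  \<comment> \<open>Seven parts pay for the approximation at the samples, one for the oscillation of
    \<open>f\<close> over a step, one for the periodic factors.\<close>
  define \<eta> where "\<eta> = e / 9"
  have \<eta>: "\<eta> > 0" using e by (simp add: \<eta>_def)
  obtain C where C: "\<And>t. norm (f t) \<le> C"
    using f by (auto simp: almost_periodic_def bcontfun_def bounded_iff)
  obtain T where T: "finite T" "\<And>\<tau>. \<exists>\<sigma>\<in>T. \<forall>t. norm (f (t + \<tau>) - f (t + \<sigma>)) \<le> \<eta>"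
    using almost_periodic_net[OF f \<eta>] by blast
  obtain d where d: "d > 0" "\<And>t s. \<bar>s\<bar> < d \<Longrightarrow> norm (f (t + s) - f t) \<le> \<eta>"
    using almost_periodic_uniformly_continuous[OF f \<eta>] by blast
  \<comment> \<open>Negative, so that the samples \<open>h * j\<close> with natural \<open>j\<close>
    sweep the half-line \<open>t \<le> 0\<close>; shorter than \<open>d\<close>, so that both
    neighbouring samples are close to \<open>t\<close>.\<close>
  define h where "h = - (d / 2)"
  have h: "h < 0" using d by (simp add: h_def)
  have "\<exists>(n::nat) c \<theta>. \<forall>j. norm (f (h * real j) - (\<Sum>i<n. c i * cis (\<theta> i * real j))) \<le> 7 * \<eta>"
    by (rule net_exponential_sum[OF C T \<eta>])
  then obtain n :: nat and c \<theta> where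
    ap: "\<forall>j. norm (f (h * real j) - (\<Sum>i<n. c i * cis (\<theta> i * real j))) \<le> 7 * \<eta>"
    by (elim exE) (rule that)
  \<comment> \<open>Linear interpolation of the samples of \<open>cis (\<theta> * x)\<close>,
    divided by \<open>cis (\<theta> * x)\<close>. It equals 1 at both ends of the unit interval, as
    periodicity requires.\<close>
  define \<psi> where "\<psi> \<theta> y = (1 - of_real y) * cis (- (\<theta> * y)) + of_real y * cis (\<theta> * (1 - y))" for \<theta> y :: real
  define D where "D = (\<Sum>i<n. norm (c i)) + 1"
  have D: "D > 0" by (simp add: D_def sum_nonneg add_nonneg_pos)
  have "\<exists>p\<in>exp_sums. \<forall>t. norm (\<psi> \<theta> (frac t) - p t) \<le> \<eta> / D" for \<theta>
    by (rule periodic_exp_sums) (auto simp: \<psi>_def \<eta> D intro!: continuous_intros continuous_on_cis)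
  then have "\<forall>\<theta>. \<exists>p. p \<in> exp_sums \<and> (\<forall>t. norm (\<psi> \<theta> (frac t) - p t) \<le> \<eta> / D)" by blast
  from choice[OF this] obtain p where p': "\<forall>\<theta>. p \<theta> \<in> exp_sums \<and> (\<forall>t. norm (\<psi> \<theta> (frac t) - p \<theta> t) \<le> \<eta> / D)" ..
  have p: "p \<theta> \<in> exp_sums" "norm (\<psi> \<theta> (frac t) - p \<theta> t) \<le> \<eta> / D" for \<theta> t using p' by auto
  define P where "P t = (\<Sum>i<n. (c i * cis ((\<theta> i / h) * t)) * p (\<theta> i) ((1/h) * t + 0))" for t
  have "P \<in> exp_sums" unfolding P_def
    by (rule exp_sums_sum, rule exp_sums_mult, rule exp_sums.mono, rule exp_sums_scale, rule p)
  moreover have "norm (f t - P t) \<le> e" if "t \<le> 0" for t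
  proof -
    define x where "x = t / h"
    define j where "j = nat \<lfloor>x\<rfloor>"
    define y where "y = frac x"
    have x0: "x \<ge> 0" using that h by (simp add: x_def divide_nonpos_neg)
    have xj: "x = real j + y" using x0 by (simp add: j_def y_def frac_def)
    have y: "0 \<le> y" "y < 1" by (simp_all add: y_def frac_lt_1)
    have t: "t = h * x" using h by (simp add: x_def)
    define E where "E j = (\<Sum>i<n. c i * cis (\<theta> i * real j))" for j
    have "norm (f (h * real j) - f t) \<le> \<eta>" "norm (f (h * real (Suc j)) - f t) \<le> \<eta>"
    proof -
      have dy: "d * y \<le> d" "d * (1 - y) \<le> d" using y d(1) by (simp_all add: mult_left_le)
      have dy0: "0 \<le> d * y" "0 \<le> d * (1 - y)" using y d(1) by simp_all
      have "h * real j = t + (- (h * y))" unfolding t xj by (simp add: algebra_simps)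
      moreover have "\<bar>- (h * y)\<bar> < d" using dy dy0 d(1) by (simp add: h_def)
      ultimately      show "norm (f (h * real j) - f t) \<le> \<eta>" using d(2)[of "- (h * y)" t] by simp
      have "h * real (Suc j) = t + h * (1 - y)" unfolding t xj by (simp add: algebra_simps)
      moreover have "\<bar>h * (1 - y)\<bar> < d" using dy dy0 d(1) by (simp add: h_def)
      ultimately show "norm (f (h * real (Suc j)) - f t) \<le> \<eta>" using d(2)[of "h * (1 - y)" t] by simp
    qed
    then have ft: "norm (f t - E j) \<le> 8 * \<eta>" "norm (f t - E (Suc j)) \<le> 8 * \<eta>"
      using ap[rule_format, of j] ap[rule_format, of "Suc j"] unfolding E_def by norm+
    have A: "norm (f t - ((1 - of_real y) * E j + of_real y * E (Suc j))) \<le> 8 * \<eta>"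
    proof -
      have "f t - ((1 - of_real y) * E j + of_real y * E (Suc j))
          = of_real (1 - y) * (f t - E j) + of_real y * (f t - E (Suc j))" by (simp add: algebra_simps)
      also have "norm \<dots> \<le> (1 - y) * norm (f t - E j) + y * norm (f t - E (Suc j))"
      proof (rule order_trans[OF norm_triangle_ineq])
        have "norm (complex_of_real (1 - y) * (f t - E j)) = (1 - y) * norm (f t - E j)"
          using y by (simp only: norm_mult norm_of_real abs_of_nonneg)
        moreover have "norm (complex_of_real y * (f t - E (Suc j))) = y * norm (f t - E (Suc j))"
          using y by (simp only: norm_mult norm_of_real abs_of_nonneg)
        ultimately show "norm (complex_of_real (1 - y) * (f t - E j)) + norm (complex_of_real y * (f t - E (Suc j)))
            \<le> (1 - y) * norm (f t - E j) + y * norm (f t - E (Suc j))" by simp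
      qed
      also have "\<dots> \<le> (1 - y) * (8 * \<eta>) + y * (8 * \<eta>)"
        using y ft by (intro add_mono mult_left_mono) auto
      finally show ?thesis by (simp add: algebra_simps)
    qed
    have B: "(1 - of_real y) * E j + of_real y * E (Suc j) = (\<Sum>i<n. (c i * cis (\<theta> i * x)) * \<psi> (\<theta> i) y)"
    proof -
      have "(1 - of_real y) * cis (\<theta> * real j) + of_real y * cis (\<theta> * real (Suc j)) = cis (\<theta> * x) * \<psi> \<theta> y" for \<theta>
      proof -
        have "cis (\<theta> * real j) = cis (\<theta> * x) * cis (- (\<theta> * y))"
             "cis (\<theta> * real (Suc j)) = cis (\<theta> * x) * cis (\<theta> * (1 - y))"
          by (simp_all add: cis_mult xj algebra_simps)
        then show ?thesis by (simp add: \<psi>_def algebra_simps)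
      qed
      then have *: "c i * (cis (\<theta> i * x) * \<psi> (\<theta> i) y) = (1 - of_real y) * (c i * cis (\<theta> i * real j))
          + of_real y * (c i * cis (\<theta> i * real (Suc j)))" for i
        by (metis distrib_left mult.left_commute)
      show ?thesis
        unfolding E_def sum_distrib_left sum.distrib[symmetric] mult.assoc * ..
    qed
    have "norm ((\<Sum>i<n. (c i * cis (\<theta> i * x)) * \<psi> (\<theta> i) y) - P t) \<le> \<eta>"
    proof -
      have "(\<Sum>i<n. (c i * cis (\<theta> i * x)) * \<psi> (\<theta> i) y) - P t
          = (\<Sum>i<n. (c i * cis (\<theta> i * x)) * (\<psi> (\<theta> i) y - p (\<theta> i) x))"
        by (simp add: P_def x_def sum_subtractf right_diff_distrib)
      also have "norm \<dots> \<le> (\<Sum>i<n. norm (c i) * (\<eta> / D))"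
        unfolding norm_mult norm_cis mult_1_right y_def
        by (intro sum_norm_le) (simp only: norm_mult norm_cis mult_1_right, intro mult_left_mono p norm_ge_zero)
      also have "\<dots> = (D - 1) * (\<eta> / D)" unfolding D_def by (simp add: sum_distrib_right[symmetric] del: times_divide_eq_right)
      also have "\<dots> \<le> \<eta>" using D \<eta> by (simp add: field_simps)
      finally show ?thesis .
    qed
    then show ?thesis
      using A norm_triangle_ineq[of "f t - (\<Sum>i<n. (c i * cis (\<theta> i * x)) * \<psi> (\<theta> i) y)"
          "(\<Sum>i<n. (c i * cis (\<theta> i * x)) * \<psi> (\<theta> i) y) - P t"]
      unfolding B by (simp add: \<eta>_def)
  qed
  ultimately show ?thesis by blast
qed

section \<open>Semi-almost periodic functions\<close>

lemma compact_closure_subset: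
  fixes A :: "'a::t2_space set"
  assumes "A \<subseteq> K" "compact K"
  shows "compact (closure A)"
proof -
  have "closure A \<subseteq> K" using assms by (intro closure_minimal compact_imp_closed)
  then show ?thesis using compact_Int_closed[OF assms(2), of "closure A"] by (simp add: inf.absorb2)
qed

lemma exp_sums_bcontfun: "p \<in> exp_sums \<Longrightarrow> p \<in> bcontfun"
  using exp_sums_bounded[of p] exp_sums_continuous[of p UNIV] by (auto simp: bcontfun_def bounded_iff)

text \<open>A shift only rotates the coefficient of a single exponential, so its orbit lies in the
  continuous image of a closed disc; the orbit of a sum lies in the sum of two compact sets.\<close>

lemma exp_sums_almost_periodic: "p \<in> exp_sums \<Longrightarrow> p \<in> almost_periodic"
proof (induction rule: exp_sums.induct)
  case (mono c \<nu>)
  define H where "H a = Bcontfun (\<lambda>t. a * cis (\<nu> * t))" for a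
  have H: "apply_bcontfun (H a) t = a * cis (\<nu> * t)" for a t
    unfolding H_def by (simp add: Bcontfun_inverse exp_sums_bcontfun exp_sums.mono)
  have dH: "dist (H a) (H b) \<le> dist a b" for a b
    by (rule dist_bound) (simp add: H dist_norm norm_mult flip: left_diff_distrib)
  have "continuous_on UNIV H"
    unfolding continuous_on_iff using dH order_le_less_trans by (metis dist_commute)
  then have K: "compact (H ` cball 0 (norm c))"
    by (intro compact_continuous_image) (auto intro: continuous_on_subset)
  have "range (\<lambda>\<tau>. Bcontfun (\<lambda>t. c * cis (\<nu> * (t + \<tau>)))) \<subseteq> H ` cball 0 (norm c)"
  proof (intro image_subsetI)
    fix \<tau>
    have "Bcontfun (\<lambda>t. c * cis (\<nu> * (t + \<tau>))) = H (c * cis (\<nu> * \<tau>))"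
      unfolding H_def by (simp add: distrib_left mult_ac flip: cis_mult)
    moreover have "c * cis (\<nu> * \<tau>) \<in> cball 0 (norm c)" by (simp add: norm_mult)
    ultimately show "Bcontfun (\<lambda>t. c * cis (\<nu> * (t + \<tau>))) \<in> H ` cball 0 (norm c)" by blast
  qed
  then show ?case
    using compact_closure_subset[OF _ K] by (simp add: almost_periodic_def exp_sums_bcontfun exp_sums.mono)
next
  case (add p q)
  define T where "T f \<tau> = Bcontfun (\<lambda>t. f (t + \<tau>))" for f :: "real \<Rightarrow> complex" and \<tau>
  have pq: "p \<in> bcontfun" "q \<in> bcontfun" "(\<lambda>t. p t + q t) \<in> bcontfun"
    using add.hyps by (auto intro: exp_sums_bcontfun exp_sums.add)
  have T: "apply_bcontfun (T f \<tau>) t = f (t + \<tau>)" if "f \<in> bcontfun" for f \<tau> t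
    unfolding T_def by (simp add: Bcontfun_inverse almost_periodic_bcontfun_translate that)
  let ?K = "{x + y |x y. x \<in> closure (range (T p)) \<and> y \<in> closure (range (T q))}"
  have K: "compact ?K"
    using add.IH by (intro compact_sums) (simp_all add: almost_periodic_def T_def)
  have "range (T (\<lambda>t. p t + q t)) \<subseteq> ?K"
  proof (intro image_subsetI)
    fix \<tau>
    have "T (\<lambda>t. p t + q t) \<tau> = T p \<tau> + T q \<tau>"
      by (rule bcontfun_eqI) (simp add: T pq plus_bcontfun.rep_eq)
    moreover have "T p \<tau> \<in> closure (range (T p))" "T q \<tau> \<in> closure (range (T q))"
      by (rule subsetD[OF closure_subset], simp)+
    ultimately show "T (\<lambda>t. p t + q t) \<tau> \<in> ?K" by blast
  qed
  then show ?case
    using compact_closure_subset[OF _ K] pq(3) by (simp add: almost_periodic_def T_def)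
qed

lemma mult_approx:
  assumes e: "e > 0"
  shows "\<exists>\<eta>>0. \<forall>x y p q :: complex. norm x \<le> C \<longrightarrow> norm y \<le> D \<longrightarrow> norm (x - p) \<le> \<eta> \<longrightarrow> norm (y - q) \<le> \<eta> \<longrightarrow>
    norm (x * y - p * q) \<le> e"
proof -
  define M where "M = \<bar>C\<bar> + \<bar>D\<bar> + 1"
  have M: "M > 0" by (simp add: M_def add_nonneg_pos)
  define \<eta> where "\<eta> = min 1 (e / M)"
  have \<eta>: "0 < \<eta>" "\<eta> \<le> 1" "\<eta> * M \<le> e" using e M by (auto simp: \<eta>_def min_def field_simps)
  have "norm (x * y - p * q) \<le> e"
    if *: "norm x \<le> C" "norm y \<le> D" "norm (x - p) \<le> \<eta>" "norm (y - q) \<le> \<eta>" for x y p q :: complex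
  proof -
    have q: "norm q \<le> \<bar>D\<bar> + 1"
      using norm_triangle_sub[of q y] * \<eta>(2) by (simp add: norm_minus_commute)
    have "x * y - p * q = x * (y - q) + (x - p) * q" by (simp add: algebra_simps)
    also have "norm \<dots> \<le> norm x * norm (y - q) + norm (x - p) * norm q"
      by (metis norm_mult norm_triangle_ineq)
    also have "\<dots> \<le> \<bar>C\<bar> * \<eta> + \<eta> * (\<bar>D\<bar> + 1)" using * q \<eta>(1) by (intro add_mono mult_mono) auto
    also have "\<dots> = \<eta> * M" by (simp add: M_def algebra_simps)
    finally show ?thesis using \<eta>(3) by simp
  qed
  then show ?thesis using \<eta>(1) by blast
qed

abbreviation arc_close :: "real \<Rightarrow> real \<Rightarrow> real \<Rightarrow> (complex \<Rightarrow> complex) \<Rightarrow> (real \<Rightarrow> complex) \<Rightarrow> real \<Rightarrow> bool" where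
  "arc_close t0 k s f p e \<equiv>
     AE z in circle. \<forall>t. 0 < t \<longrightarrow> t < s \<longrightarrow> z = cis (t0 + k * t) \<longrightarrow> norm (f z - p (ln t)) \<le> e"

text \<open>The local condition in the variable \<open>ln t\<close>. By Bohr's theorem exponential
  sums can take the place of almost periodic functions, and rescaling an arc is only a shift of
  \<open>ln t\<close>, so arcs may be shortened freely and each side may have its own
  length.\<close>

definition sap_at :: "(complex \<Rightarrow> complex) \<Rightarrow> real \<Rightarrow> bool" where
  "sap_at f t0 \<longleftrightarrow> (\<forall>e>0. \<forall>k\<in>{-1,1::real}. \<exists>s>0. \<exists>p\<in>exp_sums.
     arc_close t0 k s f p e)"

lemma sap_atE:
  assumes "sap_at f t0" "e > 0" "k = -1 \<or> k = 1"
  obtains s p where "s > 0" "p \<in> exp_sums"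
    "arc_close t0 k s f p e"
  using assms unfolding sap_at_def by blast

text \<open>Recovers the arc parameter from the point, which turns a function of \<open>ln t\<close>
  into a function on the circle.\<close>

lemma abs_Arg_arc:
  assumes "0 < t" "t < pi" "k = -1 \<or> k = (1::real)"
  shows "\<bar>Arg (cis (t0 + k * t) * cis (- t0))\<bar> = t"
proof -
  have "Arg (cis (t0 + k * t) * cis (- t0)) = k * t"
  proof (rule Arg_unique[of 1])
    have "cis (t0 + k * t) * cis (- t0) = cis (k * t)" by (simp add: cis_mult)
    then show "complex_of_real 1 * exp (\<i> * complex_of_real (k * t)) = cis (t0 + k * t) * cis (- t0)"
      by (simp add: cis_conv_exp)
  qed (use assms in auto)
  then show ?thesis using assms by (auto simp: abs_mult)
qed

text \<open>Forward, Bohr's theorem replaces the almost periodic function and \<open>ln s\<close> is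
  absorbed by a shift. Backward, exponential sums are almost periodic, and the two sides are cut to
  a common length at most 1, below \<open>pi\<close>, so that the arc parameter is determined by the
  point.\<close>

lemma semi_almost_periodic_iff:
  "semi_almost_periodic f \<longleftrightarrow> f \<in> ess_bounded circle \<and> (\<forall>t0\<in>{0..<2*pi}. sap_at f t0)"
proof (intro iffI conjI ballI)
  assume f: "semi_almost_periodic f"
  show "f \<in> ess_bounded circle" using f by (simp add: semi_almost_periodic_def)
  fix t0 assume t0: "t0 \<in> {0..<2*pi}"
  show "sap_at f t0" unfolding sap_at_def
  proof (intro allI impI ballI)
    fix e k :: real assume e: "e > 0" and k: "k \<in> {-1,1}"
    have "\<exists>s\<in>{0<..<pi}. \<forall>k\<in>{-1, 1}. \<exists>fk :: complex \<Rightarrow> complex.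
        (\<exists>g\<in>almost_periodic. \<forall>t<0. fk (cis (t0 + k * s * exp t)) = g t) \<and>
        (\<exists>d<e/2. AE z in circle. z \<in> circle_arc t0 k s \<longrightarrow> norm (f z - fk z) \<le> d)"
      by (rule f[unfolded semi_almost_periodic_def, THEN conjunct2, THEN bspec, OF t0, THEN spec,
            THEN mp, OF half_gt_zero[OF e]])
    then obtain s where s: "0 < s" "s < pi" and ex: "\<forall>k\<in>{-1, 1}. \<exists>fk :: complex \<Rightarrow> complex.
        (\<exists>g\<in>almost_periodic. \<forall>t<0. fk (cis (t0 + k * s * exp t)) = g t) \<and>
        (\<exists>d<e/2. AE z in circle. z \<in> circle_arc t0 k s \<longrightarrow> norm (f z - fk z) \<le> d)"
      unfolding greaterThanLessThan_iff by (elim bexE) (rule that, auto)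
    obtain fk g d where g: "g \<in> almost_periodic"
       "\<And>t. t < 0 \<Longrightarrow> fk (cis (t0 + k * s * exp t)) = g t"
      and d: "d < e/2" "AE z in circle. z \<in> circle_arc t0 k s \<longrightarrow> norm (f z - fk z) \<le> d"
      using bspec[OF ex k] by blast
    obtain p where p: "p \<in> exp_sums" "\<And>t. t \<le> 0 \<Longrightarrow> norm (g t - p t) \<le> e/2"
      using almost_periodic_approximation[OF g(1), of "e/2"] e by auto
    have "AE z in circle. \<forall>t. 0 < t \<longrightarrow> t < s \<longrightarrow> z = cis (t0 + k * t) \<longrightarrow> norm (f z - p (1 * ln t + (- ln s))) \<le> e"
      using d(2)
    proof eventually_elim
      case (elim z)
      show ?case
      proof (intro allI impI)
        fix t assume t: "0 < t" "t < s" "z = cis (t0 + k * t)"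
        define x where "x = ln t - ln s"
        have x: "x < 0" using t s by (simp add: x_def)
        have "s * exp x = t" using t s by (simp add: x_def exp_diff)
        then have "fk z = g x" using g(2)[OF x] t(3) by (simp add: mult.assoc)
        moreover have "norm (f z - fk z) \<le> d" using elim t by (auto simp: circle_arc_def)
        moreover have "norm (g x - p x) \<le> e/2" using p(2) x by simp
        ultimately have "norm (f z - p x) \<le> e"
          using norm_triangle_ineq[of "f z - g x" "g x - p x"] d(1) by simp
        then show "norm (f z - p (1 * ln t + (- ln s))) \<le> e" by (simp add: x_def)
      qed
    qed
    then show "\<exists>s>0. \<exists>p\<in>exp_sums. arc_close t0 k s f p e"
      using s(1) exp_sums_scale[OF p(1), of 1 "- ln s"]
      by (intro exI[of _ s] conjI bexI[of _ "\<lambda>t. p (1 * t + (- ln s))"])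
  qed
next
  assume f: "f \<in> ess_bounded circle \<and> (\<forall>t0\<in>{0..<2*pi}. sap_at f t0)"
  show "semi_almost_periodic f" unfolding semi_almost_periodic_def
  proof (intro conjI ballI allI impI)
    show "f \<in> ess_bounded circle" using f by simp
    fix t0 e :: real assume t0: "t0 \<in> {0..<2*pi}" and e: "e > 0"
    define Q where "Q k s p \<longleftrightarrow> s > 0 \<and> p \<in> exp_sums \<and> (arc_close t0 k s f p (e/2))" for k s p
    have ex: "\<exists>s p. Q k s p" if "k = -1 \<or> k = 1" for k
      unfolding Q_def by (rule sap_atE[of f t0 "e/2" k]) (use f t0 e that in auto)
    obtain s1 p1 where 1: "Q 1 s1 p1" using ex by blast
    obtain s2 p2 where 2: "Q (-1) s2 p2" using ex by blast
    define s where "s = min 1 (min s1 s2)"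
    have s: "0 < s" "s \<le> 1" "s \<le> s1" "s \<le> s2" using 1 2 by (auto simp: s_def Q_def)
    have spi: "s < pi" using s(2) pi_gt3 by linarith
    have main: "\<exists>fk :: complex \<Rightarrow> complex.
        (\<exists>g\<in>almost_periodic. \<forall>t<0. fk (cis (t0 + k * s * exp t)) = g t) \<and>
        (\<exists>d<e. AE z in circle. z \<in> circle_arc t0 k s \<longrightarrow> norm (f z - fk z) \<le> d)"
      if Q: "Q k s' p" and k: "k = -1 \<or> k = 1" and s': "s \<le> s'" for k s' p
    proof -
      define fk where "fk z = p (ln \<bar>Arg (z * cis (- t0))\<bar>)" for z
      have p: "p \<in> exp_sums" using Q by (simp add: Q_def)
      show ?thesis
      proof (intro exI[of _ fk] conjI bexI[of _ "\<lambda>t. p (1 * t + ln s)"] exI[of _ "e/2"])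
        show "(\<lambda>t. p (1 * t + ln s)) \<in> almost_periodic"
          by (intro exp_sums_almost_periodic exp_sums_scale p)
        show "\<forall>t<0. fk (cis (t0 + k * s * exp t)) = p (1 * t + ln s)"
        proof (intro allI impI)
          fix t :: real assume t: "t < 0"
          have st: "0 < s * exp t" using s by simp
          have "s * exp t \<le> s * 1" using s t by (intro mult_left_mono) auto
          then have "s * exp t < pi" using spi by simp
          then have "fk (cis (t0 + k * (s * exp t))) = p (ln (s * exp t))"
            using abs_Arg_arc[OF st _ k, of t0] by (simp add: fk_def)
          also have "ln (s * exp t) = 1 * t + ln s" using s by (simp add: ln_mult)
          finally show "fk (cis (t0 + k * s * exp t)) = p (1 * t + ln s)" by (simp add: mult.assoc)
        qed
        have "arc_close t0 k s' f p (e/2)"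
          using Q by (simp add: Q_def)
        then show "AE z in circle. z \<in> circle_arc t0 k s \<longrightarrow> norm (f z - fk z) \<le> e/2"
        proof eventually_elim
          case (elim z)
          show ?case
          proof
            assume "z \<in> circle_arc t0 k s"
            then obtain t where t: "0 < t" "t < s" "z = cis (t0 + k * t)" by (auto simp: circle_arc_def)
            then have "fk z = p (ln t)" using abs_Arg_arc[OF t(1) _ k, of t0] spi by (simp add: fk_def)
            then show "norm (f z - fk z) \<le> e/2" using elim t s' by simp
          qed
        qed
      qed (use e in auto)
    qed
    show "\<exists>s\<in>{0<..<pi}. \<forall>k\<in>{-1, 1}. \<exists>fk :: complex \<Rightarrow> complex.
        (\<exists>g\<in>almost_periodic. \<forall>t<0. fk (cis (t0 + k * s * exp t)) = g t) \<and>
        (\<exists>d<e. AE z in circle. z \<in> circle_arc t0 k s \<longrightarrow> norm (f z - fk z) \<le> d)"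
      using main[OF 1 _ s(3)] main[OF 2 _ s(4)] s(1) spi by (intro bexI[of _ s]) auto
  qed
qed

lemma sap_at_add:
  assumes "sap_at f t0" "sap_at g t0"
  shows "sap_at (\<lambda>z. f z + g z) t0"
  unfolding sap_at_def
proof (intro allI impI ballI)
  fix e k :: real assume e: "e > 0" and k: "k \<in> {-1,1}"
  obtain s p where p: "s > 0" "p \<in> exp_sums" "arc_close t0 k s f p (e/2)"
    by (rule sap_atE[OF assms(1), of "e/2" k]) (use e k in auto)
  obtain s' q where q: "s' > 0" "q \<in> exp_sums" "arc_close t0 k s' g q (e/2)"
    by (rule sap_atE[OF assms(2), of "e/2" k]) (use e k in auto)
  have sum: "norm (x + y - (a + b)) \<le> e" if "norm (x - a) \<le> e/2" "norm (y - b) \<le> e/2" for x y a b :: complex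
    using norm_diff_triangle_ineq[of x y a b] that by simp
  have "arc_close t0 k (min s s') (\<lambda>z. f z + g z) (\<lambda>t. p t + q t) e"
    using p(3) q(3) by eventually_elim (auto intro: sum)
  then show "\<exists>s>0. \<exists>p\<in>exp_sums. arc_close t0 k s (\<lambda>z. f z + g z) p e"
    using p q by (intro exI[of _ "min s s'"] conjI bexI[of _ "\<lambda>t. p t + q t"] exp_sums.add) auto
qed

lemma sap_at_mult:
  assumes "sap_at f t0" "sap_at g t0" "f \<in> ess_bounded circle" "g \<in> ess_bounded circle"
  shows "sap_at (\<lambda>z. f z * g z) t0"
  unfolding sap_at_def
proof (intro allI impI ballI)
  fix e k :: real assume e: "e > 0" and k: "k \<in> {-1,1}"
  obtain C where C: "AE z in circle. norm (f z) \<le> C" using assms(3) by (auto simp: ess_bounded_def)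
  obtain D where D: "AE z in circle. norm (g z) \<le> D" using assms(4) by (auto simp: ess_bounded_def)
  obtain \<eta> where \<eta>: "\<eta> > 0" "\<forall>x y p q :: complex. norm x \<le> C \<longrightarrow> norm y \<le> D \<longrightarrow> norm (x - p) \<le> \<eta> \<longrightarrow> norm (y - q) \<le> \<eta> \<longrightarrow>
    norm (x * y - p * q) \<le> e" using mult_approx[OF e] by blast
  obtain s p where p: "s > 0" "p \<in> exp_sums" "arc_close t0 k s f p \<eta>"
    by (rule sap_atE[OF assms(1), of \<eta> k]) (use \<eta> k in auto)
  obtain s' q where q: "s' > 0" "q \<in> exp_sums" "arc_close t0 k s' g q \<eta>"
    by (rule sap_atE[OF assms(2), of \<eta> k]) (use \<eta> k in auto)
  have "arc_close t0 k (min s s') (\<lambda>z. f z * g z) (\<lambda>t. p t * q t) e"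
    using p(3) q(3) C D by eventually_elim (use \<eta>(2) in auto)
  then show "\<exists>s>0. \<exists>p\<in>exp_sums. arc_close t0 k s (\<lambda>z. f z * g z) p e"
    using p q by (intro exI[of _ "min s s'"] conjI bexI[of _ "\<lambda>t. p t * q t"] exp_sums_mult) auto
qed

lemma ess_bounded_add: "f \<in> ess_bounded M \<Longrightarrow> g \<in> ess_bounded M \<Longrightarrow> (\<lambda>z. f z + g z) \<in> ess_bounded M"
proof -
  assume f: "f \<in> ess_bounded M" and g: "g \<in> ess_bounded M"
  obtain C where C: "AE z in M. norm (f z) \<le> C" using f by (auto simp: ess_bounded_def)
  obtain D where D: "AE z in M. norm (g z) \<le> D" using g by (auto simp: ess_bounded_def)
  have "AE z in M. norm (f z + g z) \<le> C + D"
    using C D by eventually_elim (rule norm_triangle_mono)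
  then show ?thesis using f g by (auto simp: ess_bounded_def)
qed

lemma ess_bounded_mult: "f \<in> ess_bounded M \<Longrightarrow> g \<in> ess_bounded M \<Longrightarrow> (\<lambda>z. f z * g z) \<in> ess_bounded M"
proof -
  assume f: "f \<in> ess_bounded M" and g: "g \<in> ess_bounded M"
  obtain C where C: "AE z in M. norm (f z) \<le> C" using f by (auto simp: ess_bounded_def)
  obtain D where D: "AE z in M. norm (g z) \<le> D" using g by (auto simp: ess_bounded_def)
  have "AE z in M. norm (f z * g z) \<le> \<bar>C\<bar> * \<bar>D\<bar>"
    using C D by eventually_elim (auto simp: norm_mult intro!: mult_mono)
  then show ?thesis using f g by (auto simp: ess_bounded_def)
qed

lemma ess_bounded_const: "(\<lambda>z. c) \<in> ess_bounded M"
  by (auto simp: ess_bounded_def)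

lemma SAP_iff:
  "f \<in> SAP S0 \<longleftrightarrow> f \<in> ess_bounded circle \<and> (\<forall>t0\<in>{0..<2*pi}. sap_at f t0) \<and>
     (\<exists>g. continuous_on (sphere 0 1 - S0) g \<and> (AE z in circle. z \<in> sphere 0 1 - S0 \<longrightarrow> f z = g z))"
  by (simp add: SAP_def semi_almost_periodic_iff)

lemma SAP_combine:
  assumes f: "f \<in> SAP S0" and g: "g \<in> SAP S0"
    and "(\<lambda>z. h (f z) (g z)) \<in> ess_bounded circle"
    and "\<And>t0. t0 \<in> {0..<2*pi} \<Longrightarrow> sap_at (\<lambda>z. h (f z) (g z)) t0"
    and h: "\<And>(A :: complex set) a b. continuous_on A a \<Longrightarrow> continuous_on A b \<Longrightarrow> continuous_on A (\<lambda>z. h (a z) (b z))"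
  shows "(\<lambda>z. h (f z) (g z)) \<in> SAP S0"
proof -
  obtain a where a: "continuous_on (sphere 0 1 - S0) a" "AE z in circle. z \<in> sphere 0 1 - S0 \<longrightarrow> f z = a z"
    using f by (auto simp: SAP_iff)
  obtain b where b: "continuous_on (sphere 0 1 - S0) b" "AE z in circle. z \<in> sphere 0 1 - S0 \<longrightarrow> g z = b z"
    using g by (auto simp: SAP_iff)
  have "AE z in circle. z \<in> sphere 0 1 - S0 \<longrightarrow> h (f z) (g z) = h (a z) (b z)"
    using a(2) b(2) by eventually_elim auto
  then show ?thesis using assms(3,4) h[OF a(1) b(1)] unfolding SAP_iff by blast
qed

lemma SAP_add: "f \<in> SAP S0 \<Longrightarrow> g \<in> SAP S0 \<Longrightarrow> (\<lambda>z. f z + g z) \<in> SAP S0"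
  by (rule SAP_combine[where h="(+)"])
     (auto simp: SAP_iff intro: ess_bounded_add sap_at_add continuous_on_add)

lemma SAP_mult: "f \<in> SAP S0 \<Longrightarrow> g \<in> SAP S0 \<Longrightarrow> (\<lambda>z. f z * g z) \<in> SAP S0"
  by (rule SAP_combine[where h="(*)"])
     (auto simp: SAP_iff intro: ess_bounded_mult sap_at_mult continuous_on_mult)

lemma sets_circle: "sets circle = sets (restrict_space borel (sphere 0 1))"
  and space_circle: "space circle = sphere 0 1"
  by (simp_all add: circle_def space_restrict_space)

lemma borel_measurable_circle_continuous:
  "continuous_on (sphere 0 1) f \<Longrightarrow> f \<in> borel_measurable circle"
  using borel_measurable_continuous_on_restrict[of "sphere 0 1" f]
  by (simp add: measurable_cong_sets[OF sets_circle refl])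

lemma sap_at_continuous:
  assumes f: "continuous (at (cis t0) within sphere 0 1) f"
  shows "sap_at f t0"
  unfolding sap_at_def
proof (intro allI impI ballI)
  fix e k :: real assume e: "e > 0" and k: "k \<in> {-1,1}"
  obtain d where d: "d > 0" "\<And>z. z \<in> sphere 0 1 \<Longrightarrow> dist z (cis t0) < d \<Longrightarrow> dist (f z) (f (cis t0)) < e"
    using f e unfolding continuous_within_eps_delta by metis
  have "continuous_on UNIV (\<lambda>t. cis (t0 + k * t))" by (intro continuous_intros continuous_on_cis)
  then have "isCont (\<lambda>t. cis (t0 + k * t)) 0" by (simp add: continuous_on_eq_continuous_at)
  then obtain s where s: "s > 0" "\<And>t. dist t 0 < s \<Longrightarrow> dist (cis (t0 + k * t)) (cis (t0 + k * 0)) < d"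
    using d(1) unfolding continuous_at_eps_delta by metis
  show "\<exists>s>0. \<exists>p\<in>exp_sums. arc_close t0 k s f p e"
  proof (intro exI[of _ s] conjI bexI[of _ "\<lambda>_. f (cis t0)"] AE_I2 allI impI)
    fix z t assume t: "0 < t" "t < s" "z = cis (t0 + k * t)"
    then have "dist (f z) (f (cis t0)) < e" using s(2)[of t] d(2)[of z] by (simp add: dist_norm)
    then show "norm (f z - f (cis t0)) \<le> e" by (simp add: dist_norm)
  qed (use s exp_sums_const in auto)
qed

lemma SAP_continuous:
  assumes "continuous_on (sphere 0 1) f"
  shows "f \<in> SAP S0"
  unfolding SAP_iff
proof (intro conjI ballI exI[of _ f])
  have "bounded (f ` sphere 0 1)" using assms by (intro compact_imp_bounded compact_continuous_image) auto
  then obtain C where "\<And>z. z \<in> sphere 0 1 \<Longrightarrow> norm (f z) \<le> C" unfolding bounded_iff by blast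
  then have "AE z in circle. norm (f z) \<le> C" by (intro AE_I2) (simp add: space_circle)
  then show "f \<in> ess_bounded circle"
    using borel_measurable_circle_continuous[OF assms] by (auto simp: ess_bounded_def)
  show "sap_at f t0" for t0
    using assms by (intro sap_at_continuous) (simp add: continuous_on_eq_continuous_within)
  show "continuous_on (sphere 0 1 - S0) f" using assms continuous_on_subset by blast
qed auto

lemma SAP_const: "(\<lambda>z. c) \<in> SAP S0"
  by (rule SAP_continuous) auto

section \<open>Imaginary powers of \<open>1 - cnj \<zeta> * z\<close>\<close>

definition log_power :: "complex \<Rightarrow> real \<Rightarrow> complex \<Rightarrow> complex" where
  "log_power \<zeta> l z = exp (\<i> * of_real l * Ln (1 - cnj \<zeta> * z))"

lemma Re_one_minus_pos:
  assumes "norm w \<le> 1" "w \<noteq> 1"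
  shows "Re (1 - w) > 0"
proof (rule ccontr)
  assume "\<not> ?thesis"
  then have "Re w \<ge> 1" by simp
  moreover have "(Re w)\<^sup>2 + (Im w)\<^sup>2 \<le> 1" using assms(1) by (simp add: cmod_def)
  moreover have "(Re w)\<^sup>2 \<ge> 1" using calculation(1) by simp
  ultimately have "Im w = 0" "(Re w)\<^sup>2 = 1" by (smt (z3) zero_le_power2 power2_less_eq_zero_iff zero_eq_power2)+
  then have "w = 1" using \<open>Re w \<ge> 1\<close> by (auto simp: complex_eq_iff power2_eq_1_iff)
  then show False using assms(2) by simp
qed

lemma one_minus_cnj_mult:
  assumes "norm \<zeta> = 1" "norm z \<le> 1" "z \<noteq> \<zeta>"
  shows "Re (1 - cnj \<zeta> * z) > 0" "1 - cnj \<zeta> * z \<notin> \<real>\<^sub>\<le>\<^sub>0" "1 - cnj \<zeta> * z \<noteq> 0"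
proof -
  have "cnj \<zeta> * \<zeta> = 1" using assms(1) by (metis complex_norm_square mult.commute of_real_1 power_one)
  then have "cnj \<zeta> * z \<noteq> 1" using assms(1,3) by (metis mult_cancel_left mult_zero_left zero_neq_one)
  moreover have "norm (cnj \<zeta> * z) \<le> 1" using assms by (simp add: norm_mult)
  ultimately show *: "Re (1 - cnj \<zeta> * z) > 0" by (intro Re_one_minus_pos)
  show "1 - cnj \<zeta> * z \<notin> \<real>\<^sub>\<le>\<^sub>0" using * by (simp add: complex_nonpos_Reals_iff)
  show "1 - cnj \<zeta> * z \<noteq> 0" using * by (metis less_irrefl zero_complex.sel(1))
qed

lemma norm_log_power: "norm (log_power \<zeta> l z) = exp (- l * Im (Ln (1 - cnj \<zeta> * z)))"
  by (simp add: log_power_def)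

lemma abs_Im_Ln_le:
  assumes "norm \<zeta> = 1" "norm z \<le> 1" "z \<noteq> \<zeta>"
  shows "\<bar>Im (Ln (1 - cnj \<zeta> * z))\<bar> < pi / 2"
  by (rule iffD2[OF Re_Ln_pos_lt[OF one_minus_cnj_mult(3)[OF assms]] one_minus_cnj_mult(1)[OF assms]])

text \<open>For an imaginary exponent the modulus depends only on the argument of
  \<open>1 - cnj \<zeta> * z\<close>, and this number lies in the right half-plane.\<close>

lemma norm_log_power_le:
  assumes "norm \<zeta> = 1" "norm z \<le> 1" "z \<noteq> \<zeta>"
  shows "norm (log_power \<zeta> l z) \<le> exp (\<bar>l\<bar> * (pi / 2))"
proof -
  have "- l * Im (Ln (1 - cnj \<zeta> * z)) \<le> \<bar>l\<bar> * \<bar>Im (Ln (1 - cnj \<zeta> * z))\<bar>"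
    by (metis abs_ge_self abs_minus_cancel abs_mult)
  also have "\<dots> \<le> \<bar>l\<bar> * (pi / 2)" using abs_Im_Ln_le[OF assms] by (intro mult_left_mono) auto
  finally show ?thesis by (simp add: norm_log_power)
qed

lemma log_power_0 [simp]: "log_power \<zeta> 0 z = 1" "log_power \<zeta> l 0 = 1"
  by (simp_all add: log_power_def)

lemma log_power_add: "log_power \<zeta> (l + m) z = log_power \<zeta> l z * log_power \<zeta> m z"
  by (simp add: log_power_def ring_distribs flip: exp_add)

text \<open>The map multiplies \<open>1 - cnj \<zeta> * z\<close> by the positive number
  \<open>exp \<tau>\<close>, so the logarithm changes in its real part only. This makes the powers
  eigenfunctions of the contractions towards \<open>\<zeta>\<close>.\<close>

lemma Ln_contract:
  assumes "norm \<zeta> = 1" "norm z < 1"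
  shows "Ln (1 - cnj \<zeta> * (\<zeta> + of_real (exp \<tau>) * (z - \<zeta>))) = of_real \<tau> + Ln (1 - cnj \<zeta> * z)"
proof -
  have "cnj \<zeta> * \<zeta> = 1" using assms(1) by (metis complex_norm_square mult.commute of_real_1 power_one)
  then have "1 - cnj \<zeta> * (\<zeta> + of_real (exp \<tau>) * (z - \<zeta>)) = of_real (exp \<tau>) * (1 - cnj \<zeta> * z)"
    by (simp add: algebra_simps)
  moreover have "1 - cnj \<zeta> * z \<noteq> 0" using assms by (intro one_minus_cnj_mult) auto
  moreover have "Ln (of_real (exp \<tau>)) = of_real \<tau>" by (subst Ln_of_real) simp_all
  ultimately show ?thesis using Ln_times_of_real[OF exp_gt_zero[of \<tau>]] by (simp only:)
qed

lemma log_power_contract: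
  assumes "norm \<zeta> = 1" "norm z < 1"
  shows "log_power \<zeta> l (\<zeta> + of_real (exp \<tau>) * (z - \<zeta>)) = cis (l * \<tau>) * log_power \<zeta> l z"
  unfolding log_power_def Ln_contract[OF assms] by (simp add: ring_distribs exp_add cis_conv_exp mult_ac)

lemma log_power_continuous:
  assumes "norm \<zeta> = 1"
  shows "continuous_on (cball 0 1 - {\<zeta>}) (log_power \<zeta> l)"
  unfolding log_power_def using one_minus_cnj_mult[OF assms] by (intro continuous_intros) auto

lemma log_power_holomorphic:
  assumes "norm \<zeta> = 1"
  shows "log_power \<zeta> l holomorphic_on ball 0 1"
proof -
  have "1 - cnj \<zeta> * z \<notin> \<real>\<^sub>\<le>\<^sub>0" if "z \<in> ball 0 1" for z
    using that assms by (intro one_minus_cnj_mult) auto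
  then show ?thesis unfolding log_power_def by (intro holomorphic_intros) auto
qed

text \<open>Half-angle form: \<open>1 - cis (k * t)\<close> has modulus
  \<open>2 * sin (t / 2)\<close> and argument \<open>k * (t - pi) / 2\<close>.\<close>

lemma Ln_one_minus_cis:
  assumes "0 < t" "t < pi" "k = -1 \<or> k = (1::real)"
  shows "Ln (1 - cis (k * t)) = Complex (ln (2 * sin (t / 2))) (k * (t - pi) / 2)"
proof (rule Ln_unique)
  have s: "sin (t / 2) > 0" using assms by (intro sin_gt_zero) auto
  have ct: "cos t = 1 - 2 * (sin (t / 2))\<^sup>2" using cos_double_sin[of "t / 2"] by simp
  have st: "sin t = 2 * sin (t / 2) * cos (t / 2)" using sin_double[of "t / 2"] by simp
  have *: "(t - pi) / 2 = t / 2 - pi / 2" "(pi - t) / 2 = pi / 2 - t / 2" by (simp_all add: diff_divide_distrib)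
  show "exp (Complex (ln (2 * sin (t / 2))) (k * (t - pi) / 2)) = 1 - cis (k * t)"
    using assms(3) s
    by (auto simp: complex_eq_iff Re_exp Im_exp * cos_diff sin_diff ct st power2_eq_square)
qed (use assms pi_gt_zero in \<open>auto\<close>)

text \<open>As \<open>t\<close> tends to 0 the modulus of \<open>1 - cis (k * t)\<close> behaves
  like \<open>t\<close> and its argument tends to \<open>- k * pi / 2\<close>. Both sides of
  \<open>\<zeta>\<close> thus show the same frequency, with amplitudes in the ratio
  \<open>exp (l * pi)\<close>.\<close>

lemma log_power_arc:
  assumes "norm \<zeta> = 1" "k = -1 \<or> k = (1::real)"
  shows "((\<lambda>t. log_power \<zeta> l (\<zeta> * cis (k * t)) - of_real (exp (l * k * (pi / 2))) * cis (l * ln t)) \<longlongrightarrow> 0) (at_right 0)"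
proof -
  have cz: "cnj \<zeta> * \<zeta> = 1" using assms(1) by (metis complex_norm_square mult.commute of_real_1 power_one)
  define w where "w t = cis (l * ln (2 * sin (t / 2) / t)) * of_real (exp (- (l * k * (t - pi) / 2)))" for t
  have eq: "log_power \<zeta> l (\<zeta> * cis (k * t)) = cis (l * ln t) * w t" if t: "0 < t" "t < pi" for t
  proof -
    have s: "sin (t / 2) > 0" using t by (intro sin_gt_zero) auto
    have "log_power \<zeta> l (\<zeta> * cis (k * t)) = exp (\<i> * of_real l * Ln (1 - cis (k * t)))"
      by (simp add: log_power_def cz flip: mult.assoc)
    also have "\<dots> = exp (\<i> * of_real (l * ln (2 * sin (t / 2))) + of_real (- (l * k * (t - pi) / 2)))"
      unfolding Ln_one_minus_cis[OF t assms(2)] by (rule arg_cong[where f=exp]) (simp add: complex_eq_iff)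
    also have "\<dots> = cis (l * ln (2 * sin (t / 2))) * of_real (exp (- (l * k * (t - pi) / 2)))"
      by (simp only: exp_add cis_conv_exp exp_of_real)
    also have "ln (2 * sin (t / 2)) = ln t + ln (2 * sin (t / 2) / t)"
      using t s by (simp add: ln_div)
    finally show ?thesis by (simp only: w_def distrib_left cis_mult[symmetric] mult.assoc)
  qed
  have R: "((\<lambda>t::real. 2 * sin (t / 2) / t) \<longlongrightarrow> 1) (at_right 0)" by real_asymp
  have "(w \<longlongrightarrow> cis (l * ln 1) * of_real (exp (- (l * k * (0 - pi) / 2)))) (at_right 0)"
    unfolding w_def
    by (rule tendsto_mult, rule tendsto_cis, rule tendsto_mult, rule tendsto_const, rule tendsto_ln, rule R, simp,
       rule tendsto_of_real, rule tendsto_exp) (intro tendsto_intros | simp)+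
  then have "(w \<longlongrightarrow> of_real (exp (l * k * (pi / 2)))) (at_right 0)" by simp
  then have lim: "((\<lambda>t. norm (w t - of_real (exp (l * k * (pi / 2))))) \<longlongrightarrow> 0) (at_right 0)"
    by (intro tendsto_norm_zero LIM_zero)
  have "\<forall>\<^sub>F t in at_right (0::real). 0 < t \<and> t < pi" unfolding eventually_at_right_field by (auto intro: exI[of _ pi])
  then have "\<forall>\<^sub>F t in at_right 0. norm (w t - of_real (exp (l * k * (pi / 2))))
     = norm (log_power \<zeta> l (\<zeta> * cis (k * t)) - of_real (exp (l * k * (pi / 2))) * cis (l * ln t))"
  proof eventually_elim
    case (elim t)
    have "log_power \<zeta> l (\<zeta> * cis (k * t)) - of_real (exp (l * k * (pi / 2))) * cis (l * ln t)
       = cis (l * ln t) * (w t - of_real (exp (l * k * (pi / 2))))"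
      using eq[of t] elim by (simp add: algebra_simps)
    then show ?case by (simp only: norm_mult norm_cis mult_1)
  qed
  from Lim_transform_eventually[OF lim this] show ?thesis by (rule tendsto_norm_zero_cancel)
qed

lemma at_right_0_norm_le:
  fixes F :: "real \<Rightarrow> complex"
  assumes "(F \<longlongrightarrow> 0) (at_right 0)" "e > 0"
  shows "\<exists>s>0. \<forall>t. 0 < t \<longrightarrow> t < s \<longrightarrow> norm (F t) \<le> e"
  using tendstoD[OF assms] unfolding eventually_at_right_field by (auto simp: less_imp_le)

lemma Im_Ln_arc:
  assumes "norm \<zeta> = 1" "k = -1 \<or> k = (1::real)" "0 < t" "t < pi"
  shows "Im (Ln (1 - cnj \<zeta> * (\<zeta> * cis (k * t)))) = k * (t - pi) / 2"
proof -
  have "cnj \<zeta> * \<zeta> = 1" using assms(1) by (metis complex_norm_square mult.commute of_real_1 power_one)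
  then have "cnj \<zeta> * (\<zeta> * cis (k * t)) = cis (k * t)" by (simp flip: mult.assoc)
  then show ?thesis unfolding Ln_one_minus_cis[OF assms(3,4,2)] by (simp only: Ln_one_minus_cis[OF assms(3,4,2)] complex.sel)
qed

lemma log_power_measurable: "log_power \<zeta> l \<in> borel_measurable borel"
proof -
  note Ln_measurable[measurable]
  have "continuous_on UNIV (exp :: complex \<Rightarrow> complex)" by (intro continuous_intros)
  then have [measurable]: "(exp :: complex \<Rightarrow> complex) \<in> borel_measurable borel"
    by (rule borel_measurable_continuous_onI)
  have "(\<lambda>z. 1 - cnj \<zeta> * z) \<in> borel_measurable borel"
    by (intro borel_measurable_continuous_onI continuous_intros)
  then show ?thesis unfolding log_power_def by measurable
qed

lemma borel_measurable_circle_borel: "f \<in> borel_measurable borel \<Longrightarrow> f \<in> borel_measurable circle"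
  by (simp add: measurable_cong_sets[OF sets_circle refl] measurable_restrict_space1)

lemma measurable_cis_circle:
  "cis \<in> measurable (restrict_space lborel {0..<2 * pi}) (restrict_space borel (sphere 0 1))"
proof -
  have "cis \<in> borel_measurable borel"
    by (intro borel_measurable_continuous_onI continuous_on_cis continuous_on_id)
  then have "cis \<in> borel_measurable lborel" by simp
  then show ?thesis by (intro measurable_restrict_space2 measurable_restrict_space1) auto
qed

lemma circle_singleton_null: "AE z in circle. z \<noteq> a"
proof -
  note m = measurable_cis_circle
  have "finite {t. 0 \<le> t \<and> t < 2 * pi \<and> cis t = a}"
  proof (rule finite_subset[of _ "{THE t. 0 \<le> t \<and> t < 2 * pi \<and> cis t = a}"])
    show "{t. 0 \<le> t \<and> t < 2 * pi \<and> cis t = a} \<subseteq> {THE t. 0 \<le> t \<and> t < 2 * pi \<and> cis t = a}"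
    proof
      fix t assume t: "t \<in> {t. 0 \<le> t \<and> t < 2 * pi \<and> cis t = a}"
      have "u = t" if "0 \<le> u \<and> u < 2 * pi \<and> cis u = a" for u
        using t that Arg2pi_unique[of 1 u a] Arg2pi_unique[of 1 t a] by (simp add: cis_conv_exp)
      then have "(THE t. 0 \<le> t \<and> t < 2 * pi \<and> cis t = a) = t" using t by blast
      then show "t \<in> {THE t. 0 \<le> t \<and> t < 2 * pi \<and> cis t = a}" by simp
    qed
  qed simp
  then have "{t. 0 \<le> t \<and> t < 2 * pi \<and> cis t = a} \<in> null_sets lborel"
    by (simp add: countable_finite countable_imp_null_set_lborel)
  then have "AE t in lborel. t \<notin> {t. 0 \<le> t \<and> t < 2 * pi \<and> cis t = a}" by (rule AE_not_in)
  then have "AE t in lborel. t \<in> {0..<2*pi} \<longrightarrow> cis t \<noteq> a" by eventually_elim auto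
  then have "AE t in restrict_space lborel {0..<2 * pi}. cis t \<noteq> a"
    by (subst AE_restrict_space_iff) auto
  moreover have "{x \<in> space (restrict_space borel (sphere 0 1)). x \<noteq> a} \<in> sets (restrict_space borel (sphere 0 1))"
    unfolding sets_restrict_space by (rule image_eqI[of _ _ "- {a}"]) (auto simp: space_restrict_space)
  ultimately show ?thesis unfolding circle_def by (subst AE_distr_iff[OF m]) auto
qed

text \<open>At \<open>\<zeta>\<close> the behaviour on the two arcs is a single exponential in
  \<open>ln t\<close>; at all other points of the circle the power is continuous.\<close>

lemma log_power_SAP:
  assumes "norm \<zeta> = 1" "\<zeta> \<in> S0"
  shows "log_power \<zeta> l \<in> SAP S0"
  unfolding SAP_iff
proof (intro conjI ballI exI[of _ "log_power \<zeta> l"])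
  have "AE z in circle. norm (log_power \<zeta> l z) \<le> exp (\<bar>l\<bar> * (pi / 2))"
    using circle_singleton_null[of \<zeta>] AE_space
    by eventually_elim (rule norm_log_power_le[OF assms(1)], auto simp: space_circle)
  then show "log_power \<zeta> l \<in> ess_bounded circle"
    using borel_measurable_circle_borel[OF log_power_measurable] by (auto simp: ess_bounded_def)
  have cont: "continuous_on (sphere 0 1 - {\<zeta>}) (log_power \<zeta> l)"
    by (rule continuous_on_subset[OF log_power_continuous[OF assms(1)]]) auto
  then show "continuous_on (sphere 0 1 - S0) (log_power \<zeta> l)"
    by (rule continuous_on_subset) (use assms in auto)
  fix t0 :: real assume "t0 \<in> {0..<2*pi}"
  show "sap_at (log_power \<zeta> l) t0"
  proof (cases "cis t0 = \<zeta>")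
    case False
    have "continuous (at (cis t0) within (sphere 0 1 - {\<zeta>})) (log_power \<zeta> l)"
      using cont False by (simp add: continuous_on_eq_continuous_within)
    moreover have "at (cis t0) within (sphere 0 1 - {\<zeta>}) = at (cis t0) within sphere 0 1"
      using False by (intro at_within_nhd[of _ "- {\<zeta>}"]) auto
    ultimately show ?thesis by (intro sap_at_continuous) (simp add: continuous_within)
  next
    case True
    show ?thesis unfolding sap_at_def
    proof (intro allI impI ballI)
      fix e k :: real assume e: "e > 0" and k: "k \<in> {-1,1}"
      obtain s where s: "s > 0" "\<And>t. 0 < t \<Longrightarrow> t < s \<Longrightarrow>
         norm (log_power \<zeta> l (\<zeta> * cis (k * t)) - of_real (exp (l * k * (pi / 2))) * cis (l * ln t)) \<le> e"
        using at_right_0_norm_le[OF log_power_arc[OF assms(1), of k l] e] k by auto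
      show "\<exists>s>0. \<exists>p\<in>exp_sums. arc_close t0 k s (log_power \<zeta> l) p e"
        using s exp_sums.mono[of "of_real (exp (l * k * (pi / 2)))" l] True
        by (intro exI[of _ s] conjI bexI[of _ "\<lambda>t. of_real (exp (l * k * (pi / 2))) * cis (l * t)"] AE_I2)
           (auto simp flip: cis_mult)
    qed
  qed
qed auto

section \<open>Poisson integrals on the disc and the polydisc\<close>

lemma finite_measure_circle: "finite_measure circle"
proof -
  interpret R: finite_measure "restrict_space lborel {0..<2 * pi}"
    by (rule finite_measureI) (simp add: emeasure_restrict_space space_restrict_space)
  show ?thesis unfolding circle_def by (rule R.finite_measure_distr[OF measurable_cis_circle])
qed

text \<open>Links the Lebesgue integral over \<open>circle\<close> with the gauge integral in which
  contour integrals are expressed.\<close>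

lemma circle_integral_continuous:
  fixes f :: "complex \<Rightarrow> complex"
  assumes f: "continuous_on (sphere 0 1) f"
  shows "integral\<^sup>L circle f = integral {0..2*pi} (\<lambda>t. f (cis t))"
proof -
  have fm: "f \<in> borel_measurable (restrict_space borel (sphere 0 1))"
    using f by (rule borel_measurable_continuous_on_restrict)
  have cont: "continuous_on {0..2*pi} (\<lambda>t. f (cis t))"
    by (rule continuous_on_compose2[OF f]) (auto intro: continuous_on_cis continuous_on_id)
  have int: "set_integrable lborel {0..<2*pi} (\<lambda>t. f (cis t))"
    by (rule set_integrable_subset[OF borel_integrable_atLeastAtMost'[OF cont]]) auto
  have "integral\<^sup>L circle f = integral\<^sup>L (restrict_space lborel {0..<2 * pi}) (\<lambda>t. f (cis t))"
    unfolding circle_def by (rule integral_distr[OF measurable_cis_circle fm])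
  also have "\<dots> = (LINT t:{0..<2*pi}|lborel. f (cis t))"
    unfolding set_lebesgue_integral_def by (subst integral_restrict_space) auto
  also have "\<dots> = integral {0..<2*pi} (\<lambda>t. f (cis t))"
    by (rule set_borel_integral_eq_integral(2)[OF int])
  also have "\<dots> = integral {0..2*pi} (\<lambda>t. f (cis t))"
  proof (rule integral_spike_set)
    show "negligible {x \<in> {0..<2*pi} - {0..2*pi}. f (cis x) \<noteq> 0}"
      by (rule negligible_subset[of "{}"]) auto
    show "negligible {x \<in> {0..2*pi} - {0..<2*pi}. f (cis x) \<noteq> 0}"
      by (rule negligible_subset[of "{2*pi}"]) auto
  qed
  finally show ?thesis .
qed

text \<open>The Poisson kernel for arc length that is not normalised, whence the factor
  \<open>2 * pi\<close>.\<close>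

definition poisson :: "complex \<Rightarrow> complex \<Rightarrow> real" where
  "poisson z w = (1 - (norm z)\<^sup>2) / (2 * pi * (norm (w - z))\<^sup>2)"

lemma poisson_nonneg: "norm z < 1 \<Longrightarrow> poisson z w \<ge> 0"
  unfolding poisson_def by (intro divide_nonneg_nonneg) (auto simp: power_le_one)

lemma poisson_continuous:
  assumes "norm z < 1"
  shows "continuous_on (sphere 0 1) (poisson z)"
  unfolding poisson_def using assms by (intro continuous_intros) auto

text \<open>Cauchy's formula for \<open>f u * (1 - (norm z)\<^sup>2) / (1 - cnj z * u)\<close>: the
  extra factor is 1 at \<open>u = z\<close>, and on the circle it turns the Cauchy kernel into the
  Poisson kernel.\<close>

lemma poisson_formula:
  assumes f: "continuous_on (cball 0 1) f" "f holomorphic_on ball 0 1" and z: "norm z < 1"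
  shows "f z = (LINT w|circle. poisson z w *\<^sub>R f w)"
proof -
  define g where "g u = f u * of_real (1 - (norm z)\<^sup>2) / (1 - cnj z * u)" for u
  have nz: "1 - cnj z * u \<noteq> 0" if "norm u \<le> 1" for u
  proof
    assume "1 - cnj z * u = 0"
    then have "norm (cnj z * u) = 1" by (metis eq_iff_diff_eq_0 norm_one)
    moreover have "norm (cnj z * u) \<le> norm z * 1" using that by (simp add: norm_mult mult_left_le)
    ultimately show False using z by simp
  qed
  have gc: "continuous_on (cball 0 1) g" unfolding g_def using f(1) nz by (intro continuous_intros) auto
  have gh: "g holomorphic_on ball 0 1" unfolding g_def using f(2) nz by (intro holomorphic_intros) auto
  have z1: "(norm z)\<^sup>2 < 1" using z by (simp add: power_less_one_iff abs_square_less_1)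
  have zz: "cnj z * z = of_real ((norm z)\<^sup>2)" unfolding complex_norm_square by (rule mult.commute)
  have gz: "g z = f z" using nz[of z] z unfolding g_def zz by (simp del: of_real_power)
  have "((\<lambda>u. g u / (u - z)) has_contour_integral (2 * of_real pi * \<i> * f z)) (part_circlepath 0 1 0 (2*pi))"
    using Cauchy_integral_circlepath[OF gc gh, of z] z gz by (simp add: circlepath_def)
  then have "((\<lambda>t. g (cis t) / (cis t - z) * \<i> * cis t) has_integral (2 * of_real pi * \<i> * f z)) {0..2*pi}"
    by (subst (asm) has_contour_integral_part_circlepath_iff) auto
  then have "((\<lambda>t. (1 / (2 * of_real pi * \<i>)) * (g (cis t) / (cis t - z) * \<i> * cis t)) has_integral
       ((1 / (2 * of_real pi * \<i>)) * (2 * of_real pi * \<i> * f z))) {0..2*pi}"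
    by (rule has_integral_mult_right)
  moreover have "(1 / (2 * of_real pi * \<i>)) * (2 * of_real pi * \<i> * f z) = f z" by simp
  moreover have "(1 / (2 * of_real pi * \<i>)) * (g (cis t) / (cis t - z) * \<i> * cis t) = poisson z (cis t) *\<^sub>R f (cis t)" for t
  proof -
    let ?w = "cis t"
    have w: "?w * cnj ?w = 1" by (simp add: complex_norm_square[symmetric])
    have wz: "?w - z \<noteq> 0" using z by (metis norm_cis eq_iff_diff_eq_0 less_irrefl)
    have "(norm (?w - z))\<^sup>2 \<noteq> 0" using wz by simp
    have "complex_of_real ((norm (?w - z))\<^sup>2) * ?w = (?w - z) * (?w * cnj (?w - z))"
      by (simp only: complex_norm_square mult_ac)
    also have "?w * cnj (?w - z) = 1 - cnj z * ?w" using w by (simp add: algebra_simps)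
    finally have "(1 - cnj z * ?w) * (?w - z) = complex_of_real ((norm (?w - z))\<^sup>2) * ?w" by (simp add: mult.commute)
    then have "?w / ((1 - cnj z * ?w) * (?w - z)) = 1 / complex_of_real ((norm (?w - z))\<^sup>2)"
      by (simp add: cis_neq_zero)
    moreover have gen: "(1 / (2 * p * i)) * (a * c / D / E * i * w) = c * a / (2 * p) * (w / (D * E))"
      if "i \<noteq> 0" for p i a c D E w :: complex
      using that by (auto simp: divide_simps)
    ultimately have "(1 / (2 * of_real pi * \<i>)) * (g ?w / (?w - z) * \<i> * ?w)
       = of_real (1 - (norm z)\<^sup>2) * f ?w / (2 * of_real pi) * (1 / complex_of_real ((norm (?w - z))\<^sup>2))"
      unfolding g_def by (simp only: gen complex_i_not_zero not_False_eq_True)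
    then show ?thesis by (simp add: poisson_def scaleR_conv_of_real)
  qed
  ultimately have "((\<lambda>t. poisson z (cis t) *\<^sub>R f (cis t)) has_integral f z) {0..2*pi}" by simp
  moreover have "continuous_on (sphere 0 1) (\<lambda>w. poisson z w *\<^sub>R f w)"
    by (intro continuous_intros poisson_continuous z continuous_on_subset[OF f(1)]) auto
  ultimately show ?thesis by (simp add: circle_integral_continuous integral_unique)
qed

text \<open>Harmonic measure of the disc seen from \<open>z\<close>, a probability measure when
  \<open>z\<close> lies in the disc.\<close>

definition harm :: "complex \<Rightarrow> complex measure" where
  "harm z = density circle (\<lambda>w. ennreal (poisson z w))"

lemma sets_harm: "sets (harm z) = sets circle" and space_harm: "space (harm z) = sphere 0 1"
  by (simp_all add: harm_def space_circle)

lemma poisson_measurable [measurable]: "norm z < 1 \<Longrightarrow> poisson z \<in> borel_measurable circle"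
  using borel_measurable_continuous_on_restrict[OF poisson_continuous]
  by (simp add: measurable_cong_sets[OF sets_circle refl])

lemma integral_harm:
  assumes "norm z < 1" "f \<in> borel_measurable circle"
  shows "integral\<^sup>L (harm z) f = (LINT w|circle. poisson z w *\<^sub>R (f w :: complex))"
  unfolding harm_def using assms poisson_nonneg[OF assms(1)] by (intro integral_density) auto

lemma poisson_reproducing:
  assumes f: "continuous_on (cball 0 1) f" "f holomorphic_on ball 0 1" and z: "norm z < 1"
  shows "f z = integral\<^sup>L (harm z) f"
  using poisson_formula[OF assms] integral_harm[OF z borel_measurable_circle_continuous]
    continuous_on_subset[OF f(1), of "sphere 0 1"] by auto

lemma poisson_integrable:
  assumes z: "norm z < 1"
  shows "integrable circle (poisson z)"
proof -
  interpret finite_measure circle by (rule finite_measure_circle)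
  have "bounded (poisson z ` sphere 0 1)"
    by (intro compact_imp_bounded compact_continuous_image poisson_continuous z) auto
  then obtain B where "\<And>w. w \<in> sphere 0 1 \<Longrightarrow> norm (poisson z w) \<le> B" unfolding bounded_iff by blast
  then show ?thesis
    using z by (intro integrable_const_bound[of _ B] AE_I2) (auto simp: space_circle)
qed

lemma poisson_integral:
  assumes z: "norm z < 1"
  shows "(LINT w|circle. poisson z w) = 1"
proof -
  have "complex_of_real (LINT w|circle. poisson z w) = (LINT w|circle. of_real (poisson z w))"
    by (rule integral_complex_of_real[symmetric])
  also have "\<dots> = 1" using poisson_formula[OF _ _ z, of "\<lambda>_. 1"] by (simp add: scaleR_conv_of_real)
  finally show ?thesis by simp
qed

lemma emeasure_harm:
  assumes z: "norm z < 1"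
  shows "emeasure (harm z) (space (harm z)) = 1"
proof -
  interpret finite_measure circle by (rule finite_measure_circle)
  have "emeasure (harm z) (space (harm z)) = (\<integral>\<^sup>+w. ennreal (poisson z w) \<partial>circle)"
    unfolding harm_def using z by (subst emeasure_density) (auto intro!: nn_integral_cong)
  also have "\<dots> = 1" using nn_integral_eq_integral[OF poisson_integrable[OF z]] poisson_nonneg[OF z] poisson_integral[OF z] by simp
  finally show ?thesis .
qed

lemma finite_measure_harm: "norm z < 1 \<Longrightarrow> finite_measure (harm z)"
  by (rule finite_measureI) (simp add: emeasure_harm)

lemma measure_harm: "norm z < 1 \<Longrightarrow> measure (harm z) (sphere 0 1) = 1"
  using emeasure_harm[of z] by (simp add: measure_def space_harm)

lemma AE_harm: "norm z < 1 \<Longrightarrow> AE w in circle. P w \<Longrightarrow> AE w in harm z. P w"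
  unfolding harm_def by (subst AE_density) auto

lemma harm_integrable:
  assumes "norm z < 1" "f \<in> ess_bounded circle"
  shows "integrable (harm z) f"
proof -
  interpret finite_measure "harm z" by (rule finite_measure_harm[OF assms(1)])
  obtain C where "AE w in circle. norm (f w) \<le> C" using assms(2) by (auto simp: ess_bounded_def)
  then show ?thesis using assms AE_harm
    by (intro integrable_const_bound[of _ C]) (auto simp: ess_bounded_def measurable_cong_sets[OF sets_harm refl])
qed

lemma harm_bound:
  assumes z: "norm z < 1" and f: "f \<in> ess_bounded circle" and C: "AE w in circle. norm (f w) \<le> C"
  shows "norm (integral\<^sup>L (harm z) f) \<le> C"
proof -
  interpret finite_measure "harm z" by (rule finite_measure_harm[OF z])
  have "norm (integral\<^sup>L (harm z) f) \<le> (LINT w|harm z. norm (f w))" by (rule integral_norm_bound)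
  also have "\<dots> \<le> (LINT w|harm z. C)"
    using AE_harm[OF z C] harm_integrable[OF z f] by (intro integral_mono_AE) auto
  finally show ?thesis by (simp add: space_harm measure_harm[OF z])
qed

text \<open>Away from \<open>\<zeta>\<close> the Poisson kernel tends to zero uniformly as \<open>z\<close> tends to \<open>\<zeta>\<close>.\<close>

lemma harm_local_bound:
  assumes \<zeta>: "norm \<zeta> = 1" and f: "f \<in> ess_bounded circle" and d: "d > 0" and e: "e > 0"
    and C: "AE w in circle. dist w \<zeta> < d \<longrightarrow> norm (f w) \<le> e"
  shows "\<exists>\<delta>>0. \<forall>z. norm z < 1 \<longrightarrow> dist z \<zeta> < \<delta> \<longrightarrow> norm (integral\<^sup>L (harm z) f) \<le> 2 * e"
proof -
  interpret fc: finite_measure circle by (rule finite_measure_circle)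
  obtain B where B: "AE w in circle. norm (f w) \<le> B" using f by (auto simp: ess_bounded_def)
  define M where "M = \<bar>B\<bar> * 2 / (2 * pi * (d / 2)\<^sup>2) * measure circle (sphere 0 1) + 1"
  have M: "M > 0" unfolding M_def by (intro add_nonneg_pos mult_nonneg_nonneg divide_nonneg_nonneg) auto
  \<comment> \<open>The bound \<open>d / 2\<close> keeps \<open>z\<close> at least
    \<open>d / 2\<close> away from the far part of the circle. There the kernel is at most a
    multiple of \<open>\<delta>\<close>, and \<open>M\<close> collects the constants that turn this
    into \<open>e\<close>.\<close>
  define \<delta> where "\<delta> = min (d / 2) (e / M)"
  have \<delta>: "\<delta> > 0" "\<delta> \<le> d / 2" "\<delta> * M \<le> e" using M e d by (auto simp: \<delta>_def min_def field_simps)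
  show ?thesis
  proof (intro exI[of _ \<delta>] conjI allI impI)
    fix z assume z: "norm z < 1" "dist z \<zeta> < \<delta>"
    interpret finite_measure "harm z" by (rule finite_measure_harm[OF z(1)])
    define c where "c = \<bar>B\<bar> * (2 * \<delta> / (2 * pi * (d / 2)\<^sup>2))"
    have c: "c \<ge> 0" unfolding c_def using \<delta>(1) by (intro mult_nonneg_nonneg divide_nonneg_nonneg) auto
    note intp = poisson_integrable[OF z(1)] and one = poisson_integral[OF z(1)]
    have fm: "f \<in> borel_measurable circle" using f by (simp add: ess_bounded_def)
    have intf: "integrable circle (\<lambda>w. poisson z w *\<^sub>R f w)"
      using harm_integrable[OF z(1) f] unfolding harm_def
      by (subst (asm) integrable_density) (use z fm poisson_nonneg[OF z(1)] in auto)
    have "norm (integral\<^sup>L (harm z) f) = norm (LINT w|circle. poisson z w *\<^sub>R f w)"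
      by (simp add: integral_harm[OF z(1) fm])
    also have "\<dots> \<le> (LINT w|circle. norm (poisson z w *\<^sub>R f w))" by (rule integral_norm_bound)
    also have "\<dots> \<le> (LINT w|circle. poisson z w * e + c)"
    proof (rule integral_mono_AE)
      show "AE w in circle. norm (poisson z w *\<^sub>R f w) \<le> poisson z w * e + c"
        using C B AE_space
      proof eventually_elim
        case (elim w)
        have p0: "poisson z w \<ge> 0" using poisson_nonneg[OF z(1)] .
        show ?case
        proof (cases "dist w \<zeta> < d")
          case True
          then show ?thesis using elim p0 c by (auto simp: intro!: order_trans[OF mult_left_mono[of "norm (f w)" e]])
        next
          case False
          have w: "norm w = 1" using elim by (simp add: space_circle)
          have "norm (w - z) \<ge> d / 2"
            using False z(2) \<delta>(2) dist_triangle[of w \<zeta> z] by (simp add: dist_norm norm_minus_commute)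
          then have "(norm (w - z))\<^sup>2 \<ge> (d / 2)\<^sup>2" using d by (intro power_mono) auto
          moreover have "1 - (norm z)\<^sup>2 \<le> 2 * \<delta>"
          proof -
            have "1 - norm z \<le> \<delta>" using z(2) \<zeta> norm_triangle_ineq2[of \<zeta> z] by (simp add: dist_norm norm_minus_commute)
            moreover have "1 - (norm z)\<^sup>2 = (1 - norm z) * (1 + norm z)" by (simp add: power2_eq_square algebra_simps)
            moreover have "(1 - norm z) * (1 + norm z) \<le> \<delta> * 2"
              using calculation(1) z(1) \<delta>(1) by (intro mult_mono) auto
            ultimately show ?thesis by simp
          qed
          ultimately have "poisson z w \<le> 2 * \<delta> / (2 * pi * (d / 2)\<^sup>2)"
            unfolding poisson_def using d \<delta>(1) by (intro frac_le mult_left_mono) auto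
          then have "poisson z w * norm (f w) \<le> (2 * \<delta> / (2 * pi * (d / 2)\<^sup>2)) * \<bar>B\<bar>"
            using elim p0 by (intro mult_mono) (auto intro: order_trans)
          moreover have "poisson z w * e \<ge> 0" using p0 e by simp
          ultimately show ?thesis using p0 by (simp add: c_def mult.commute)
        qed
      qed
    qed (use integrable_norm[OF intf] intp in auto)
    also have "\<dots> = e + c * measure circle (sphere 0 1)"
      using intp one by (simp add: space_circle mult.commute)
    also have "c * measure circle (sphere 0 1) \<le> \<delta> * M"
      using \<delta>(1) by (simp add: c_def M_def algebra_simps)
    finally show "norm (integral\<^sup>L (harm z) f) \<le> 2 * e" using \<delta>(3) by simp
  qed (use \<delta> in auto)
qed

text \<open>The kernel is uniformly continuous for centres in a closed disc of radius
  \<open>R < 1\<close>, and it is integrated against a bounded function.\<close>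

lemma harm_continuous:
  assumes \<zeta>: "norm \<zeta> < 1" and f: "f \<in> ess_bounded circle" and e: "e > 0"
  shows "\<exists>\<delta>>0. \<forall>z. norm z < 1 \<longrightarrow> dist z \<zeta> < \<delta> \<longrightarrow>
     norm (integral\<^sup>L (harm z) f - integral\<^sup>L (harm \<zeta>) f) \<le> e"
proof -
  interpret fc: finite_measure circle by (rule finite_measure_circle)
  obtain B where B: "AE w in circle. norm (f w) \<le> B" using f by (auto simp: ess_bounded_def)
  have fm: "f \<in> borel_measurable circle" using f by (simp add: ess_bounded_def)
  define R where "R = (1 + norm \<zeta>) / 2"
  have R: "norm \<zeta> < R" "R < 1" using \<zeta> by (auto simp: R_def)
  let ?K = "cball (0::complex) R \<times> sphere (0::complex) 1"
  have "uniformly_continuous_on ?K (\<lambda>x. poisson (fst x) (snd x))"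
    unfolding poisson_def using R by (intro compact_uniformly_continuous continuous_intros compact_Times) auto
  moreover define \<eta> where "\<eta> = e / ((\<bar>B\<bar> + 1) * (measure circle (sphere 0 1) + 1))"
  have \<eta>: "\<eta> > 0" unfolding \<eta>_def using e by (intro divide_pos_pos mult_pos_pos) (auto simp: add_nonneg_pos)
  ultimately obtain \<delta>0 where \<delta>0: "\<delta>0 > 0"
    "\<And>x y. x \<in> ?K \<Longrightarrow> y \<in> ?K \<Longrightarrow> dist y x < \<delta>0 \<Longrightarrow> dist (poisson (fst y) (snd y)) (poisson (fst x) (snd x)) < \<eta>"
    unfolding uniformly_continuous_on_def by metis
  define \<delta> where "\<delta> = min \<delta>0 (R - norm \<zeta>)"
  show ?thesis
  proof (intro exI[of _ \<delta>] conjI allI impI)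
    show "\<delta> > 0" using \<delta>0 R by (simp add: \<delta>_def)
    fix z assume z: "norm z < 1" "dist z \<zeta> < \<delta>"
    have zR: "norm z \<le> R" using z(2) norm_triangle_ineq2[of z \<zeta>] by (simp add: \<delta>_def dist_norm)
    have ifz: "integrable circle (\<lambda>w. poisson a w *\<^sub>R f w)" if a: "norm a < 1" for a
      using harm_integrable[OF a f] unfolding harm_def
      by (subst (asm) integrable_density) (use a fm poisson_nonneg[OF a] in auto)
    have "norm (integral\<^sup>L (harm z) f - integral\<^sup>L (harm \<zeta>) f)
        = norm (LINT w|circle. poisson z w *\<^sub>R f w - poisson \<zeta> w *\<^sub>R f w)"
      using ifz[OF z(1)] ifz[OF \<zeta>] by (simp add: integral_harm z(1) \<zeta> fm)
    also have "\<dots> \<le> (LINT w|circle. norm (poisson z w *\<^sub>R f w - poisson \<zeta> w *\<^sub>R f w))"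
      by (rule integral_norm_bound)
    also have "\<dots> \<le> (LINT w|circle. \<eta> * (\<bar>B\<bar> + 1))"
    proof (rule integral_mono_AE)
      show "AE w in circle. norm (poisson z w *\<^sub>R f w - poisson \<zeta> w *\<^sub>R f w) \<le> \<eta> * (\<bar>B\<bar> + 1)"
        using B AE_space
      proof eventually_elim
        case (elim w)
        have w: "norm w = 1" using elim by (simp add: space_circle)
        have "dist (poisson z w) (poisson \<zeta> w) < \<eta>"
          using \<delta>0(2)[of "(\<zeta>, w)" "(z, w)"] w zR R z(2) by (simp add: dist_Pair_Pair \<delta>_def)
        then have "\<bar>poisson z w - poisson \<zeta> w\<bar> * norm (f w) \<le> \<eta> * (\<bar>B\<bar> + 1)"
          using elim(1) by (intro mult_mono) (auto simp: dist_real_def)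
        then show ?case by (simp flip: scaleR_left_diff_distrib)
      qed
    qed (use ifz z \<zeta> in auto)
    also have "\<dots> = \<eta> * (\<bar>B\<bar> + 1) * measure circle (sphere 0 1)" by (simp add: space_circle)
    also have "\<dots> \<le> \<eta> * (\<bar>B\<bar> + 1) * (measure circle (sphere 0 1) + 1)"
      using \<eta> by (intro mult_left_mono) auto
    also have "\<dots> = e" unfolding \<eta>_def
      by (simp add: add_nonneg_pos less_imp_neq[symmetric] add_nonneg_eq_0_iff)
    finally show "norm (integral\<^sup>L (harm z) f - integral\<^sup>L (harm \<zeta>) f) \<le> e" .
  qed
qed

text \<open>Bounded convergence along radii tending to 1 passes the Poisson formula from the dilates
  to the boundary function. The formula for the dilates is a hypothesis rather than holomorphy, so
  that harmonic functions such as an argument are covered.\<close>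

lemma harm_radial_limit:
  assumes z: "norm z < 1" and H: "H \<in> borel_measurable circle"
    and hm: "\<And>r. 0 < r \<Longrightarrow> r < 1 \<Longrightarrow> (\<lambda>w. h (of_real r * w)) \<in> borel_measurable circle"
    and rep: "\<And>r. 0 < r \<Longrightarrow> r < 1 \<Longrightarrow> h (of_real r * z) = integral\<^sup>L (harm z) (\<lambda>w. h (of_real r * w))"
    and bd: "\<And>w. norm w < 1 \<Longrightarrow> norm (h w) \<le> C" and cont: "isCont h z"
    and lim: "AE w in circle. ((\<lambda>r. h (complex_of_real r * w)) \<longlongrightarrow> H w) (at_left 1)"
  shows "(h z :: complex) = integral\<^sup>L (harm z) H"
proof -
  interpret finite_measure "harm z" by (rule finite_measure_harm[OF z])
  define r where "r n = 1 - 1 / (real n + 2)" for n :: nat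
  have r: "0 < r n" "r n < 1" for n by (auto simp: r_def field_simps)
  have rlim: "filterlim r (at_left 1) sequentially" unfolding r_def by real_asymp
  have r1: "r \<longlonglongrightarrow> 1" unfolding r_def by real_asymp
  have "(\<lambda>n. integral\<^sup>L (harm z) (\<lambda>w. h (of_real (r n) * w))) \<longlonglongrightarrow> integral\<^sup>L (harm z) H"
  proof (rule integral_dominated_convergence[where w = "\<lambda>_. C"])
    show "AE w in harm z. (\<lambda>n. h (of_real (r n) * w)) \<longlonglongrightarrow> H w"
      using AE_harm[OF z lim] by eventually_elim (rule filterlim_compose[OF _ rlim])
    show "AE w in harm z. norm (h (of_real (r n) * w)) \<le> C" for n
      using r[of n] by (intro AE_I2 bd) (simp add: space_harm norm_mult)
  qed (use H hm r in \<open>auto simp: measurable_cong_sets[OF sets_harm refl]\<close>)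
  moreover have "(\<lambda>n. h (of_real (r n) * z)) \<longlonglongrightarrow> h z"
  proof (rule isCont_tendsto_compose[OF cont])
    have "(\<lambda>n. of_real (r n) * z) \<longlonglongrightarrow> of_real 1 * z" by (intro tendsto_intros r1)
    then show "(\<lambda>n. of_real (r n) * z) \<longlonglongrightarrow> z" by simp
  qed
  ultimately show ?thesis using rep[OF r] LIMSEQ_unique by simp
qed

section \<open>Products of harmonic measures on the torus\<close>

lemma space_torus: "space torus = {z. \<forall>k. norm (z k) = 1}"
  by (auto simp: torus_def space_PiM space_circle PiE_def extensional_def)

lemma product_sigma_finite_circle: "product_sigma_finite (\<lambda>k. circle)"
proof -
  interpret finite_measure circle by (rule finite_measure_circle)
  show ?thesis by unfold_locales
qed

lemma AE_torus_component:
  assumes "AE w in circle. P w"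
  shows "AE z in torus. P (z (k :: 'n::finite))"
proof -
  interpret product_sigma_finite "\<lambda>k::'n. circle" by (rule product_sigma_finite_circle)
  obtain N where N: "{w \<in> space circle. \<not> P w} \<subseteq> N" "emeasure circle N = 0" "N \<in> sets circle"
    using assms by (rule AE_E)
  let ?A = "\<lambda>j. if j = k then N else space circle"
  have "emeasure torus (Pi\<^sub>E UNIV ?A) = (\<Prod>j\<in>UNIV. emeasure circle (?A j))"
    unfolding torus_def using N by (intro emeasure_PiM) auto
  also have "\<dots> = 0" using N by (intro prod_zero) auto
  finally have "emeasure torus (Pi\<^sub>E UNIV ?A) = 0" .
  moreover have "Pi\<^sub>E UNIV ?A \<in> sets torus" unfolding torus_def using N by (intro sets_PiM_I_finite) auto
  moreover have "{z \<in> space torus. \<not> P (z k)} \<subseteq> Pi\<^sub>E UNIV ?A"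
    using N(1) by (auto simp: space_torus space_circle PiE_def extensional_def)
  ultimately show ?thesis by (intro AE_I)
qed

lemma measurable_torus_component: "(\<lambda>z. z k) \<in> measurable torus circle"
  unfolding torus_def by (rule measurable_component_singleton) simp

definition harm_n :: "('n::finite \<Rightarrow> complex) \<Rightarrow> ('n \<Rightarrow> complex) measure" where
  "harm_n z = (\<Pi>\<^sub>M k\<in>UNIV. harm (z k))"

lemma product_sigma_finite_harm:
  assumes "\<And>k. norm (z k) < 1"
  shows "product_sigma_finite (\<lambda>k. harm (z k))"
proof -
  have "sigma_finite_measure (harm (z k))" for k
    using finite_measure_harm[OF assms] by (simp add: finite_measure_def)
  then show ?thesis by (simp add: product_sigma_finite_def)
qed

lemma sets_harm_n: "sets (harm_n z) = sets torus"
  unfolding harm_n_def torus_def by (intro sets_PiM_cong) (auto simp: sets_harm)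

lemma space_harm_n: "space (harm_n z) = {z. \<forall>k. norm (z k) = 1}"
  using sets_eq_imp_space_eq[OF sets_harm_n] by (simp add: space_torus)

text \<open>Serves to carry statements that hold almost everywhere on the torus over to the product
  of harmonic measures.\<close>

lemma harm_n_density:
  fixes z :: "'n::finite \<Rightarrow> complex"
  assumes z: "\<And>k. norm (z k) < 1"
  shows "harm_n z = density torus (\<lambda>x. \<Prod>k\<in>UNIV. ennreal (poisson (z k) (x k)))"
proof -
  interpret H: product_sigma_finite "\<lambda>k. harm (z k)" by (rule product_sigma_finite_harm[OF z])
  interpret C: product_sigma_finite "\<lambda>k::'n. circle" by (rule product_sigma_finite_circle)
  have pm: "(\<lambda>x. ennreal (poisson (z k) (x k))) \<in> borel_measurable torus" for k
  proof -
    have "(\<lambda>w. ennreal (poisson (z k) w)) \<in> borel_measurable circle"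
      using poisson_measurable[OF z[of k]] by measurable
    from measurable_compose[OF measurable_torus_component this] show ?thesis .
  qed
  have "density torus (\<lambda>x. \<Prod>k\<in>UNIV. ennreal (poisson (z k) (x k))) = (\<Pi>\<^sub>M k\<in>UNIV. harm (z k))"
  proof (rule H.PiM_eqI)
    show "sets (density torus (\<lambda>x. \<Prod>k\<in>UNIV. ennreal (poisson (z k) (x k)))) = sets (\<Pi>\<^sub>M k\<in>UNIV. harm (z k))"
      using sets_harm_n[of z] by (simp add: harm_n_def)
    fix A assume A: "\<And>i. i \<in> UNIV \<Longrightarrow> A i \<in> sets (harm (z i))"
    then have A': "A i \<in> sets circle" for i by (simp add: sets_harm)
    have "Pi\<^sub>E UNIV A \<in> sets torus" unfolding torus_def using A' by (intro sets_PiM_I_finite) auto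
    then have "emeasure (density torus (\<lambda>x. \<Prod>k\<in>UNIV. ennreal (poisson (z k) (x k)))) (Pi\<^sub>E UNIV A)
       = (\<integral>\<^sup>+x. (\<Prod>k\<in>UNIV. ennreal (poisson (z k) (x k))) * indicator (Pi\<^sub>E UNIV A) x \<partial>torus)"
      using pm by (intro emeasure_density borel_measurable_prod_ennreal) auto
    also have "\<dots> = (\<integral>\<^sup>+x. (\<Prod>k\<in>UNIV. ennreal (poisson (z k) (x k)) * indicator (A k) (x k)) \<partial>torus)"
    proof (rule nn_integral_cong)
      fix x
      have "indicator (Pi\<^sub>E UNIV A) x = (\<Prod>k\<in>UNIV. indicator (A k) (x k) :: ennreal)"
      proof (cases "x \<in> Pi\<^sub>E UNIV A")
        case True
        then show ?thesis by (auto simp: PiE_def Pi_def)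
      next
        case False
        then obtain k where "x k \<notin> A k" by (auto simp: PiE_def Pi_def extensional_def)
        then have "(\<Prod>k\<in>UNIV. indicator (A k) (x k) :: ennreal) = 0" by (intro prod_zero bexI[of _ k]) auto
        then show ?thesis using False by simp
      qed
      then show "(\<Prod>k\<in>UNIV. ennreal (poisson (z k) (x k))) * indicator (Pi\<^sub>E UNIV A) x
         = (\<Prod>k\<in>UNIV. ennreal (poisson (z k) (x k)) * indicator (A k) (x k))"
        by (simp add: prod.distrib)
    qed
    also have "\<dots> = (\<Prod>k\<in>UNIV. \<integral>\<^sup>+w. ennreal (poisson (z k) w) * indicator (A k) w \<partial>circle)"
      unfolding torus_def using A' z by (intro C.product_nn_integral_prod) auto
    also have "\<dots> = (\<Prod>k\<in>UNIV. emeasure (harm (z k)) (A k))"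
      unfolding harm_def using A' z by (intro prod.cong refl emeasure_density[symmetric]) auto
    finally show "emeasure (density torus (\<lambda>x. \<Prod>k\<in>UNIV. ennreal (poisson (z k) (x k)))) (Pi\<^sub>E UNIV A)
       = (\<Prod>k\<in>UNIV. emeasure (harm (z k)) (A k))" .
  qed simp
  then show ?thesis by (simp add: harm_n_def)
qed

lemma AE_harm_n:
  fixes z :: "'n::finite \<Rightarrow> complex"
  assumes z: "\<And>k. norm (z k) < 1" and "AE x in torus. P x"
  shows "AE x in harm_n z. P x"
proof -
  have pm: "(\<lambda>x. ennreal (poisson (z k) (x k))) \<in> borel_measurable torus" for k
  proof -
    have "(\<lambda>w. ennreal (poisson (z k) w)) \<in> borel_measurable circle"
      using poisson_measurable[OF z[of k]] by measurable
    from measurable_compose[OF measurable_torus_component this] show ?thesis .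
  qed
  then have "(\<lambda>x. \<Prod>k\<in>UNIV. ennreal (poisson (z k) (x k))) \<in> borel_measurable torus"
    by (intro borel_measurable_prod_ennreal) auto
  then show ?thesis unfolding harm_n_density[OF z] using assms(2) by (subst AE_density) auto
qed

lemma emeasure_PiM_harm:
  assumes "\<And>k. norm (z k) < 1" "finite J"
  shows "emeasure (Pi\<^sub>M J (\<lambda>k. harm (z k))) (space (Pi\<^sub>M J (\<lambda>k. harm (z k)))) = 1"
proof -
  interpret H: product_sigma_finite "\<lambda>k. harm (z k)" by (rule product_sigma_finite_harm[OF assms(1)])
  show ?thesis unfolding space_PiM using assms by (subst H.emeasure_PiM) (auto simp: emeasure_harm)
qed

lemma finite_measure_PiM_harm:
  assumes "\<And>k. norm (z k) < 1" "finite J"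
  shows "finite_measure (Pi\<^sub>M J (\<lambda>k. harm (z k)))"
  by (rule finite_measureI) (simp add: emeasure_PiM_harm[OF assms])

lemma measure_harm_n: "(\<And>k. norm (z k) < 1) \<Longrightarrow> measure (harm_n z) (space (harm_n z)) = 1"
  by (simp add: measure_def harm_n_def emeasure_PiM_harm)

lemma finite_measure_harm_n: "(\<And>k. norm (z k) < 1) \<Longrightarrow> finite_measure (harm_n z)"
  unfolding harm_n_def by (intro finite_measure_PiM_harm) auto

lemma harm_n_integrable:
  assumes z: "\<And>k. norm (z k) < 1" and f: "f \<in> ess_bounded torus"
  shows "integrable (harm_n z) f"
proof -
  interpret finite_measure "harm_n z" by (rule finite_measure_harm_n[OF z])
  obtain C where "AE w in torus. norm (f w) \<le> C" using f by (auto simp: ess_bounded_def)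
  then show ?thesis using f AE_harm_n[OF z]
    by (intro integrable_const_bound[of _ C]) (auto simp: ess_bounded_def measurable_cong_sets[OF sets_harm_n refl])
qed

lemma harm_n_bound:
  assumes z: "\<And>k. norm (z k) < 1" and f: "f \<in> ess_bounded torus" and C: "AE w in torus. norm (f w) \<le> C"
  shows "norm (integral\<^sup>L (harm_n z) f) \<le> C"
proof -
  interpret finite_measure "harm_n z" by (rule finite_measure_harm_n[OF z])
  have "norm (integral\<^sup>L (harm_n z) f) \<le> (LINT w|harm_n z. norm (f w))" by (rule integral_norm_bound)
  also have "\<dots> \<le> (LINT w|harm_n z. C)"
    using AE_harm_n[OF z C] integrable_norm[OF harm_n_integrable[OF z f]] by (intro integral_mono_AE) auto
  finally show ?thesis by (simp add: measure_harm_n[OF z])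
qed

lemma harm_n_prod:
  fixes z :: "'n::finite \<Rightarrow> complex"
  assumes z: "\<And>k. norm (z k) < 1" and f: "\<And>k. f k \<in> ess_bounded circle"
  shows "(LINT x|harm_n z. (\<Prod>k\<in>UNIV. f k (x k))) = (\<Prod>k\<in>UNIV. integral\<^sup>L (harm (z k)) (f k))"
proof -
  interpret H: product_sigma_finite "\<lambda>k. harm (z k)" by (rule product_sigma_finite_harm[OF z])
  show ?thesis unfolding harm_n_def
    by (intro H.product_integral_prod harm_integrable z f) auto
qed

text \<open>Prepared for an induction over coordinates: those in \<open>J\<close> vary on the
  circle, the others are frozen at \<open>z\<close>.\<close>

lemma measurable_glue:
  fixes z :: "'n::finite \<Rightarrow> complex" and g :: "('n \<Rightarrow> complex) \<Rightarrow> complex"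
  assumes M: "\<And>k. sets (M k) = sets circle" and z: "\<And>k. norm (z k) \<le> 1"
    and g: "continuous_on {x. \<forall>k. norm (x k) \<le> 1} g"
  shows "(\<lambda>x. g (\<lambda>k. if k \<in> J then x k else z k)) \<in> borel_measurable (Pi\<^sub>M J M)"
proof -
  have id: "(\<lambda>w. w) \<in> borel_measurable (M k)" for k
    using borel_measurable_circle_borel[of "\<lambda>w. w"] by (simp add: measurable_cong_sets[OF M refl])
  have sp: "space (M k) = sphere 0 1" for k
    using sets_eq_imp_space_eq[OF M] by (simp add: space_circle)
  have "(\<lambda>x k. if k \<in> J then x k else z k) \<in> measurable (Pi\<^sub>M J M) (Pi\<^sub>M UNIV (\<lambda>_. borel))"
  proof (rule measurable_abs_UNIV)
    fix k
    show "(\<lambda>x. if k \<in> J then x k else z k) \<in> borel_measurable (Pi\<^sub>M J M)"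
    proof (cases "k \<in> J")
      case True
      then have "(\<lambda>x. x k) \<in> measurable (Pi\<^sub>M J M) (M k)" by (rule measurable_component_singleton)
      from measurable_comp[OF this id[of k]] have "(\<lambda>x. x k) \<in> borel_measurable (Pi\<^sub>M J M)" by (simp add: o_def)
      then show ?thesis using True by simp
    qed simp
  qed
  then have "(\<lambda>x k. if k \<in> J then x k else z k) \<in> measurable (Pi\<^sub>M J M) borel"
    by (simp add: measurable_cong_sets[OF refl sets_PiM_equal_borel])
  then have "(\<lambda>x k. if k \<in> J then x k else z k) \<in> measurable (Pi\<^sub>M J M) (restrict_space borel {x. \<forall>k. norm (x k) \<le> 1})"
    by (rule measurable_restrict_space2[rotated]) (auto simp: space_PiM sp z PiE_def Pi_def intro!: eq_refl)
  from measurable_compose[OF this borel_measurable_continuous_on_restrict[OF g]] show ?thesis .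
qed

text \<open>Induction on the set \<open>J\<close> of coordinates that run over the circle while the
  others stay at \<open>z\<close>: Fubini isolates one coordinate, and the Poisson formula of one
  variable replaces it by \<open>z i\<close>.\<close>

lemma harm_n_reproducing:
  fixes z :: "'n::finite \<Rightarrow> complex"
  assumes z: "\<And>k. norm (z k) < 1"
    and gc: "continuous_on {x. \<forall>k. norm (x k) \<le> 1} g" and gb: "\<And>x. (\<And>k. norm (x k) \<le> 1) \<Longrightarrow> norm (g x) \<le> C"
    and gi: "\<And>x i. (\<And>k. norm (x k) \<le> 1) \<Longrightarrow>
       continuous_on (cball 0 1) (\<lambda>y. g (x(i := y))) \<and> (\<lambda>y. g (x(i := y))) holomorphic_on ball 0 1"
  shows "integral\<^sup>L (harm_n z) g = g z"
proof -
  interpret H: product_sigma_finite "\<lambda>k. harm (z k)" by (rule product_sigma_finite_harm[OF z])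
  have z': "norm (z k) \<le> 1" for k using z less_imp_le by blast
  have "(LINT x|Pi\<^sub>M J (\<lambda>k. harm (z k)). g (\<lambda>k. if k \<in> J then x k else z k)) = g z" if "finite J" for J
    using that
  proof (induction J rule: finite_induct)
    case empty
    then show ?case by (simp add: PiM_empty lebesgue_integral_count_space_finite)
  next
    case (insert i J)
    interpret F: finite_measure "Pi\<^sub>M (insert i J) (\<lambda>k. harm (z k))"
      using insert by (intro finite_measure_PiM_harm z) auto
    have int: "integrable (Pi\<^sub>M (insert i J) (\<lambda>k. harm (z k))) (\<lambda>x. g (\<lambda>k. if k \<in> insert i J then x k else z k))"
    proof (rule F.integrable_const_bound[of _ C])
      show "AE x in Pi\<^sub>M (insert i J) (\<lambda>k. harm (z k)). norm (g (\<lambda>k. if k \<in> insert i J then x k else z k)) \<le> C"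
        by (intro AE_I2 gb) (auto simp: space_PiM space_harm z' PiE_def Pi_def intro!: eq_refl)
    qed (intro measurable_glue sets_harm z' gc)
    have "(LINT x|Pi\<^sub>M (insert i J) (\<lambda>k. harm (z k)). g (\<lambda>k. if k \<in> insert i J then x k else z k))
       = (LINT x|Pi\<^sub>M J (\<lambda>k. harm (z k)). LINT y|harm (z i). g (\<lambda>k. if k \<in> insert i J then (x(i := y)) k else z k))"
      by (rule H.product_integral_insert[OF insert(1,2) int])
    also have "\<dots> = (LINT x|Pi\<^sub>M J (\<lambda>k. harm (z k)). g (\<lambda>k. if k \<in> J then x k else z k))"
    proof (rule Bochner_Integration.integral_cong[OF refl])
      fix x assume x: "x \<in> space (Pi\<^sub>M J (\<lambda>k. harm (z k)))"
      define w where "w k = (if k \<in> J then x k else z k)" for k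
      have w: "norm (w k) \<le> 1" for k
        using x z' by (auto simp: w_def space_PiM space_harm PiE_def Pi_def intro!: eq_refl)
      have "(\<lambda>k. if k \<in> insert i J then (x(i := y)) k else z k) = w(i := y)" for y
        using insert(2) by (auto simp: w_def fun_eq_iff)
      then have "(LINT y|harm (z i). g (\<lambda>k. if k \<in> insert i J then (x(i := y)) k else z k))
         = (LINT y|harm (z i). g (w(i := y)))" by simp
      also have "\<dots> = g (w(i := z i))"
        using gi[OF w] by (intro poisson_reproducing[symmetric] z) auto
      also have "w(i := z i) = w" using insert(2) by (auto simp: w_def fun_eq_iff)
      finally show "(LINT y|harm (z i). g (\<lambda>k. if k \<in> insert i J then (x(i := y)) k else z k))
         = g (\<lambda>k. if k \<in> J then x k else z k)" by (simp add: w_def)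
    qed
    finally show ?case using insert by simp
  qed
  from this[of UNIV] show ?thesis by (simp add: harm_n_def)
qed

lemma norm_dilate_less:
  fixes y :: complex
  assumes "0 < r" "r < 1" "norm y \<le> 1"
  shows "norm (of_real r * y) < 1"
proof -
  have "r * norm y \<le> r * 1" using assms by (intro mult_left_mono) auto
  with assms(2) have "r * norm y < 1" by linarith
  then show ?thesis using assms(1) by (simp add: norm_mult)
qed

lemma Hinf_n_dilate:
  fixes f :: "('n::finite \<Rightarrow> complex) \<Rightarrow> complex"
  assumes f: "f \<in> Hinf_n" and r: "0 < r" "r < 1"
  shows "continuous_on {x. \<forall>k. norm (x k) \<le> 1} (\<lambda>x. f (\<lambda>k. of_real r * x k))"
proof -
  have fc: "continuous_on polydisc f" using f by (simp add: Hinf_n_def)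
  show ?thesis
  proof (rule continuous_on_compose2[OF fc])
    show "continuous_on {x. \<forall>k. norm (x k) \<le> 1} (\<lambda>x k. complex_of_real r * x k)"
      by (intro continuous_on_coordinatewise_then_product continuous_intros
          continuous_on_subset[OF continuous_on_product_coordinates]) auto
  qed (use norm_dilate_less[OF r] in \<open>auto simp: polydisc_def\<close>)
qed

lemma Hinf_n_dilate_coordinate:
  fixes f :: "('n::finite \<Rightarrow> complex) \<Rightarrow> complex"
  assumes f: "f \<in> Hinf_n" and r: "0 < r" "r < 1" and x: "\<And>k. norm (x k) \<le> 1"
  shows "continuous_on (cball 0 1) (\<lambda>y. f (\<lambda>k. of_real r * (x(i := y)) k)) \<and>
        (\<lambda>y. f (\<lambda>k. of_real r * (x(i := y)) k)) holomorphic_on ball 0 1"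
proof -
  note sm = norm_dilate_less[OF r]
  define w where "w k = of_real r * x k" for k
  have w: "w \<in> polydisc" using x sm by (simp add: polydisc_def w_def)
  have eq: "(\<lambda>k. of_real r * (x(i := y)) k) = w(i := of_real r * y)" for y by (auto simp: w_def)
  have h: "(\<lambda>y. f (w(i := y))) holomorphic_on ball 0 1" using f w by (simp add: Hinf_n_def)
  have "(\<lambda>y. f (w(i := y))) \<circ> (\<lambda>y. of_real r * y) holomorphic_on ball 0 1"
  proof (rule holomorphic_on_compose_gen[OF _ h])
    show "(\<lambda>y. of_real r * y) holomorphic_on ball 0 1" by (intro holomorphic_intros)
    show "(\<lambda>y. of_real r * y) ` ball 0 1 \<subseteq> ball (0::complex) 1"
      unfolding image_subset_iff mem_ball_0 using sm by (simp add: less_imp_le)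
  qed
  then have h2: "(\<lambda>y. f (w(i := of_real r * y))) holomorphic_on ball 0 1" by (simp add: o_def)
  have "continuous_on (cball 0 1) (\<lambda>y. f (w(i := of_real r * y)))"
    using sm by (intro continuous_on_compose2[OF holomorphic_on_imp_continuous_on[OF h]] continuous_intros) auto
  then show ?thesis unfolding eq using h2 by blast
qed

text \<open>The dilates are continuous on the closed polydisc and holomorphic in each variable, so
  the product formula holds for them; bounded convergence lets the common radius tend to 1.\<close>

theorem Hinf_n_poisson:
  fixes f :: "('n::finite \<Rightarrow> complex) \<Rightarrow> complex"
  assumes f: "f \<in> Hinf_n" and z: "z \<in> polydisc" and F: "F \<in> borel_measurable torus"
    and lim: "AE x in torus. ((\<lambda>r. f (\<lambda>k. complex_of_real r * x k)) \<longlongrightarrow> F x) (at_left 1)"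
  shows "f z = integral\<^sup>L (harm_n z) F"
proof -
  have z': "norm (z k) < 1" for k using z by (simp add: polydisc_def)
  interpret finite_measure "harm_n z" by (rule finite_measure_harm_n[OF z'])
  obtain C where C: "\<And>x. x \<in> polydisc \<Longrightarrow> norm (f x) \<le> C"
    using f unfolding Hinf_n_def bounded_iff by blast
  have C': "norm (f (\<lambda>k. of_real r * x k)) \<le> C" if "0 < r" "r < 1" "\<And>k. norm (x k) \<le> 1" for r x
  proof (rule C)
    show "(\<lambda>k. of_real r * x k) \<in> polydisc" using norm_dilate_less[OF that] by (simp add: polydisc_def)
  qed
  define r where "r n = 1 - 1 / (real n + 2)" for n :: nat
  have r: "0 < r n" "r n < 1" for n by (auto simp: r_def field_simps)
  have rlim: "filterlim r (at_left 1) sequentially" unfolding r_def by real_asymp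
  have r1: "r \<longlonglongrightarrow> 1" unfolding r_def by real_asymp
  have "(\<lambda>n. integral\<^sup>L (harm_n z) (\<lambda>w. f (\<lambda>k. of_real (r n) * w k))) \<longlonglongrightarrow> integral\<^sup>L (harm_n z) F"
  proof (rule integral_dominated_convergence[where w = "\<lambda>_. C"])
    show "AE w in harm_n z. (\<lambda>n. f (\<lambda>k. of_real (r n) * w k)) \<longlonglongrightarrow> F w"
      using AE_harm_n[OF z' lim] by eventually_elim (rule filterlim_compose[OF _ rlim])
    show "AE w in harm_n z. norm (f (\<lambda>k. of_real (r n) * w k)) \<le> C" for n
      using r by (intro AE_I2 C') (auto simp: space_harm_n)
    show "(\<lambda>w. f (\<lambda>k. of_real (r n) * w k)) \<in> borel_measurable (harm_n z)" for n
      using measurable_glue[of "\<lambda>k. harm (z k)" "\<lambda>_. 0" "\<lambda>x. f (\<lambda>k. of_real (r n) * x k)" UNIV]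
        Hinf_n_dilate[OF f r] by (simp add: sets_harm harm_n_def)
  qed (use F in \<open>auto simp: measurable_cong_sets[OF sets_harm_n refl]\<close>)
  moreover have "integral\<^sup>L (harm_n z) (\<lambda>w. f (\<lambda>k. of_real (r n) * w k)) = f (\<lambda>k. of_real (r n) * z k)" for n
    by (rule harm_n_reproducing[OF z' Hinf_n_dilate[OF f r] C'[OF r] Hinf_n_dilate_coordinate[OF f r]])
  moreover have "(\<lambda>n. f (\<lambda>k. of_real (r n) * z k)) \<longlonglongrightarrow> f z"
  proof -
    have "continuous_on {0..1} (\<lambda>r. f (\<lambda>k. of_real r * z k))"
    proof (rule continuous_on_compose2[of polydisc f])
      show "continuous_on polydisc f" using f by (simp add: Hinf_n_def)
      show "continuous_on {0..1} (\<lambda>r k. complex_of_real r * z k)"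
        by (intro continuous_on_coordinatewise_then_product continuous_intros)
      show "(\<lambda>r k. complex_of_real r * z k) ` {0..1} \<subseteq> polydisc"
      proof (clarsimp simp: polydisc_def norm_mult)
        fix r :: real and k assume "0 \<le> r" "r \<le> 1"
        then show "r * norm (z k) < 1" using z'[of k]
          by (metis mult_left_le_one_le norm_ge_zero order_le_less_trans)
      qed
    qed
    note c = this
    have ev: "\<forall>\<^sub>F n in sequentially. r n \<in> {0..1}" using r by (auto intro!: always_eventually less_imp_le)
    have "(\<lambda>n. f (\<lambda>k. of_real (r n) * z k)) \<longlonglongrightarrow> f (\<lambda>k. of_real 1 * z k)"
      by (rule continuous_on_tendsto_compose[where f="\<lambda>r. f (\<lambda>k. of_real r * z k)", OF c r1 _ ev]) simp
    then show ?thesis by simp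
  qed
  ultimately show ?thesis using LIMSEQ_unique by simp
qed

section \<open>Homogeneous functions at a boundary point\<close>

text \<open>Finite sums of products with exactly one factor per coordinate: the normal form that
  product measures integrate factor by factor.\<close>

inductive_set tensor :: "('n::finite \<Rightarrow> (complex \<Rightarrow> complex) set) \<Rightarrow> (('n \<Rightarrow> complex) \<Rightarrow> complex) set"
  for \<Gamma> :: "'n::finite \<Rightarrow> (complex \<Rightarrow> complex) set" where
  prod: "(\<And>k. g k \<in> \<Gamma> k) \<Longrightarrow> (\<lambda>z. \<Prod>k\<in>UNIV. g k (z k)) \<in> tensor \<Gamma>"
| add: "p \<in> tensor \<Gamma> \<Longrightarrow> q \<in> tensor \<Gamma> \<Longrightarrow> (\<lambda>z. p z + q z) \<in> tensor \<Gamma>"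

lemma tensor_mono: "p \<in> tensor \<Gamma> \<Longrightarrow> (\<And>k. \<Gamma> k \<subseteq> \<Gamma>' k) \<Longrightarrow> p \<in> tensor \<Gamma>'"
  by (induction rule: tensor.induct) (auto intro: tensor.intros)

lemma tensor_component:
  fixes f :: "complex \<Rightarrow> complex"
  assumes "f \<in> \<Gamma> k" "\<And>j. (\<lambda>_. 1) \<in> \<Gamma> j"
  shows "(\<lambda>z. f (z k)) \<in> tensor \<Gamma>"
proof -
  have "(\<Prod>j\<in>UNIV. (if j = k then f else (\<lambda>_. 1)) (z j)) = f (z k)" for z :: "'a \<Rightarrow> complex"
    by (subst prod.remove[of _ k]) auto
  moreover have "(\<lambda>z. \<Prod>j\<in>UNIV. (if j = k then f else (\<lambda>_. 1)) (z j)) \<in> tensor \<Gamma>"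
    by (rule tensor.prod) (use assms in auto)
  ultimately show ?thesis by simp
qed

lemma tensor_const:
  assumes "\<And>j c. (\<lambda>_. c) \<in> \<Gamma> j"
  shows "(\<lambda>z. c) \<in> tensor \<Gamma>"
  using tensor_component[of "\<lambda>_. c" \<Gamma> undefined] assms by simp

lemma tensor_mult:
  assumes "p \<in> tensor \<Gamma>" "q \<in> tensor \<Gamma>"
    and \<Gamma>: "\<And>k f g. f \<in> \<Gamma> k \<Longrightarrow> g \<in> \<Gamma> k \<Longrightarrow> (\<lambda>w. f w * g w) \<in> \<Gamma> k"
  shows "(\<lambda>z. p z * q z) \<in> tensor \<Gamma>"
  using assms(1)
proof induction
  case (prod g)
  from assms(2) show ?case
  proof induction
    case (prod h)
    have "(\<lambda>z. \<Prod>k\<in>UNIV. (\<lambda>w. g k w * h k w) (z k)) \<in> tensor \<Gamma>"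
      by (rule tensor.prod[where g = "\<lambda>k w. g k w * h k w"]) (use \<Gamma> prod.hyps \<open>\<And>k. g k \<in> \<Gamma> k\<close> in auto)
    then show ?case by (simp add: prod.distrib)
  next
    case (add p q)
    show ?case using tensor.add[OF add.IH] by (simp add: distrib_left)
  qed
next
  case (add p q)
  show ?case using tensor.add[OF add.IH] by (simp add: distrib_right)
qed

lemma SAP_poly_tensor: "p \<in> SAP_poly S \<Longrightarrow> p \<in> tensor (\<lambda>k. SAP (S k))"
proof (induction rule: SAP_poly.induct)
  case (var f k)
  then show ?case by (rule tensor_component) (rule SAP_const)
next
  case (const c)
  show ?case by (rule tensor_const) (rule SAP_const)
next
  case (mult p q)
  then show ?case by (intro tensor_mult SAP_mult)
qed (rule tensor.add)

lemma ess_bounded_component: "f \<in> ess_bounded circle \<Longrightarrow> (\<lambda>z. f (z k)) \<in> ess_bounded torus"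
  using AE_torus_component measurable_compose[OF measurable_torus_component]
  unfolding ess_bounded_def by blast

lemma ess_bounded_prod: "(\<And>k. k \<in> A \<Longrightarrow> f k \<in> ess_bounded M) \<Longrightarrow> (\<lambda>z. \<Prod>k\<in>A. f k z) \<in> ess_bounded M"
proof (induction A rule: infinite_finite_induct)
  case (insert x F)
  then show ?case using ess_bounded_mult[of "f x" M] by simp
qed (simp_all add: ess_bounded_const)

lemma SAP_ess_bounded: "f \<in> SAP S0 \<Longrightarrow> f \<in> ess_bounded circle"
  by (simp add: SAP_iff)

lemma tensor_SAP_ess_bounded: "p \<in> tensor (\<lambda>k. SAP (S k)) \<Longrightarrow> p \<in> ess_bounded torus"
proof (induction rule: tensor.induct)
  case (prod g)
  then show ?case by (intro ess_bounded_prod ess_bounded_component SAP_ess_bounded)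
qed (rule ess_bounded_add)

definition harm_ext :: "(complex \<Rightarrow> complex) \<Rightarrow> complex \<Rightarrow> complex" where
  "harm_ext g z = integral\<^sup>L (harm z) g"

lemma harm_ext_tensor:
  assumes "p \<in> tensor (\<lambda>k. SAP (S k))"
  shows "\<exists>q\<in>tensor (\<lambda>k. harm_ext ` SAP (S k)). \<forall>z\<in>polydisc. integral\<^sup>L (harm_n z) p = q z"
  using assms
proof induction
  case (prod g)
  have "(\<lambda>z. \<Prod>k\<in>UNIV. harm_ext (g k) (z k)) \<in> tensor (\<lambda>k. harm_ext ` SAP (S k))"
    by (rule tensor.prod) (use prod in auto)
  moreover have "(LINT x|harm_n z. (\<Prod>k\<in>UNIV. g k (x k))) = (\<Prod>k\<in>UNIV. harm_ext (g k) (z k))"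
    if "z \<in> polydisc" for z
    unfolding harm_ext_def
  proof (rule harm_n_prod)
    show "norm (z k) < 1" for k using that by (simp add: polydisc_def)
    show "g k \<in> ess_bounded circle" for k by (rule SAP_ess_bounded[OF prod])
  qed
  ultimately show ?case
    by (intro bexI[of _ "\<lambda>z. \<Prod>k\<in>UNIV. harm_ext (g k) (z k)"] ballI)
next
  case (add p q)
  obtain p' q' where p': "p' \<in> tensor (\<lambda>k. harm_ext ` SAP (S k))" "\<forall>z\<in>polydisc. integral\<^sup>L (harm_n z) p = p' z"
    and q': "q' \<in> tensor (\<lambda>k. harm_ext ` SAP (S k))" "\<forall>z\<in>polydisc. integral\<^sup>L (harm_n z) q = q' z"
    using add.IH by blast
  have "integral\<^sup>L (harm_n z) (\<lambda>x. p x + q x) = p' z + q' z" if "z \<in> polydisc" for z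
  proof -
    have z: "norm (z k) < 1" for k using that by (simp add: polydisc_def)
    have "integrable (harm_n z) p" "integrable (harm_n z) q"
      by (rule harm_n_integrable[OF z tensor_SAP_ess_bounded[OF add.hyps(1)]],
          rule harm_n_integrable[OF z tensor_SAP_ess_bounded[OF add.hyps(2)]])
    then show ?thesis using that p'(2) q'(2) by simp
  qed
  then show ?case
    by (intro bexI[OF _ tensor.add[OF p'(1) q'(1)]] ballI)
qed

text \<open>Poisson integration does not increase the norm, so an approximation of the boundary
  function extends into the polydisc with the same error. The factors obtained are harmonic, in
  general not holomorphic.\<close>

lemma Hinf_SAPn_harmonic_approx:
  fixes S :: "'n::finite \<Rightarrow> complex set"
  assumes f: "f \<in> Hinf_SAPn S" and e: "e > 0"
  shows "\<exists>q\<in>tensor (\<lambda>k. harm_ext ` SAP (S k)). \<forall>z\<in>polydisc. norm (f z - q z) \<le> e"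
proof -
  obtain F where F: "F \<in> SAPn S" "AE z in torus. ((\<lambda>r. f (\<lambda>k. complex_of_real r * z k)) \<longlongrightarrow> F z) (at_left 1)"
    and fH: "f \<in> Hinf_n" using f by (auto simp: Hinf_SAPn_def)
  have Fb: "F \<in> ess_bounded torus" using F(1) by (simp add: SAPn_def)
  have "\<exists>p\<in>SAP_poly S. AE z in torus. norm (F z - p z) \<le> e" using F(1) e by (simp add: SAPn_def)
  then obtain p where p: "p \<in> SAP_poly S" "AE z in torus. norm (F z - p z) \<le> e" by blast
  have pt: "p \<in> tensor (\<lambda>k. SAP (S k))" by (rule SAP_poly_tensor[OF p(1)])
  have pb: "p \<in> ess_bounded torus" by (rule tensor_SAP_ess_bounded[OF pt])
  obtain q where q: "q \<in> tensor (\<lambda>k. harm_ext ` SAP (S k))" "\<forall>z\<in>polydisc. integral\<^sup>L (harm_n z) p = q z"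
    using harm_ext_tensor[OF pt] by blast
  have "norm (f z - q z) \<le> e" if z: "z \<in> polydisc" for z
  proof -
    have z': "norm (z k) < 1" for k using z by (simp add: polydisc_def)
    have "(\<lambda>x. F x + (- 1) * p x) \<in> ess_bounded torus"
      by (intro ess_bounded_add ess_bounded_mult ess_bounded_const Fb pb)
    then have d: "(\<lambda>x. F x - p x) \<in> ess_bounded torus" by simp
    have "f z - q z = integral\<^sup>L (harm_n z) F - integral\<^sup>L (harm_n z) p"
      using Hinf_n_poisson[OF fH z _ F(2)] Fb q(2) z by (simp add: ess_bounded_def)
    also have "\<dots> = integral\<^sup>L (harm_n z) (\<lambda>x. F x - p x)"
      by (rule Bochner_Integration.integral_diff[symmetric]) (intro harm_n_integrable z' Fb pb)+
    finally show ?thesis using harm_n_bound[OF z' d p(2)] by simp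
  qed
  then show ?thesis using q(1) by blast
qed

text \<open>Bounded eigenfunctions of the contractions towards \<open>\<zeta>\<close>, without any
  holomorphy. For \<open>\<zeta>\<close> on the circle the restriction to
  \<open>\<tau> \<le> 0\<close> keeps the moved point in the disc.\<close>

definition homogeneous :: "complex \<Rightarrow> real \<Rightarrow> (complex \<Rightarrow> complex) \<Rightarrow> bool" where
  "homogeneous \<zeta> l G \<longleftrightarrow> (\<exists>B. \<forall>z. norm z < 1 \<longrightarrow> norm (G z) \<le> B) \<and>
     (\<forall>z \<tau>. norm z < 1 \<longrightarrow> \<tau> \<le> 0 \<longrightarrow> G (\<zeta> + of_real (exp \<tau>) * (z - \<zeta>)) = cis (l * \<tau>) * G z)"

definition hom_sum :: "complex \<Rightarrow> (complex \<Rightarrow> complex) \<Rightarrow> bool" where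
  "hom_sum \<zeta> Q \<longleftrightarrow> (\<exists>\<Lambda> G. finite \<Lambda> \<and> (\<forall>l. homogeneous \<zeta> l (G l)) \<and> (\<forall>z. norm z < 1 \<longrightarrow> Q z = (\<Sum>l\<in>\<Lambda>. G l z)))"

lemma homogeneous_zero: "homogeneous \<zeta> l (\<lambda>z. 0)"
  by (auto simp: homogeneous_def)

lemma homogeneous_add:
  assumes "homogeneous \<zeta> l F" "homogeneous \<zeta> l G"
  shows "homogeneous \<zeta> l (\<lambda>z. F z + G z)"
proof -
  obtain B where "\<And>z. norm z < 1 \<Longrightarrow> norm (F z) \<le> B" using assms by (auto simp: homogeneous_def)
  moreover obtain C where "\<And>z. norm z < 1 \<Longrightarrow> norm (G z) \<le> C" using assms by (auto simp: homogeneous_def)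
  ultimately have "norm z < 1 \<Longrightarrow> norm (F z + G z) \<le> B + C" for z by (intro norm_triangle_mono)
  then show ?thesis using assms by (auto simp: homogeneous_def distrib_left)
qed

lemma homogeneous_scale:
  assumes "homogeneous \<zeta> l F"
  shows "homogeneous \<zeta> l (\<lambda>z. c * F z)"
proof -
  obtain B where "\<And>z. norm z < 1 \<Longrightarrow> norm (F z) \<le> B" using assms by (auto simp: homogeneous_def)
  then have "norm z < 1 \<Longrightarrow> norm (c * F z) \<le> norm c * B" for z by (simp add: norm_mult mult_left_mono)
  then show ?thesis using assms by (auto simp: homogeneous_def mult.left_commute)
qed

lemma hom_sum_single:
  assumes "homogeneous \<zeta> l Q" "\<And>z. norm z < 1 \<Longrightarrow> Q' z = Q z"
  shows "hom_sum \<zeta> Q'"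
  unfolding hom_sum_def
  by (rule exI[of _ "{l}"], rule exI[of _ "\<lambda>m. if m = l then Q else (\<lambda>_. 0)"]) (use assms homogeneous_zero in auto)

lemma hom_sum_add:
  assumes "hom_sum \<zeta> P" "hom_sum \<zeta> Q"
  shows "hom_sum \<zeta> (\<lambda>z. P z + Q z)"
proof -
  obtain \<Lambda> F where F: "finite \<Lambda>" "\<And>l. homogeneous \<zeta> l (F l)" "\<And>z. norm z < 1 \<Longrightarrow> P z = (\<Sum>l\<in>\<Lambda>. F l z)"
    using assms(1) unfolding hom_sum_def by blast
  obtain M G where G: "finite M" "\<And>l. homogeneous \<zeta> l (G l)" "\<And>z. norm z < 1 \<Longrightarrow> Q z = (\<Sum>l\<in>M. G l z)"
    using assms(2) unfolding hom_sum_def by blast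
  define H where "H l z = (if l \<in> \<Lambda> then F l z else 0) + (if l \<in> M then G l z else 0)" for l z
  have "homogeneous \<zeta> l (H l)" for l
    unfolding H_def using F(2) G(2) by (intro homogeneous_add) (cases "l \<in> \<Lambda>"; cases "l \<in> M"; simp add: homogeneous_zero)+
  moreover have "P z + Q z = (\<Sum>l\<in>\<Lambda> \<union> M. H l z)" if "norm z < 1" for z
  proof -
    have "(\<Sum>l\<in>\<Lambda> \<union> M. if l \<in> \<Lambda> then F l z else 0) = (\<Sum>l\<in>\<Lambda>. F l z)"
      using F(1) G(1) by (intro sum.mono_neutral_cong_right) auto
    moreover have "(\<Sum>l\<in>\<Lambda> \<union> M. if l \<in> M then G l z else 0) = (\<Sum>l\<in>M. G l z)"
      using F(1) G(1) by (intro sum.mono_neutral_cong_right) auto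
    ultimately show ?thesis using F(3) G(3) that by (simp add: H_def sum.distrib)
  qed
  ultimately show ?thesis unfolding hom_sum_def using F(1) G(1)
    by (intro exI[of _ "\<Lambda> \<union> M"] exI[of _ H]) auto
qed

lemma hom_sum_scale:
  assumes "hom_sum \<zeta> P"
  shows "hom_sum \<zeta> (\<lambda>z. c * P z)"
proof -
  obtain \<Lambda> F where F: "finite \<Lambda>" "\<And>l. homogeneous \<zeta> l (F l)" "\<And>z. norm z < 1 \<Longrightarrow> P z = (\<Sum>l\<in>\<Lambda>. F l z)"
    using assms(1) unfolding hom_sum_def by blast
  then show ?thesis unfolding hom_sum_def
    by (intro exI[of _ \<Lambda>] exI[of _ "\<lambda>l z. c * F l z"]) (auto simp: homogeneous_scale sum_distrib_left)
qed

lemma hom_sum_cong: "hom_sum \<zeta> P \<Longrightarrow> (\<And>z. norm z < 1 \<Longrightarrow> Q z = P z) \<Longrightarrow> hom_sum \<zeta> Q"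
  unfolding hom_sum_def by (elim ex_forward) auto

text \<open>\<open>H\<close> is a boundary function whose harmonic extension is an explicit sum of homogeneous functions;
  \<open>p 1\<close> and \<open>p (-1)\<close> describe its behaviour on the two sides of \<open>\<zeta>\<close> in the logarithmic variable.\<close>

definition model :: "complex \<Rightarrow> (complex \<Rightarrow> complex) \<Rightarrow> (real \<Rightarrow> real \<Rightarrow> complex) \<Rightarrow> bool" where
  "model \<zeta> H p \<longleftrightarrow> H \<in> ess_bounded circle \<and> hom_sum \<zeta> (harm_ext H) \<and>
     (\<forall>k\<in>{-1,1}. ((\<lambda>t. H (\<zeta> * cis (k * t)) - p k (ln t)) \<longlongrightarrow> 0) (at_right 0))"

lemma model_cong: "model \<zeta> H p \<Longrightarrow> (\<And>k x. k \<in> {-1,1} \<Longrightarrow> p k x = q k x) \<Longrightarrow> model \<zeta> H q"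
  by (simp add: model_def)

lemma model_add:
  assumes "model \<zeta> H p" "model \<zeta> K q"
  shows "model \<zeta> (\<lambda>z. H z + K z) (\<lambda>k x. p k x + q k x)"
  unfolding model_def
proof (intro conjI ballI allI impI)
  have HK: "H \<in> ess_bounded circle" "K \<in> ess_bounded circle" using assms by (auto simp: model_def)
  then show "(\<lambda>z. H z + K z) \<in> ess_bounded circle" by (rule ess_bounded_add)
  have "hom_sum \<zeta> (\<lambda>z. harm_ext H z + harm_ext K z)" using assms by (intro hom_sum_add) (auto simp: model_def)
  then show "hom_sum \<zeta> (harm_ext (\<lambda>z. H z + K z))"
    by (rule hom_sum_cong) (simp add: harm_ext_def harm_integrable HK)
  fix k :: real assume "k \<in> {-1,1}"
  then have "((\<lambda>t. (H (\<zeta> * cis (k * t)) - p k (ln t)) + (K (\<zeta> * cis (k * t)) - q k (ln t))) \<longlongrightarrow> 0 + 0) (at_right 0)"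
    using assms unfolding model_def by (intro tendsto_add) blast+
  then show "((\<lambda>t. H (\<zeta> * cis (k * t)) + K (\<zeta> * cis (k * t)) - (p k (ln t) + q k (ln t))) \<longlongrightarrow> 0) (at_right 0)"
    by (simp add: add_diff_add)
qed

lemma model_scale:
  assumes "model \<zeta> H p"
  shows "model \<zeta> (\<lambda>z. c * H z) (\<lambda>k x. c * p k x)"
  unfolding model_def
proof (intro conjI ballI allI impI)
  have H: "H \<in> ess_bounded circle" using assms by (auto simp: model_def)
  then show "(\<lambda>z. c * H z) \<in> ess_bounded circle" by (intro ess_bounded_mult ess_bounded_const)
  have "hom_sum \<zeta> (\<lambda>z. c * harm_ext H z)" using assms by (intro hom_sum_scale) (auto simp: model_def)
  then show "hom_sum \<zeta> (harm_ext (\<lambda>z. c * H z))"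
    by (rule hom_sum_cong) (simp add: harm_ext_def)
  fix k :: real assume "k \<in> {-1,1}"
  then have "((\<lambda>t. c * (H (\<zeta> * cis (k * t)) - p k (ln t))) \<longlongrightarrow> c * 0) (at_right 0)"
    using assms unfolding model_def by (intro tendsto_mult_left) blast
  then show "((\<lambda>t. c * H (\<zeta> * cis (k * t)) - c * p k (ln t)) \<longlongrightarrow> 0) (at_right 0)"
    by (simp add: right_diff_distrib)
qed

lemma harm_integral_bounded_linear:
  assumes z: "norm z < 1" and T: "bounded_linear T" and f: "f \<in> ess_bounded circle"
  shows "harm_ext (\<lambda>w. T (f w)) z = T (harm_ext f z)"
  unfolding harm_ext_def by (rule integral_bounded_linear[OF T harm_integrable[OF z f]])

lemma Ln_dilate_holomorphic:
  assumes \<zeta>: "norm \<zeta> = 1" and r: "0 < r" "r < 1"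
  shows "continuous_on (cball 0 1) (\<lambda>w. Ln (1 - cnj \<zeta> * (of_real r * w)))"
    "(\<lambda>w. Ln (1 - cnj \<zeta> * (of_real r * w))) holomorphic_on ball 0 1"
proof -
  have *: "1 - cnj \<zeta> * (of_real r * w) \<notin> \<real>\<^sub>\<le>\<^sub>0" if "norm w \<le> 1" for w
  proof (rule one_minus_cnj_mult(2)[OF \<zeta>])
    have "norm (of_real r * w) < 1" by (rule norm_dilate_less[OF r that])
    then show "norm (of_real r * w) \<le> 1" "of_real r * w \<noteq> \<zeta>" using \<zeta> by auto
  qed
  show "continuous_on (cball 0 1) (\<lambda>w. Ln (1 - cnj \<zeta> * (of_real r * w)))"
    using * by (intro continuous_intros) auto
  show "(\<lambda>w. Ln (1 - cnj \<zeta> * (of_real r * w))) holomorphic_on ball 0 1"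
    using * by (intro holomorphic_intros) auto
qed

lemma radial_limit_continuous:
  fixes h :: "complex \<Rightarrow> complex"
  assumes h: "continuous_on (cball 0 1 - {\<zeta>}) h" and w: "norm w = 1" "w \<noteq> \<zeta>" and \<zeta>: "norm \<zeta> = 1"
  shows "((\<lambda>r. h (complex_of_real r * w)) \<longlongrightarrow> h w) (at_left 1)"
proof -
  have "continuous_on {0..1} (\<lambda>r. h (complex_of_real r * w))"
  proof (rule continuous_on_compose2[OF h])
    show "(\<lambda>r. complex_of_real r * w) ` {0..1} \<subseteq> cball 0 1 - {\<zeta>}"
    proof (intro image_subsetI)
      fix r :: real assume r: "r \<in> {0..1}"
      have "of_real r * w \<noteq> \<zeta>"
      proof
        assume "of_real r * w = \<zeta>"
        then have "\<bar>r\<bar> * 1 = 1" using \<zeta> w(1) by (metis norm_mult norm_of_real)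
        then have "r = 1" using r by auto
        then show False using \<open>of_real r * w = \<zeta>\<close> w(2) by simp
      qed
      then show "complex_of_real r * w \<in> cball 0 1 - {\<zeta>}" using r w(1) by (simp add: norm_mult)
    qed
  qed (intro continuous_intros)
  then have "((\<lambda>r. h (complex_of_real r * w)) \<longlongrightarrow> h (of_real 1 * w)) (at 1 within {0..1})"
    unfolding continuous_on_def by (drule_tac x = 1 in bspec) simp_all
  moreover have "at (1::real) within {0..1} = at_left 1"
    by (rule at_within_Icc_at_left) simp
  ultimately show ?thesis by simp
qed

text \<open>The dilates are holomorphic in the disc and continuous up to the circle, and the radial
  limits exist off the single point \<open>\<zeta>\<close>.\<close>

lemma harm_ext_log_power:
  assumes \<zeta>: "norm \<zeta> = 1" and z: "norm z < 1"
  shows "harm_ext (log_power \<zeta> l) z = log_power \<zeta> l z"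
  unfolding harm_ext_def
proof (rule harm_radial_limit[symmetric, OF z borel_measurable_circle_borel[OF log_power_measurable]])
  fix r :: real assume r: "0 < r" "r < 1"
  have c: "continuous_on (cball 0 1) (\<lambda>w. log_power \<zeta> l (of_real r * w))"
    unfolding log_power_def by (intro continuous_intros Ln_dilate_holomorphic[OF \<zeta> r])
  have h: "(\<lambda>w. log_power \<zeta> l (of_real r * w)) holomorphic_on ball 0 1"
    unfolding log_power_def by (intro holomorphic_intros Ln_dilate_holomorphic[OF \<zeta> r])
  show "log_power \<zeta> l (of_real r * z) = integral\<^sup>L (harm z) (\<lambda>w. log_power \<zeta> l (of_real r * w))"
    using poisson_reproducing[OF c h z] .
  show "(\<lambda>w. log_power \<zeta> l (of_real r * w)) \<in> borel_measurable circle"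
    by (rule borel_measurable_circle_continuous[OF continuous_on_subset[OF c]]) auto
next
  show "norm (log_power \<zeta> l w) \<le> exp (\<bar>l\<bar> * (pi / 2))" if "norm w < 1" for w
    using that \<zeta> by (intro norm_log_power_le) auto
  show "isCont (log_power \<zeta> l) z"
    using log_power_holomorphic[OF \<zeta>, of l] z
    by (meson at_within_open continuous_on_eq_continuous_at holomorphic_on_imp_continuous_on mem_ball_0 open_ball)
  show "AE w in circle. ((\<lambda>r. log_power \<zeta> l (complex_of_real r * w)) \<longlongrightarrow> log_power \<zeta> l w) (at_left 1)"
    using circle_singleton_null[of \<zeta>] AE_space
    by eventually_elim (rule radial_limit_continuous[OF log_power_continuous[OF \<zeta>] _ _ \<zeta>], auto simp: space_circle)
qed

lemma homogeneous_log_power: "norm \<zeta> = 1 \<Longrightarrow> homogeneous \<zeta> l (log_power \<zeta> l)"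
  unfolding homogeneous_def
proof (intro conjI exI[of _ "exp (\<bar>l\<bar> * (pi / 2))"] allI impI)
  fix z :: complex assume "norm \<zeta> = 1" "norm z < 1"
  then show "norm (log_power \<zeta> l z) \<le> exp (\<bar>l\<bar> * (pi / 2))" by (intro norm_log_power_le) auto
qed (rule log_power_contract)

lemma log_power_ess_bounded: "norm \<zeta> = 1 \<Longrightarrow> log_power \<zeta> l \<in> ess_bounded circle"
  by (rule SAP_ess_bounded[of _ "{\<zeta>}"], rule log_power_SAP) auto

lemma model_log_power:
  assumes \<zeta>: "norm \<zeta> = 1"
  shows "model \<zeta> (log_power \<zeta> l) (\<lambda>k x. of_real (exp (l * k * (pi / 2))) * cis (l * x))"
  unfolding model_def
proof (intro conjI ballI allI impI)
  show "hom_sum \<zeta> (harm_ext (log_power \<zeta> l))"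
    by (rule hom_sum_single[OF homogeneous_log_power[OF \<zeta>]]) (rule harm_ext_log_power[OF \<zeta>])
  fix k :: real assume "k \<in> {-1, 1}"
  then show "((\<lambda>t. log_power \<zeta> l (\<zeta> * cis (k * t)) - of_real (exp (l * k * (pi / 2))) * cis (l * ln t)) \<longlongrightarrow> 0) (at_right 0)"
    by (intro log_power_arc[OF \<zeta>]) auto
qed (rule log_power_ess_bounded[OF \<zeta>])

lemma ess_bounded_cnj: "f \<in> ess_bounded M \<Longrightarrow> (\<lambda>z. cnj (f z)) \<in> ess_bounded M"
  unfolding ess_bounded_def using bounded_linear_cnj
  by (auto intro: measurable_compose[OF _ borel_measurable_continuous_onI] linear_continuous_on)

text \<open>Conjugating the power with exponent \<open>- l\<close> brings back the frequency
  \<open>l\<close> but inverts the amplitudes on the two sides. This is the second model needed to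
  treat the two sides separately.\<close>

lemma model_cnj_log_power:
  assumes \<zeta>: "norm \<zeta> = 1"
  shows "model \<zeta> (\<lambda>z. cnj (log_power \<zeta> (- l) z)) (\<lambda>k x. of_real (exp (- l * k * (pi / 2))) * cis (l * x))"
  unfolding model_def
proof (intro conjI ballI allI impI)
  show "(\<lambda>z. cnj (log_power \<zeta> (- l) z)) \<in> ess_bounded circle"
    by (intro ess_bounded_cnj log_power_ess_bounded \<zeta>)
  have "homogeneous \<zeta> (- l) (log_power \<zeta> (- l))" by (rule homogeneous_log_power[OF \<zeta>])
  then have "homogeneous \<zeta> l (\<lambda>z. cnj (log_power \<zeta> (- l) z))" by (simp add: homogeneous_def cis_cnj)
  then show "hom_sum \<zeta> (harm_ext (\<lambda>z. cnj (log_power \<zeta> (- l) z)))"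
    by (rule hom_sum_single)
       (simp add: harm_integral_bounded_linear[OF _ bounded_linear_cnj log_power_ess_bounded[OF \<zeta>]] harm_ext_log_power[OF \<zeta>])
  fix k :: real assume "k \<in> {-1, 1}"
  then have "((\<lambda>t. log_power \<zeta> (- l) (\<zeta> * cis (k * t)) - of_real (exp (- l * k * (pi / 2))) * cis (- l * ln t)) \<longlongrightarrow> 0) (at_right 0)"
    by (intro log_power_arc[OF \<zeta>]) auto
  from bounded_linear.tendsto[OF bounded_linear_cnj this]
  show "((\<lambda>t. cnj (log_power \<zeta> (- l) (\<zeta> * cis (k * t))) - of_real (exp (- l * k * (pi / 2))) * cis (l * ln t)) \<longlongrightarrow> 0) (at_right 0)"
    by (simp add: cis_cnj)
qed

lemma model_const: "model \<zeta> (\<lambda>_. 1) (\<lambda>k x. 1)"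
  unfolding model_def
proof (intro conjI ballI allI impI)
  have "homogeneous \<zeta> 0 (\<lambda>_. 1)" by (auto simp: homogeneous_def)
  then show "hom_sum \<zeta> (harm_ext (\<lambda>_. 1))"
    by (rule hom_sum_single) (simp add: harm_ext_def space_harm measure_harm)
qed (auto simp: ess_bounded_const)

text \<open>The companion at frequency 0, where the power and its conjugate are both constant: a
  bounded harmonic function, invariant under contraction towards \<open>\<zeta>\<close>, with
  different limits on the two sides.\<close>

definition arg_fun :: "complex \<Rightarrow> complex \<Rightarrow> complex" where
  "arg_fun \<zeta> z = of_real (Im (Ln (1 - cnj \<zeta> * z)))"

text \<open>The logarithm is unbounded, but its imaginary part is not. Taking imaginary parts
  commutes with Poisson integration of the dilates, and the limit is taken only afterwards.\<close>

lemma harm_ext_arg_fun: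
  assumes \<zeta>: "norm \<zeta> = 1" and z: "norm z < 1"
  shows "harm_ext (arg_fun \<zeta>) z = arg_fun \<zeta> z"
    and "arg_fun \<zeta> \<in> ess_bounded circle"
proof -
  have T: "bounded_linear (\<lambda>x. complex_of_real (Im x))"
    by (rule bounded_linear_compose[OF bounded_linear_of_real bounded_linear_Im])
  note Ln_measurable[measurable]
  have "(\<lambda>z. 1 - cnj \<zeta> * z) \<in> borel_measurable borel"
    by (intro borel_measurable_continuous_onI continuous_intros)
  from measurable_compose[OF this Ln_measurable] have "(\<lambda>z. Ln (1 - cnj \<zeta> * z)) \<in> borel_measurable borel" .
  then have m: "arg_fun \<zeta> \<in> borel_measurable circle"
    unfolding arg_fun_def by (intro borel_measurable_circle_borel) measurable
  have bd: "norm (arg_fun \<zeta> w) \<le> pi / 2" if "norm w \<le> 1" "w \<noteq> \<zeta>" for w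
    using abs_Im_Ln_le[OF \<zeta> that] by (simp only: arg_fun_def norm_of_real less_imp_le)
  have cont: "continuous_on (cball 0 1 - {\<zeta>}) (arg_fun \<zeta>)"
    unfolding arg_fun_def using one_minus_cnj_mult[OF \<zeta>] by (intro continuous_intros) auto
  have "AE w in circle. norm (arg_fun \<zeta> w) \<le> pi / 2"
    using circle_singleton_null[of \<zeta>] AE_space by eventually_elim (rule bd, auto simp: space_circle)
  then show "arg_fun \<zeta> \<in> ess_bounded circle" unfolding ess_bounded_def using m by blast
  show "harm_ext (arg_fun \<zeta>) z = arg_fun \<zeta> z"
    unfolding harm_ext_def
  proof (rule harm_radial_limit[symmetric, OF z m])
    fix r :: real assume r: "0 < r" "r < 1"
    define L where "L w = Ln (1 - cnj \<zeta> * (of_real r * w))" for w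
    have c: "continuous_on (cball 0 1) L" and h: "L holomorphic_on ball 0 1"
      unfolding L_def by (rule Ln_dilate_holomorphic[OF \<zeta> r])+
    have Lb: "L \<in> ess_bounded circle"
      by (rule SAP_ess_bounded[OF SAP_continuous[OF continuous_on_subset[OF c]]]) auto
    have "harm_ext (\<lambda>w. complex_of_real (Im (L w))) z = complex_of_real (Im (harm_ext L z))"
      by (rule harm_integral_bounded_linear[OF z T Lb])
    also have "harm_ext L z = L z" unfolding harm_ext_def by (rule poisson_reproducing[OF c h z, symmetric])
    finally show "arg_fun \<zeta> (of_real r * z) = integral\<^sup>L (harm z) (\<lambda>w. arg_fun \<zeta> (of_real r * w))"
      by (simp add: arg_fun_def L_def harm_ext_def)
    have "continuous_on (cball 0 1) (\<lambda>w. arg_fun \<zeta> (of_real r * w))"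
      unfolding arg_fun_def by (intro continuous_intros Ln_dilate_holomorphic[OF \<zeta> r])
    then show "(\<lambda>w. arg_fun \<zeta> (of_real r * w)) \<in> borel_measurable circle"
      by (intro borel_measurable_circle_continuous) (auto intro: continuous_on_subset)
  next
    show "norm (arg_fun \<zeta> w) \<le> pi / 2" if "norm w < 1" for w using that \<zeta> by (intro bd) auto
    show "isCont (arg_fun \<zeta>) z"
    proof -
      have "continuous_on (ball 0 1) (arg_fun \<zeta>)" by (rule continuous_on_subset[OF cont]) (use \<zeta> in auto)
      then show ?thesis using z by (simp add: continuous_on_eq_continuous_at)
    qed
    show "AE w in circle. ((\<lambda>r. arg_fun \<zeta> (complex_of_real r * w)) \<longlongrightarrow> arg_fun \<zeta> w) (at_left 1)"
      using circle_singleton_null[of \<zeta>] AE_space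
      by eventually_elim (rule radial_limit_continuous[OF cont _ _ \<zeta>], auto simp: space_circle)
  qed
qed

lemma model_arg_fun:
  assumes \<zeta>: "norm \<zeta> = 1"
  shows "model \<zeta> (arg_fun \<zeta>) (\<lambda>k x. of_real (- k * pi / 2))"
  unfolding model_def
proof (intro conjI ballI allI impI)
  show "arg_fun \<zeta> \<in> ess_bounded circle" by (rule harm_ext_arg_fun(2)[OF \<zeta>, of 0]) simp
  have "homogeneous \<zeta> 0 (arg_fun \<zeta>)"
    unfolding homogeneous_def
  proof (intro conjI exI[of _ "pi / 2"] allI impI)
    show "norm (arg_fun \<zeta> z) \<le> pi / 2" if "norm z < 1" for z
    proof -
      have "norm z \<le> 1" "z \<noteq> \<zeta>" using that \<zeta> by auto
      from abs_Im_Ln_le[OF \<zeta> this] show ?thesis by (simp only: arg_fun_def norm_of_real less_imp_le)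
    qed
    fix z :: complex and \<tau> :: real assume z: "norm z < 1"
    show "arg_fun \<zeta> (\<zeta> + of_real (exp \<tau>) * (z - \<zeta>)) = cis (0 * \<tau>) * arg_fun \<zeta> z"
      unfolding arg_fun_def Ln_contract[OF \<zeta> z] by simp
  qed
  then show "hom_sum \<zeta> (harm_ext (arg_fun \<zeta>))"
    by (rule hom_sum_single) (rule harm_ext_arg_fun(1)[OF \<zeta>])
  fix k :: real assume k: "k \<in> {-1, 1}"
  have "\<forall>\<^sub>F t in at_right (0::real). 0 < t \<and> t < pi" unfolding eventually_at_right_field by (auto intro: exI[of _ pi])
  then have "\<forall>\<^sub>F t in at_right 0. of_real (k * t / 2) = arg_fun \<zeta> (\<zeta> * cis (k * t)) - of_real (- k * pi / 2)"
  proof eventually_elim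
    case (elim t)
    have "Im (Ln (1 - cnj \<zeta> * (\<zeta> * cis (k * t)))) = k * (t - pi) / 2"
      by (rule Im_Ln_arc[OF \<zeta>]) (use k elim in auto)
    then have "arg_fun \<zeta> (\<zeta> * cis (k * t)) - of_real (- k * pi / 2) = of_real (k * (t - pi) / 2 - (- k * pi / 2))"
      by (simp only: arg_fun_def of_real_diff)
    also have "k * (t - pi) / 2 - (- k * pi / 2) = k * t / 2" by (simp add: field_simps)
    finally show ?case by simp
  qed
  moreover have "((\<lambda>t. complex_of_real (k * t / 2)) \<longlongrightarrow> of_real (k * 0 / 2)) (at_right 0)" by (intro tendsto_intros) simp
  ultimately show "((\<lambda>t. arg_fun \<zeta> (\<zeta> * cis (k * t)) - of_real (- k * pi / 2)) \<longlongrightarrow> 0) (at_right 0)"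
    using Lim_transform_eventually by fastforce
qed

text \<open>At a nonzero frequency the amplitudes of the power and of the conjugate power on the two
  sides are linearly independent vectors, so a combination of them vanishes on one side. At
  frequency 0 the constant and \<open>arg_fun\<close> play this part.\<close>

lemma model_one_sided:
  assumes \<zeta>: "norm \<zeta> = 1" and k0: "k0 = -1 \<or> k0 = (1::real)" and p: "p \<in> exp_sums"
  shows "\<exists>H. model \<zeta> H (\<lambda>k x. if k = k0 then p x else 0)"
  using p
proof induction
  case (mono c \<nu>)
  show ?case
  proof (cases "\<nu> = 0")
    case True
    \<comment> \<open>With the limits \<open>- k * pi / 2\<close> of \<open>arg_fun\<close> the
      bracket tends to \<open>(1 + k * k0) / 2\<close>, the indicator of the side
      \<open>k0\<close>.\<close>
    have "model \<zeta> (\<lambda>z. c * ((1 / 2) * 1 + of_real (- k0 / pi) * arg_fun \<zeta> z))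
       (\<lambda>k x. c * ((1 / 2) * 1 + of_real (- k0 / pi) * of_real (- k * pi / 2)))"
      by (intro model_scale model_add model_const model_arg_fun \<zeta>)
    then have "model \<zeta> (\<lambda>z. c * ((1 / 2) * 1 + of_real (- k0 / pi) * arg_fun \<zeta> z))
       (\<lambda>k x. if k = k0 then c * cis (\<nu> * x) else 0)"
      by (rule model_cong) (use k0 True in auto)
    then show ?thesis by blast
  next
    case False
    define E where "E = exp (\<nu> * k0 * (pi / 2))"
    have E: "E > 0" by (simp add: E_def)
    have E1: "E ^ 4 \<noteq> 1"
    proof
      assume "E ^ 4 = 1"
      then have "E = 1" using E by (metis less_le power_eq_1_iff real_norm_def abs_of_pos zero_neq_numeral)
      then have "\<nu> * k0 * (pi / 2) = 0" by (simp add: E_def)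
      then show False using False k0 by auto
    qed
    \<comment> \<open>Solution of \<open>a * E + b / E = 1\<close> on the side \<open>k0\<close> and
      \<open>a / E + b * E = 0\<close> on the other side; the determinant vanishes only if
      \<open>E ^ 4 = 1\<close>.\<close>
    define a where "a = E ^ 3 / (E ^ 4 - 1)"
    define b where "b = - E / (E ^ 4 - 1)"
    have "model \<zeta> (\<lambda>z. c * (of_real a * log_power \<zeta> \<nu> z + of_real b * cnj (log_power \<zeta> (- \<nu>) z)))
       (\<lambda>k x. c * (of_real a * (of_real (exp (\<nu> * k * (pi / 2))) * cis (\<nu> * x))
               + of_real b * (of_real (exp (- \<nu> * k * (pi / 2))) * cis (\<nu> * x))))"
      by (intro model_scale model_add model_log_power model_cnj_log_power \<zeta>)
    then have "model \<zeta> (\<lambda>z. c * (of_real a * log_power \<zeta> \<nu> z + of_real b * cnj (log_power \<zeta> (- \<nu>) z)))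
       (\<lambda>k x. if k = k0 then c * cis (\<nu> * x) else 0)"
    proof (rule model_cong)
      fix k x :: real assume k: "k \<in> {-1, 1}"
      have v: "a * exp (\<nu> * k * (pi / 2)) + b * exp (- \<nu> * k * (pi / 2)) = (if k = k0 then 1 else 0)"
      proof (cases "k = k0")
        case True
        have "exp (- \<nu> * k * (pi / 2)) = 1 / E" by (simp add: E_def True exp_minus inverse_eq_divide)
        moreover have "exp (\<nu> * k * (pi / 2)) = E" by (simp add: E_def True)
        moreover have "a * E + b * (1 / E) = (E ^ 4 - 1) / (E ^ 4 - 1)"
        proof -
          have "a * E = E ^ 4 / (E ^ 4 - 1)" by (simp add: a_def power_numeral_reduce mult_ac)
          moreover have "b * (1 / E) = - 1 / (E ^ 4 - 1)" using E by (simp add: b_def)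
          ultimately show ?thesis by (simp only: add_divide_distrib[symmetric] diff_conv_add_uminus)
        qed
        ultimately show ?thesis using E1 True by simp
      next
        case F: False
        then have k': "k = - k0" using k k0 by auto
        have "exp (\<nu> * k * (pi / 2)) = 1 / E" by (simp add: E_def k' exp_minus inverse_eq_divide)
        moreover have "exp (- \<nu> * k * (pi / 2)) = E" by (simp add: E_def k')
        moreover have "a * (1 / E) + b * E = 0" using E by (simp add: a_def b_def power_numeral_reduce)
        ultimately show ?thesis using F by simp
      qed
      have eq: "c * (of_real a * (of_real (exp (\<nu> * k * (pi / 2))) * cis (\<nu> * x))
               + of_real b * (of_real (exp (- \<nu> * k * (pi / 2))) * cis (\<nu> * x)))
         = c * (of_real (a * exp (\<nu> * k * (pi / 2)) + b * exp (- \<nu> * k * (pi / 2))) * cis (\<nu> * x))"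
        by (simp add: algebra_simps)
      show "c * (of_real a * (of_real (exp (\<nu> * k * (pi / 2))) * cis (\<nu> * x))
               + of_real b * (of_real (exp (- \<nu> * k * (pi / 2))) * cis (\<nu> * x)))
         = (if k = k0 then c * cis (\<nu> * x) else 0)" by (rule trans[OF eq[unfolded v]]) simp
    qed
    then show ?thesis by blast
  qed
next
  case (add p q)
  then obtain H K where "model \<zeta> H (\<lambda>k x. if k = k0 then p x else 0)" "model \<zeta> K (\<lambda>k x. if k = k0 then q x else 0)"
    by blast
  from model_add[OF this] have "model \<zeta> (\<lambda>z. H z + K z) (\<lambda>k x. if k = k0 then p x + q x else 0)"
    by (rule model_cong) simp
  then show ?case by (rule exI[where x = "\<lambda>z. H z + K z"])
qed

section \<open>Local behaviour of harmonic extensions\<close>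

definition loc_hom :: "complex \<Rightarrow> (complex \<Rightarrow> complex) \<Rightarrow> bool" where
  "loc_hom \<zeta> g \<longleftrightarrow> (\<forall>e>0. \<exists>d>0. \<exists>Q. hom_sum \<zeta> Q \<and> (\<forall>z. norm z < 1 \<longrightarrow> dist z \<zeta> < d \<longrightarrow> norm (g z - Q z) \<le> e))"

definition loc_const :: "complex \<Rightarrow> (complex \<Rightarrow> complex) \<Rightarrow> bool" where
  "loc_const \<zeta> g \<longleftrightarrow> (\<exists>c. \<forall>e>0. \<exists>d>0. \<forall>z. norm z < 1 \<longrightarrow> dist z \<zeta> < d \<longrightarrow> norm (g z - c) \<le> e)"

lemma circle_near:
  assumes \<zeta>: "norm \<zeta> = 1" and s: "s > 0"
  shows "\<exists>d>0. \<forall>z. norm z = 1 \<longrightarrow> dist z \<zeta> < d \<longrightarrow> z \<noteq> \<zeta> \<longrightarrow>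
     (\<exists>k t. (k = -1 \<or> k = (1::real)) \<and> 0 < t \<and> t < s \<and> z = \<zeta> * cis (k * t))"
proof -
  have "isCont Arg 1" by (rule continuous_at_Arg) simp
  then obtain d where d: "d > 0" "\<And>w. dist w 1 < d \<Longrightarrow> dist (Arg w) (Arg 1) < s"
    using s unfolding continuous_at_eps_delta by metis
  have z1: "\<zeta> * cnj \<zeta> = 1" using \<zeta> by (metis complex_norm_square of_real_1 power_one)
  show ?thesis
  proof (rule exI[of _ d], rule conjI[OF d(1)], rule allI, intro impI)
    fix z assume z: "norm z = 1" "dist z \<zeta> < d" "z \<noteq> \<zeta>"
    define w where "w = z * cnj \<zeta>"
    have w1: "norm w = 1" using z \<zeta> by (simp add: w_def norm_mult)
    have "w - 1 = (z - \<zeta>) * cnj \<zeta>" using z1 by (simp add: w_def algebra_simps)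
    then have "dist w 1 = dist z \<zeta>" using \<zeta> by (simp add: dist_norm norm_mult)
    then have A: "\<bar>Arg w\<bar> < s" using d(2)[of w] z by (simp add: dist_real_def)
    have wA: "w = cis (Arg w)" using w1 Arg_eq[of w] by (cases "w = 0") (auto simp: cis_conv_exp)
    have zw: "z = \<zeta> * w" using z1 by (simp add: w_def mult.left_commute[of \<zeta>])
    have "Arg w \<noteq> 0" using wA zw z(3) by (metis cis_zero mult.right_neutral)
    then show "\<exists>k t. (k = -1 \<or> k = (1::real)) \<and> 0 < t \<and> t < s \<and> z = \<zeta> * cis (k * t)"
      using A wA zw by (intro exI[of _ "sgn (Arg w)"] exI[of _ "\<bar>Arg w\<bar>"]) (auto simp: sgn_if)
  qed
qed

text \<open>One-sided models are added so as to match \<open>g\<close> on both sides of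
  \<open>\<zeta>\<close>. The difference is small on the circle near \<open>\<zeta>\<close>, hence
  its Poisson integral is small in the disc near \<open>\<zeta>\<close>, and the extension of the
  model is a sum of homogeneous functions.\<close>

lemma harm_ext_loc_hom:
  assumes g: "g \<in> SAP S0" and \<zeta>: "norm \<zeta> = 1"
  shows "loc_hom \<zeta> (harm_ext g)"
  unfolding loc_hom_def
proof (intro allI impI)
  fix e :: real assume e: "e > 0"
  \<comment> \<open>Both \<open>g\<close> and the model are within \<open>\<eta>\<close> of the same
    exponential sum, and passing to the Poisson integral doubles the bound
    \<open>2 * \<eta>\<close>.\<close>
  define \<eta> where "\<eta> = e / 4"
  have \<eta>: "\<eta> > 0" using e by (simp add: \<eta>_def)
  define t0 where "t0 = Arg2pi \<zeta>"
  have t0: "t0 \<in> {0..<2*pi}" using Arg2pi[of \<zeta>] by (simp add: t0_def)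
  have zt: "cis t0 = \<zeta>" using Arg2pi_eq[of \<zeta>] \<zeta> by (auto simp: t0_def cis_conv_exp)
  have sap: "sap_at g t0" using g t0 by (simp add: SAP_iff)
  obtain s1 p1 where 1: "s1 > 0" "p1 \<in> exp_sums"
    "arc_close t0 1 s1 g p1 \<eta>"
    by (rule sap_atE[OF sap \<eta>, of 1]) auto
  obtain s2 p2 where 2: "s2 > 0" "p2 \<in> exp_sums"
    "arc_close t0 (-1) s2 g p2 \<eta>"
    by (rule sap_atE[OF sap \<eta>, of "-1"]) auto
  obtain H1 where H1: "model \<zeta> H1 (\<lambda>k x. if k = 1 then p1 x else 0)"
    using model_one_sided[OF \<zeta> _ 1(2), of 1] by blast
  obtain H2 where H2: "model \<zeta> H2 (\<lambda>k x. if k = -1 then p2 x else 0)"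
    using model_one_sided[OF \<zeta> _ 2(2), of "-1"] by blast
  define H where "H z = H1 z + H2 z" for z
  have H: "model \<zeta> H (\<lambda>k x. (if k = 1 then p1 x else 0) + (if k = -1 then p2 x else 0))"
    unfolding H_def by (rule model_add[OF H1 H2])
  then have Hb: "H \<in> ess_bounded circle" and Hs: "hom_sum \<zeta> (harm_ext H)" by (auto simp: model_def)
  have HL: "((\<lambda>t. H (\<zeta> * cis (1 * t)) - p1 (ln t)) \<longlongrightarrow> 0) (at_right 0)"
    "((\<lambda>t. H (\<zeta> * cis ((-1) * t)) - p2 (ln t)) \<longlongrightarrow> 0) (at_right 0)"
    using H unfolding model_def by auto
  obtain s3 where 3: "s3 > 0" "\<And>t. 0 < t \<Longrightarrow> t < s3 \<Longrightarrow> norm (H (\<zeta> * cis (1 * t)) - p1 (ln t)) \<le> \<eta>"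
    using at_right_0_norm_le[OF HL(1) \<eta>] by blast
  obtain s4 where 4: "s4 > 0" "\<And>t. 0 < t \<Longrightarrow> t < s4 \<Longrightarrow> norm (H (\<zeta> * cis ((-1) * t)) - p2 (ln t)) \<le> \<eta>"
    using at_right_0_norm_le[OF HL(2) \<eta>] by blast
  define s where "s = min (min s1 s2) (min s3 s4)"
  have s: "s > 0" "s \<le> s1" "s \<le> s2" "s \<le> s3" "s \<le> s4" using 1 2 3 4 by (auto simp: s_def)
  obtain d where d: "d > 0" "\<And>z. norm z = 1 \<Longrightarrow> dist z \<zeta> < d \<Longrightarrow> z \<noteq> \<zeta> \<Longrightarrow>
     \<exists>k t. (k = -1 \<or> k = (1::real)) \<and> 0 < t \<and> t < s \<and> z = \<zeta> * cis (k * t)"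
    using circle_near[OF \<zeta> s(1)] by blast
  have gb: "g \<in> ess_bounded circle" using g by (rule SAP_ess_bounded)
  have "(\<lambda>w. g w + (-1) * H w) \<in> ess_bounded circle"
    by (intro ess_bounded_add ess_bounded_mult ess_bounded_const gb Hb)
  then have gH: "(\<lambda>w. g w - H w) \<in> ess_bounded circle" by simp
  have "AE w in circle. dist w \<zeta> < d \<longrightarrow> norm (g w - H w) \<le> 2 * \<eta>"
    using 1(3) 2(3) circle_singleton_null[of \<zeta>] AE_space
  proof eventually_elim
    case (elim w)
    show ?case
    proof
      assume "dist w \<zeta> < d"
      then obtain k t where kt: "k = -1 \<or> k = (1::real)" "0 < t" "t < s" "w = \<zeta> * cis (k * t)"
        using d(2)[of w] elim by (auto simp: space_circle)
      have w: "w = cis (t0 + k * t)" using kt(4) by (simp add: zt flip: cis_mult)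
      from kt(1) obtain q where "norm (g w - q) \<le> \<eta>" "norm (H w - q) \<le> \<eta>"
      proof
        assume k: "k = -1"
        show thesis
        proof (rule that[of "p2 (ln t)"])
          show "norm (g w - p2 (ln t)) \<le> \<eta>" using elim(2) kt s w k by auto
          show "norm (H w - p2 (ln t)) \<le> \<eta>" using 4(2)[of t] kt s k by simp
        qed
      next
        assume k: "k = 1"
        show thesis
        proof (rule that[of "p1 (ln t)"])
          show "norm (g w - p1 (ln t)) \<le> \<eta>" using elim(1) kt s w k by auto
          show "norm (H w - p1 (ln t)) \<le> \<eta>" using 3(2)[of t] kt s k by simp
        qed
      qed
      then show "norm (g w - H w) \<le> 2 * \<eta>" by norm
    qed
  qed
  then obtain \<delta> where \<delta>: "\<delta> > 0"
      "\<And>z. norm z < 1 \<Longrightarrow> dist z \<zeta> < \<delta> \<Longrightarrow> norm (integral\<^sup>L (harm z) (\<lambda>w. g w - H w)) \<le> 2 * (2 * \<eta>)"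
    using harm_local_bound[OF \<zeta> gH d(1), of "2 * \<eta>"] \<eta> by auto
  show "\<exists>\<delta>>0. \<exists>Q. hom_sum \<zeta> Q \<and> (\<forall>z. norm z < 1 \<longrightarrow> dist z \<zeta> < \<delta> \<longrightarrow> norm (harm_ext g z - Q z) \<le> e)"
  proof (intro exI[of _ \<delta>] exI[of _ "harm_ext H"] conjI allI impI Hs \<delta>(1))
    fix z assume z: "norm z < 1" "dist z \<zeta> < \<delta>"
    have "harm_ext g z - harm_ext H z = integral\<^sup>L (harm z) (\<lambda>w. g w - H w)"
      unfolding harm_ext_def using harm_integrable[OF z(1)] gb Hb by simp
    then show "norm (harm_ext g z - harm_ext H z) \<le> e" using \<delta>(2)[OF z] by (simp add: \<eta>_def)
  qed
qed

lemma harm_ext_loc_const_boundary: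
  assumes g: "g \<in> SAP S0" and \<zeta>: "norm \<zeta> = 1" "\<zeta> \<notin> S0" and S0: "closed S0"
  shows "loc_const \<zeta> (harm_ext g)"
proof -
  have gb: "g \<in> ess_bounded circle" using g by (rule SAP_ess_bounded)
  obtain h where h: "continuous_on (sphere 0 1 - S0) h" "AE z in circle. z \<in> sphere 0 1 - S0 \<longrightarrow> g z = h z"
    using g by (auto simp: SAP_iff)
  show ?thesis
    unfolding loc_const_def
  proof (rule exI[of _ "h \<zeta>"], intro allI impI)
  fix e :: real assume e: "e > 0"
  obtain d1 where d1: "d1 > 0" "\<And>z. z \<in> sphere 0 1 - S0 \<Longrightarrow> dist z \<zeta> < d1 \<Longrightarrow> dist (h z) (h \<zeta>) < e/2"
    using h(1) \<zeta> e unfolding continuous_on_iff by (metis DiffI half_gt_zero mem_sphere_0)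
  obtain d2 where d2: "d2 > 0" "\<And>z. dist z \<zeta> < d2 \<Longrightarrow> z \<notin> S0"
    using S0 \<zeta>(2) open_dist[of "- S0"] by (auto simp: open_Compl)
  have "(\<lambda>w. g w + (-1) * h \<zeta>) \<in> ess_bounded circle"
    by (intro ess_bounded_add ess_bounded_mult ess_bounded_const gb)
  then have gH: "(\<lambda>w. g w - h \<zeta>) \<in> ess_bounded circle" by simp
  have "AE w in circle. dist w \<zeta> < min d1 d2 \<longrightarrow> norm (g w - h \<zeta>) \<le> e/2"
    using h(2) AE_space
  proof eventually_elim
    case (elim w)
    then show ?case using d1(2)[of w] d2(2)[of w] by (auto simp: space_circle dist_norm)
  qed
  then obtain d where d: "d > 0"
      "\<And>z. norm z < 1 \<Longrightarrow> dist z \<zeta> < d \<Longrightarrow> norm (integral\<^sup>L (harm z) (\<lambda>w. g w - h \<zeta>)) \<le> 2 * (e/2)"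
    using harm_local_bound[OF \<zeta>(1) gH, of "min d1 d2" "e/2"] d1 d2 e by auto
  show "\<exists>d>0. \<forall>z. norm z < 1 \<longrightarrow> dist z \<zeta> < d \<longrightarrow> norm (harm_ext g z - h \<zeta>) \<le> e"
  proof (intro exI[of _ d] conjI allI impI d(1))
    fix z assume z: "norm z < 1" "dist z \<zeta> < d"
    interpret finite_measure "harm z" by (rule finite_measure_harm[OF z(1)])
    have "harm_ext g z - h \<zeta> = integral\<^sup>L (harm z) (\<lambda>w. g w - h \<zeta>)"
      unfolding harm_ext_def using harm_integrable[OF z(1) gb] measure_harm[OF z(1)] by (simp add: space_harm)
    then show "norm (harm_ext g z - h \<zeta>) \<le> e" using d(2)[OF z] by simp
  qed
  qed
qed

lemma harm_ext_loc_const_interior: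
  assumes g: "g \<in> SAP S0" and \<zeta>: "norm \<zeta> < 1"
  shows "loc_const \<zeta> (harm_ext g)"
  unfolding loc_const_def harm_ext_def
  using harm_continuous[OF \<zeta> SAP_ess_bounded[OF g]] by blast

lemma harm_ext_bounded:
  assumes "g \<in> SAP S0"
  shows "\<exists>B. \<forall>z. norm z < 1 \<longrightarrow> norm (harm_ext g z) \<le> B"
proof -
  have gb: "g \<in> ess_bounded circle" using assms by (rule SAP_ess_bounded)
  then obtain C where "AE w in circle. norm (g w) \<le> C" by (auto simp: ess_bounded_def)
  then show ?thesis unfolding harm_ext_def using harm_bound[OF _ gb] by blast
qed

section \<open>Folner sets and averages\<close>

text \<open>Sets of bounded integer combinations of \<open>\<Lambda>\<close> grow polynomially, so some of them grow by a factor
  close to 1.\<close>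

lemma Folner_set:
  fixes \<Lambda> :: "real set"
  assumes fin: "finite \<Lambda>" and \<eta>: "\<eta> > 0"
  shows "\<exists>E. finite E \<and> E \<noteq> {} \<and> (\<forall>l\<in>\<Lambda>. real (card (E \<inter> (+) l ` E)) \<ge> (1 - \<eta>) * real (card E))"
proof -
  define S where "S L = (\<lambda>m. \<Sum>l\<in>\<Lambda>. real (m l) * l) ` (\<Pi>\<^sub>E l\<in>\<Lambda>. {..<L})" for L :: nat
  have finS: "finite (S L)" for L unfolding S_def using fin by (intro finite_imageI finite_PiE) auto
  have cardS: "card (S L) \<le> L ^ card \<Lambda>" for L
  proof -
    have "card (S L) \<le> card (\<Pi>\<^sub>E l\<in>\<Lambda>. {..<L})" unfolding S_def using fin by (intro card_image_le finite_PiE) auto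
    then show ?thesis using fin by (simp add: card_PiE)
  qed
  have ne: "S L \<noteq> {}" if "L > 0" for L
    unfolding S_def using that by (auto simp: PiE_eq_empty_iff)
  have mono: "S L \<subseteq> S (Suc L)" for L
    unfolding S_def by (intro image_mono PiE_mono) auto
  have shift: "(+) l ` S L \<subseteq> S (Suc L)" if l: "l \<in> \<Lambda>" for l L
  proof
    fix y assume "y \<in> (+) l ` S L"
    then obtain m where m: "m \<in> (\<Pi>\<^sub>E l\<in>\<Lambda>. {..<L})" "y = l + (\<Sum>l\<in>\<Lambda>. real (m l) * l)" by (auto simp: S_def)
    have "(\<Sum>x\<in>\<Lambda>. real ((m(l := Suc (m l))) x) * x) = real (Suc (m l)) * l + (\<Sum>x\<in>\<Lambda> - {l}. real (m x) * x)"
      using l fin by (subst sum.remove[of _ l]) auto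
    also have "\<dots> = l + (real (m l) * l + (\<Sum>x\<in>\<Lambda> - {l}. real (m x) * x))" by (simp add: algebra_simps)
    also have "\<dots> = y" unfolding m(2) using l fin by (subst (2) sum.remove[of _ l]) auto
    finally have y: "y = (\<Sum>x\<in>\<Lambda>. real ((m(l := Suc (m l))) x) * x)" by simp
    have "m(l := Suc (m l)) \<in> (\<Pi>\<^sub>E l\<in>\<Lambda>. {..<Suc L})"
      using m(1) l by (auto simp: PiE_def Pi_def extensional_def less_SucI)
    then show "y \<in> S (Suc L)" unfolding S_def y by (rule imageI)
  qed
  have "\<exists>L>0. real (card (S (Suc L))) \<le> (1 + \<eta>) * real (card (S L))"
  proof (rule ccontr)
    assume "\<not> ?thesis"
    then have grow: "real (card (S (Suc L))) > (1 + \<eta>) * real (card (S L))" if "L > 0" for L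
      using that by (meson not_le)
    have lower: "real (card (S (Suc L))) \<ge> (1 + \<eta>) ^ L" for L
    proof (induction L)
      case 0
      have "card (S (Suc 0)) \<noteq> 0" using finS[of "Suc 0"] ne[of "Suc 0"] by (simp only: card_eq_0_iff) auto
      then show ?case by simp
    next
      case (Suc L)
      have "(1 + \<eta>) ^ Suc L \<le> (1 + \<eta>) * real (card (S (Suc L)))" using Suc \<eta> by simp
      also have "\<dots> \<le> real (card (S (Suc (Suc L))))" using grow[of "Suc L"] by simp
      finally show ?case .
    qed
    have "((\<lambda>L. real (Suc L) ^ card \<Lambda> / (1 + \<eta>) ^ L) \<longlongrightarrow> 0) sequentially" using \<eta> by real_asymp
    then have "\<forall>\<^sub>F L in sequentially. real (Suc L) ^ card \<Lambda> / (1 + \<eta>) ^ L < 1"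
      by (rule order_tendstoD(2)) simp
    then obtain L where "real (Suc L) ^ card \<Lambda> / (1 + \<eta>) ^ L < 1"
      using eventually_happens trivial_limit_sequentially by blast
    then have "real (Suc L) ^ card \<Lambda> < (1 + \<eta>) ^ L" using \<eta> by (simp add: field_simps)
    moreover have "real (card (S (Suc L))) \<le> real (Suc L) ^ card \<Lambda>"
      using cardS[of "Suc L"] by (simp only: flip: of_nat_power of_nat_le_iff)
    ultimately show False using lower[of L] by linarith
  qed
  then obtain L where L: "L > 0" "real (card (S (Suc L))) \<le> (1 + \<eta>) * real (card (S L))" by blast
  have "real (card (S L \<inter> (+) l ` S L)) \<ge> (1 - \<eta>) * real (card (S L))" if l: "l \<in> \<Lambda>" for l
  proof -
    have "card ((+) l ` S L) = card (S L)" by (intro card_image inj_onI) simp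
    \<comment> \<open>The set and its translate have equal size and their union lies in
      \<open>S (Suc L)\<close>, so a small growth factor forces a large overlap.\<close>
    moreover have "card (S L) + card ((+) l ` S L) = card (S L \<union> (+) l ` S L) + card (S L \<inter> (+) l ` S L)"
      using finS by (intro card_Un_Int) auto
    moreover have "card (S L \<union> (+) l ` S L) \<le> card (S (Suc L))"
      using mono shift[OF l] finS by (intro card_mono) auto
    ultimately have "2 * real (card (S L)) \<le> real (card (S (Suc L))) + real (card (S L \<inter> (+) l ` S L))" by linarith
    then show ?thesis using L(2) by (simp add: algebra_simps)
  qed
  then show ?thesis using finS[of L] ne[OF L(1)] by (intro exI[of _ "S L"]) auto
qed

text \<open>A mean with mesh \<open>1 / N\<close> over an interval of length \<open>N\<close> that
  starts at \<open>N\<close>. Finite sums need no integrability and inherit holomorphy in parameters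
  at once.\<close>

definition avg :: "nat \<Rightarrow> (real \<Rightarrow> complex) \<Rightarrow> complex" where
  "avg N g = (\<Sum>j<N\<^sup>2. g (real N + real j / real N)) / of_nat (N\<^sup>2)"

text \<open>The step of the averages tends to zero, so that there is no resonance with any frequency, while
  the averaged interval moves to infinity.\<close>

lemma avg_cis:
  shows "(\<lambda>N. avg N (\<lambda>x. cis (\<kappa> * x))) \<longlonglongrightarrow> (if \<kappa> = 0 then 1 else 0)"
proof (cases "\<kappa> = 0")
  case True
  have "\<forall>\<^sub>F N in sequentially. avg N (\<lambda>x. cis (\<kappa> * x)) = 1"
    using eventually_gt_at_top[of 0] by eventually_elim (simp add: avg_def True)
  then show ?thesis using True by (simp add: tendsto_eventually)
next
  case False
  define a where "a = \<bar>\<kappa>\<bar>"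
  have a: "a > 0" using False by (simp add: a_def)
  \<comment> \<open>The mean is a geometric sum, bounded by 2 over the distance of its ratio from 1,
    divided by the number of terms; here \<open>N\<^sup>2 * sin (a / (2 * N))\<close> grows like
    \<open>a * N / 2\<close>.\<close>
  have "((\<lambda>N. 1 / ((real N)\<^sup>2 * \<bar>sin (a / (2 * real N))\<bar>)) \<longlongrightarrow> 0) sequentially"
    using a by real_asymp
  moreover have "\<forall>\<^sub>F N in sequentially. norm (avg N (\<lambda>x. cis (\<kappa> * x))) \<le> 1 / ((real N)\<^sup>2 * \<bar>sin (a / (2 * real N))\<bar>)"
  proof -
    have "\<forall>\<^sub>F N in sequentially. real N > a" using filterlim_real_sequentially by (simp add: filterlim_at_top_dense)
    then show ?thesis
    proof eventually_elim
      case (elim N)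
      have N: "real N > 0" using elim a by linarith
      define x where "x = cis (\<kappa> / real N)"
      have nx: "norm (1 - x) = 2 * \<bar>sin (a / (2 * real N))\<bar>"
      proof -
        define y where "y = \<kappa> / real N / 2"
        have x: "x = cis (2 * y)" by (simp add: x_def y_def)
        have "(norm (1 - x))\<^sup>2 = (1 - cos (2 * y))\<^sup>2 + (sin (2 * y))\<^sup>2"
          unfolding x cmod_power2 by simp
        also have "\<dots> = (2 * (sin y)\<^sup>2)\<^sup>2 + (2 * sin y * cos y)\<^sup>2"
          unfolding cos_double_sin sin_double by simp
        also have "\<dots> = (2 * sin y)\<^sup>2 * ((sin y)\<^sup>2 + (cos y)\<^sup>2)" by algebra
        also have "\<dots> = \<bar>2 * sin y\<bar>\<^sup>2" by (simp only: sin_cos_squared_add mult_1_right power2_abs)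
        finally have "norm (1 - x) = \<bar>2 * sin y\<bar>"
          by (rule power2_eq_imp_eq) (rule norm_ge_zero, rule abs_ge_zero)
        then have "norm (1 - x) = \<bar>2 * sin (\<kappa> / real N / 2)\<bar>" by (simp only: y_def)
        also have "\<dots> = 2 * \<bar>sin (a / (2 * real N))\<bar>"
          by (cases "\<kappa> \<ge> 0") (simp_all add: a_def abs_mult mult.commute)
        finally show ?thesis .
      qed
      have "sin (a / (2 * real N)) > 0"
      proof (rule sin_gt_zero)
        have "a / (2 * real N) < 1" using elim N by (simp add: field_simps)
        then show "a / (2 * real N) < pi" using pi_gt3 by linarith
      qed (use a N in auto)
      then have x1: "x \<noteq> 1" using nx by auto
      have "(\<Sum>j<N\<^sup>2. cis (\<kappa> * (real N + real j / real N))) = cis (\<kappa> * real N) * (\<Sum>j<N\<^sup>2. x ^ j)"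
        by (simp add: sum_distrib_left x_def Complex.DeMoivre cis_mult algebra_simps)
      also have "\<dots> = cis (\<kappa> * real N) * ((1 - x ^ (N\<^sup>2)) / (1 - x))"
        using x1 by (simp add: sum_gp_strict)
      finally have "norm (\<Sum>j<N\<^sup>2. cis (\<kappa> * (real N + real j / real N))) = norm (1 - x ^ (N\<^sup>2)) / norm (1 - x)"
        by (simp add: norm_mult norm_divide)
      also have "\<dots> \<le> 2 / norm (1 - x)"
      proof (rule divide_right_mono)
        have "norm (1 - x ^ (N\<^sup>2)) \<le> norm (1::complex) + norm (x ^ (N\<^sup>2))" by (rule norm_triangle_ineq4)
        then show "norm (1 - x ^ (N\<^sup>2)) \<le> 2" by (simp add: norm_power x_def)
      qed simp
      also have "\<dots> = 1 / \<bar>sin (a / (2 * real N))\<bar>" unfolding nx by simp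
      finally have "norm (\<Sum>j<N\<^sup>2. cis (\<kappa> * (real N + real j / real N))) / (real N)\<^sup>2 \<le> 1 / \<bar>sin (a / (2 * real N))\<bar> / (real N)\<^sup>2"
        by (intro divide_right_mono) auto
      then show ?case by (simp add: avg_def norm_divide mult.commute norm_power)
    qed
  qed
  ultimately have "(\<lambda>N. avg N (\<lambda>x. cis (\<kappa> * x))) \<longlonglongrightarrow> 0" by (rule Lim_null_comparison[rotated])
  then show ?thesis using False by simp
qed

lemma avg_diff: "avg N (\<lambda>x. f x - g x) = avg N f - avg N g"
  by (simp add: avg_def sum_subtractf diff_divide_distrib)

lemma avg_mult: "avg N (\<lambda>x. c * f x) = c * avg N f"
  by (simp add: avg_def flip: sum_distrib_left)

lemma avg_sum: "avg N (\<lambda>x. \<Sum>i\<in>I. f i x) = (\<Sum>i\<in>I. avg N (f i))"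
  unfolding avg_def by (subst sum.swap) (simp add: sum_divide_distrib)

lemma avg_le:
  assumes "N > 0" "\<And>x. x \<ge> real N \<Longrightarrow> norm (f x) \<le> b x"
  shows "norm (avg N f) \<le> Re (avg N (\<lambda>x. of_real (b x)))"
proof -
  have "norm (\<Sum>j<N\<^sup>2. f (real N + real j / real N)) \<le> (\<Sum>j<N\<^sup>2. b (real N + real j / real N))"
    using assms by (intro sum_norm_le) auto
  then have "norm (\<Sum>j<N\<^sup>2. f (real N + real j / real N)) / (real N)\<^sup>2 \<le> (\<Sum>j<N\<^sup>2. b (real N + real j / real N)) / (real N)\<^sup>2"
    by (intro divide_right_mono) auto
  moreover have "avg N (\<lambda>x. of_real (b x)) = of_real ((\<Sum>j<N\<^sup>2. b (real N + real j / real N)) / (real N)\<^sup>2)"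
    by (simp add: avg_def)
  ultimately show ?thesis by (simp add: avg_def norm_divide norm_power)
qed

lemma avg_const: "N > 0 \<Longrightarrow> avg N (\<lambda>x. c) = c"
  by (simp add: avg_def)

lemma avg_bound:
  assumes "N > 0" "\<And>x. x \<ge> real N \<Longrightarrow> norm (f x) \<le> b"
  shows "norm (avg N f) \<le> b"
  using avg_le[OF assms(1), of f "\<lambda>_. b"] assms by (simp add: avg_const)

text \<open>The Fejer kernel of the finite set \<open>E\<close>, twisted by \<open>\<alpha>\<close>.
  As a squared modulus it is nonnegative, and it is scaled to have mean 1 for nonempty
  \<open>E\<close> and unitary \<open>\<alpha>\<close>. The trivial twist serves the local
  approximation, a unitary homomorphism serves Kronecker's theorem.\<close>

definition fejer :: "(real \<Rightarrow> complex) \<Rightarrow> real set \<Rightarrow> real \<Rightarrow> real" where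
  "fejer \<alpha> E x = (norm (\<Sum>\<mu>\<in>E. \<alpha> (- \<mu>) * cis (\<mu> * x)))\<^sup>2 / real (card E)"

lemma fejer_nonneg: "fejer \<alpha> E x \<ge> 0"
  by (simp add: fejer_def)

context
  fixes \<alpha> :: "real \<Rightarrow> complex"
  assumes hom: "\<And>l m. \<alpha> (l + m) = \<alpha> l * \<alpha> m" and unit: "\<And>l. norm (\<alpha> l) = 1"
begin

lemma unit_hom_0: "\<alpha> 0 = 1"
  using hom[of 0 0] unit[of 0] by (metis add.right_neutral mult_cancel_left2 norm_zero zero_neq_one)

lemma unit_hom_minus: "cnj (\<alpha> l) = \<alpha> (- l)"
proof -
  have "\<alpha> l * \<alpha> (- l) = 1" using hom[of l "- l"] unit_hom_0 by simp
  moreover have "\<alpha> l * cnj (\<alpha> l) = 1" using unit[of l] by (simp add: complex_norm_square[symmetric])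
  ultimately show ?thesis by (metis mult_cancel_left norm_zero unit zero_neq_one)
qed

lemma fejer_eq:
  "complex_of_real (fejer \<alpha> E x) = (\<Sum>p\<in>E\<times>E. \<alpha> (snd p - fst p) * cis ((fst p - snd p) * x)) / of_nat (card E)"
proof -
  have "complex_of_real ((norm (\<Sum>\<mu>\<in>E. \<alpha> (- \<mu>) * cis (\<mu> * x)))\<^sup>2)
     = (\<Sum>\<mu>\<in>E. \<alpha> (- \<mu>) * cis (\<mu> * x)) * cnj (\<Sum>\<mu>\<in>E. \<alpha> (- \<mu>) * cis (\<mu> * x))"
    by (rule complex_norm_square)
  also have "\<dots> = (\<Sum>\<mu>\<in>E. \<Sum>\<nu>\<in>E. (\<alpha> (- \<mu>) * \<alpha> \<nu>) * (cis (\<mu> * x) * cis (- (\<nu> * x))))"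
    unfolding cnj_sum sum_product by (intro sum.cong refl) (simp add: cis_cnj unit_hom_minus mult_ac)
  also have "\<dots> = (\<Sum>\<mu>\<in>E. \<Sum>\<nu>\<in>E. \<alpha> (\<nu> - \<mu>) * cis ((\<mu> - \<nu>) * x))"
    by (simp add: cis_mult left_diff_distrib flip: hom)
  also have "\<dots> = (\<Sum>p\<in>E\<times>E. \<alpha> (snd p - fst p) * cis ((fst p - snd p) * x))"
    by (simp add: sum.cartesian_product case_prod_beta)
  finally show ?thesis by (simp add: fejer_def del: of_real_power)
qed

text \<open>After expanding the square, averaging keeps the pairs whose difference is
  \<open>l\<close>, and on these the twists cancel because \<open>\<alpha>\<close> is a
  homomorphism. The pairs are counted by the overlap of \<open>E\<close> with its translate by
  \<open>l\<close>.\<close>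

lemma fejer_mean:
  assumes "finite E"
  shows "(\<lambda>N. avg N (\<lambda>x. of_real (fejer \<alpha> E x) * (cis (- l * x) * \<alpha> l)))
     \<longlonglongrightarrow> of_nat (card (E \<inter> (+) l ` E)) / of_nat (card E)"
proof -
  have "of_real (fejer \<alpha> E x) * (cis (- l * x) * \<alpha> l)
     = (1 / of_nat (card E)) * (\<Sum>p\<in>E\<times>E. \<alpha> (l + (snd p - fst p)) * cis ((fst p - snd p - l) * x))" for x
  proof -
    have "\<alpha> (l + (snd p - fst p)) * cis ((fst p - snd p - l) * x)
       = \<alpha> (snd p - fst p) * cis ((fst p - snd p) * x) * (cis (- l * x) * \<alpha> l)" for p :: "real \<times> real"
    proof -
      have "\<alpha> (l + (snd p - fst p)) = \<alpha> l * \<alpha> (snd p - fst p)" by (rule hom)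
      moreover have "cis ((fst p - snd p - l) * x) = cis ((fst p - snd p) * x) * cis (- l * x)"
        by (simp add: cis_mult algebra_simps)
      ultimately show ?thesis by (simp only: mult_ac)
    qed
    then show ?thesis unfolding fejer_eq by (simp add: sum_distrib_right[symmetric])
  qed
  then have eq: "avg N (\<lambda>x. of_real (fejer \<alpha> E x) * (cis (- l * x) * \<alpha> l))
     = (1 / of_nat (card E)) * (\<Sum>p\<in>E\<times>E. \<alpha> (l + (snd p - fst p)) * avg N (\<lambda>x. cis ((fst p - snd p - l) * x)))" for N
    by (simp only: avg_mult avg_sum)
  have "(\<lambda>N. avg N (\<lambda>x. of_real (fejer \<alpha> E x) * (cis (- l * x) * \<alpha> l)))
     \<longlonglongrightarrow> (1 / of_nat (card E)) * (\<Sum>p\<in>E\<times>E. \<alpha> (l + (snd p - fst p)) * (if fst p - snd p - l = 0 then 1 else 0))"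
    unfolding eq by (intro tendsto_mult tendsto_const tendsto_sum avg_cis)
  also have "(\<Sum>p\<in>E\<times>E. \<alpha> (l + (snd p - fst p)) * (if fst p - snd p - l = 0 then 1 else 0))
     = (\<Sum>p\<in>E\<times>E. if fst p - snd p - l = 0 then 1 else 0)"
  proof (intro sum.cong refl)
    fix p :: "real \<times> real"
    note unit_hom_0
    then have "\<alpha> (l + (snd p - fst p)) = 1" if "fst p - snd p - l = 0"
    proof -
      have "l + (snd p - fst p) = 0" using that by linarith
      then show ?thesis using unit_hom_0 by (simp only:)
    qed
    then show "\<alpha> (l + (snd p - fst p)) * (if fst p - snd p - l = 0 then 1 else 0) = (if fst p - snd p - l = 0 then 1 else 0)"
      by (cases "fst p - snd p - l = 0") simp_all
  qed
  also have "(\<Sum>p\<in>E\<times>E. if fst p - snd p - l = 0 then 1 else 0) = (of_nat (card {p\<in>E\<times>E. fst p - snd p - l = 0}) :: complex)"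
    using assms by (simp add: sum.If_cases Int_def)
  also have "card {p\<in>E\<times>E. fst p - snd p - l = 0} = card (E \<inter> (+) l ` E)"
  proof (rule bij_betw_same_card[of fst])
    show "bij_betw fst {p\<in>E\<times>E. fst p - snd p - l = 0} (E \<inter> (+) l ` E)"
      by (rule bij_betw_byWitness[where f' = "\<lambda>x. (x, x - l)"]) (auto simp: image_iff)
  qed
  finally show ?thesis by simp
qed
end

section \<open>Local approximation by power sums\<close>

text \<open>\<open>B\<close> collects the coordinates at which \<open>\<zeta> k\<close> is a
  singular boundary point, and \<open>\<Gamma> k\<close> the admissible factors in coordinate
  \<open>k\<close>. Of these factors only two local properties enter: sums of homogeneous functions
  near \<open>\<zeta> k\<close> for \<open>k\<close> in \<open>B\<close>, a limit at
  \<open>\<zeta> k\<close> otherwise.\<close>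

locale local_approximation =
  fixes \<zeta> :: "'n::finite \<Rightarrow> complex" and B :: "'n set" and \<Gamma> :: "'n \<Rightarrow> (complex \<Rightarrow> complex) set"
  assumes B_norm: "k \<in> B \<Longrightarrow> norm (\<zeta> k) = 1"
    and const: "(\<lambda>_. c) \<in> \<Gamma> k"
    and bounded: "g \<in> \<Gamma> k \<Longrightarrow> \<exists>C. \<forall>w. norm w < 1 \<longrightarrow> norm (g w) \<le> C"
    and hom: "k \<in> B \<Longrightarrow> g \<in> \<Gamma> k \<Longrightarrow> loc_hom (\<zeta> k) g"
    and const_limit: "k \<notin> B \<Longrightarrow> g \<in> \<Gamma> k \<Longrightarrow> loc_const (\<zeta> k) g"
begin

text \<open>Holomorphy is asked of \<open>f\<close> only, not of the approximating tensors. The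
  class is chosen to be stable under taking coefficients in one coordinate, so that the coordinates
  of \<open>B\<close> can be treated in turn.\<close>

definition X :: "(('n \<Rightarrow> complex) \<Rightarrow> complex) set" where
  "X = {f. (\<forall>z\<in>polydisc. \<forall>k. (\<lambda>w. f (z(k := w))) holomorphic_on ball 0 1) \<and>
     (\<forall>e>0. \<exists>q\<in>tensor \<Gamma>. \<forall>z\<in>polydisc. norm (f z - q z) \<le> e)}"

lemma polydisc_upd: "z \<in> polydisc \<Longrightarrow> norm w < 1 \<Longrightarrow> z(k := w) \<in> (polydisc :: ('n \<Rightarrow> complex) set)"
  by (simp add: polydisc_def)

lemma polydisc_norm: "z \<in> polydisc \<Longrightarrow> norm (z k) < 1"
  by (simp add: polydisc_def)

definition contract :: "'n \<Rightarrow> real \<Rightarrow> ('n \<Rightarrow> complex) \<Rightarrow> 'n \<Rightarrow> complex" where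
  "contract k x z = z(k := \<zeta> k + of_real (exp (- x)) * (z k - \<zeta> k))"

lemma contract_norm:
  assumes "norm (\<zeta> k) \<le> 1" "norm w < 1" "x \<ge> 0"
  shows "norm (\<zeta> k + of_real (exp (- x)) * (w - \<zeta> k)) < 1"
proof -
  have e: "0 < exp (- x)" "exp (- x) \<le> 1" using assms by auto
  have "\<zeta> k + of_real (exp (- x)) * (w - \<zeta> k) = of_real (1 - exp (- x)) * \<zeta> k + of_real (exp (- x)) * w"
    by (simp add: algebra_simps)
  also have "norm \<dots> \<le> norm (of_real (1 - exp (- x)) * \<zeta> k) + norm (of_real (exp (- x)) * w)"
    by (rule norm_triangle_ineq)
  also have "\<dots> = (1 - exp (- x)) * norm (\<zeta> k) + exp (- x) * norm w"
  proof -
    have "\<bar>1 - exp (- x)\<bar> = 1 - exp (- x)" "\<bar>exp (- x)\<bar> = exp (- x)" using e by auto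
    then show ?thesis by (simp only: norm_mult norm_of_real)
  qed
  also have "\<dots> < (1 - exp (- x)) * 1 + exp (- x) * 1"
    using e assms by (intro add_le_less_mono mult_left_mono mult_strict_left_mono) auto
  finally show ?thesis by simp
qed

lemma contract_polydisc: "k \<in> B \<Longrightarrow> z \<in> polydisc \<Longrightarrow> x \<ge> 0 \<Longrightarrow> contract k x z \<in> polydisc"
  unfolding contract_def by (intro polydisc_upd contract_norm) (auto simp: B_norm polydisc_norm)

lemma contract_near:
  assumes k: "k \<in> B" and d: "d > 0"
  shows "\<exists>X0\<ge>0. \<forall>z\<in>polydisc. \<forall>x\<ge>X0. dist (contract k x z k) (\<zeta> k) < d"
proof (intro exI[of _ "max 0 (- ln (d / 2))"] conjI ballI allI impI)
  fix z :: "'n \<Rightarrow> complex" and x assume z: "z \<in> polydisc" and x: "x \<ge> max 0 (- ln (d / 2))"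
  have "exp (- x) \<le> exp (ln (d / 2))" using x by simp
  then have e: "exp (- x) \<le> d / 2" using d by simp
  have "norm (z k - \<zeta> k) \<le> norm (z k) + norm (\<zeta> k)" by (rule norm_triangle_ineq4)
  then have "norm (z k - \<zeta> k) < 2" using polydisc_norm[OF z, of k] B_norm[OF k] by simp
  then have *: "exp (- x) * norm (z k - \<zeta> k) < exp (- x) * 2" by (intro mult_strict_left_mono) auto
  show "dist (contract k x z k) (\<zeta> k) < d"
  proof -
    have "exp (- x) * norm (z k - \<zeta> k) < d" using * e by linarith
    then show ?thesis by (simp add: contract_def dist_norm norm_mult)
  qed
qed simp

text \<open>Homogeneity in coordinate \<open>k\<close> alone. The last conjunct keeps the remaining
  dependence within tensors, which later places the coefficients in \<open>X\<close>.\<close>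

definition khom :: "'n \<Rightarrow> real \<Rightarrow> (('n \<Rightarrow> complex) \<Rightarrow> complex) \<Rightarrow> bool" where
  "khom k l \<Phi> \<longleftrightarrow> (\<exists>C. \<forall>z\<in>polydisc. norm (\<Phi> z) \<le> C) \<and>
     (\<forall>z\<in>polydisc. \<forall>x\<ge>0. \<Phi> (contract k x z) = cis (- l * x) * \<Phi> z) \<and> (\<lambda>z. \<Phi> (z(k := 0))) \<in> tensor \<Gamma>"

lemma khom_zero: "khom k l (\<lambda>z. 0)"
  using tensor_const[of \<Gamma> 0] const by (auto simp: khom_def)

lemma khom_add: "khom k l \<Phi> \<Longrightarrow> khom k l \<Psi> \<Longrightarrow> khom k l (\<lambda>z. \<Phi> z + \<Psi> z)"
proof -
  assume a: "khom k l \<Phi>" and b: "khom k l \<Psi>"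
  obtain C where "\<And>z. z \<in> polydisc \<Longrightarrow> norm (\<Phi> z) \<le> C" using a by (auto simp: khom_def)
  moreover obtain D where "\<And>z. z \<in> polydisc \<Longrightarrow> norm (\<Psi> z) \<le> D" using b by (auto simp: khom_def)
  ultimately have "z \<in> polydisc \<Longrightarrow> norm (\<Phi> z + \<Psi> z) \<le> C + D" for z by (intro norm_triangle_mono)
  then show ?thesis using a b by (auto simp: khom_def distrib_left intro: tensor.add)
qed

text \<open>Approximation near \<open>\<zeta> k\<close> in coordinate \<open>k\<close>, uniform in
  all the others. \<open>\<Phi>\<close> is defined at every frequency and vanishes outside
  \<open>\<Lambda>\<close>, so that it can be compared with a coefficient at any frequency.\<close>

definition khom_approx where
  "khom_approx k f e d \<Lambda> \<Phi> \<longleftrightarrow> d > 0 \<and> finite \<Lambda> \<and> (\<forall>l. khom k l (\<Phi> l)) \<and> (\<forall>l. l \<notin> \<Lambda> \<longrightarrow> \<Phi> l = (\<lambda>z. 0)) \<and>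
     (\<forall>z\<in>polydisc. dist (z k) (\<zeta> k) < d \<longrightarrow> norm (f z - (\<Sum>l\<in>\<Lambda>. \<Phi> l z)) \<le> e)"

lemma khom_approxD:
  assumes "khom_approx k f e d \<Lambda> \<Phi>"
  shows "d > 0" "finite \<Lambda>" "\<And>l. khom k l (\<Phi> l)" "\<And>l. l \<notin> \<Lambda> \<Longrightarrow> \<Phi> l = (\<lambda>z. 0)"
    "\<And>z. z \<in> polydisc \<Longrightarrow> dist (z k) (\<zeta> k) < d \<Longrightarrow> norm (f z - (\<Sum>l\<in>\<Lambda>. \<Phi> l z)) \<le> e"
  using assms unfolding khom_approx_def by blast+

text \<open>In each product only the factor in coordinate \<open>k\<close> is replaced by a sum of
  homogeneous functions; the other factors are bounded and do not notice the contraction.\<close>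

lemma tensor_khom:
  assumes k: "k \<in> B" and q: "q \<in> tensor \<Gamma>"
  shows "\<forall>e>0. \<exists>\<delta> \<Lambda> \<Phi>. khom_approx k q e \<delta> \<Lambda> \<Phi>"
  using q
proof induction
  case (prod g)
  show ?case
  proof (intro allI impI)
    fix e :: real assume e: "e > 0"
    obtain C where C: "\<And>j w. norm w < 1 \<Longrightarrow> norm (g j w) \<le> C j" using bounded[OF prod] by metis
    define M where "M = (\<Prod>j\<in>-{k}. \<bar>C j\<bar>) + 1"
    have M: "M > 0" by (simp add: M_def add_nonneg_pos prod_nonneg)
    have rest: "norm (\<Prod>j\<in>-{k}. g j (z j)) \<le> M" if z: "z \<in> polydisc" for z
    proof -
      have "norm (\<Prod>j\<in>-{k}. g j (z j)) = (\<Prod>j\<in>-{k}. norm (g j (z j)))" by (rule prod_norm[symmetric])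
      also have "\<dots> \<le> (\<Prod>j\<in>-{k}. \<bar>C j\<bar>)"
        using order_trans[OF C[OF polydisc_norm[OF z]] abs_ge_self] by (intro prod_mono) auto
      finally show ?thesis by (simp add: M_def)
    qed
    have "e / M > 0" using e M by simp
    then obtain \<delta> Q where \<delta>: "\<delta> > 0" and Q: "hom_sum (\<zeta> k) Q"
      and ap: "\<And>w. norm w < 1 \<Longrightarrow> dist w (\<zeta> k) < \<delta> \<Longrightarrow> norm (g k w - Q w) \<le> e / M"
      using hom[OF k prod] unfolding loc_hom_def by meson
    obtain \<Lambda> G where G: "finite \<Lambda>" "\<And>l. homogeneous (\<zeta> k) l (G l)" "\<And>w. norm w < 1 \<Longrightarrow> Q w = (\<Sum>l\<in>\<Lambda>. G l w)"
      using Q unfolding hom_sum_def by blast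
    define \<Phi> where "\<Phi> l = (if l \<in> \<Lambda> then (\<lambda>z. G l (z k) * (\<Prod>j\<in>-{k}. g j (z j))) else (\<lambda>z. 0))" for l
    have "khom k l (\<Phi> l)" for l
    proof (cases "l \<in> \<Lambda>")
      case True
      obtain D where D: "\<And>w. norm w < 1 \<Longrightarrow> norm (G l w) \<le> D" using G(2)[of l] by (auto simp: homogeneous_def)
      have "norm (G l (z k) * (\<Prod>j\<in>-{k}. g j (z j))) \<le> D * M" if z: "z \<in> polydisc" for z
        unfolding norm_mult using D[OF polydisc_norm[OF z]] rest[OF z] M
        by (intro mult_mono) (auto intro: order_trans[OF norm_ge_zero])
      moreover have "\<Phi> l (contract k x z) = cis (- l * x) * \<Phi> l z" if z: "z \<in> polydisc" and x: "x \<ge> 0" for z x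
      proof -
        have "G l (\<zeta> k + of_real (exp (- x)) * (z k - \<zeta> k)) = cis (l * (- x)) * G l (z k)"
          using G(2)[of l] polydisc_norm[OF z, of k] x unfolding homogeneous_def by auto
        moreover have "(\<Prod>j\<in>-{k}. g j (contract k x z j)) = (\<Prod>j\<in>-{k}. g j (z j))"
          by (intro prod.cong) (auto simp: contract_def)
        ultimately show ?thesis using True by (simp add: \<Phi>_def contract_def)
      qed
      moreover have "(\<lambda>z. \<Phi> l (z(k := 0))) \<in> tensor \<Gamma>"
      proof -
        have "(\<lambda>z. \<Prod>j\<in>UNIV. (if j = k then (\<lambda>_. G l 0) else g j) (z j)) \<in> tensor \<Gamma>"
          by (rule tensor.prod) (use prod const in auto)
        also have "(\<lambda>z. \<Prod>j\<in>UNIV. (if j = k then (\<lambda>_. G l 0) else g j) (z j)) = (\<lambda>z. \<Phi> l (z(k := 0)))"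
        proof
          fix z :: "'n \<Rightarrow> complex"
          have "(\<Prod>j\<in>UNIV. (if j = k then (\<lambda>_. G l 0) else g j) (z j))
             = G l 0 * (\<Prod>j\<in>UNIV-{k}. (if j = k then (\<lambda>_. G l 0) else g j) (z j))"
            by (subst prod.remove[of _ k]) auto
          also have "(\<Prod>j\<in>UNIV-{k}. (if j = k then (\<lambda>_. G l 0) else g j) (z j)) = (\<Prod>j\<in>-{k}. g j ((z(k := 0)) j))"
            by (intro prod.cong) auto
          finally show "(\<Prod>j\<in>UNIV. (if j = k then (\<lambda>_. G l 0) else g j) (z j)) = \<Phi> l (z(k := 0))"
            using True by (simp add: \<Phi>_def)
        qed
        finally show ?thesis .
      qed
      ultimately show ?thesis unfolding khom_def using True by (auto simp: \<Phi>_def)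
    qed (simp add: \<Phi>_def khom_zero)
    moreover have "norm ((\<Prod>j\<in>UNIV. g j (z j)) - (\<Sum>l\<in>\<Lambda>. \<Phi> l z)) \<le> e"
      if z: "z \<in> polydisc" and d: "dist (z k) (\<zeta> k) < \<delta>" for z
    proof -
      have "(\<Prod>j\<in>UNIV. g j (z j)) = g k (z k) * (\<Prod>j\<in>-{k}. g j (z j))"
        by (subst prod.remove[of _ k]) (auto simp: Compl_eq_Diff_UNIV)
      moreover have "(\<Sum>l\<in>\<Lambda>. \<Phi> l z) = Q (z k) * (\<Prod>j\<in>-{k}. g j (z j))"
        by (simp add: \<Phi>_def G(3)[OF polydisc_norm[OF z]] sum_distrib_right)
      ultimately have "(\<Prod>j\<in>UNIV. g j (z j)) - (\<Sum>l\<in>\<Lambda>. \<Phi> l z) = (g k (z k) - Q (z k)) * (\<Prod>j\<in>-{k}. g j (z j))"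
        by (simp only: left_diff_distrib)
      then have "norm ((\<Prod>j\<in>UNIV. g j (z j)) - (\<Sum>l\<in>\<Lambda>. \<Phi> l z)) = norm (g k (z k) - Q (z k)) * norm (\<Prod>j\<in>-{k}. g j (z j))"
        by (simp only: norm_mult)
      also have "\<dots> \<le> (e / M) * M"
        using ap[OF polydisc_norm[OF z] d] rest[OF z] e M by (intro mult_mono) auto
      finally show ?thesis using M by simp
    qed
    ultimately have "khom_approx k (\<lambda>z. \<Prod>j\<in>UNIV. g j (z j)) e \<delta> \<Lambda> \<Phi>"
      unfolding khom_approx_def using \<delta> G(1) by (auto simp: \<Phi>_def)
    then show "\<exists>\<delta> \<Lambda> \<Phi>. khom_approx k (\<lambda>z. \<Prod>j\<in>UNIV. g j (z j)) e \<delta> \<Lambda> \<Phi>" by blast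
  qed
next
  case (add p q)
  show ?case
  proof (intro allI impI)
    fix e :: real assume e: "e > 0"
    obtain \<delta> \<Lambda> \<Phi> where p: "khom_approx k p (e/2) \<delta> \<Lambda> \<Phi>" using add.IH(1) half_gt_zero[OF e] by blast
    obtain \<delta>' \<Lambda>' \<Psi> where q: "khom_approx k q (e/2) \<delta>' \<Lambda>' \<Psi>" using add.IH(2) half_gt_zero[OF e] by blast
    note 1 = khom_approxD[OF p] and 2 = khom_approxD[OF q]
    have "norm (p z + q z - (\<Sum>l\<in>\<Lambda>\<union>\<Lambda>'. \<Phi> l z + \<Psi> l z)) \<le> e"
      if z: "z \<in> polydisc" and d: "dist (z k) (\<zeta> k) < min \<delta> \<delta>'" for z
    proof -
      have "(\<Sum>l\<in>\<Lambda>\<union>\<Lambda>'. \<Phi> l z) = (\<Sum>l\<in>\<Lambda>. \<Phi> l z)"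
        using 1(2,4) 2(2) by (intro sum.mono_neutral_right) auto
      moreover have "(\<Sum>l\<in>\<Lambda>\<union>\<Lambda>'. \<Psi> l z) = (\<Sum>l\<in>\<Lambda>'. \<Psi> l z)"
        using 2(2,4) 1(2) by (intro sum.mono_neutral_right) auto
      ultimately show ?thesis
        using norm_diff_triangle_ineq[of "p z" "q z" "\<Sum>l\<in>\<Lambda>. \<Phi> l z" "\<Sum>l\<in>\<Lambda>'. \<Psi> l z"] 1(5)[OF z] 2(5)[OF z] d
        by (simp add: sum.distrib)
    qed
    then have "khom_approx k (\<lambda>z. p z + q z) e (min \<delta> \<delta>') (\<Lambda> \<union> \<Lambda>') (\<lambda>l z. \<Phi> l z + \<Psi> l z)"
      unfolding khom_approx_def using 1 2 by (auto intro: khom_add)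
    then show "\<exists>\<delta> \<Lambda> \<Phi>. khom_approx k (\<lambda>z. p z + q z) e \<delta> \<Lambda> \<Phi>" by blast
  qed
qed

end

context local_approximation
begin

lemma X_khom_approx:
  assumes f: "f \<in> X" and k: "k \<in> B" and e: "e > 0"
  shows "\<exists>d \<Lambda> \<Phi>. khom_approx k f e d \<Lambda> \<Phi>"
proof -
  obtain q where q: "q \<in> tensor \<Gamma>" "\<And>z. z \<in> polydisc \<Longrightarrow> norm (f z - q z) \<le> e/2"
    using f half_gt_zero[OF e] unfolding X_def by blast
  obtain d \<Lambda> \<Phi> where ka: "khom_approx k q (e/2) d \<Lambda> \<Phi>"
    using tensor_khom[OF k q(1)] half_gt_zero[OF e] by blast
  note 1 = khom_approxD[OF ka]
  have "norm (f z - (\<Sum>l\<in>\<Lambda>. \<Phi> l z)) \<le> e" if "z \<in> polydisc" "dist (z k) (\<zeta> k) < d" for z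
    using norm_triangle_ineq[of "f z - q z" "q z - (\<Sum>l\<in>\<Lambda>. \<Phi> l z)"] 1(5)[OF that] q(2)[OF that(1)] by simp
  then have "khom_approx k f e d \<Lambda> \<Phi>" using ka unfolding khom_approx_def by blast
  then show ?thesis by blast
qed

abbreviation mean where
  "mean N k \<mu> f z \<equiv> avg N (\<lambda>x. f (contract k x z) * cis (\<mu> * x))"

text \<open>Along the contraction \<open>\<Phi> l\<close> oscillates as
  \<open>cis (- l * x)\<close>, so averaging against \<open>cis (\<mu> * x)\<close> singles out
  \<open>l = \<mu>\<close>. One \<open>e\<close> pays for replacing \<open>f\<close>, the other for
  finitely many averages that are not yet at their limits; both are uniform in
  \<open>z\<close>.\<close>

lemma khom_avg:
  assumes k: "k \<in> B" and e: "e > 0" and ka: "khom_approx k f e d \<Lambda> \<Phi>"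
  shows "\<exists>N0>0. \<forall>N\<ge>N0. \<forall>z\<in>polydisc. norm (mean N k \<mu> f z - \<Phi> \<mu> z) \<le> 2 * e"
proof -
  note d = khom_approxD(1)[OF ka] and \<Lambda> = khom_approxD(2)[OF ka]
    and \<Phi> = khom_approxD(3,4)[OF ka] and ap = khom_approxD(5)[OF ka]
  obtain X0 where X0: "X0 \<ge> 0" "\<And>z x. z \<in> polydisc \<Longrightarrow> x \<ge> X0 \<Longrightarrow> dist (contract k x z k) (\<zeta> k) < d"
    using contract_near[OF k d] by blast
  obtain C where C: "\<And>l z. z \<in> polydisc \<Longrightarrow> norm (\<Phi> l z) \<le> C l"
    using \<Phi>(1) unfolding khom_def by metis
  have "(\<lambda>N. \<Sum>l\<in>\<Lambda>. \<bar>C l\<bar> * norm (avg N (\<lambda>x. cis ((\<mu> - l) * x)) - (if \<mu> - l = 0 then 1 else 0))) \<longlonglongrightarrow> (\<Sum>l\<in>\<Lambda>. \<bar>C l\<bar> * 0)"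
    by (intro tendsto_sum tendsto_mult tendsto_const tendsto_norm_zero LIM_zero avg_cis)
  then have "\<forall>\<^sub>F N in sequentially. (\<Sum>l\<in>\<Lambda>. \<bar>C l\<bar> * norm (avg N (\<lambda>x. cis ((\<mu> - l) * x)) - (if \<mu> - l = 0 then 1 else 0))) < e"
    using e by (intro order_tendstoD(2)) auto
  then obtain N1 where N1: "\<And>N. N \<ge> N1 \<Longrightarrow> (\<Sum>l\<in>\<Lambda>. \<bar>C l\<bar> * norm (avg N (\<lambda>x. cis ((\<mu> - l) * x)) - (if \<mu> - l = 0 then 1 else 0))) < e"
    unfolding eventually_sequentially by blast
  define N0 where "N0 = max N1 (nat \<lceil>X0\<rceil> + 1)"
  have "norm (mean N k \<mu> f z - \<Phi> \<mu> z) \<le> 2 * e" if N: "N \<ge> N0" and z: "z \<in> polydisc" for N z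
  proof -
    have N': "N > 0" "real N \<ge> X0" "N \<ge> N1" using N unfolding N0_def by (auto simp: le_nat_iff) linarith
    let ?S = "\<Sum>l\<in>\<Lambda>. \<Phi> l z * avg N (\<lambda>x. cis ((\<mu> - l) * x))"
    have "norm (mean N k \<mu> f z - ?S) \<le> e"
    proof -
      have "mean N k \<mu> f z - ?S
          = avg N (\<lambda>x. f (contract k x z) * cis (\<mu> * x) - (\<Sum>l\<in>\<Lambda>. \<Phi> l z * cis ((\<mu> - l) * x)))"
        by (simp only: avg_diff avg_sum avg_mult)
      also have "norm \<dots> \<le> e"
      proof (rule avg_bound[OF N'(1)])
        fix x assume x: "x \<ge> real N"
        have x0: "x \<ge> 0" "x \<ge> X0" using x N' by linarith+
        have "(\<Sum>l\<in>\<Lambda>. \<Phi> l z * cis ((\<mu> - l) * x)) = (\<Sum>l\<in>\<Lambda>. \<Phi> l (contract k x z)) * cis (\<mu> * x)"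
        proof -
          have "\<Phi> l (contract k x z) = cis (- l * x) * \<Phi> l z" for l
            using \<Phi>(1)[of l] z x0 unfolding khom_def by blast
          moreover have "cis ((\<mu> - l) * x) = cis (- l * x) * cis (\<mu> * x)" for l
            by (simp add: cis_mult algebra_simps)
          ultimately show ?thesis by (simp add: sum_distrib_left sum_distrib_right mult_ac)
        qed
        then have "f (contract k x z) * cis (\<mu> * x) - (\<Sum>l\<in>\<Lambda>. \<Phi> l z * cis ((\<mu> - l) * x))
           = (f (contract k x z) - (\<Sum>l\<in>\<Lambda>. \<Phi> l (contract k x z))) * cis (\<mu> * x)"
          by (simp only: left_diff_distrib)
        then have "norm (f (contract k x z) * cis (\<mu> * x) - (\<Sum>l\<in>\<Lambda>. \<Phi> l z * cis ((\<mu> - l) * x)))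
           = norm (f (contract k x z) - (\<Sum>l\<in>\<Lambda>. \<Phi> l (contract k x z)))" by (simp add: norm_mult)
        also have "\<dots> \<le> e" by (rule ap[OF contract_polydisc[OF k z x0(1)] X0(2)[OF z x0(2)]])
        finally show "norm (f (contract k x z) * cis (\<mu> * x) - (\<Sum>l\<in>\<Lambda>. \<Phi> l z * cis ((\<mu> - l) * x))) \<le> e" .
      qed
      finally show ?thesis .
    qed
    moreover have "norm (?S - \<Phi> \<mu> z) \<le> e"
    proof -
      have "\<Phi> \<mu> z = (\<Sum>l\<in>\<Lambda>. \<Phi> l z * (if \<mu> - l = 0 then 1 else 0))"
      proof (cases "\<mu> \<in> \<Lambda>")
        case True
        have "(\<Sum>l\<in>\<Lambda>. \<Phi> l z * (if \<mu> - l = 0 then 1 else 0)) = (\<Sum>l\<in>\<Lambda>. if l = \<mu> then \<Phi> l z else 0)"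
          by (intro sum.cong) auto
        then show ?thesis using True \<Lambda> by simp
      next
        case False
        have "(\<Sum>l\<in>\<Lambda>. \<Phi> l z * (if \<mu> - l = 0 then 1 else 0)) = 0"
          by (rule sum.neutral) (use False in auto)
        then show ?thesis unfolding \<Phi>(2)[OF False] by (simp only:)
      qed
      then have "?S - \<Phi> \<mu> z = (\<Sum>l\<in>\<Lambda>. \<Phi> l z * (avg N (\<lambda>x. cis ((\<mu> - l) * x)) - (if \<mu> - l = 0 then 1 else 0)))"
        by (simp only: sum_subtractf right_diff_distrib)
      also have "norm \<dots> \<le> (\<Sum>l\<in>\<Lambda>. \<bar>C l\<bar> * norm (avg N (\<lambda>x. cis ((\<mu> - l) * x)) - (if \<mu> - l = 0 then 1 else 0)))"
        using order_trans[OF C[OF z] abs_ge_self] by (intro sum_norm_le) (auto simp: norm_mult intro!: mult_right_mono)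
      also have "\<dots> \<le> e" using N1[OF N'(3)] by simp
      finally show ?thesis .
    qed
    ultimately show ?thesis
      using norm_triangle_ineq[of "mean N k \<mu> f z - ?S" "?S - \<Phi> \<mu> z"] by simp
  qed
  then show ?thesis by (intro exI[of _ N0]) (auto simp: N0_def)
qed

text \<open>The Bohr-Fourier coefficient of \<open>f\<close> at frequency \<open>\<mu>\<close> along
  the contraction of coordinate \<open>k\<close>.\<close>

definition coeff :: "'n \<Rightarrow> real \<Rightarrow> (('n \<Rightarrow> complex) \<Rightarrow> complex) \<Rightarrow> ('n \<Rightarrow> complex) \<Rightarrow> complex" where
  "coeff k \<mu> f z = lim (\<lambda>N. mean N k \<mu> f z)"

lemma avg_Cauchy:
  assumes f: "f \<in> X" and k: "k \<in> B" and e: "e > 0"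
  shows "\<exists>N0>0. \<forall>N\<ge>N0. \<forall>M\<ge>N0. \<forall>z\<in>polydisc. norm (mean N k \<mu> f z -
     mean M k \<mu> f z) \<le> e"
proof -
  have e4: "e / 4 > 0" using e by simp
  obtain d \<Lambda> \<Phi> where ka: "khom_approx k f (e/4) d \<Lambda> \<Phi>"
    using X_khom_approx[OF f k e4] by blast
  note * = khom_approxD[OF ka]
  obtain N0 where N0: "N0 > 0" "\<And>N z. N \<ge> N0 \<Longrightarrow> z \<in> polydisc \<Longrightarrow>
     norm (mean N k \<mu> f z - \<Phi> \<mu> z) \<le> 2 * (e/4)"
    using khom_avg[OF k e4 ka, of \<mu>] by blast
  have "norm (mean N k \<mu> f z - mean M k \<mu> f z) \<le> e"
    if "N \<ge> N0" "M \<ge> N0" "z \<in> polydisc" for N M z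
    using norm_triangle_ineq4[of "mean N k \<mu> f z - \<Phi> \<mu> z"
        "mean M k \<mu> f z - \<Phi> \<mu> z"] N0(2)[OF that(1,3)] N0(2)[OF that(2,3)] by simp
  then show ?thesis using N0(1) by blast
qed

lemma coeff_lim:
  assumes f: "f \<in> X" and k: "k \<in> B" and z: "z \<in> polydisc"
  shows "(\<lambda>N. mean N k \<mu> f z) \<longlonglongrightarrow> coeff k \<mu> f z"
proof -
  have "Cauchy (\<lambda>N. mean N k \<mu> f z)"
  proof (rule metric_CauchyI)
    fix e :: real assume "e > 0"
    then have "e / 2 > 0" by simp
    from avg_Cauchy[OF f k this, of \<mu>] obtain N0 where
      N0: "\<And>N M. N \<ge> N0 \<Longrightarrow> M \<ge> N0 \<Longrightarrow> norm (mean N k \<mu> f z -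
         mean M k \<mu> f z) \<le> e/2" using z by blast
    have "dist (mean N k \<mu> f z) (mean M k \<mu> f z) < e"
      if "N \<ge> N0" "M \<ge> N0" for N M
      using N0[OF that] \<open>e > 0\<close> unfolding dist_norm by linarith
    then show "\<exists>M. \<forall>m\<ge>M. \<forall>n\<ge>M. dist (mean m k \<mu> f z)
        (mean n k \<mu> f z) < e" by blast
  qed
  then show ?thesis unfolding coeff_def Cauchy_convergent_iff convergent_LIMSEQ_iff .
qed

lemma coeff_uniform:
  assumes f: "f \<in> X" and k: "k \<in> B" and e: "e > 0"
  shows "\<exists>N0>0. \<forall>N\<ge>N0. \<forall>z\<in>polydisc. norm (mean N k \<mu> f z - coeff k \<mu> f z) \<le> e"
proof -
  obtain N0 where N0: "N0 > 0" "\<And>N M z. N \<ge> N0 \<Longrightarrow> M \<ge> N0 \<Longrightarrow> z \<in> polydisc \<Longrightarrow>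
     norm (mean N k \<mu> f z - mean M k \<mu> f z) \<le> e"
    using avg_Cauchy[OF f k e, of \<mu>] by blast
  have "norm (mean N k \<mu> f z - coeff k \<mu> f z) \<le> e" if N: "N \<ge> N0" and z: "z \<in> polydisc" for N z
  proof (rule Lim_norm_ubound[OF trivial_limit_sequentially])
    show "(\<lambda>M. mean N k \<mu> f z - mean M k \<mu> f z)
       \<longlonglongrightarrow> mean N k \<mu> f z - coeff k \<mu> f z"
      by (intro tendsto_diff tendsto_const coeff_lim f k z)
    show "\<forall>\<^sub>F M in sequentially. norm (mean N k \<mu> f z - mean M k \<mu> f z) \<le> e"
      using eventually_ge_at_top[of N0] by eventually_elim (rule N0(2)[OF N _ z])
  qed
  then show ?thesis using N0(1) by blast
qed

lemma coeff_khom: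
  assumes f: "f \<in> X" and k: "k \<in> B" and e: "e > 0" and ka: "khom_approx k f e d \<Lambda> \<Phi>"
    and z: "z \<in> polydisc"
  shows "norm (coeff k \<mu> f z - \<Phi> \<mu> z) \<le> 2 * e"
proof (rule Lim_norm_ubound[OF trivial_limit_sequentially])
  obtain N0 where N0: "N0 > 0" "\<And>N z. N \<ge> N0 \<Longrightarrow> z \<in> polydisc \<Longrightarrow>
     norm (mean N k \<mu> f z - \<Phi> \<mu> z) \<le> 2 * e"
    using khom_avg[OF k e ka, of \<mu>] by blast
  show "(\<lambda>N. mean N k \<mu> f z - \<Phi> \<mu> z) \<longlonglongrightarrow> coeff k \<mu> f z - \<Phi> \<mu> z"
    by (intro tendsto_diff tendsto_const coeff_lim f k z)
  show "\<forall>\<^sub>F N in sequentially. norm (mean N k \<mu> f z - \<Phi> \<mu> z) \<le> 2 * e"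
    using eventually_ge_at_top[of N0] by eventually_elim (rule N0(2)[OF _ z])
qed

text \<open>For every \<open>e\<close> the coefficient is within a multiple of \<open>e\<close> of a
  function that obeys this law exactly, and the law is preserved by uniform limits.\<close>

lemma coeff_contract:
  assumes f: "f \<in> X" and k: "k \<in> B" and z: "z \<in> polydisc" and x: "x \<ge> 0"
  shows "coeff k \<mu> f (contract k x z) = cis (- \<mu> * x) * coeff k \<mu> f z"
proof -
  have "norm (coeff k \<mu> f (contract k x z) - cis (- \<mu> * x) * coeff k \<mu> f z) \<le> e" if e: "e > 0" for e
  proof -
    have e4: "e / 4 > 0" using e by simp
    obtain d \<Lambda> \<Phi> where ka: "khom_approx k f (e/4) d \<Lambda> \<Phi>"
      using X_khom_approx[OF f k e4] by blast
    note * = khom_approxD[OF ka]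
    note c = coeff_khom[OF f k e4 ka]
    have h: "\<Phi> \<mu> (contract k x z) = cis (- \<mu> * x) * \<Phi> \<mu> z"
      using *(3)[of \<mu>] z x unfolding khom_def by blast
    define u where "u = coeff k \<mu> f (contract k x z) - \<Phi> \<mu> (contract k x z)"
    define v where "v = coeff k \<mu> f z - \<Phi> \<mu> z"
    have "norm u \<le> 2 * (e/4)" unfolding u_def by (rule c[OF contract_polydisc[OF k z x]])
    moreover have "norm (cis (- \<mu> * x) * v) \<le> 2 * (e/4)"
      unfolding norm_mult norm_cis mult_1 v_def by (rule c[OF z])
    moreover have "coeff k \<mu> f (contract k x z) - cis (- \<mu> * x) * coeff k \<mu> f z = u - cis (- \<mu> * x) * v"
      unfolding u_def v_def h right_diff_distrib by simp
    ultimately show ?thesis using norm_triangle_ineq4[of u "cis (- \<mu> * x) * v"] by simp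
  qed
  then have "norm (coeff k \<mu> f (contract k x z) - cis (- \<mu> * x) * coeff k \<mu> f z) \<le> 0"
    by (rule field_le_epsilon[of _ 0, simplified])
  then show ?thesis by simp
qed

lemma X_holomorphic: "f \<in> X \<Longrightarrow> z \<in> polydisc \<Longrightarrow> (\<lambda>w. f (z(k := w))) holomorphic_on ball 0 1"
  by (simp add: X_def)

lemma contract_upd: "j \<noteq> k \<Longrightarrow> contract k x (z(j := w)) = (contract k x z)(j := w)"
  by (auto simp: contract_def)

text \<open>The means are finite sums of holomorphic functions and converge uniformly on the
  polydisc. Holomorphy thus comes from \<open>f\<close>, while the tensors provide only the
  convergence.\<close>

lemma coeff_holomorphic:
  assumes f: "f \<in> X" and k: "k \<in> B" and z: "z \<in> polydisc"
  shows "(\<lambda>w. coeff k \<mu> f (z(j := w))) holomorphic_on ball 0 1"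
proof (rule holomorphic_uniform_sequence[OF open_ball])
  have tm: "(\<lambda>w. f (contract k x (z(j := w)))) holomorphic_on ball 0 1" if x: "x \<ge> 0" for x
  proof (cases "j = k")
    case True
    have "(\<lambda>w. f (z(k := w))) \<circ> (\<lambda>w. \<zeta> k + of_real (exp (- x)) * (w - \<zeta> k)) holomorphic_on ball 0 1"
    proof (rule holomorphic_on_compose_gen[OF _ X_holomorphic[OF f z]])
      show "(\<lambda>w. \<zeta> k + of_real (exp (- x)) * (w - \<zeta> k)) holomorphic_on ball 0 1" by (intro holomorphic_intros)
      show "(\<lambda>w. \<zeta> k + of_real (exp (- x)) * (w - \<zeta> k)) ` ball 0 1 \<subseteq> ball 0 1"
        unfolding image_subset_iff mem_ball_0 using contract_norm[of k _ x] B_norm[OF k] x by simp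
    qed
    moreover have "contract k x (z(j := w)) = z(k := \<zeta> k + of_real (exp (- x)) * (w - \<zeta> k))" for w
      by (simp add: contract_def True)
    ultimately show ?thesis by (simp add: o_def)
  next
    case False
    show ?thesis unfolding contract_upd[OF False] by (rule X_holomorphic[OF f contract_polydisc[OF k z x]])
  qed
  show "(\<lambda>w. avg n (\<lambda>x. f (contract k x (z(j := w))) * cis (\<mu> * x))) holomorphic_on ball 0 1" for n
    unfolding avg_def divide_inverse by (intro holomorphic_intros tm) auto
  fix w :: complex assume w: "w \<in> ball 0 1"
  obtain d where d: "d > 0" "cball w d \<subseteq> ball 0 1" using open_contains_cball[THEN iffD1, OF open_ball] w by blast
  have "uniform_limit (cball w d) (\<lambda>n w. avg n (\<lambda>x. f (contract k x (z(j := w))) * cis (\<mu> * x)))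
     (\<lambda>w. coeff k \<mu> f (z(j := w))) sequentially"
  proof (rule uniform_limitI)
    fix e :: real assume "e > 0"
    then have "e / 2 > 0" by simp
    from coeff_uniform[OF f k this, of \<mu>] obtain N0 where N0: "\<And>N z. N \<ge> N0 \<Longrightarrow> z \<in> polydisc \<Longrightarrow>
      norm (mean N k \<mu> f z - coeff k \<mu> f z) \<le> e/2" by blast
    show "\<forall>\<^sub>F n in sequentially. \<forall>w\<in>cball w d. dist (avg n (\<lambda>x. f (contract k x (z(j := w))) * cis (\<mu> * x)))
         (coeff k \<mu> f (z(j := w))) < e"
      using eventually_ge_at_top[of N0]
    proof eventually_elim
      case (elim n)
      show ?case
      proof
        fix u assume "u \<in> cball w d"
        then have "z(j := u) \<in> polydisc" using d(2) z by (auto intro!: polydisc_upd)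
        from N0[OF elim this] show "dist (avg n (\<lambda>x. f (contract k x (z(j := u))) * cis (\<mu> * x)))
         (coeff k \<mu> f (z(j := u))) < e" using \<open>e > 0\<close> unfolding dist_norm by linarith
      qed
    qed
  qed
  then show "\<exists>d>0. cball w d \<subseteq> ball 0 1 \<and> uniform_limit (cball w d)
      (\<lambda>n w. avg n (\<lambda>x. f (contract k x (z(j := w))) * cis (\<mu> * x))) (\<lambda>w. coeff k \<mu> f (z(j := w))) sequentially"
    using d by blast
qed

text \<open>By homogeneity the identity holds on a radius, hence everywhere by the identity theorem.\<close>

lemma coeff_form:
  assumes f: "f \<in> X" and k: "k \<in> B" and z: "z \<in> polydisc"
  shows "coeff k \<mu> f z = log_power (\<zeta> k) \<mu> (z k) * coeff k \<mu> f (z(k := 0))"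
proof -
  note \<zeta>k = B_norm[OF k]
  define g where "g w = coeff k \<mu> f (z(k := w)) * log_power (\<zeta> k) (- \<mu>) w - coeff k \<mu> f (z(k := 0))" for w
  have gh: "g holomorphic_on ball 0 1"
    unfolding g_def by (intro holomorphic_intros coeff_holomorphic f k z log_power_holomorphic \<zeta>k)
  have inv: "log_power (\<zeta> k) \<mu> w * log_power (\<zeta> k) (- \<mu>) w = 1" for w
    using log_power_add[of "\<zeta> k" \<mu> "- \<mu>" w] by simp
  have zero: "g (\<zeta> k * of_real (1 - exp (- x))) = 0" if x: "x \<ge> 0" for x
  proof -
    let ?w = "\<zeta> k * of_real (1 - exp (- x))"
    have w: "?w = \<zeta> k + of_real (exp (- x)) * (0 - \<zeta> k)" by (simp add: algebra_simps)
    have z0: "z(k := 0) \<in> polydisc" using z by (intro polydisc_upd) auto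
    have "contract k x (z(k := 0)) = z(k := ?w)" unfolding w by (simp add: contract_def)
    then have "coeff k \<mu> f (z(k := ?w)) = cis (- \<mu> * x) * coeff k \<mu> f (z(k := 0))"
      using coeff_contract[OF f k z0 x, of \<mu>] by simp
    moreover have "log_power (\<zeta> k) (- \<mu>) ?w = cis ((- \<mu>) * (- x)) * log_power (\<zeta> k) (- \<mu>) 0"
      unfolding w by (rule log_power_contract[OF \<zeta>k]) simp
    ultimately show ?thesis by (simp add: g_def cis_mult)
  qed
  have "g (z k) = 0"
  proof (rule analytic_continuation[OF gh open_ball connected_ball])
    let ?U = "(\<lambda>x. \<zeta> k * of_real (1 - exp (- x))) ` {0<..}"
    show "?U \<subseteq> ball 0 1"
    proof (intro image_subsetI)
      fix x :: real assume "x \<in> {0<..}"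
      then have "\<bar>1 - exp (- x)\<bar> < 1" by simp
      then show "\<zeta> k * of_real (1 - exp (- x)) \<in> ball 0 1"
        by (simp only: mem_ball_0 norm_mult \<zeta>k norm_of_real mult_1)
    qed
    show "0 \<in> ball (0::complex) 1" by simp
    show "0 islimpt ?U"
      unfolding islimpt_sequential
    proof (intro exI[of _ "\<lambda>n. \<zeta> k * of_real (1 - exp (- (1 / (real n + 1))))"] conjI allI)
      fix n
      have "1 - exp (- (1 / (real n + 1))) > 0" by simp
      then have "\<zeta> k * of_real (1 - exp (- (1 / (real n + 1)))) \<noteq> 0"
        using \<zeta>k by (metis less_irrefl mult_eq_0_iff norm_zero of_real_eq_0_iff zero_neq_one)
      then show "\<zeta> k * of_real (1 - exp (- (1 / (real n + 1)))) \<in> ?U - {0}" by auto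
    next
      have "(\<lambda>n. 1 - exp (- (1 / (real n + 1)))) \<longlonglongrightarrow> 0" by real_asymp
      then have "(\<lambda>n. \<zeta> k * of_real (1 - exp (- (1 / (real n + 1))))) \<longlonglongrightarrow> \<zeta> k * of_real 0"
        by (intro tendsto_intros)
      then show "(\<lambda>n. \<zeta> k * of_real (1 - exp (- (1 / (real n + 1))))) \<longlonglongrightarrow> 0" by simp
    qed
    show "z k \<in> ball 0 1" using z by (simp add: polydisc_def)
  qed (use zero in auto)
  then have "log_power (\<zeta> k) \<mu> (z k) * coeff k \<mu> f (z(k := 0))
     = coeff k \<mu> f z * (log_power (\<zeta> k) \<mu> (z k) * log_power (\<zeta> k) (- \<mu>) (z k))"
    by (simp add: g_def mult_ac)
  then show ?thesis unfolding inv by simp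
qed

text \<open>Restricted to \<open>z k = 0\<close>, the functions \<open>\<Phi> \<mu>\<close> are
  tensors and approximate the coefficient; hence the coordinate step can be applied again to
  it.\<close>

lemma coeff_X:
  assumes f: "f \<in> X" and k: "k \<in> B"
  shows "(\<lambda>z. coeff k \<mu> f (z(k := 0))) \<in> X"
  unfolding X_def
proof (intro CollectI conjI ballI allI impI)
  fix z :: "'n \<Rightarrow> complex" and j assume z: "z \<in> polydisc"
  show "(\<lambda>w. coeff k \<mu> f ((z(j := w))(k := 0))) holomorphic_on ball 0 1"
  proof (cases "j = k")
    case False
    have "(\<lambda>w. coeff k \<mu> f ((z(k := 0))(j := w))) holomorphic_on ball 0 1"
      using z by (intro coeff_holomorphic f k polydisc_upd) auto
    then show ?thesis using False by (simp add: fun_upd_twist)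
  qed simp
next
  fix e :: real assume e: "e > 0"
  then have e2: "e / 2 > 0" by simp
  obtain d \<Lambda> \<Phi> where ka: "khom_approx k f (e/2) d \<Lambda> \<Phi>"
    using X_khom_approx[OF f k e2] by blast
  note * = khom_approxD[OF ka]
  show "\<exists>q\<in>tensor \<Gamma>. \<forall>z\<in>polydisc. norm (coeff k \<mu> f (z(k := 0)) - q z) \<le> e"
  proof (rule bexI[of _ "\<lambda>z. \<Phi> \<mu> (z(k := 0))"], rule ballI)
    show "(\<lambda>z. \<Phi> \<mu> (z(k := 0))) \<in> tensor \<Gamma>" using *(3)[of \<mu>] by (simp add: khom_def)
    fix z :: "'n \<Rightarrow> complex" assume "z \<in> polydisc"
    then have "z(k := 0) \<in> polydisc" by (intro polydisc_upd) auto
    from coeff_khom[OF f k e2 ka this, of \<mu>] show "norm (coeff k \<mu> f (z(k := 0)) - \<Phi> \<mu> (z(k := 0))) \<le> e" by simp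
  qed
qed

definition indep :: "'n \<Rightarrow> (('n \<Rightarrow> complex) \<Rightarrow> complex) \<Rightarrow> bool" where
  "indep j f \<longleftrightarrow> (\<forall>z\<in>polydisc. \<forall>w. norm w < 1 \<longrightarrow> f (z(j := w)) = f z)"

text \<open>Coordinates eliminated earlier stay eliminated when a further one is treated.\<close>

lemma coeff_indep:
  assumes f: "f \<in> X" and k: "k \<in> B" and j: "j = k \<or> indep j f"
  shows "indep j (\<lambda>z. coeff k \<mu> f (z(k := 0)))"
proof (cases "j = k")
  case False
  show ?thesis unfolding indep_def
  proof (intro ballI allI impI)
    fix z :: "'n \<Rightarrow> complex" and w :: complex assume z: "z \<in> polydisc" and w: "norm w < 1"
    let ?y = "z(k := 0)"
    have y: "?y \<in> polydisc" using z by (intro polydisc_upd) auto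
    have "avg N (\<lambda>x. f (contract k x (?y(j := w))) * cis (\<mu> * x)) = avg N (\<lambda>x. f (contract k x ?y) * cis (\<mu> * x))" for N
    proof -
      have "f (contract k x (?y(j := w))) = f (contract k x ?y)" if "x \<ge> 0" for x
        using contract_polydisc[OF k y that] w j False unfolding contract_upd[OF False] indep_def by blast
      then show ?thesis by (simp add: avg_def)
    qed
    then have "coeff k \<mu> f (?y(j := w)) = coeff k \<mu> f ?y" by (simp add: coeff_def)
    then show "coeff k \<mu> f ((z(j := w))(k := 0)) = coeff k \<mu> f (z(k := 0))"
      using False by (simp add: fun_upd_twist)
  qed
qed (simp add: indep_def)

text \<open>Averaging against the Fejer kernel of a Folner set: since the kernel is positive, the error of
  the local approximation is not amplified by the number of frequencies.\<close>

lemma coordinate_step: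
  assumes f: "f \<in> X" and k: "k \<in> B" and e: "e > 0"
  shows "\<exists>E d. finite E \<and> d > 0 \<and> (\<forall>z\<in>polydisc. dist (z k) (\<zeta> k) < d \<longrightarrow>
     norm (f z - (\<Sum>p\<in>E\<times>E. log_power (\<zeta> k) (fst p - snd p) (z k) * coeff k (fst p - snd p) f (z(k := 0)))
        / of_nat (card E)) \<le> e)"
proof -
  have e3: "e / 3 > 0" using e by simp
  obtain d \<Lambda> \<Phi> where ka: "khom_approx k f (e/3) d \<Lambda> \<Phi>"
    using X_khom_approx[OF f k e3] by blast
  note * = khom_approxD[OF ka]
  obtain C where C: "\<And>l z. z \<in> polydisc \<Longrightarrow> norm (\<Phi> l z) \<le> C l"
    using *(3) unfolding khom_def by metis
  define D where "D = (\<Sum>l\<in>\<Lambda>. \<bar>C l\<bar>) + 1"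
  have D: "D > 0" by (simp add: D_def add_nonneg_pos sum_nonneg)
  \<comment> \<open>The overlap defect of a frequency \<open>l\<close> is multiplied by the bound of
    \<open>\<Phi> l\<close>, and \<open>D\<close> exceeds the sum of these bounds; hence the
    accuracy \<open>e / 3 / D\<close>.\<close>
  obtain E where E: "finite E" "E \<noteq> {}"
    "\<And>l. l \<in> \<Lambda> \<Longrightarrow> real (card (E \<inter> (+) l ` E)) \<ge> (1 - e / 3 / D) * real (card E)"
    using Folner_set[OF *(2), of "e / 3 / D"] e D by auto
  have cE: "card E > 0" using E by (simp add: card_gt_0_iff)
  define \<kappa> where "\<kappa> l = (of_nat (card (E \<inter> (+) l ` E)) / of_nat (card E) :: complex)" for l
  have \<kappa>: "norm (1 - \<kappa> l) \<le> e / 3 / D" if l: "l \<in> \<Lambda>" for l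
  proof -
    have c: "card (E \<inter> (+) l ` E) \<le> card E" using E(1) by (intro card_mono) auto
    have "1 - \<kappa> l = complex_of_real (1 - real (card (E \<inter> (+) l ` E)) / real (card E))" by (simp add: \<kappa>_def)
    then have "norm (1 - \<kappa> l) = \<bar>1 - real (card (E \<inter> (+) l ` E)) / real (card E)\<bar>" by (simp only: norm_of_real)
    also have "\<dots> = 1 - real (card (E \<inter> (+) l ` E)) / real (card E)" using c cE by simp
    also have "\<dots> \<le> e / 3 / D" using E(3)[OF l] cE by (simp add: field_simps)
    finally show ?thesis .
  qed
  have kernel_mean: "(\<lambda>N. avg N (\<lambda>x. of_real (fejer (\<lambda>_. 1) E x) * cis (- l * x))) \<longlonglongrightarrow> \<kappa> l" for l
    using fejer_mean[of "\<lambda>_. 1" E l] E(1) by (simp add: \<kappa>_def)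
  obtain X0 where X0: "X0 \<ge> 0" "\<And>z x. z \<in> polydisc \<Longrightarrow> x \<ge> X0 \<Longrightarrow> dist (contract k x z k) (\<zeta> k) < d"
    using contract_near[OF k *(1)] by blast
  have "norm (f z - (\<Sum>p\<in>E\<times>E. log_power (\<zeta> k) (fst p - snd p) (z k) * coeff k (fst p - snd p) f (z(k := 0)))
        / of_nat (card E)) \<le> e" if z: "z \<in> polydisc" and d: "dist (z k) (\<zeta> k) < d" for z
  proof -
    let ?q = "(\<Sum>p\<in>E\<times>E. coeff k (fst p - snd p) f z) / of_nat (card E)"
    have q: "(\<Sum>p\<in>E\<times>E. log_power (\<zeta> k) (fst p - snd p) (z k) * coeff k (fst p - snd p) f (z(k := 0))) / of_nat (card E) = ?q"
      by (simp add: coeff_form[OF f k z, symmetric])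
    \<comment> \<open>The local error averaged along the contraction against the kernel. Its limit
      compares the Fejer sum of the coefficients with the \<open>\<Phi> l\<close> damped by
      \<open>\<kappa> l\<close>; as the kernel is nonnegative with mean 1, the limit has norm at
      most \<open>e / 3\<close>.\<close>
    define Y where "Y N = avg N (\<lambda>x. (f (contract k x z) - (\<Sum>l\<in>\<Lambda>. \<Phi> l z * cis (- l * x))) * of_real (fejer (\<lambda>_. 1) E x))" for N
    have Y1: "Y \<longlonglongrightarrow> ?q - (\<Sum>l\<in>\<Lambda>. \<Phi> l z * \<kappa> l)"
    proof -
      have "Y N = (\<Sum>p\<in>E\<times>E. avg N (\<lambda>x. f (contract k x z) * cis ((fst p - snd p) * x))) / of_nat (card E)
          - (\<Sum>l\<in>\<Lambda>. \<Phi> l z * avg N (\<lambda>x. of_real (fejer (\<lambda>_. 1) E x) * cis (- l * x)))" for N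
      proof -
        have "(f (contract k x z) - (\<Sum>l\<in>\<Lambda>. \<Phi> l z * cis (- l * x))) * of_real (fejer (\<lambda>_. 1) E x)
          = (1 / of_nat (card E)) * (\<Sum>p\<in>E\<times>E. f (contract k x z) * cis ((fst p - snd p) * x))
            - (\<Sum>l\<in>\<Lambda>. \<Phi> l z * (of_real (fejer (\<lambda>_. 1) E x) * cis (- l * x)))" for x
        proof -
          have "f (contract k x z) * of_real (fejer (\<lambda>_. 1) E x)
             = (1 / of_nat (card E)) * (\<Sum>p\<in>E\<times>E. f (contract k x z) * cis ((fst p - snd p) * x))"
            unfolding fejer_eq[of "\<lambda>_. 1", simplified] by (simp add: sum_distrib_left[symmetric])
          moreover have "(\<Sum>l\<in>\<Lambda>. \<Phi> l z * cis (- l * x)) * of_real (fejer (\<lambda>_. 1) E x)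
             = (\<Sum>l\<in>\<Lambda>. \<Phi> l z * (of_real (fejer (\<lambda>_. 1) E x) * cis (- l * x)))"
            unfolding sum_distrib_right by (intro sum.cong refl) (simp only: mult_ac)
          ultimately show ?thesis by (simp only: left_diff_distrib)
        qed
        then show ?thesis unfolding Y_def by (simp only: avg_diff avg_sum avg_mult) simp
      qed
      then have Yeq: "Y = (\<lambda>N. (\<Sum>p\<in>E\<times>E. avg N (\<lambda>x. f (contract k x z) * cis ((fst p - snd p) * x))) * inverse (of_nat (card E))
          - (\<Sum>l\<in>\<Lambda>. \<Phi> l z * avg N (\<lambda>x. of_real (fejer (\<lambda>_. 1) E x) * cis (- l * x))))" unfolding divide_inverse ..
      show ?thesis unfolding Yeq divide_inverse
        by (intro tendsto_diff tendsto_mult tendsto_sum tendsto_const coeff_lim f k z kernel_mean)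
    qed
    have K1: "(\<lambda>N. avg N (\<lambda>x. of_real (fejer (\<lambda>_. 1) E x))) \<longlonglongrightarrow> 1"
      using kernel_mean[of 0] cE by (simp add: \<kappa>_def)
    have "(\<lambda>N. e / 3 * Re (avg N (\<lambda>x. of_real (fejer (\<lambda>_. 1) E x)))) \<longlonglongrightarrow> e / 3 * Re 1"
      by (intro tendsto_intros K1)
    moreover have "(\<lambda>N. norm (Y N)) \<longlonglongrightarrow> norm (?q - (\<Sum>l\<in>\<Lambda>. \<Phi> l z * \<kappa> l))"
      by (rule tendsto_norm[OF Y1])
    moreover have "\<forall>\<^sub>F N in sequentially. norm (Y N) \<le> e / 3 * Re (avg N (\<lambda>x. of_real (fejer (\<lambda>_. 1) E x)))"
      using eventually_ge_at_top[of "nat \<lceil>X0\<rceil> + 1"]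
    proof eventually_elim
      case (elim N)
      have N: "N > 0" "real N \<ge> X0" using elim by (auto simp: le_nat_iff) linarith
      have "norm (Y N) \<le> Re (avg N (\<lambda>x. of_real (e / 3 * fejer (\<lambda>_. 1) E x)))"
        unfolding Y_def
      proof (rule avg_le[OF N(1)])
        fix x assume x: "x \<ge> real N"
        have x0: "x \<ge> 0" "x \<ge> X0" using x N by linarith+
        have "(\<Sum>l\<in>\<Lambda>. \<Phi> l z * cis (- l * x)) = (\<Sum>l\<in>\<Lambda>. \<Phi> l (contract k x z))"
        proof (intro sum.cong refl)
          fix l show "\<Phi> l z * cis (- l * x) = \<Phi> l (contract k x z)"
            using *(3)[of l] z x0 unfolding khom_def by (simp add: mult.commute)
        qed
        then have "norm (f (contract k x z) - (\<Sum>l\<in>\<Lambda>. \<Phi> l z * cis (- l * x))) \<le> e / 3"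
          using *(5)[OF contract_polydisc[OF k z x0(1)] X0(2)[OF z x0(2)]] by simp
        then show "norm ((f (contract k x z) - (\<Sum>l\<in>\<Lambda>. \<Phi> l z * cis (- l * x))) * of_real (fejer (\<lambda>_. 1) E x)) \<le> e / 3 * fejer (\<lambda>_. 1) E x"
          unfolding norm_mult norm_of_real abs_of_nonneg[OF fejer_nonneg] by (intro mult_right_mono fejer_nonneg)
      qed
      also have "\<dots> = e / 3 * Re (avg N (\<lambda>x. of_real (fejer (\<lambda>_. 1) E x)))"
        by (simp only: of_real_mult avg_mult) simp
      finally show ?case .
    qed
    ultimately have Y2: "norm (?q - (\<Sum>l\<in>\<Lambda>. \<Phi> l z * \<kappa> l)) \<le> e / 3"
      using tendsto_le[OF trivial_limit_sequentially] by fastforce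
    \<comment> \<open>Undoing the damping costs the second \<open>e / 3\<close>; the third is the
      local approximation of \<open>f\<close> at \<open>z\<close> itself.\<close>
    have "norm ((\<Sum>l\<in>\<Lambda>. \<Phi> l z) - (\<Sum>l\<in>\<Lambda>. \<Phi> l z * \<kappa> l)) \<le> e / 3"
    proof -
      have "(\<Sum>l\<in>\<Lambda>. \<Phi> l z) - (\<Sum>l\<in>\<Lambda>. \<Phi> l z * \<kappa> l) = (\<Sum>l\<in>\<Lambda>. \<Phi> l z * (1 - \<kappa> l))"
        by (simp add: sum_subtractf right_diff_distrib)
      also have "norm \<dots> \<le> (\<Sum>l\<in>\<Lambda>. \<bar>C l\<bar> * (e / 3 / D))"
        using order_trans[OF C[OF z] abs_ge_self] \<kappa> by (intro sum_norm_le) (simp only: norm_mult, intro mult_mono, auto)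
      also have "\<dots> = (\<Sum>l\<in>\<Lambda>. \<bar>C l\<bar>) * (e / 3 / D)" by (rule sum_distrib_right[symmetric])
      also have "(\<Sum>l\<in>\<Lambda>. \<bar>C l\<bar>) = D - 1" by (simp add: D_def)
      also have "(D - 1) * (e / 3 / D) \<le> D * (e / 3 / D)" using e D by (intro mult_right_mono) auto
      finally show ?thesis using D by simp
    qed
    then show ?thesis unfolding q using Y2 *(5)[OF z d]
      norm_triangle_ineq[of "f z - (\<Sum>l\<in>\<Lambda>. \<Phi> l z)" "(\<Sum>l\<in>\<Lambda>. \<Phi> l z) - ?q"]
      norm_triangle_ineq4[of "(\<Sum>l\<in>\<Lambda>. \<Phi> l z) - (\<Sum>l\<in>\<Lambda>. \<Phi> l z * \<kappa> l)" "?q - (\<Sum>l\<in>\<Lambda>. \<Phi> l z * \<kappa> l)"]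
      by simp
  qed
  then show ?thesis using E(1) *(1) by blast
qed

end

section \<open>Sums of products of powers near a point of the closed polydisc\<close>

inductive_set power_sums :: "('n::finite \<Rightarrow> complex) \<Rightarrow> 'n set \<Rightarrow> (('n \<Rightarrow> complex) \<Rightarrow> complex) set" for \<zeta> B where
  mono: "(\<And>k. k \<notin> B \<Longrightarrow> \<mu> k = 0) \<Longrightarrow> (\<lambda>z. c * (\<Prod>k\<in>UNIV. log_power (\<zeta> k) (\<mu> k) (z k))) \<in> power_sums \<zeta> B"
| add: "p \<in> power_sums \<zeta> B \<Longrightarrow> q \<in> power_sums \<zeta> B \<Longrightarrow> (\<lambda>z. p z + q z) \<in> power_sums \<zeta> B"

context local_approximation
begin

text \<open>The filter of neighbourhoods of \<open>\<zeta>\<close> within the polydisc;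
  \<open>\<zeta>\<close> itself may lie on the boundary.\<close>

definition near :: "('n \<Rightarrow> complex) filter" where
  "near = (INF d\<in>{0<..}. principal {z \<in> polydisc. \<forall>k. dist (z k) (\<zeta> k) < d})"

lemma eventually_near:
  "eventually P near \<longleftrightarrow> (\<exists>d>0. \<forall>z\<in>polydisc. (\<forall>k. dist (z k) (\<zeta> k) < d) \<longrightarrow> P z)"
proof -
  have "eventually P near \<longleftrightarrow> (\<exists>d\<in>{0<..}. eventually P (principal {z \<in> polydisc. \<forall>k. dist (z k) (\<zeta> k) < d}))"
    unfolding near_def
  proof (rule eventually_INF_base)
    fix a b :: real assume "a \<in> {0<..}" "b \<in> {0<..}"
    then show "\<exists>x\<in>{0<..}. principal {z \<in> polydisc. \<forall>k. dist (z k) (\<zeta> k) < x}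
      \<le> inf (principal {z \<in> polydisc. \<forall>k. dist (z k) (\<zeta> k) < a}) (principal {z \<in> polydisc. \<forall>k. dist (z k) (\<zeta> k) < b})"
      by (intro bexI[of _ "min a b"]) auto
  qed simp
  then show ?thesis by (simp only: eventually_principal Ball_def Bex_def mem_Collect_eq imp_conjL greaterThan_iff)
qed

lemma eventually_near_component:
  assumes "d > 0" "\<And>z. z \<in> polydisc \<Longrightarrow> dist (z k) (\<zeta> k) < d \<Longrightarrow> P z"
  shows "eventually P near"
  unfolding eventually_near using assms by blast

lemma near_polydisc: "\<forall>\<^sub>F z in near. z \<in> polydisc"
  unfolding eventually_near by (auto intro: exI[of _ 1])

lemma near_approx_add:
  fixes p q :: "('n \<Rightarrow> complex) \<Rightarrow> complex"
  assumes "\<forall>e>0. \<exists>r\<in>P. \<forall>\<^sub>F z in near. norm (p z - r z) \<le> e" "\<forall>e>0. \<exists>r\<in>P. \<forall>\<^sub>F z in near. norm (q z - r z) \<le> e"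
    and add: "\<And>p q. p \<in> P \<Longrightarrow> q \<in> P \<Longrightarrow> (\<lambda>z. p z + q z) \<in> P"
  shows "\<forall>e>0. \<exists>r\<in>P. \<forall>\<^sub>F z in near. norm (p z + q z - r z) \<le> e"
proof (intro allI impI)
  fix e :: real assume e: "e > 0"
  obtain p' where p: "p' \<in> P" "\<forall>\<^sub>F z in near. norm (p z - p' z) \<le> e/2" using assms(1) half_gt_zero[OF e] by blast
  obtain q' where q: "q' \<in> P" "\<forall>\<^sub>F z in near. norm (q z - q' z) \<le> e/2" using assms(2) half_gt_zero[OF e] by blast
  have "\<forall>\<^sub>F z in near. norm (p z + q z - (p' z + q' z)) \<le> e"
    using p(2) q(2)
  proof eventually_elim
    case (elim z)
    then show ?case using norm_diff_triangle_ineq[of "p z" "q z" "p' z" "q' z"] by simp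
  qed
  then show "\<exists>r\<in>P. \<forall>\<^sub>F z in near. norm (p z + q z - r z) \<le> e" by (rule bexI[OF _ add[OF p(1) q(1)]])
qed

lemma near_approx_trans:
  fixes p q r :: "('n \<Rightarrow> complex) \<Rightarrow> complex"
  assumes "\<forall>\<^sub>F z in near. norm (p z - q z) \<le> e/2" "\<forall>\<^sub>F z in near. norm (q z - r z) \<le> e/2"
  shows "\<forall>\<^sub>F z in near. norm (p z - r z) \<le> e"
  using assms
proof eventually_elim
  case (elim z)
  then show ?case using norm_triangle_ineq[of "p z - q z" "q z - r z"] by simp
qed

text \<open>The intermediate stage of the elimination: the coordinates in \<open>J\<close> enter
  through powers only, and the remaining factor \<open>h\<close> is independent of them and still in
  \<open>X\<close>.\<close>

inductive_set partial_sums :: "'n set \<Rightarrow> (('n \<Rightarrow> complex) \<Rightarrow> complex) set" for J where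
  mono: "(\<And>j. j \<notin> J \<Longrightarrow> \<mu> j = 0) \<Longrightarrow> h \<in> X \<Longrightarrow> (\<And>j. j \<in> J \<Longrightarrow> indep j h) \<Longrightarrow>
    (\<lambda>z. c * (\<Prod>j\<in>UNIV. log_power (\<zeta> j) (\<mu> j) (z j)) * h z) \<in> partial_sums J"
| add: "p \<in> partial_sums J \<Longrightarrow> q \<in> partial_sums J \<Longrightarrow> (\<lambda>z. p z + q z) \<in> partial_sums J"

lemma zero_X: "(\<lambda>z. 0) \<in> X"
  unfolding X_def using tensor_const[of \<Gamma> 0] const by (auto intro!: bexI[of _ "\<lambda>z. 0"])

lemma zero_partial_sums: "(\<lambda>z. 0) \<in> partial_sums J"
  using partial_sums.mono[of J "\<lambda>_. 0" "\<lambda>_. 0" 0] zero_X by (simp add: indep_def)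

lemma partial_sums_sum: "(\<And>i. i \<in> I \<Longrightarrow> p i \<in> partial_sums J) \<Longrightarrow> (\<lambda>z. \<Sum>i\<in>I. p i z) \<in> partial_sums J"
proof (induction I rule: infinite_finite_induct)
  case (insert x F)
  then show ?case using partial_sums.add[of "p x" J] by simp
qed (simp_all add: zero_partial_sums)

lemma log_power_prod_bound:
  assumes "\<And>j. j \<notin> B \<Longrightarrow> \<mu> j = 0" "z \<in> polydisc"
  shows "norm (\<Prod>j\<in>UNIV. log_power (\<zeta> j) (\<mu> j) (z j)) \<le> (\<Prod>j\<in>UNIV. exp (\<bar>\<mu> j\<bar> * (pi / 2)))"
proof -
  have "norm (log_power (\<zeta> j) (\<mu> j) (z j)) \<le> exp (\<bar>\<mu> j\<bar> * (pi / 2))" for j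
  proof (cases "j \<in> B")
    case True
    have "norm (z j) \<le> 1" "z j \<noteq> \<zeta> j" using polydisc_norm[OF assms(2), of j] B_norm[OF True] by auto
    then show ?thesis by (rule norm_log_power_le[OF B_norm[OF True]])
  qed (simp add: assms)
  then show ?thesis unfolding prod_norm[symmetric] by (intro prod_mono) auto
qed

text \<open>The powers are bounded on the polydisc, so multiplication by a fixed monomial magnifies
  errors by at most a constant.\<close>

lemma monomial_near:
  assumes \<mu>: "\<And>j. j \<notin> B \<Longrightarrow> \<mu> j = 0" and e: "e > 0"
  shows "\<exists>\<eta>>0. \<forall>h h'. (\<forall>\<^sub>F z in near. norm (h z - h' z) \<le> \<eta>) \<longrightarrow>
    (\<forall>\<^sub>F z in near. norm (c * (\<Prod>j\<in>UNIV. log_power (\<zeta> j) (\<mu> j) (z j)) * h z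
       - c * (\<Prod>j\<in>UNIV. log_power (\<zeta> j) (\<mu> j) (z j)) * h' z) \<le> e)"
proof -
  define M where "M = norm c * (\<Prod>j\<in>UNIV. exp (\<bar>\<mu> j\<bar> * (pi / 2))) + 1"
  have M: "M > 0" unfolding M_def by (intro add_nonneg_pos mult_nonneg_nonneg prod_nonneg) auto
  let ?u = "\<lambda>z. \<Prod>j\<in>UNIV. log_power (\<zeta> j) (\<mu> j) (z j)"
  have "\<forall>\<^sub>F z in near. norm (c * ?u z * h z - c * ?u z * h' z) \<le> e"
    if "\<forall>\<^sub>F z in near. norm (h z - h' z) \<le> e / M" for h h'
    using that near_polydisc
  proof eventually_elim
    case (elim z)
    have "norm (c * ?u z * h z - c * ?u z * h' z) = norm c * norm (?u z) * norm (h z - h' z)"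
      by (simp only: norm_mult flip: right_diff_distrib)
    also have "\<dots> \<le> norm c * (\<Prod>j\<in>UNIV. exp (\<bar>\<mu> j\<bar> * (pi / 2))) * (e / M)"
      using log_power_prod_bound[of \<mu>, OF \<mu> elim(2)] elim(1) by (intro mult_mono mult_left_mono mult_nonneg_nonneg prod_nonneg) auto
    also have "\<dots> \<le> M * (e / M)" using e M by (intro mult_right_mono) (auto simp: M_def)
    finally show ?case using M by simp
  qed
  then show ?thesis using e M by (intro exI[of _ "e / M"]) auto
qed

text \<open>The coordinate step is applied to the remaining factor \<open>h\<close>. The new power
  takes the slot \<open>\<mu> k\<close>, which is 0 so far, and a coefficient of \<open>h\<close>
  becomes the new remaining factor.\<close>

lemma partial_sums_step:
  assumes k: "k \<in> B" "k \<notin> J" and J: "J \<subseteq> B" and q: "q \<in> partial_sums J"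
  shows "\<forall>e>0. \<exists>q'\<in>partial_sums (insert k J). \<forall>\<^sub>F z in near. norm (q z - q' z) \<le> e"
  using q
proof induction
  case (mono \<mu> h c)
  show ?case
  proof (intro allI impI)
    fix e :: real assume e: "e > 0"
    have \<mu>B: "\<And>j. j \<notin> B \<Longrightarrow> \<mu> j = 0" using mono(1) J by blast
    let ?u = "\<lambda>z. \<Prod>j\<in>UNIV. log_power (\<zeta> j) (\<mu> j) (z j)"
    obtain \<eta> where \<eta>: "\<eta> > 0" "\<forall>h h'. (\<forall>\<^sub>F z in near. norm (h z - h' z) \<le> \<eta>) \<longrightarrow>
        (\<forall>\<^sub>F z in near. norm (c * ?u z * h z - c * ?u z * h' z) \<le> e)"
      using monomial_near[where c = c and \<mu> = \<mu>, OF \<mu>B e] by blast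
    from coordinate_step[OF mono(2) k(1) \<eta>(1)] obtain E d where E: "finite E" "d > 0"
      and ap: "\<And>z. z \<in> polydisc \<Longrightarrow> dist (z k) (\<zeta> k) < d \<Longrightarrow>
        norm (h z - (\<Sum>p\<in>E\<times>E. log_power (\<zeta> k) (fst p - snd p) (z k) * coeff k (fst p - snd p) h (z(k := 0))) / of_nat (card E)) \<le> \<eta>"
      by blast
    let ?h = "\<lambda>z. (\<Sum>p\<in>E\<times>E. log_power (\<zeta> k) (fst p - snd p) (z k) * coeff k (fst p - snd p) h (z(k := 0))) / of_nat (card E)"
    have "(\<lambda>z. c * ?u z * ?h z) \<in> partial_sums (insert k J)"
    proof -
      have "(\<lambda>z. \<Sum>p\<in>E\<times>E. (c / of_nat (card E)) * (\<Prod>j\<in>UNIV. log_power (\<zeta> j) ((\<mu>(k := fst p - snd p)) j) (z j))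
           * coeff k (fst p - snd p) h (z(k := 0))) \<in> partial_sums (insert k J)"
      proof (rule partial_sums_sum)
        fix p
        show "(\<lambda>z. (c / of_nat (card E)) * (\<Prod>j\<in>UNIV. log_power (\<zeta> j) ((\<mu>(k := fst p - snd p)) j) (z j))
           * coeff k (fst p - snd p) h (z(k := 0))) \<in> partial_sums (insert k J)"
        proof (rule partial_sums.mono)
          show "(\<mu>(k := fst p - snd p)) j = 0" if "j \<notin> insert k J" for j using that mono(1) by auto
          show "(\<lambda>z. coeff k (fst p - snd p) h (z(k := 0))) \<in> X" by (rule coeff_X[OF mono(2) k(1)])
          show "indep j (\<lambda>z. coeff k (fst p - snd p) h (z(k := 0)))" if "j \<in> insert k J" for j
            by (rule coeff_indep[OF mono(2) k(1)]) (use that mono(3) in auto)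
        qed
      qed
      also have "(\<lambda>z. \<Sum>p\<in>E\<times>E. (c / of_nat (card E)) * (\<Prod>j\<in>UNIV. log_power (\<zeta> j) ((\<mu>(k := fst p - snd p)) j) (z j))
           * coeff k (fst p - snd p) h (z(k := 0))) = (\<lambda>z. c * ?u z * ?h z)"
      proof
        fix z
        have "(\<Prod>j\<in>UNIV. log_power (\<zeta> j) ((\<mu>(k := l)) j) (z j)) = ?u z * log_power (\<zeta> k) l (z k)" for l
        proof -
          have "(\<Prod>j\<in>UNIV. log_power (\<zeta> j) ((\<mu>(k := l)) j) (z j))
             = log_power (\<zeta> k) l (z k) * (\<Prod>j\<in>UNIV-{k}. log_power (\<zeta> j) ((\<mu>(k := l)) j) (z j))"
            by (subst prod.remove[of _ k]) auto
          also have "(\<Prod>j\<in>UNIV-{k}. log_power (\<zeta> j) ((\<mu>(k := l)) j) (z j)) = (\<Prod>j\<in>UNIV-{k}. log_power (\<zeta> j) (\<mu> j) (z j))"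
            by (intro prod.cong) auto
          also have "\<dots> = ?u z" using mono(1)[OF k(2)] by (subst (2) prod.remove[of _ k]) auto
          finally show ?thesis by (simp add: mult.commute)
        qed
        then show "(\<Sum>p\<in>E\<times>E. (c / of_nat (card E)) * (\<Prod>j\<in>UNIV. log_power (\<zeta> j) ((\<mu>(k := fst p - snd p)) j) (z j))
           * coeff k (fst p - snd p) h (z(k := 0))) = c * ?u z * ?h z"
          by (simp only: sum_divide_distrib sum_distrib_left) (simp add: mult_ac)
      qed
      finally show ?thesis .
    qed
    moreover have "\<forall>\<^sub>F z in near. norm (c * ?u z * h z - c * ?u z * ?h z) \<le> e"
      by (rule \<eta>(2)[rule_format]) (rule eventually_near_component[OF E(2) ap])
    ultimately show "\<exists>q'\<in>partial_sums (insert k J). \<forall>\<^sub>F z in near. norm (c * ?u z * h z - q' z) \<le> e"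
      by (intro bexI[of _ "\<lambda>z. c * ?u z * ?h z"])
  qed
next
  case (add p q)
  show ?case by (rule near_approx_add[OF add.IH partial_sums.add])
qed

lemma X_partial_sums:
  assumes f: "f \<in> X" and J: "J \<subseteq> B"
  shows "\<forall>e>0. \<exists>q\<in>partial_sums J. \<forall>\<^sub>F z in near. norm (f z - q z) \<le> e"
proof -
  have "finite J" by simp
  then show ?thesis using J
  proof (induction J rule: finite_induct)
    case empty
    have "(\<lambda>z. 1 * (\<Prod>j\<in>UNIV. log_power (\<zeta> j) ((\<lambda>_. 0) j) (z j)) * f z) \<in> partial_sums {}"
      by (rule partial_sums.mono) (use f in auto)
    then have "f \<in> partial_sums {}" by simp
    then show ?case by (auto intro!: bexI[of _ f])
  next
    case (insert k J)
    have k: "k \<in> B" "J \<subseteq> B" using insert.prems by auto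
    show ?case
    proof (intro allI impI)
      fix e :: real assume e: "e > 0"
      obtain q where q: "q \<in> partial_sums J" "\<forall>\<^sub>F z in near. norm (f z - q z) \<le> e/2"
        using insert.IH[OF k(2)] half_gt_zero[OF e] by blast
      obtain q' where q': "q' \<in> partial_sums (insert k J)" "\<forall>\<^sub>F z in near. norm (q z - q' z) \<le> e/2"
        using partial_sums_step[OF k(1) insert.hyps(2) k(2) q(1)] half_gt_zero[OF e] by blast
      show "\<exists>q\<in>partial_sums (insert k J). \<forall>\<^sub>F z in near. norm (f z - q z) \<le> e"
        using near_approx_trans[OF q(2) q'(2)] q'(1) by blast
    qed
  qed
qed

text \<open>Once the coordinates in \<open>B\<close> are frozen, each factor depends on a coordinate
  in which the family has limits at \<open>\<zeta>\<close>, or is constant.\<close>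

lemma tensor_near:
  assumes q: "q \<in> tensor \<Gamma>"
  shows "\<exists>c. ((\<lambda>z. q (\<lambda>j. if j \<in> B then 0 else z j)) \<longlongrightarrow> c) near"
  using q
proof induction
  case (prod g)
  have "\<exists>c. ((\<lambda>z. g j (if j \<in> B then 0 else z j)) \<longlongrightarrow> c) near" for j
  proof (cases "j \<in> B")
    case False
    obtain c where c: "\<forall>\<epsilon>>0. \<exists>\<delta>>0. \<forall>w. norm w < 1 \<longrightarrow> dist w (\<zeta> j) < \<delta> \<longrightarrow> norm (g j w - c) \<le> \<epsilon>"
      using const_limit[OF False prod] unfolding loc_const_def by blast
    have "((\<lambda>z. g j (z j)) \<longlongrightarrow> c) near"
    proof (rule tendstoI)
      fix e :: real assume e: "e > 0"
      obtain \<delta> where \<delta>: "\<delta> > 0" "\<forall>w. norm w < 1 \<longrightarrow> dist w (\<zeta> j) < \<delta> \<longrightarrow> norm (g j w - c) \<le> e / 2"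
        using c half_gt_zero[OF e] by blast
      show "\<forall>\<^sub>F z in near. dist (g j (z j)) c < e"
      proof (rule eventually_near_component[OF \<delta>(1)])
        fix z assume "z \<in> polydisc" "dist (z j) (\<zeta> j) < \<delta>"
        then have "norm (g j (z j) - c) \<le> e / 2" using \<delta>(2) polydisc_norm by blast
        then show "dist (g j (z j)) c < e" using e unfolding dist_norm by linarith
      qed
    qed
    then show ?thesis using False by auto
  qed auto
  then obtain c where "\<And>j. ((\<lambda>z. g j (if j \<in> B then 0 else z j)) \<longlongrightarrow> c j) near" by metis
  then show ?case by (intro exI[of _ "\<Prod>j\<in>UNIV. c j"] tendsto_prod)
next
  case (add p q)
  obtain c where c: "((\<lambda>z. p (\<lambda>j. if j \<in> B then 0 else z j)) \<longlongrightarrow> c) near" using add.IH(1) by blast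
  obtain d where d: "((\<lambda>z. q (\<lambda>j. if j \<in> B then 0 else z j)) \<longlongrightarrow> d) near" using add.IH(2) by blast
  show ?case by (rule exI[where x = "c + d"]) (rule tendsto_add[OF c d])
qed

lemma indep_many:
  assumes h: "\<And>j. j \<in> J \<Longrightarrow> indep j h" and z: "z \<in> polydisc"
  shows "h (\<lambda>j. if j \<in> J then 0 else z j) = h z"
proof -
  have "finite J" by simp
  then show ?thesis using h
  proof (induction J rule: finite_induct)
    case (insert i J)
    let ?y = "\<lambda>j. if j \<in> J then 0 else z j"
    have y: "?y \<in> polydisc" using z by (auto simp: polydisc_def)
    have "(\<lambda>j. if j \<in> insert i J then 0 else z j) = ?y(i := 0)" by auto
    then have "h (\<lambda>j. if j \<in> insert i J then 0 else z j) = h ?y"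
      using insert.prems[of i] y unfolding indep_def by simp
    then show ?case using insert by simp
  qed simp
qed

text \<open>The remaining factor now depends on coordinates outside \<open>B\<close> only.
  Evaluating it and an approximating tensor with zeros in the coordinates of \<open>B\<close> shows
  that it is nearly constant close to \<open>\<zeta>\<close>.\<close>

lemma partial_sums_power_sums:
  assumes q: "q \<in> partial_sums B"
  shows "\<forall>e>0. \<exists>p\<in>power_sums \<zeta> B. \<forall>\<^sub>F z in near. norm (q z - p z) \<le> e"
  using q
proof induction
  case (mono \<mu> h c)
  show ?case
  proof (intro allI impI)
    fix e :: real assume e: "e > 0"
    let ?u = "\<lambda>z. \<Prod>j\<in>UNIV. log_power (\<zeta> j) (\<mu> j) (z j)"
    obtain \<eta> where \<eta>: "\<eta> > 0" "\<forall>h h'. (\<forall>\<^sub>F z in near. norm (h z - h' z) \<le> \<eta>) \<longrightarrow>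
        (\<forall>\<^sub>F z in near. norm (c * ?u z * h z - c * ?u z * h' z) \<le> e)"
      using monomial_near[where c = c and \<mu> = \<mu>, OF mono(1) e] by blast
    obtain q where q: "q \<in> tensor \<Gamma>" "\<And>z. z \<in> polydisc \<Longrightarrow> norm (h z - q z) \<le> \<eta>/2"
      using mono(2) half_gt_zero[OF \<eta>(1)] unfolding X_def by blast
    obtain d where d: "((\<lambda>z. q (\<lambda>j. if j \<in> B then 0 else z j)) \<longlongrightarrow> d) near" using tensor_near[OF q(1)] by blast
    have "\<forall>\<^sub>F z in near. norm (h z - d) \<le> \<eta>"
      using tendstoD[OF d half_gt_zero[OF \<eta>(1)]] near_polydisc
    proof eventually_elim
      case (elim z)
      let ?y = "\<lambda>j. if j \<in> B then 0 else z j"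
      have y: "?y \<in> polydisc" using elim(2) by (auto simp: polydisc_def)
      show ?case
        using norm_triangle_ineq[of "h ?y - q ?y" "q ?y - d"] q(2)[OF y] elim(1)
          indep_many[of B h, OF mono(3) elim(2)] by (simp add: dist_norm)
    qed
    then have "\<forall>\<^sub>F z in near. norm (c * ?u z * h z - c * ?u z * d) \<le> e" by (rule \<eta>(2)[rule_format])
    moreover have "c * ?u z * d = (c * d) * ?u z" for z by (simp only: mult_ac)
    moreover have "(\<lambda>z. (c * d) * ?u z) \<in> power_sums \<zeta> B" by (rule power_sums.mono) (rule mono(1))
    ultimately show "\<exists>p\<in>power_sums \<zeta> B. \<forall>\<^sub>F z in near. norm (c * ?u z * h z - p z) \<le> e"
      by (intro bexI[of _ "\<lambda>z. (c * d) * ?u z"]) simp_all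
  qed
next
  case (add p q)
  show ?case by (rule near_approx_add[OF add.IH power_sums.add])
qed

theorem X_power_sums:
  assumes f: "f \<in> X" and e: "e > 0"
  shows "\<exists>p\<in>power_sums \<zeta> B. \<forall>\<^sub>F z in near. norm (f z - p z) \<le> e"
proof -
  obtain q where q: "q \<in> partial_sums B" "\<forall>\<^sub>F z in near. norm (f z - q z) \<le> e/2"
    using X_partial_sums[OF f order_refl] half_gt_zero[OF e] by blast
  obtain p where p: "p \<in> power_sums \<zeta> B" "\<forall>\<^sub>F z in near. norm (q z - p z) \<le> e/2"
    using partial_sums_power_sums[OF q(1)] half_gt_zero[OF e] by blast
  show ?thesis using near_approx_trans[OF q(2) p(2)] p(1) by blast
qed

end

text \<open>The singular coordinates are those with \<open>\<zeta> k\<close> in \<open>S k\<close>.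
  At the others a harmonic extension has a limit, either because \<open>\<zeta> k\<close> is
  interior or because the boundary function is continuous near \<open>\<zeta> k\<close>, the set
  \<open>S k\<close> being closed.\<close>

theorem Hinf_SAPn_local_power_sums:
  fixes S :: "'n::finite \<Rightarrow> complex set" and \<zeta> :: "'n \<Rightarrow> complex"
  assumes S: "\<And>k. closed (S k)" "\<And>k. S k \<subseteq> sphere 0 1" and f: "f \<in> Hinf_SAPn S"
    and \<zeta>: "\<And>k. norm (\<zeta> k) \<le> 1" and e: "\<epsilon> > 0"
  shows "\<exists>\<delta>>0. \<exists>p\<in>power_sums \<zeta> {k. \<zeta> k \<in> S k}. \<forall>z\<in>polydisc. (\<forall>k. dist (z k) (\<zeta> k) < \<delta>) \<longrightarrow>
     norm (f z - p z) \<le> \<epsilon>"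
proof -
  \<comment> \<open>Constants are adjoined because the harmonic extension of a constant agrees with
    it on the disc only, while the locale asks for the constant function everywhere.\<close>
  interpret local_approximation \<zeta> "{k. \<zeta> k \<in> S k}" "\<lambda>k. harm_ext ` SAP (S k) \<union> range (\<lambda>c _. c)"
  proof
    fix k g
    show "norm (\<zeta> k) = 1" if "k \<in> {k. \<zeta> k \<in> S k}" using that S(2)[of k] by auto
    show "(\<lambda>_. c) \<in> harm_ext ` SAP (S k) \<union> range (\<lambda>c _. c)" for c by blast
    assume g: "g \<in> harm_ext ` SAP (S k) \<union> range (\<lambda>c _. c)"
    then show "\<exists>C. \<forall>w. norm w < 1 \<longrightarrow> norm (g w) \<le> C" using harm_ext_bounded by blast
    show "loc_hom (\<zeta> k) g" if "k \<in> {k. \<zeta> k \<in> S k}"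
      using g
    proof
      assume "g \<in> harm_ext ` SAP (S k)"
      then show ?thesis using harm_ext_loc_hom that S(2) by fastforce
    next
      assume "g \<in> range (\<lambda>c _. c)"
      then obtain c where g: "g = (\<lambda>_. c)" by blast
      have "homogeneous (\<zeta> k) 0 g" by (auto simp: homogeneous_def g)
      then have "hom_sum (\<zeta> k) g" by (rule hom_sum_single) simp
      then show ?thesis unfolding loc_hom_def by (auto intro!: exI[of _ "1::real"] exI[of _ g])
    qed
    show "loc_const (\<zeta> k) g" if "k \<notin> {k. \<zeta> k \<in> S k}"
      using g
    proof
      assume "g \<in> harm_ext ` SAP (S k)"
      then obtain g' where g': "g = harm_ext g'" "g' \<in> SAP (S k)" by blast
      show ?thesis
      proof (cases "norm (\<zeta> k) = 1")
        case True
        then show ?thesis unfolding g' using that S(1) by (intro harm_ext_loc_const_boundary[OF g'(2)]) auto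
      next
        case False
        then show ?thesis unfolding g' using \<zeta>[of k] by (intro harm_ext_loc_const_interior[OF g'(2)]) simp
      qed
    next
      assume "g \<in> range (\<lambda>c _. c)"
      then obtain c where g: "g = (\<lambda>_. c)" by blast
      show ?thesis unfolding loc_const_def g
        by (rule exI[of _ c]) (auto intro: exI[of _ "1::real"])
    qed
  qed
  have "f \<in> X" unfolding X_def
  proof (intro CollectI conjI ballI allI impI)
    fix z :: "'n \<Rightarrow> complex" and k assume "z \<in> polydisc"
    then show "(\<lambda>w. f (z(k := w))) holomorphic_on ball 0 1"
      using f by (simp add: Hinf_SAPn_def Hinf_n_def)
  next
    fix \<epsilon> :: real assume "\<epsilon> > 0"
    from Hinf_SAPn_harmonic_approx[OF f this] obtain q where
      q: "q \<in> tensor (\<lambda>k. harm_ext ` SAP (S k))" "\<forall>z\<in>polydisc. norm (f z - q z) \<le> \<epsilon>" by blast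
    have qt: "q \<in> tensor (\<lambda>k. harm_ext ` SAP (S k) \<union> range (\<lambda>c _. c))" by (rule tensor_mono[OF q(1)]) blast
    show "\<exists>q\<in>tensor (\<lambda>k. harm_ext ` SAP (S k) \<union> range (\<lambda>c _. c)). \<forall>z\<in>polydisc. norm (f z - q z) \<le> \<epsilon>"
      by (rule bexI[where x = q]) (rule q(2), rule qt)
  qed
  from X_power_sums[OF this e] show ?thesis unfolding eventually_near by blast
qed

section \<open>The algebras of bounded holomorphic functions\<close>

lemma radial_eventually: "\<forall>\<^sub>F r in at_left (1::real). 0 < r \<and> r < 1"
  unfolding eventually_at_left_field by (intro exI[of _ 0]) auto

abbreviation radial_limit :: "(complex \<Rightarrow> complex) \<Rightarrow> (complex \<Rightarrow> complex) \<Rightarrow> bool" where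
  "radial_limit f F \<equiv> AE z in circle. ((\<lambda>r. f (complex_of_real r * z)) \<longlongrightarrow> F z) (at_left 1)"

abbreviation radial_limit_n :: "(('n::finite \<Rightarrow> complex) \<Rightarrow> complex) \<Rightarrow> (('n \<Rightarrow> complex) \<Rightarrow> complex) \<Rightarrow> bool" where
  "radial_limit_n f F \<equiv> AE z in torus. ((\<lambda>r. f (\<lambda>k. complex_of_real r * z k)) \<longlongrightarrow> F z) (at_left 1)"

lemma Hinf_SAP_I:
  assumes f: "f holomorphic_on ball 0 1" "\<And>z. norm z < 1 \<Longrightarrow> norm (f z) \<le> C" and F: "F \<in> SAP S0"
    and lim: "radial_limit f F"
  shows "(\<lambda>z. if norm z < 1 then f z else 0) \<in> Hinf_SAP S0"
proof -
  have "(\<lambda>z. if norm z < 1 then f z else 0) holomorphic_on ball 0 1"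
    by (rule holomorphic_transform[OF f(1)]) auto
  moreover have "bounded ((\<lambda>z. if norm z < 1 then f z else 0) ` ball 0 1)"
    unfolding bounded_iff using f(2) by (intro exI[of _ C]) auto
  moreover have "AE z in circle. ((\<lambda>r. if norm (complex_of_real r * z) < 1 then f (complex_of_real r * z) else 0) \<longlongrightarrow> F z) (at_left 1)"
    using lim AE_space
  proof eventually_elim
    case (elim z)
    have "\<forall>\<^sub>F r in at_left 1. f (complex_of_real r * z) = (if norm (complex_of_real r * z) < 1 then f (complex_of_real r * z) else 0)"
      using radial_eventually by eventually_elim (use elim in \<open>auto simp: space_circle norm_mult\<close>)
    from tendsto_cong[OF this, of "F z"] elim show ?case by simp
  qed
  ultimately show ?thesis unfolding Hinf_SAP_def Hinf_def using F by (intro CollectI conjI bexI[of _ F]) auto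
qed

lemma Hinf_SAP_D:
  assumes "f \<in> Hinf_SAP S0"
  shows "\<exists>F C. f holomorphic_on ball 0 1 \<and> (\<forall>z. norm z < 1 \<longrightarrow> norm (f z) \<le> C) \<and> (\<forall>z. norm z \<ge> 1 \<longrightarrow> f z = 0) \<and>
    F \<in> SAP S0 \<and> radial_limit f F"
proof -
  have H: "f \<in> Hinf" using assms by (simp add: Hinf_SAP_def)
  then obtain C where "\<forall>x\<in>f ` ball 0 1. norm x \<le> C" unfolding Hinf_def bounded_iff by blast
  then have C: "\<forall>z. norm z < 1 \<longrightarrow> norm (f z) \<le> C" by auto
  obtain F where F: "F \<in> SAP S0" "radial_limit f F"
    using assms by (auto simp: Hinf_SAP_def)
  have "f holomorphic_on ball 0 1" "\<forall>z. norm z \<ge> 1 \<longrightarrow> f z = 0" using H by (auto simp: Hinf_def)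
  then show ?thesis using C F by blast
qed

lemma Hinf_SAP_continuous:
  assumes f: "f holomorphic_on ball 0 1" and c: "continuous_on (cball 0 1) f"
  shows "(\<lambda>z. if norm z < 1 then f z else 0) \<in> Hinf_SAP S0"
proof -
  have "bounded (f ` cball 0 1)" using c by (intro compact_imp_bounded compact_continuous_image) auto
  then obtain C where "\<forall>x\<in>f ` cball 0 1. norm x \<le> C" unfolding bounded_iff by blast
  then have C: "\<And>z. norm z < 1 \<Longrightarrow> norm (f z) \<le> C" by auto
  show ?thesis
  proof (rule Hinf_SAP_I[OF f C])
    show "f \<in> SAP S0" by (rule SAP_continuous) (rule continuous_on_subset[OF c], auto)
    show "radial_limit f f"
      using circle_singleton_null[of 1] AE_space
    proof eventually_elim
      case (elim z)
      show ?case
        by (rule radial_limit_continuous[of 1]) (use elim in \<open>auto simp: space_circle intro: continuous_on_subset[OF c]\<close>)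
    qed
  qed
qed

lemma Hinf_SAP_log_power:
  assumes \<zeta>: "norm \<zeta> = 1" "\<zeta> \<in> S0"
  shows "(\<lambda>z. if norm z < 1 then log_power \<zeta> l z else 0) \<in> Hinf_SAP S0"
proof (rule Hinf_SAP_I[OF log_power_holomorphic[OF \<zeta>(1)] _ log_power_SAP[OF \<zeta>]])
  show "norm (log_power \<zeta> l z) \<le> exp (\<bar>l\<bar> * (pi / 2))" if "norm z < 1" for z
    using that \<zeta> by (intro norm_log_power_le) auto
  show "AE w in circle. ((\<lambda>r. log_power \<zeta> l (complex_of_real r * w)) \<longlongrightarrow> log_power \<zeta> l w) (at_left 1)"
    using circle_singleton_null[of \<zeta>] AE_space
    by eventually_elim (rule radial_limit_continuous[OF log_power_continuous[OF \<zeta>(1)] _ _ \<zeta>(1)], auto simp: space_circle)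
qed

lemma Hinf_SAP_const: "(\<lambda>z. if norm z < 1 then c else 0) \<in> Hinf_SAP S0"
  by (rule Hinf_SAP_continuous) auto

lemma Hinf_SAP_combine:
  assumes f: "f \<in> Hinf_SAP S0" and g: "g \<in> Hinf_SAP S0"
    and SAP: "\<And>F G. F \<in> SAP S0 \<Longrightarrow> G \<in> SAP S0 \<Longrightarrow> (\<lambda>z. h (F z) (G z)) \<in> SAP S0"
    and hol: "\<And>a b. a holomorphic_on ball 0 1 \<Longrightarrow> b holomorphic_on ball 0 1 \<Longrightarrow> (\<lambda>z. h (a z) (b z)) holomorphic_on ball 0 1"
    and bound: "\<And>C D. \<exists>M. \<forall>x. norm x \<le> C \<longrightarrow> (\<forall>y. norm y \<le> D \<longrightarrow> norm (h x y) \<le> M)" and h0: "h 0 0 = 0"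
    and lim: "\<And>a b x y. (a \<longlongrightarrow> x) (at_left (1::real)) \<Longrightarrow> (b \<longlongrightarrow> y) (at_left 1) \<Longrightarrow> ((\<lambda>r. h (a r) (b r)) \<longlongrightarrow> h x y) (at_left 1)"
  shows "(\<lambda>z. h (f z) (g z)) \<in> Hinf_SAP S0"
proof -
  obtain F C where F: "f holomorphic_on ball 0 1" "\<And>z. norm z < 1 \<Longrightarrow> norm (f z) \<le> C" "\<And>z. norm z \<ge> 1 \<Longrightarrow> f z = 0"
    "F \<in> SAP S0" "radial_limit f F" using Hinf_SAP_D[OF f] by blast
  obtain G D where G: "g holomorphic_on ball 0 1" "\<And>z. norm z < 1 \<Longrightarrow> norm (g z) \<le> D" "\<And>z. norm z \<ge> 1 \<Longrightarrow> g z = 0"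
    "G \<in> SAP S0" "radial_limit g G" using Hinf_SAP_D[OF g] by blast
  obtain M where M: "\<forall>x. norm x \<le> C \<longrightarrow> (\<forall>y. norm y \<le> D \<longrightarrow> norm (h x y) \<le> M)" using bound by blast
  have "(\<lambda>z. if norm z < 1 then h (f z) (g z) else 0) \<in> Hinf_SAP S0"
  proof (rule Hinf_SAP_I[OF hol[OF F(1) G(1)] _ SAP[OF F(4) G(4)]])
    show "norm (h (f z) (g z)) \<le> M" if "norm z < 1" for z using M F(2)[OF that] G(2)[OF that] by blast
    show "radial_limit (\<lambda>z. h (f z) (g z)) (\<lambda>z. h (F z) (G z))"
      using F(5) G(5) by eventually_elim (rule lim)
  qed
  also have "(\<lambda>z. if norm z < 1 then h (f z) (g z) else 0) = (\<lambda>z. h (f z) (g z))" using F(3) G(3) h0 by (auto simp: not_less)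
  finally show ?thesis .
qed

lemma norm_add_bound: "\<exists>M. \<forall>x :: complex. norm x \<le> C \<longrightarrow> (\<forall>y. norm y \<le> D \<longrightarrow> norm (x + y) \<le> M)"
  by (intro exI[of _ "C + D"]) (auto intro: norm_triangle_mono)

lemma norm_mult_bound: "\<exists>M. \<forall>x :: complex. norm x \<le> C \<longrightarrow> (\<forall>y. norm y \<le> D \<longrightarrow> norm (x * y) \<le> M)"
  by (intro exI[of _ "\<bar>C\<bar> * \<bar>D\<bar>"]) (auto simp: norm_mult intro!: mult_mono)

lemma Hinf_SAP_add: "f \<in> Hinf_SAP S0 \<Longrightarrow> g \<in> Hinf_SAP S0 \<Longrightarrow> (\<lambda>z. f z + g z) \<in> Hinf_SAP S0"
  by (rule Hinf_SAP_combine[where h = "(+)"]) (auto intro: SAP_add holomorphic_on_add norm_add_bound tendsto_add)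

lemma Hinf_SAP_mult: "f \<in> Hinf_SAP S0 \<Longrightarrow> g \<in> Hinf_SAP S0 \<Longrightarrow> (\<lambda>z. f z * g z) \<in> Hinf_SAP S0"
  by (rule Hinf_SAP_combine[where h = "(*)"]) (auto intro: SAP_mult holomorphic_on_mult norm_mult_bound tendsto_mult)

section \<open>Division by \<open>z - a\<close> on the disc\<close>

definition diff_quot :: "(complex \<Rightarrow> complex) \<Rightarrow> complex \<Rightarrow> complex \<Rightarrow> complex" where
  "diff_quot f a z = (if z = a then deriv f a else (f z - f a) / (z - a))"

lemma diff_quot_mult: "f z - f a = (z - a) * diff_quot f a z"
  by (simp add: diff_quot_def)

lemma diff_quot_holomorphic:
  assumes f: "f holomorphic_on ball 0 1" and a: "norm a < 1"
  shows "diff_quot f a holomorphic_on ball 0 1"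
  unfolding diff_quot_def[abs_def] using a by (intro pole_lemma[OF f]) simp

text \<open>At distance at least \<open>(1 - norm a) / 2\<close> from \<open>a\<close> the
  denominator is bounded below; inside that circle the maximum principle carries the bound
  inwards.\<close>

lemma diff_quot_bound:
  assumes f: "f holomorphic_on ball 0 1" and C: "\<forall>z. norm z < 1 \<longrightarrow> norm (f z) \<le> C" and a: "norm a < 1"
    and z: "norm z < 1"
  shows "norm (diff_quot f a z) \<le> 4 * C / (1 - norm a)"
proof -
  define g where "g = diff_quot f a"
  note g_def = g_def diff_quot_def[abs_def]
  have C0: "C \<ge> 0" using C a order_trans[OF norm_ge_zero] by blast
  have gh: "g holomorphic_on ball 0 1" unfolding g_def(1) by (rule diff_quot_holomorphic[OF f a])
  define \<rho> where "\<rho> = (1 - norm a) / 2"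
  have \<rho>: "\<rho> > 0" using a by (simp add: \<rho>_def)
  have far: "norm (g z) \<le> 2 * C / \<rho>" if "norm z < 1" "dist z a \<ge> \<rho>" for z
  proof -
    have "norm (f z - f a) \<le> 2 * C" using norm_triangle_ineq4[of "f z" "f a"] C[rule_format, OF that(1)] C[rule_format, OF a] by simp
    moreover have "norm (z - a) \<ge> \<rho>" using that(2) by (simp add: dist_norm)
    moreover have "z \<noteq> a" using that(2) \<rho> by auto
    ultimately show ?thesis unfolding g_def using \<rho> C0
      by (simp add: norm_divide) (intro frac_le, auto)
  qed
  have sub: "cball a \<rho> \<subseteq> ball 0 1"
  proof
    fix z assume "z \<in> cball a \<rho>"
    then have "norm z \<le> norm a + \<rho>" using norm_triangle_ineq2[of z a] by (simp add: dist_norm norm_minus_commute)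
    moreover have "norm a + \<rho> < 1" using a by (simp add: \<rho>_def field_simps)
    ultimately show "z \<in> ball 0 1" by simp
  qed
  show ?thesis
  proof -
    have "norm (g z) \<le> 2 * C / \<rho>"
    proof (cases "dist z a \<ge> \<rho>")
      case False
      show ?thesis
      proof (rule maximum_modulus_frontier[where S = "ball a \<rho>" and f = g])
        show "g holomorphic_on interior (ball a \<rho>)"
          using sub by (intro holomorphic_on_subset[OF gh]) (auto simp: subset_iff)
        show "continuous_on (closure (ball a \<rho>)) g"
          using sub \<rho> by (intro continuous_on_subset[OF holomorphic_on_imp_continuous_on[OF gh]]) (simp add: closure_ball)
        show "norm (g w) \<le> 2 * C / \<rho>" if "w \<in> frontier (ball a \<rho>)" for w
        proof (rule far)
          have "w \<in> sphere a \<rho>" using that \<rho> by (simp add: frontier_ball)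
          then show "norm w < 1" "dist w a \<ge> \<rho>" using sub by (auto simp: dist_commute subset_iff)
        qed
        show "z \<in> ball a \<rho>" using False by (simp add: dist_commute)
      qed auto
    qed (rule far[OF z])
    then show ?thesis by (simp add: \<rho>_def mult.commute g_def(1))
  qed
qed

text \<open>The boundary values of the quotient are those of \<open>f - f a\<close> times the
  inverse of \<open>z - a\<close>, which is continuous on the circle and therefore in every
  \<open>SAP\<close>.\<close>

lemma Hinf_SAP_divide:
  assumes f: "f \<in> Hinf_SAP S0" and a: "norm a < 1"
  shows "\<exists>g\<in>Hinf_SAP S0. \<forall>z. norm z < 1 \<longrightarrow> f z - f a = (z - a) * g z"
proof -
  obtain F C where F: "f holomorphic_on ball 0 1" "\<And>z. norm z < 1 \<Longrightarrow> norm (f z) \<le> C" "\<And>z. norm z \<ge> 1 \<Longrightarrow> f z = 0"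
    "F \<in> SAP S0" "radial_limit f F" using Hinf_SAP_D[OF f] by blast
  define g where "g = diff_quot f a"
  have C: "\<forall>z. norm z < 1 \<longrightarrow> norm (f z) \<le> C" using F(2) by blast
  have g: "g holomorphic_on ball 0 1" "f z - f a = (z - a) * g z" for z
    unfolding g_def by (rule diff_quot_holomorphic[OF F(1) a], rule diff_quot_mult)
  have gb: "norm (g z) \<le> 4 * C / (1 - norm a)" if "norm z < 1" for z
    unfolding g_def by (rule diff_quot_bound[OF F(1) C a that])
  have inv: "(\<lambda>z. inverse (z - a)) \<in> SAP S0"
    using a by (intro SAP_continuous continuous_intros) auto
  have "(\<lambda>z. if norm z < 1 then g z else 0) \<in> Hinf_SAP S0"
  proof (rule Hinf_SAP_I[OF g(1) gb])
    show "(\<lambda>z. (F z + (- f a)) * inverse (z - a)) \<in> SAP S0"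
      by (intro SAP_mult SAP_add SAP_const F inv)
    show "AE z in circle. ((\<lambda>r. g (complex_of_real r * z)) \<longlongrightarrow> (F z + (- f a)) * inverse (z - a)) (at_left 1)"
      using F(5) AE_space
    proof eventually_elim
      case (elim z)
      have za: "z \<noteq> a" using elim a by (auto simp: space_circle)
      have id: "((\<lambda>r. complex_of_real r * z) \<longlongrightarrow> of_real 1 * z) (at_left 1)" by (intro tendsto_intros)
      then have lim: "((\<lambda>r. (f (complex_of_real r * z) + (- f a)) * inverse (complex_of_real r * z - a))
         \<longlongrightarrow> (F z + (- f a)) * inverse (of_real 1 * z - a)) (at_left 1)"
        using za elim by (intro tendsto_intros) auto
      have "\<forall>\<^sub>F r in at_left 1. complex_of_real r * z \<noteq> a"
        using tendsto_imp_eventually_ne[OF id, of a] za by simp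
      then have "\<forall>\<^sub>F r in at_left 1. (f (complex_of_real r * z) + (- f a)) * inverse (complex_of_real r * z - a) = g (complex_of_real r * z)"
        by eventually_elim (simp add: g_def diff_quot_def divide_inverse)
      from Lim_transform_eventually[OF lim this] show ?case by simp
    qed
  qed
  then show ?thesis using g(2) a by (intro bexI[of _ "\<lambda>z. if norm z < 1 then g z else 0"]) auto
qed

section \<open>The algebra on the polydisc\<close>

definition lift_component :: "'n::finite \<Rightarrow> (complex \<Rightarrow> complex) \<Rightarrow> ('n \<Rightarrow> complex) \<Rightarrow> complex" where
  "lift_component k f z = (if z \<in> polydisc then f (z k) else 0)"

lemma Hinf_SAPn_I:
  fixes f :: "('n::finite \<Rightarrow> complex) \<Rightarrow> complex"
  assumes c: "continuous_on polydisc f"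
    and h: "\<And>z k. z \<in> polydisc \<Longrightarrow> (\<lambda>w. f (z(k := w))) holomorphic_on ball 0 1"
    and b: "\<And>z. z \<in> polydisc \<Longrightarrow> norm (f z) \<le> C" and F: "F \<in> SAPn S"
    and lim: "radial_limit_n f F"
  shows "(\<lambda>z. if z \<in> polydisc then f z else 0) \<in> Hinf_SAPn S"
proof -
  let ?f = "\<lambda>z. if z \<in> polydisc then f z else 0"
  have "continuous_on polydisc ?f" using c by (rule continuous_on_eq) auto
  moreover have "(\<lambda>w. ?f (z(k := w))) holomorphic_on ball 0 1" if "z \<in> polydisc" for z k
    by (rule holomorphic_transform[OF h[OF that, of k]]) (use that in \<open>auto simp: polydisc_def\<close>)
  moreover have "bounded (?f ` polydisc)"
    unfolding bounded_iff using b by (intro exI[of _ C]) auto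
  moreover have "AE z in torus. ((\<lambda>r. ?f (\<lambda>k. complex_of_real r * z k)) \<longlongrightarrow> F z) (at_left 1)"
    using lim AE_space
  proof eventually_elim
    case (elim z)
    have "\<forall>\<^sub>F r in at_left 1. f (\<lambda>k. complex_of_real r * z k) = ?f (\<lambda>k. complex_of_real r * z k)"
      using radial_eventually by eventually_elim (use elim in \<open>auto simp: space_torus polydisc_def norm_mult\<close>)
    from tendsto_cong[OF this, of "F z"] elim show ?case by simp
  qed
  ultimately show ?thesis unfolding Hinf_SAPn_def Hinf_n_def using F by (intro CollectI conjI bexI[of _ F]) auto
qed

lemma Hinf_SAPn_D:
  fixes f :: "('n::finite \<Rightarrow> complex) \<Rightarrow> complex"
  assumes "f \<in> Hinf_SAPn S"
  shows "\<exists>F C. continuous_on polydisc f \<and> (\<forall>z\<in>polydisc. \<forall>k. (\<lambda>w. f (z(k := w))) holomorphic_on ball 0 1) \<and>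
    (\<forall>z\<in>polydisc. norm (f z) \<le> C) \<and> (\<forall>z. z \<notin> polydisc \<longrightarrow> f z = 0) \<and>
    F \<in> SAPn S \<and> radial_limit_n f F"
proof -
  have H: "f \<in> Hinf_n" using assms by (simp add: Hinf_SAPn_def)
  then obtain C where "\<forall>x\<in>f ` polydisc. norm x \<le> C" unfolding Hinf_n_def bounded_iff by blast
  then have C: "\<forall>z\<in>polydisc. norm (f z) \<le> C" by auto
  obtain F where F: "F \<in> SAPn S" "radial_limit_n f F"
    using assms by (auto simp: Hinf_SAPn_def)
  have "continuous_on polydisc f" "\<forall>z\<in>polydisc. \<forall>k. (\<lambda>w. f (z(k := w))) holomorphic_on ball 0 1"
    "\<forall>z. z \<notin> polydisc \<longrightarrow> f z = 0" using H by (auto simp: Hinf_n_def)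
  then show ?thesis using C F by blast
qed

lemma SAPn_poly:
  assumes "p \<in> SAP_poly S"
  shows "p \<in> SAPn S"
  using assms tensor_SAP_ess_bounded[OF SAP_poly_tensor[OF assms]]
  by (auto simp: SAPn_def intro!: bexI[of _ p])

lemma SAPn_add:
  assumes F: "F \<in> SAPn S" and G: "G \<in> SAPn S"
  shows "(\<lambda>z. F z + G z) \<in> SAPn S"
  unfolding SAPn_def
proof (intro CollectI conjI allI impI)
  show "(\<lambda>z. F z + G z) \<in> ess_bounded torus" using F G by (intro ess_bounded_add) (auto simp: SAPn_def)
  fix e :: real assume e: "e > 0"
  obtain p where p: "p \<in> SAP_poly S" "AE z in torus. norm (F z - p z) \<le> e/2"
    using F half_gt_zero[OF e] unfolding SAPn_def by blast
  obtain q where q: "q \<in> SAP_poly S" "AE z in torus. norm (G z - q z) \<le> e/2"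
    using G half_gt_zero[OF e] unfolding SAPn_def by blast
  have "AE z in torus. norm (F z + G z - (p z + q z)) \<le> e"
    using p(2) q(2)
  proof eventually_elim
    case (elim z)
    then show ?case using norm_diff_triangle_ineq[of "F z" "G z" "p z" "q z"] by simp
  qed
  then show "\<exists>p\<in>SAP_poly S. AE z in torus. norm (F z + G z - p z) \<le> e"
    by (rule bexI[OF _ SAP_poly.add[OF p(1) q(1)]])
qed

lemma SAPn_mult:
  assumes F: "F \<in> SAPn S" and G: "G \<in> SAPn S"
  shows "(\<lambda>z. F z * G z) \<in> SAPn S"
  unfolding SAPn_def
proof (intro CollectI conjI allI impI)
  have Fb: "F \<in> ess_bounded torus" and Gb: "G \<in> ess_bounded torus" using F G by (auto simp: SAPn_def)
  then show "(\<lambda>z. F z * G z) \<in> ess_bounded torus" by (rule ess_bounded_mult)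
  fix e :: real assume e: "e > 0"
  obtain C where C: "AE z in torus. norm (F z) \<le> C" using Fb by (auto simp: ess_bounded_def)
  obtain D where D: "AE z in torus. norm (G z) \<le> D" using Gb by (auto simp: ess_bounded_def)
  obtain \<eta> where \<eta>: "\<eta> > 0" "\<forall>x y p q :: complex. norm x \<le> C \<longrightarrow> norm y \<le> D \<longrightarrow> norm (x - p) \<le> \<eta> \<longrightarrow> norm (y - q) \<le> \<eta> \<longrightarrow>
    norm (x * y - p * q) \<le> e" using mult_approx[OF e] by blast
  obtain p where p: "p \<in> SAP_poly S" "AE z in torus. norm (F z - p z) \<le> \<eta>"
    using F \<eta>(1) unfolding SAPn_def by blast
  obtain q where q: "q \<in> SAP_poly S" "AE z in torus. norm (G z - q z) \<le> \<eta>"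
    using G \<eta>(1) unfolding SAPn_def by blast
  have "AE z in torus. norm (F z * G z - p z * q z) \<le> e"
    using p(2) q(2) C D by eventually_elim (use \<eta>(2) in blast)
  then show "\<exists>p\<in>SAP_poly S. AE z in torus. norm (F z * G z - p z) \<le> e"
    by (rule bexI[OF _ SAP_poly.mult[OF p(1) q(1)]])
qed

lemma Hinf_SAPn_lift:
  fixes k :: "'n::finite"
  assumes f: "f \<in> Hinf_SAP (S k)"
  shows "lift_component k f \<in> Hinf_SAPn S"
proof -
  obtain F C where F: "f holomorphic_on ball 0 1" "\<And>z. norm z < 1 \<Longrightarrow> norm (f z) \<le> C" "\<And>z. norm z \<ge> 1 \<Longrightarrow> f z = 0"
    "F \<in> SAP (S k)" "radial_limit f F" using Hinf_SAP_D[OF f] by blast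
  have "(\<lambda>z. if z \<in> polydisc then f (z k) else 0) \<in> Hinf_SAPn S"
  proof (rule Hinf_SAPn_I)
    show "continuous_on polydisc (\<lambda>z. f (z k))"
      by (rule continuous_on_compose2[OF holomorphic_on_imp_continuous_on[OF F(1)]])
         (auto simp: polydisc_def intro: continuous_on_subset[OF continuous_on_product_coordinates])
    show "(\<lambda>w. f ((z(j := w)) k)) holomorphic_on ball 0 1" for z :: "'n \<Rightarrow> complex" and j
      using F(1) by (cases "j = k") auto
    show "norm (f (z k)) \<le> C" if "z \<in> polydisc" for z using that by (intro F(2)) (simp add: polydisc_def)
    show "(\<lambda>z. F (z k)) \<in> SAPn S" by (intro SAPn_poly SAP_poly.var F(4))
    show "AE z in torus. ((\<lambda>r. f (complex_of_real r * z k)) \<longlongrightarrow> F (z k)) (at_left 1)"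
      by (rule AE_torus_component[OF F(5)])
  qed
  then show ?thesis by (simp add: lift_component_def[abs_def])
qed

lemma Hinf_SAPn_const: "(\<lambda>z. if z \<in> polydisc then c else 0) \<in> Hinf_SAPn S"
  by (rule Hinf_SAPn_I[where F = "\<lambda>_. c" and C = "norm c"]) (auto intro: SAPn_poly SAP_poly.const)

lemma Hinf_SAPn_combine:
  fixes f :: "('n::finite \<Rightarrow> complex) \<Rightarrow> complex"
  assumes f: "f \<in> Hinf_SAPn S" and g: "g \<in> Hinf_SAPn S"
    and SAP: "\<And>F G. F \<in> SAPn S \<Longrightarrow> G \<in> SAPn S \<Longrightarrow> (\<lambda>z. h (F z) (G z)) \<in> SAPn S"
    and hol: "\<And>a b. a holomorphic_on ball 0 1 \<Longrightarrow> b holomorphic_on ball 0 1 \<Longrightarrow> (\<lambda>z. h (a z) (b z)) holomorphic_on ball 0 1"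
    and cont: "\<And>(A :: ('n \<Rightarrow> complex) set) a b. continuous_on A a \<Longrightarrow> continuous_on A b \<Longrightarrow> continuous_on A (\<lambda>z. h (a z) (b z))"
    and bound: "\<And>C D. \<exists>M. \<forall>x. norm x \<le> C \<longrightarrow> (\<forall>y. norm y \<le> D \<longrightarrow> norm (h x y) \<le> M)" and h0: "h 0 0 = 0"
    and lim: "\<And>a b x y. (a \<longlongrightarrow> x) (at_left (1::real)) \<Longrightarrow> (b \<longlongrightarrow> y) (at_left 1) \<Longrightarrow> ((\<lambda>r. h (a r) (b r)) \<longlongrightarrow> h x y) (at_left 1)"
  shows "(\<lambda>z. h (f z) (g z)) \<in> Hinf_SAPn S"
proof -
  obtain F C where F: "continuous_on polydisc f" "\<And>z k. z \<in> polydisc \<Longrightarrow> (\<lambda>w. f (z(k := w))) holomorphic_on ball 0 1"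
    "\<And>z. z \<in> polydisc \<Longrightarrow> norm (f z) \<le> C" "\<And>z. z \<notin> polydisc \<Longrightarrow> f z = 0"
    "F \<in> SAPn S" "radial_limit_n f F" using Hinf_SAPn_D[OF f] by blast
  obtain G D where G: "continuous_on polydisc g" "\<And>z k. z \<in> polydisc \<Longrightarrow> (\<lambda>w. g (z(k := w))) holomorphic_on ball 0 1"
    "\<And>z. z \<in> polydisc \<Longrightarrow> norm (g z) \<le> D" "\<And>z. z \<notin> polydisc \<Longrightarrow> g z = 0"
    "G \<in> SAPn S" "radial_limit_n g G" using Hinf_SAPn_D[OF g] by blast
  obtain M where M: "\<forall>x. norm x \<le> C \<longrightarrow> (\<forall>y. norm y \<le> D \<longrightarrow> norm (h x y) \<le> M)" using bound by blast
  have "(\<lambda>z. if z \<in> polydisc then h (f z) (g z) else 0) \<in> Hinf_SAPn S"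
  proof (rule Hinf_SAPn_I[OF cont[OF F(1) G(1)] _ _ SAP[OF F(5) G(5)]])
    show "(\<lambda>w. h (f (z(k := w))) (g (z(k := w)))) holomorphic_on ball 0 1" if "z \<in> polydisc" for z k
      by (rule hol[OF F(2)[OF that] G(2)[OF that]])
    show "norm (h (f z) (g z)) \<le> M" if "z \<in> polydisc" for z using M F(3)[OF that] G(3)[OF that] by blast
    show "radial_limit_n (\<lambda>z. h (f z) (g z)) (\<lambda>z. h (F z) (G z))"
      using F(6) G(6) by eventually_elim (rule lim)
  qed
  also have "(\<lambda>z. if z \<in> polydisc then h (f z) (g z) else 0) = (\<lambda>z. h (f z) (g z))" using F(4) G(4) h0 by auto
  finally show ?thesis .
qed

lemma Hinf_SAPn_add: "f \<in> Hinf_SAPn S \<Longrightarrow> g \<in> Hinf_SAPn S \<Longrightarrow> (\<lambda>z. f z + g z) \<in> Hinf_SAPn S"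
  by (rule Hinf_SAPn_combine[where h = "(+)"])
    (auto intro: SAPn_add holomorphic_on_add continuous_on_add norm_add_bound tendsto_add)

lemma Hinf_SAPn_mult: "f \<in> Hinf_SAPn S \<Longrightarrow> g \<in> Hinf_SAPn S \<Longrightarrow> (\<lambda>z. f z * g z) \<in> Hinf_SAPn S"
  by (rule Hinf_SAPn_combine[where h = "(*)"])
    (auto intro: SAPn_mult holomorphic_on_mult continuous_on_mult norm_mult_bound tendsto_mult)

section \<open>Slices in one coordinate of the torus\<close>

lemma measurable_torus_upd:
  "(\<lambda>p. (fst p)(k := snd p)) \<in> measurable (torus \<Otimes>\<^sub>M circle) (torus :: ('n::finite \<Rightarrow> complex) measure)"
proof -
  have "(\<lambda>p j. if j = k then snd p else fst p j) \<in> measurable (torus \<Otimes>\<^sub>M circle) (\<Pi>\<^sub>M j\<in>(UNIV :: 'n set). circle)"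
  proof (rule measurable_abs_UNIV)
    fix j :: 'n
    have "(\<lambda>p. fst p j) \<in> measurable (torus \<Otimes>\<^sub>M circle) circle"
      by (rule measurable_compose[OF measurable_fst measurable_torus_component])
    then show "(\<lambda>p. if j = k then snd p else fst p j) \<in> measurable (torus \<Otimes>\<^sub>M circle) circle"
      by (cases "j = k") auto
  qed
  moreover have "(\<lambda>p j. if j = k then snd p else fst p j) = (\<lambda>p :: ('n \<Rightarrow> complex) \<times> complex. (fst p)(k := snd p))" by (auto simp: fun_eq_iff)
  ultimately show ?thesis unfolding torus_def[symmetric] by simp
qed

text \<open>Fubini with coordinate \<open>k\<close> split off. The outer variable runs over the
  whole torus, with a dummy coordinate \<open>k\<close>, so that the result combines with other
  statements about points of the torus.\<close>

lemma AE_torus_upd: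
  fixes P :: "('n::finite \<Rightarrow> complex) \<Rightarrow> bool"
  assumes "AE z in torus. P z"
  shows "AE z in torus. AE w in circle. P (z(k := w))"
proof -
  interpret fc: finite_measure circle by (rule finite_measure_circle)
  interpret C: product_sigma_finite "\<lambda>k::'n. circle" by (rule product_sigma_finite_circle)
  obtain N where N: "{z \<in> space torus. \<not> P z} \<subseteq> N" "emeasure torus N = 0" "N \<in> sets torus"
    using assms by (rule AE_E)
  let ?I = "UNIV - {k} :: 'n set"
  have ins: "insert k ?I = UNIV" by auto
  have tor: "torus = Pi\<^sub>M (insert k ?I) (\<lambda>k. circle)" by (simp add: ins torus_def)
  \<comment> \<open>The measure of the slice of the null set through \<open>z\<close> in direction
    \<open>k\<close>. It ignores \<open>z k\<close>, so its integral over the torus is a multiple of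
    its integral over the other coordinates, which is the measure of the null set.\<close>
  define h where "h z = (\<integral>\<^sup>+w. indicator N (z(k := w)) \<partial>circle)" for z :: "'n \<Rightarrow> complex"
  have N_meas: "(\<lambda>p. indicator N ((fst p)(k := snd p)) :: ennreal) \<in> borel_measurable (torus \<Otimes>\<^sub>M circle)"
    using measurable_compose[OF measurable_torus_upd borel_measurable_indicator[OF N(3)], of k] .
  have h_meas: "h \<in> borel_measurable torus"
    unfolding h_def using fc.borel_measurable_nn_integral[of "\<lambda>z w. indicator N (z(k := w))" torus] N_meas
    by (simp add: case_prod_beta)
  have h_upd: "h (z(k := w)) = h z" for z w by (simp add: h_def)
  have "(\<integral>\<^sup>+z. h z \<partial>torus) = (\<integral>\<^sup>+x. \<integral>\<^sup>+w. h (x(k := w)) \<partial>circle \<partial>Pi\<^sub>M ?I (\<lambda>k. circle))"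
    unfolding tor by (rule C.product_nn_integral_insert) (use h_meas in \<open>auto simp: torus_def\<close>)
  also have "\<dots> = (\<integral>\<^sup>+x. h x * emeasure circle (space circle) \<partial>Pi\<^sub>M ?I (\<lambda>k. circle))"
    unfolding h_upd by simp
  also have "\<dots> = 0"
  proof -
    have z0: "(\<integral>\<^sup>+x. h x \<partial>Pi\<^sub>M ?I (\<lambda>k. circle)) = 0"
    proof -
      have "(\<integral>\<^sup>+x. h x \<partial>Pi\<^sub>M ?I (\<lambda>k. circle)) = (\<integral>\<^sup>+z. indicator N z \<partial>torus)"
        unfolding h_def tor
        by (rule C.product_nn_integral_insert[symmetric]) (use N(3) in \<open>auto simp: torus_def\<close>)
      then show ?thesis using N by simp
    qed
    have hI: "h \<in> borel_measurable (Pi\<^sub>M ?I (\<lambda>k. circle))"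
    proof -
      \<comment> \<open>The 1 is an arbitrary point of the circle in the slot that \<open>h\<close>
        ignores; it lets measurability on the torus pass to the remaining coordinates.\<close>
      have m: "(\<lambda>x. x(k := (1::complex))) \<in> measurable (Pi\<^sub>M ?I (\<lambda>k. circle)) torus"
      proof -
        have "(\<lambda>x j. if j = k then (1::complex) else x j) \<in> measurable (Pi\<^sub>M ?I (\<lambda>k. circle)) (\<Pi>\<^sub>M j\<in>(UNIV :: 'n set). circle)"
        proof (rule measurable_abs_UNIV)
          fix j :: 'n
          show "(\<lambda>x. if j = k then (1::complex) else x j) \<in> measurable (Pi\<^sub>M ?I (\<lambda>k. circle)) circle"
          proof (cases "j = k")
            case False
            have "(\<lambda>x. x j) \<in> measurable (Pi\<^sub>M ?I (\<lambda>k. circle)) circle"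
              by (rule measurable_component_singleton) (use False in auto)
            then show ?thesis using False by simp
          qed (simp add: space_circle)
        qed
        moreover have "(\<lambda>x j. if j = k then (1::complex) else x j) = (\<lambda>x. x(k := (1::complex)))" by (auto simp: fun_eq_iff)
        ultimately show ?thesis unfolding torus_def[symmetric] by simp
      qed
      show ?thesis using measurable_compose[OF m h_meas] by (simp add: h_upd)
    qed
    have "(\<integral>\<^sup>+x. h x * emeasure circle (space circle) \<partial>Pi\<^sub>M ?I (\<lambda>k. circle))
       = (\<integral>\<^sup>+x. h x \<partial>Pi\<^sub>M ?I (\<lambda>k. circle)) * emeasure circle (space circle)"
      by (rule nn_integral_multc[OF hI])
    then show ?thesis using z0 by simp
  qed
  finally have "AE z in torus. h z = 0" using h_meas by (simp add: nn_integral_0_iff_AE)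
  then show ?thesis using AE_space
  proof eventually_elim
    case (elim z)
    have "(\<lambda>w. indicator N (z(k := w)) :: ennreal) \<in> borel_measurable circle"
      using measurable_compose[OF measurable_Pair1' N_meas, of z] elim by simp
    then have "AE w in circle. (indicator N (z(k := w)) :: ennreal) = 0"
      using elim(1) unfolding h_def by (simp add: nn_integral_0_iff_AE)
    then show ?case using AE_space
    proof eventually_elim
      case (elim w)
      have "z(k := w) \<in> space torus" using elim \<open>z \<in> space torus\<close> by (simp add: space_torus space_circle)
      then show ?case using N(1) elim by (auto simp: indicator_def split: if_splits)
    qed
  qed
qed

text \<open>Poisson integration in coordinate \<open>k\<close> turns one factor of each product into
  a number.\<close>

lemma tensor_SAP_poly:
  fixes S :: "'n::finite \<Rightarrow> complex set"
  assumes p: "p \<in> tensor (\<lambda>k. SAP (S k))" and a: "norm a < 1"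
  shows "\<exists>q\<in>SAP_poly S. \<forall>z\<in>space torus. integral\<^sup>L (harm a) (\<lambda>w. p (z(k := w))) = q z"
  using p
proof induction
  case (prod g)
  have "(\<lambda>z. \<Prod>j\<in>A. g j (z j)) \<in> SAP_poly S" if "finite A" for A :: "'n set"
    using that
  proof (induction A rule: finite_induct)
    case empty
    show ?case using SAP_poly.const[of 1] by simp
  next
    case (insert j A)
    show ?case using SAP_poly.mult[OF SAP_poly.var[of "g j" S j, OF prod] insert.IH] insert.hyps by simp
  qed
  then have "(\<lambda>z. \<Prod>j\<in>-{k}. g j (z j)) \<in> SAP_poly S" by simp
  from SAP_poly.mult[OF SAP_poly.const[of "harm_ext (g k) a"] this]
  have m: "(\<lambda>z. harm_ext (g k) a * (\<Prod>j\<in>-{k}. g j (z j))) \<in> SAP_poly S" .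
  have "integral\<^sup>L (harm a) (\<lambda>w. \<Prod>j\<in>UNIV. g j ((z(k := w)) j)) = harm_ext (g k) a * (\<Prod>j\<in>-{k}. g j (z j))" for z
  proof -
    have "(\<Prod>j\<in>UNIV. g j ((z(k := w)) j)) = g k w * (\<Prod>j\<in>-{k}. g j (z j))" for w
    proof -
      have "(\<Prod>j\<in>UNIV. g j ((z(k := w)) j)) = g k w * (\<Prod>j\<in>UNIV-{k}. g j ((z(k := w)) j))"
        by (subst prod.remove[of _ k]) auto
      also have "(\<Prod>j\<in>UNIV-{k}. g j ((z(k := w)) j)) = (\<Prod>j\<in>-{k}. g j (z j))" by (intro prod.cong) auto
      finally show ?thesis .
    qed
    then show ?thesis by (simp add: harm_ext_def)
  qed
  then show ?case by (intro bexI[OF _ m] ballI)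
next
  case (add p q)
  obtain p' where p': "p' \<in> SAP_poly S" "\<forall>z\<in>space torus. integral\<^sup>L (harm a) (\<lambda>w. p (z(k := w))) = p' z"
    using add.IH(1) by blast
  obtain q' where q': "q' \<in> SAP_poly S" "\<forall>z\<in>space torus. integral\<^sup>L (harm a) (\<lambda>w. q (z(k := w))) = q' z"
    using add.IH(2) by blast
  have int: "integrable (harm a) (\<lambda>w. r (z(k := w)))" if "r \<in> tensor (\<lambda>k. SAP (S k))" for r z
    using that
  proof induction
    case (prod g)
    have "(\<lambda>w. \<Prod>j\<in>UNIV. g j ((z(k := w)) j)) = (\<lambda>w. g k w * (\<Prod>j\<in>UNIV-{k}. g j (z j)))"
    proof
      fix w
      have "(\<Prod>j\<in>UNIV. g j ((z(k := w)) j)) = g k w * (\<Prod>j\<in>UNIV-{k}. g j ((z(k := w)) j))"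
        by (subst prod.remove[of _ k]) auto
      also have "(\<Prod>j\<in>UNIV-{k}. g j ((z(k := w)) j)) = (\<Prod>j\<in>UNIV-{k}. g j (z j))" by (intro prod.cong) auto
      finally show "(\<Prod>j\<in>UNIV. g j ((z(k := w)) j)) = g k w * (\<Prod>j\<in>UNIV-{k}. g j (z j))" .
    qed
    then show ?case using harm_integrable[OF a SAP_ess_bounded[OF prod[of k]]] by simp
  qed simp
  have "integral\<^sup>L (harm a) (\<lambda>w. p (z(k := w)) + q (z(k := w))) = p' z + q' z" if "z \<in> space torus" for z
    using int[OF add.hyps(1)] int[OF add.hyps(2)] p'(2) q'(2) that by simp
  then show ?case by (intro bexI[OF _ SAP_poly.add[OF p'(1) q'(1)]] ballI)
qed

lemma ess_bounded_slice:
  assumes F: "F \<in> ess_bounded torus"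
  shows "AE z in torus. (\<lambda>w. F (z(k := w))) \<in> ess_bounded circle"
proof -
  obtain C where "AE z in torus. norm (F z) \<le> C" using F by (auto simp: ess_bounded_def)
  from AE_torus_upd[OF this, of k] show ?thesis using AE_space
  proof eventually_elim
    case (elim z)
    have "(\<lambda>p. F ((fst p)(k := snd p))) \<in> borel_measurable (torus \<Otimes>\<^sub>M circle)"
      using measurable_compose[OF measurable_torus_upd, of F borel k] F by (simp add: ess_bounded_def)
    from measurable_compose[OF measurable_Pair1' this, of z] elim
    have "(\<lambda>w. F (z(k := w))) \<in> borel_measurable circle" by simp
    then show ?case using elim by (auto simp: ess_bounded_def)
  qed
qed

text \<open>The candidate for the boundary function of \<open>f\<close> with coordinate
  \<open>k\<close> frozen at \<open>a\<close>. Poisson integration in one variable does not increase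
  the norm and maps approximating polynomials to polynomials.\<close>

lemma SAPn_slice:
  fixes S :: "'n::finite \<Rightarrow> complex set"
  assumes F: "F \<in> SAPn S" and a: "norm a < 1"
  shows "(\<lambda>z. integral\<^sup>L (harm a) (\<lambda>w. F (z(k := w)))) \<in> SAPn S"
proof -
  interpret fc: finite_measure circle by (rule finite_measure_circle)
  have Fb: "F \<in> ess_bounded torus" using F by (simp add: SAPn_def)
  obtain C where C: "AE z in torus. norm (F z) \<le> C" using Fb by (auto simp: ess_bounded_def)
  have Fm: "(\<lambda>p. F ((fst p)(k := snd p))) \<in> borel_measurable (torus \<Otimes>\<^sub>M circle)"
    using measurable_compose[OF measurable_torus_upd, of F borel k] Fb by (simp add: ess_bounded_def)
  have slice_m: "(\<lambda>w. F (z(k := w))) \<in> borel_measurable circle" if "z \<in> space torus" for z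
    using measurable_compose[OF measurable_Pair1'[OF that] Fm] by simp
  have pm: "(\<lambda>p. poisson a (snd p)) \<in> borel_measurable (torus \<Otimes>\<^sub>M circle)"
    by (rule measurable_compose[OF measurable_snd poisson_measurable[OF a]])
  have "(\<lambda>z. LINT w|circle. poisson a w *\<^sub>R F (z(k := w))) \<in> borel_measurable torus"
    using fc.borel_measurable_lebesgue_integral[of "\<lambda>z w. poisson a w *\<^sub>R F (z(k := w))" torus]
      borel_measurable_scaleR[OF pm Fm] by (simp add: case_prod_beta)
  then have m: "(\<lambda>z. integral\<^sup>L (harm a) (\<lambda>w. F (z(k := w)))) \<in> borel_measurable torus"
    by (rule measurable_cong[THEN iffD1, rotated]) (simp add: integral_harm[OF a slice_m])
  have bound: "AE z in torus. norm (integral\<^sup>L (harm a) (\<lambda>w. F (z(k := w)))) \<le> C"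
    using AE_torus_upd[OF C, of k] ess_bounded_slice[OF Fb, of k]
    by eventually_elim (rule harm_bound[OF a])
  show ?thesis unfolding SAPn_def
  proof (intro CollectI conjI allI impI)
    show "(\<lambda>z. integral\<^sup>L (harm a) (\<lambda>w. F (z(k := w)))) \<in> ess_bounded torus"
      using m bound by (auto simp: ess_bounded_def)
    fix e :: real assume "e > 0"
    then obtain p where p: "p \<in> SAP_poly S" "AE z in torus. norm (F z - p z) \<le> e"
      using F unfolding SAPn_def by blast
    have pt: "p \<in> tensor (\<lambda>k. SAP (S k))" by (rule SAP_poly_tensor[OF p(1)])
    have pb: "p \<in> ess_bounded torus" by (rule tensor_SAP_ess_bounded[OF pt])
    obtain q where q: "q \<in> SAP_poly S" "\<forall>z\<in>space torus. integral\<^sup>L (harm a) (\<lambda>w. p (z(k := w))) = q z"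
      using tensor_SAP_poly[OF pt a] by blast
    have "AE z in torus. norm (integral\<^sup>L (harm a) (\<lambda>w. F (z(k := w))) - q z) \<le> e"
      using AE_torus_upd[OF p(2), of k] ess_bounded_slice[OF Fb, of k] ess_bounded_slice[OF pb, of k] AE_space
    proof eventually_elim
      case (elim z)
      have "(\<lambda>w. F (z(k := w)) + (-1) * p (z(k := w))) \<in> ess_bounded circle"
        by (intro ess_bounded_add ess_bounded_mult ess_bounded_const elim)
      then have d: "(\<lambda>w. F (z(k := w)) - p (z(k := w))) \<in> ess_bounded circle" by simp
      have "integral\<^sup>L (harm a) (\<lambda>w. F (z(k := w))) - q z
         = integral\<^sup>L (harm a) (\<lambda>w. F (z(k := w)) - p (z(k := w)))"
        using q(2) elim harm_integrable[OF a elim(2)] harm_integrable[OF a elim(3)] by simp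
      then show ?case using harm_bound[OF a d elim(1)] by simp
    qed
    then show "\<exists>q\<in>SAP_poly S. AE z in torus. norm (integral\<^sup>L (harm a) (\<lambda>w. F (z(k := w))) - q z) \<le> e"
      by (rule bexI[OF _ q(1)])
  qed
qed

lemma poisson_bound:
  assumes "norm b \<le> \<rho>" "\<rho> < 1" "norm w = 1"
  shows "poisson b w \<le> 1 / (2 * pi * (1 - \<rho>)\<^sup>2)"
proof -
  have b1: "norm b < 1" using assms by linarith
  have "norm (w - b) \<ge> 1 - \<rho>" using norm_triangle_ineq2[of w b] assms by simp
  then have "(norm (w - b))\<^sup>2 \<ge> (1 - \<rho>)\<^sup>2" using assms by (intro power_mono) auto
  moreover have "(1 - \<rho>)\<^sup>2 > 0" using assms by simp
  moreover have "(norm b)\<^sup>2 \<le> 1" using b1 by (simp add: power_le_one)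
  ultimately show ?thesis unfolding poisson_def by (intro frac_le mult_left_mono) auto
qed

text \<open>Along this path coordinate \<open>k\<close> stays at \<open>a\<close> while the others
  shrink. Writing \<open>a\<close> as \<open>r\<close> times \<open>a / r\<close> expresses the
  value as the Poisson integral at \<open>a / r\<close> of the slice of a dilate, and kernel and
  dilate both converge as \<open>r\<close> tends to 1.\<close>

lemma slice_radial_limit:
  fixes f :: "('n::finite \<Rightarrow> complex) \<Rightarrow> complex"
  assumes f: "f \<in> Hinf_n" and C: "\<And>z. z \<in> polydisc \<Longrightarrow> norm (f z) \<le> C" and a: "norm a < 1" and z: "z \<in> space torus"
    and F: "F \<in> borel_measurable circle"
    and lim: "AE w in circle. ((\<lambda>r. f (\<lambda>j. complex_of_real r * (z(k := w)) j)) \<longlongrightarrow> F w) (at_left 1)"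
  shows "((\<lambda>r. f ((\<lambda>j. complex_of_real r * z j)(k := a))) \<longlongrightarrow> integral\<^sup>L (harm a) F) (at_left 1)"
proof -
  interpret fc: finite_measure circle by (rule finite_measure_circle)
  \<comment> \<open>For radii above \<open>\<rho>0\<close> the centres \<open>a / r\<close> stay in
    the disc of radius \<open>\<rho> < 1\<close>, which gives one dominating bound for all the
    kernels.\<close>
  define \<rho>0 where "\<rho>0 = (1 + norm a) / 2"
  have \<rho>0: "\<rho>0 < 1" "norm a < \<rho>0" "0 < \<rho>0" using a by (auto simp: \<rho>0_def) (smt (z3) norm_ge_zero)
  have z1: "norm (z j) = 1" for j using z by (simp add: space_torus)
  define \<rho> where "\<rho> = norm a / \<rho>0"
  have \<rho>: "\<rho> < 1" "0 \<le> \<rho>" using \<rho>0 by (auto simp: \<rho>_def)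
  show ?thesis
  proof (rule tendsto_at_left_sequentially[OF \<rho>0(1)])
    fix s :: "nat \<Rightarrow> real" assume s: "\<And>n. s n < 1" "\<And>n. \<rho>0 < s n" and s1: "s \<longlonglongrightarrow> 1"
    have s0: "0 < s n" for n using s(2)[of n] \<rho>0(3) by linarith
    define b where "b n = a / of_real (s n)" for n
    have nb: "norm (b n) \<le> \<rho>" for n
    proof -
      have "norm (b n) = norm a / s n" using s0[of n] by (simp add: b_def norm_divide)
      also have "\<dots> \<le> norm a / \<rho>0" using s(2)[of n] \<rho>0(3) by (intro divide_left_mono) auto
      finally show ?thesis by (simp add: \<rho>_def)
    qed
    then have nb1: "norm (b n) < 1" for n using \<rho>(1) order_le_less_trans by blast
    have fw: "norm (f (\<lambda>j. of_real (s n) * (z(k := w)) j)) \<le> C" if "norm w \<le> 1" for n w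
    proof (rule C)
      show "(\<lambda>j. of_real (s n) * (z(k := w)) j) \<in> polydisc"
        using norm_dilate_less[OF s0 s(1)] z1 that by (auto simp: polydisc_def eq_refl)
    qed
    have zz: "norm (z j) \<le> 1" for j using z1 by simp
    note dil = Hinf_n_dilate_coordinate[where i = k and x = z, OF f s0 s(1) zz]
    have fm: "(\<lambda>w. f (\<lambda>j. of_real (s n) * (z(k := w)) j)) \<in> borel_measurable circle" for n
      by (rule borel_measurable_circle_continuous) (rule continuous_on_subset[OF conjunct1[OF dil]], auto)
    have eq: "f ((\<lambda>j. of_real (s n) * z j)(k := a)) = (LINT w|circle. poisson (b n) w *\<^sub>R f (\<lambda>j. of_real (s n) * (z(k := w)) j))" for n
    proof -
      have "(\<lambda>j. of_real (s n) * z j)(k := a) = (\<lambda>j. of_real (s n) * (z(k := b n)) j)"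
        using s0[of n] by (auto simp: b_def)
      then show ?thesis using poisson_formula[OF conjunct1[OF dil] conjunct2[OF dil] nb1, of n n] by simp
    qed
    have "(\<lambda>n. LINT w|circle. poisson (b n) w *\<^sub>R f (\<lambda>j. of_real (s n) * (z(k := w)) j)) \<longlonglongrightarrow> (LINT w|circle. poisson a w *\<^sub>R F w)"
    proof (rule integral_dominated_convergence[where w = "\<lambda>_. 1 / (2 * pi * (1 - \<rho>)\<^sup>2) * \<bar>C\<bar>"])
      show "(\<lambda>w. poisson a w *\<^sub>R F w) \<in> borel_measurable circle"
        by (rule borel_measurable_scaleR[OF poisson_measurable[OF a] F])
      show "(\<lambda>w. poisson (b n) w *\<^sub>R f (\<lambda>j. of_real (s n) * (z(k := w)) j)) \<in> borel_measurable circle" for n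
        by (rule borel_measurable_scaleR[OF poisson_measurable[OF nb1] fm])
      show "AE w in circle. norm (poisson (b n) w *\<^sub>R f (\<lambda>j. of_real (s n) * (z(k := w)) j)) \<le> 1 / (2 * pi * (1 - \<rho>)\<^sup>2) * \<bar>C\<bar>" for n
      proof (rule AE_I2)
        fix w assume "w \<in> space circle"
        then have w: "norm w = 1" by (simp add: space_circle)
        have "\<bar>poisson (b n) w\<bar> \<le> 1 / (2 * pi * (1 - \<rho>)\<^sup>2)"
          using poisson_bound[OF nb \<rho>(1) w, of n] poisson_nonneg[OF nb1, of n w] by simp
        moreover have "norm (f (\<lambda>j. of_real (s n) * (z(k := w)) j)) \<le> \<bar>C\<bar>"
          by (rule order_trans[OF fw abs_ge_self]) (simp add: w)
        ultimately show "norm (poisson (b n) w *\<^sub>R f (\<lambda>j. of_real (s n) * (z(k := w)) j)) \<le> 1 / (2 * pi * (1 - \<rho>)\<^sup>2) * \<bar>C\<bar>"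
          unfolding norm_scaleR by (intro mult_mono) auto
      qed
      show "AE w in circle. (\<lambda>n. poisson (b n) w *\<^sub>R f (\<lambda>j. of_real (s n) * (z(k := w)) j)) \<longlonglongrightarrow> poisson a w *\<^sub>R F w"
        using lim AE_space
      proof eventually_elim
        case (elim w)
        have w: "norm w = 1" using elim by (simp add: space_circle)
        have sl: "filterlim s (at_left 1) sequentially"
          unfolding filterlim_at using s s1 by (auto intro!: always_eventually simp: less_imp_neq)
        have bl: "b \<longlonglongrightarrow> a"
        proof -
          have "b \<longlonglongrightarrow> a / of_real 1" unfolding b_def by (intro tendsto_intros s1) auto
          then show ?thesis by simp
        qed
        have "(\<lambda>n. poisson (b n) w) \<longlonglongrightarrow> poisson a w"
          unfolding poisson_def using a w by (intro tendsto_intros bl) auto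
        then show ?case by (intro tendsto_scaleR filterlim_compose[OF elim(1) sl])
      qed
    qed (simp add: fc.integrable_const)
    then show "(\<lambda>n. f ((\<lambda>j. of_real (s n) * z j)(k := a))) \<longlonglongrightarrow> integral\<^sup>L (harm a) F"
      unfolding eq by (simp add: integral_harm[OF a F])
  qed
qed

lemma Hinf_SAPn_slice:
  fixes f :: "('n::finite \<Rightarrow> complex) \<Rightarrow> complex"
  assumes f: "f \<in> Hinf_SAPn S" and a: "norm a < 1"
  shows "(\<lambda>z. if z \<in> polydisc then f (z(k := a)) else 0) \<in> Hinf_SAPn S"
proof -
  obtain F C where F: "continuous_on polydisc f" "\<And>z k. z \<in> polydisc \<Longrightarrow> (\<lambda>w. f (z(k := w))) holomorphic_on ball 0 1"
    "\<And>z. z \<in> polydisc \<Longrightarrow> norm (f z) \<le> C" "\<And>z. z \<notin> polydisc \<Longrightarrow> f z = 0"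
    "F \<in> SAPn S" "radial_limit_n f F"
    using Hinf_SAPn_D[OF f] by blast
  have fH: "f \<in> Hinf_n" using f by (simp add: Hinf_SAPn_def)
  have Fb: "F \<in> ess_bounded torus" using F(5) by (simp add: SAPn_def)
  have upd: "z(k := a) \<in> polydisc" if "z \<in> polydisc" for z :: "'n \<Rightarrow> complex" using that a by (simp add: polydisc_def)
  show ?thesis
  proof (rule Hinf_SAPn_I[where C = C and F = "\<lambda>z. integral\<^sup>L (harm a) (\<lambda>w. F (z(k := w)))"])
    show "continuous_on polydisc (\<lambda>z. f (z(k := a)))"
    proof (rule continuous_on_compose2[OF F(1)])
      show "continuous_on polydisc (\<lambda>z :: 'n \<Rightarrow> complex. z(k := a))"
      proof (rule continuous_on_coordinatewise_then_product)
        fix j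
        show "continuous_on polydisc (\<lambda>z :: 'n \<Rightarrow> complex. (z(k := a)) j)"
          by (cases "j = k") (auto intro: continuous_on_subset[OF continuous_on_product_coordinates])
      qed
    qed (use upd in auto)
    show "(\<lambda>w. f ((z(j := w))(k := a))) holomorphic_on ball 0 1" if z: "z \<in> polydisc" for z j
    proof (cases "j = k")
      case False
      then show ?thesis using F(2)[OF upd[OF z], of j] by (simp add: fun_upd_twist)
    qed simp
    show "norm (f (z(k := a))) \<le> C" if "z \<in> polydisc" for z by (rule F(3)[OF upd[OF that]])
    show "(\<lambda>z. integral\<^sup>L (harm a) (\<lambda>w. F (z(k := w)))) \<in> SAPn S" by (rule SAPn_slice[OF F(5) a])
    show "AE z in torus. ((\<lambda>r. f ((\<lambda>j. complex_of_real r * z j)(k := a))) \<longlongrightarrow> integral\<^sup>L (harm a) (\<lambda>w. F (z(k := w)))) (at_left 1)"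
      using AE_torus_upd[OF F(6), of k] ess_bounded_slice[OF Fb, of k] AE_space
    proof eventually_elim
      case (elim z)
      show ?case
        by (rule slice_radial_limit[OF fH F(3) a elim(3) _ elim(1)]) (use elim(2) in \<open>simp_all add: ess_bounded_def\<close>)
    qed
  qed
qed

text \<open>Cauchy's estimate on circles of radius \<open>\<rho> / 4\<close> around points of the
  half-size disc bounds the derivative.\<close>

lemma bounded_holomorphic_Lipschitz:
  assumes q: "q holomorphic_on ball a \<rho>" and C: "\<And>w. w \<in> ball a \<rho> \<Longrightarrow> norm (q w) \<le> C" and \<rho>: "\<rho> > 0"
    and w: "w \<in> ball a (\<rho> / 2)" "w' \<in> ball a (\<rho> / 2)"
  shows "norm (q w - q w') \<le> (4 * C / \<rho>) * norm (w - w')"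
proof (rule field_differentiable_bound[OF convex_ball _ _ w])
  fix x assume x: "x \<in> ball a (\<rho> / 2)"
  have sub: "cball x (\<rho> / 4) \<subseteq> ball a \<rho>"
  proof
    fix y assume "y \<in> cball x (\<rho> / 4)"
    then have "dist a y < \<rho> / 2 + \<rho> / 4" using x dist_triangle[of a y x] by simp
    then show "y \<in> ball a \<rho>" using \<rho> by simp
  qed
  have "x \<in> ball a \<rho>" using x \<rho> by simp
  then have "(q has_field_derivative deriv q x) (at x)"
    by (rule holomorphic_derivI[OF q open_ball])
  then show "(q has_field_derivative deriv q x) (at x within ball a (\<rho> / 2))" by (rule has_field_derivative_at_within)
  have "norm ((deriv ^^ 1) q x) \<le> fact 1 * C / (\<rho> / 4) ^ 1"
  proof (rule Cauchy_inequality)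
    show "q holomorphic_on ball x (\<rho> / 4)"
      by (rule holomorphic_on_subset[OF q]) (use sub in \<open>auto simp: subset_iff\<close>)
    show "continuous_on (cball x (\<rho> / 4)) q"
      by (rule continuous_on_subset[OF holomorphic_on_imp_continuous_on[OF q] sub])
    show "norm (q y) \<le> C" if "norm (x - y) = \<rho> / 4" for y
    proof (rule C)
      have "y \<in> cball x (\<rho> / 4)" using that by (simp add: dist_norm)
      then show "y \<in> ball a \<rho>" using sub by blast
    qed
  qed (use \<rho> in auto)
  then show "norm (deriv q x) \<le> 4 * C / \<rho>" by (simp add: mult.commute)
qed

text \<open>In coordinate \<open>k\<close> this is the difference quotient of one variable, with the
  same bound, and its boundary values come from those of \<open>f\<close> and of the slice. The work
  lies in joint continuity, and in holomorphy in the other coordinates, at points with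
  \<open>z k = a\<close>.\<close>

lemma Hinf_SAPn_divide:
  fixes f :: "('n::finite \<Rightarrow> complex) \<Rightarrow> complex"
  assumes f: "f \<in> Hinf_SAPn S" and a: "norm a < 1"
  shows "\<exists>g\<in>Hinf_SAPn S. \<forall>z\<in>polydisc. f z - f (z(k := a)) = (z k - a) * g z"
proof -
  obtain F C where F: "continuous_on polydisc f" "\<And>z k. z \<in> polydisc \<Longrightarrow> (\<lambda>w. f (z(k := w))) holomorphic_on ball 0 1"
    "\<And>z. z \<in> polydisc \<Longrightarrow> norm (f z) \<le> C" "\<And>z. z \<notin> polydisc \<Longrightarrow> f z = 0"
    "F \<in> SAPn S" "radial_limit_n f F"
    using Hinf_SAPn_D[OF f] by blast
  define f0 where "f0 = (\<lambda>z. if z \<in> polydisc then f (z(k := a)) else 0)"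
  have f0: "f0 \<in> Hinf_SAPn S" unfolding f0_def by (rule Hinf_SAPn_slice[OF f a])
  obtain F0 where F0: "continuous_on polydisc f0" "F0 \<in> SAPn S"
    "radial_limit_n f0 F0"
    using Hinf_SAPn_D[OF f0] by blast
  have upd: "z(k := w) \<in> polydisc" if "z \<in> polydisc" "norm w < 1" for z :: "'n \<Rightarrow> complex" and w k using that by (simp add: polydisc_def)
  have comp: "norm (z j) < 1" if "z \<in> polydisc" for z :: "'n \<Rightarrow> complex" and j using that by (simp add: polydisc_def)
  define g where "g z = diff_quot (\<lambda>w. f (z(k := w))) a (z k)" for z
  define D where "D = 4 * C / (1 - norm a)"
  have fC: "\<forall>w. norm w < 1 \<longrightarrow> norm (f (z(k := w))) \<le> C" if "z \<in> polydisc" for z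
    using F(3) upd[OF that] by blast
  have gk: "(\<lambda>w. g (z(k := w))) holomorphic_on ball 0 1" if z: "z \<in> polydisc" for z
    unfolding g_def using diff_quot_holomorphic[OF F(2)[OF z, of k] a] by simp
  have gb: "norm (g z) \<le> D" if z: "z \<in> polydisc" for z
    unfolding g_def D_def by (rule diff_quot_bound[OF F(2)[OF z] fC[OF z] a comp[OF z]])
  have gm: "f z - f (z(k := a)) = (z k - a) * g z" for z
    using diff_quot_mult[of "\<lambda>w. f (z(k := w))" "z k" a] by (simp add: g_def)
  have gq: "g z = (f z - f0 z) / (z k - a)" if "z \<in> polydisc" "z k \<noteq> a" for z
    using gm[of z] that by (simp add: f0_def field_simps)
  define \<rho> where "\<rho> = 1 - norm a"
  have \<rho>: "\<rho> > 0" using a by (simp add: \<rho>_def)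
  have sub: "ball a \<rho> \<subseteq> ball 0 1"
  proof
    fix y assume "y \<in> ball a \<rho>"
    then show "y \<in> ball 0 1" using norm_triangle_ineq2[of y a] by (simp add: \<rho>_def dist_norm norm_minus_commute)
  qed
  define L where "L = 4 * D / \<rho>"
  have lip: "norm (g (z(k := w)) - g (z(k := w'))) \<le> L * norm (w - w')"
    if z: "z \<in> polydisc" and w: "w \<in> ball a (\<rho> / 2)" "w' \<in> ball a (\<rho> / 2)" for z w w'
    unfolding L_def
  proof (rule bounded_holomorphic_Lipschitz[OF _ _ \<rho> w])
    show "(\<lambda>w. g (z(k := w))) holomorphic_on ball a \<rho>" by (rule holomorphic_on_subset[OF gk[OF z] sub])
    show "norm (g (z(k := u))) \<le> D" if "u \<in> ball a \<rho>" for u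
      using that sub by (intro gb upd z) auto
  qed
  text \<open>Off \<open>z k = a\<close> the quotient is explicit; at \<open>z k = a\<close> it is a locally uniform limit, by the
    Lipschitz bound, of the functions obtained by moving the coordinate \<open>k\<close> slightly.\<close>
  define u where "u n = a + of_real (\<rho> / (4 * (real n + 1)))" for n :: nat
  have u: "u n \<in> ball a (\<rho> / 2)" "u n \<noteq> a" for n
  proof -
    have "\<rho> / (4 * (real n + 1)) \<le> \<rho> / 4" using \<rho> by (intro divide_left_mono) auto
    also have "\<dots> < \<rho> / 2" using \<rho> by simp
    finally have "\<bar>\<rho> / (4 * (real n + 1))\<bar> < \<rho> / 2" using \<rho> by simp
    moreover have "dist a (u n) = \<bar>\<rho> / (4 * (real n + 1))\<bar>"
    proof -
      have "norm (a - (a + of_real c)) = \<bar>c\<bar>" for c :: real by simp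
      then show ?thesis unfolding u_def dist_norm .
    qed
    ultimately show "u n \<in> ball a (\<rho> / 2)" by simp
    have "\<rho> / (4 * (real n + 1)) > 0" using \<rho> by simp
    then have "complex_of_real (\<rho> / (4 * (real n + 1))) \<noteq> 0" by (simp only: of_real_eq_0_iff)
    moreover have "a + c \<noteq> a" if "c \<noteq> 0" for c using that by simp
    ultimately show "u n \<noteq> a" unfolding u_def by blast
  qed
  have un: "norm (u n) < 1" for n using u(1)[of n] sub \<rho> by (auto simp: subset_iff)
  have uL: "(\<lambda>n. L * norm (a - u n)) \<longlonglongrightarrow> 0"
  proof -
    have "(\<lambda>n. \<rho> / (4 * (real n + 1))) \<longlonglongrightarrow> 0" by real_asymp
    then have "u \<longlonglongrightarrow> a + of_real 0" unfolding u_def by (intro tendsto_intros)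
    then have "(\<lambda>n. L * norm (a - u n)) \<longlonglongrightarrow> L * norm (a - (a + of_real 0))" by (intro tendsto_intros)
    then show ?thesis by simp
  qed
  have near: "\<forall>\<^sub>F n in sequentially. \<forall>z\<in>polydisc. z k = a \<longrightarrow> norm (g (z(k := u n)) - g z) < e" if "e > 0" for e
  proof -
    have "\<forall>\<^sub>F n in sequentially. L * norm (a - u n) < e" using uL that by (rule order_tendstoD(2))
    then show ?thesis
    proof eventually_elim
      case (elim n)
      show ?case
      proof (intro ballI impI)
        fix z :: "'n \<Rightarrow> complex" assume z: "z \<in> polydisc" "z k = a"
        have "norm (g (z(k := a)) - g (z(k := u n))) \<le> L * norm (a - u n)"
          by (rule lip[OF z(1) _ u(1)]) (use \<rho> in simp)
        moreover have "z(k := a) = z" using z(2) by auto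
        ultimately show "norm (g (z(k := u n)) - g z) < e" using elim by (simp add: norm_minus_commute)
      qed
    qed
  qed
  have gj: "(\<lambda>w. g (z(j := w))) holomorphic_on ball 0 1" if z: "z \<in> polydisc" for z j
  proof (cases "j = k")
    case True
    then show ?thesis using gk[OF z] by simp
  next
    case jk: False
    have off: "(\<lambda>w. g (y(j := w))) holomorphic_on ball 0 1" if y: "y \<in> polydisc" and ya: "y k \<noteq> a" for y
    proof -
      have "(\<lambda>w. (f (y(j := w)) - f ((y(k := a))(j := w))) / (y k - a)) holomorphic_on ball 0 1"
        using ya a by (intro holomorphic_intros F(2) upd y) auto
      then show ?thesis
      proof (rule holomorphic_transform)
        fix w :: complex assume "w \<in> ball 0 1"
        then have "y(j := w) \<in> polydisc" using y by (intro upd) auto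
        moreover have "(y(k := a))(j := w) = (y(j := w))(k := a)" using jk by (simp add: fun_upd_twist)
        ultimately show "(f (y(j := w)) - f ((y(k := a))(j := w))) / (y k - a) = g (y(j := w))"
          using gq[of "y(j := w)"] jk ya by (simp add: f0_def)
      qed
    qed
    show ?thesis
    proof (cases "z k = a")
      case True
      show ?thesis
      proof (rule holomorphic_uniform_sequence[OF open_ball])
        show "(\<lambda>w. g ((z(k := u n))(j := w))) holomorphic_on ball 0 1" for n
          by (rule off) (use u un z in \<open>auto intro: upd\<close>)
        fix x :: complex assume x: "x \<in> ball 0 1"
        obtain d where d: "d > 0" "cball x d \<subseteq> ball 0 1" using open_contains_cball[THEN iffD1, OF open_ball] x by blast
        have "uniform_limit (cball x d) (\<lambda>n w. g ((z(k := u n))(j := w))) (\<lambda>w. g (z(j := w))) sequentially"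
        proof (rule uniform_limitI)
          fix e :: real assume "e > 0"
          from near[OF this] show "\<forall>\<^sub>F n in sequentially. \<forall>w\<in>cball x d. dist (g ((z(k := u n))(j := w))) (g (z(j := w))) < e"
          proof eventually_elim
            case (elim n)
            show ?case
            proof
              fix w assume "w \<in> cball x d"
              then have w: "norm w < 1" using d(2) by auto
              have "(z(k := u n))(j := w) = (z(j := w))(k := u n)" using jk by (simp add: fun_upd_twist)
              moreover have "norm (g ((z(j := w))(k := u n)) - g (z(j := w))) < e"
                using elim[rule_format, of "z(j := w)"] upd[OF z w, of j] jk True by simp
              ultimately show "dist (g ((z(k := u n))(j := w))) (g (z(j := w))) < e" by (simp add: dist_norm)
            qed
          qed
        qed
        then show "\<exists>d>0. cball x d \<subseteq> ball 0 1 \<and>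
           uniform_limit (cball x d) (\<lambda>n w. g ((z(k := u n))(j := w))) (\<lambda>w. g (z(j := w))) sequentially"
          using d by blast
      qed
    qed (rule off[OF z])
  qed
  have gc: "continuous_on polydisc g"
  proof -
    have open_pd: "open (polydisc :: ('n \<Rightarrow> complex) set)"
    proof -
      have eq: "(polydisc :: ('n \<Rightarrow> complex) set) = (\<Inter>j\<in>UNIV. {z. norm (z j) < 1})" by (auto simp: polydisc_def)
      show ?thesis unfolding eq
        by (intro open_INT ballI open_Collect_less continuous_intros continuous_on_product_coordinates) auto
    qed
    have coord: "continuous_on A (\<lambda>z :: 'n \<Rightarrow> complex. z k)" for A
      by (rule continuous_on_subset[OF continuous_on_product_coordinates]) auto
    have c1: "continuous_on (polydisc \<inter> {z. z k \<noteq> a}) g"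
    proof -
      have "continuous_on (polydisc \<inter> {z. z k \<noteq> a}) (\<lambda>z. (f z - f0 z) / (z k - a))"
        by (intro continuous_intros continuous_on_subset[OF F(1)] continuous_on_subset[OF F0(1)] coord) auto
      then show ?thesis by (rule continuous_on_eq) (use gq in auto)
    qed
    have upd_c: "continuous_on polydisc (\<lambda>z :: 'n \<Rightarrow> complex. z(k := c))" for c
    proof (rule continuous_on_coordinatewise_then_product)
      fix j
      show "continuous_on polydisc (\<lambda>z :: 'n \<Rightarrow> complex. (z(k := c)) j)"
        by (cases "j = k") (auto intro: continuous_on_subset[OF continuous_on_product_coordinates])
    qed
    have gu: "continuous_on polydisc (\<lambda>z. g (z(k := u n)))" for n
    proof -
      have "continuous_on polydisc (\<lambda>z. (f (z(k := u n)) - f0 z) / (u n - a))"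
        by (intro continuous_intros continuous_on_compose2[OF F(1) upd_c] F0(1)) (use u un upd in auto)
      then show ?thesis
      proof (rule continuous_on_eq)
        fix z :: "'n \<Rightarrow> complex" assume z: "z \<in> polydisc"
        have "f0 (z(k := u n)) = f0 z" using z upd[OF z un, of k n] by (simp add: f0_def)
        then show "(f (z(k := u n)) - f0 z) / (u n - a) = g (z(k := u n))"
          using gq[OF upd[OF z un], of k n] u(2)[of n] by simp
      qed
    qed
    show ?thesis
      unfolding continuous_on_def
    proof
      fix x :: "'n \<Rightarrow> complex" assume x: "x \<in> polydisc"
      show "(g \<longlongrightarrow> g x) (at x within polydisc)"
      proof (cases "x k = a")
        case False
        have "open (polydisc \<inter> {z :: 'n \<Rightarrow> complex. z k \<noteq> a})"
          by (intro open_Int open_pd open_Collect_neq coord continuous_intros)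
        then have "isCont g x" using c1 x False by (auto simp: continuous_on_eq_continuous_at)
        then show ?thesis unfolding isCont_def by (rule tendsto_within_subset) simp
      next
        case True
        show ?thesis
        proof (rule tendstoI)
          fix e :: real assume e: "e > 0"
          have e4: "e / 4 > 0" using e by simp
          \<comment> \<open>Three errors of \<open>e / 4\<close>: move coordinate \<open>k\<close>
            of \<open>z\<close> to \<open>u n\<close>, compare the points with that coordinate
            fixed, where the quotient is explicit, and move it back at \<open>x\<close>.\<close>
          have "\<forall>\<^sub>F n in sequentially. (\<forall>z\<in>polydisc. z k = a \<longrightarrow> norm (g (z(k := u n)) - g z) < e / 4) \<and> L * norm (a - u n) < e / 4"
            by (intro eventually_conj near[OF e4] order_tendstoD(2)[OF uL e4])
          then obtain n where n: "\<forall>z\<in>polydisc. z k = a \<longrightarrow> norm (g (z(k := u n)) - g z) < e / 4" "L * norm (a - u n) < e / 4"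
            by (auto simp: eventually_sequentially)
          have ck: "((\<lambda>z. z k) \<longlongrightarrow> a) (at x within polydisc)"
            using coord[of polydisc] x True unfolding continuous_on_def by auto
          have "((\<lambda>z. L * norm (z k - u n)) \<longlongrightarrow> L * norm (a - u n)) (at x within polydisc)"
            by (intro tendsto_intros ck)
          then have ev1: "\<forall>\<^sub>F z in at x within polydisc. L * norm (z k - u n) < e / 4"
            using n(2) by (rule order_tendstoD(2))
          have ev2: "\<forall>\<^sub>F z in at x within polydisc. z k \<in> ball a (\<rho> / 2)"
            using tendstoD[OF ck, of "\<rho> / 2"] \<rho> by (simp add: dist_commute)
          have ev3: "\<forall>\<^sub>F z in at x within polydisc. dist (g (z(k := u n))) (g (x(k := u n))) < e / 4"
            by (rule tendstoD[OF _ e4]) (use gu[of n] x in \<open>simp add: continuous_on_def\<close>)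
          have ev4: "\<forall>\<^sub>F z in at x within polydisc. z \<in> polydisc" by (simp add: eventually_at_filter)
          from ev1 ev2 ev3 ev4 show "\<forall>\<^sub>F z in at x within polydisc. dist (g z) (g x) < e"
          proof eventually_elim
            case (elim z)
            have "norm (g (z(k := z k)) - g (z(k := u n))) \<le> L * norm (z k - u n)"
              by (rule lip[OF elim(4) elim(2) u(1)])
            then have "dist (g z) (g (z(k := u n))) < e / 4" using elim(1) by (simp add: dist_norm)
            moreover have "dist (g (x(k := u n))) (g x) < e / 4" using n(1) x True by (simp add: dist_norm)
            ultimately show ?case
              using elim(3) dist_triangle[of "g z" "g x" "g (z(k := u n))"] dist_triangle[of "g (z(k := u n))" "g x" "g (x(k := u n))"] e
              by linarith
          qed
        qed
      qed
    qed
  qed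
  have inv: "(\<lambda>z. inverse (z - a)) \<in> SAP (S k)"
    using a by (intro SAP_continuous continuous_intros) auto
  have "(\<lambda>z. if z \<in> polydisc then g z else 0) \<in> Hinf_SAPn S"
  proof (rule Hinf_SAPn_I[OF gc gj gb])
    show "(\<lambda>z. (F z + (- 1) * F0 z) * inverse (z k - a)) \<in> SAPn S"
      by (intro SAPn_mult SAPn_add SAPn_poly[OF SAP_poly.const] SAPn_poly[OF SAP_poly.var[where f = "\<lambda>w. inverse (w - a)" and S = S and k = k, OF inv]] F F0)
    show "AE z in torus. ((\<lambda>r. g (\<lambda>j. complex_of_real r * z j)) \<longlongrightarrow> (F z + (- 1) * F0 z) * inverse (z k - a)) (at_left 1)"
      using F(6) F0(3) AE_space
    proof eventually_elim
      case (elim z)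
      have zn: "norm (z j) = 1" for j using elim by (auto simp: space_torus)
      have za: "z k \<noteq> a" using zn[of k] a by auto
      have id: "((\<lambda>r. complex_of_real r * z k) \<longlongrightarrow> of_real 1 * z k) (at_left 1)" by (intro tendsto_intros)
      then have lim: "((\<lambda>r. (f (\<lambda>j. complex_of_real r * z j) + (- 1) * f0 (\<lambda>j. complex_of_real r * z j)) * inverse (complex_of_real r * z k - a))
         \<longlongrightarrow> (F z + (- 1) * F0 z) * inverse (of_real 1 * z k - a)) (at_left 1)"
        using za elim by (intro tendsto_intros) auto
      have "\<forall>\<^sub>F r in at_left 1. complex_of_real r * z k \<noteq> a"
        using tendsto_imp_eventually_ne[OF id, of a] za by simp
      then have "\<forall>\<^sub>F r in at_left 1. (f (\<lambda>j. complex_of_real r * z j) + (- 1) * f0 (\<lambda>j. complex_of_real r * z j)) * inverse (complex_of_real r * z k - a)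
           = g (\<lambda>j. complex_of_real r * z j)"
        using radial_eventually
      proof eventually_elim
        case (elim r)
        have "(\<lambda>j. complex_of_real r * z j) \<in> polydisc" using elim(2) zn by (simp add: polydisc_def norm_mult)
        from gq[OF this elim(1)] show ?case by (simp add: divide_inverse)
      qed
      from Lim_transform_eventually[OF lim this] show ?case by simp
    qed
  qed
  then show ?thesis
    by (rule bexI[rotated]) (use gm in auto)
qed

section \<open>Characters of function algebras\<close>

lemma continuous_map_complex_mult:
  fixes f g :: "'a \<Rightarrow> complex"
  shows "continuous_map X euclidean f \<Longrightarrow> continuous_map X euclidean g \<Longrightarrow> continuous_map X euclidean (\<lambda>x. f x * g x)"
  by (simp add: continuous_map_atin tendsto_mult)

lemma closedin_equalizer:
  fixes f g :: "'a \<Rightarrow> complex"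
  assumes "continuous_map X euclidean f" "continuous_map X euclidean g"
  shows "closedin X {x \<in> topspace X. f x = g x}"
  using closedin_continuous_map_preimage[OF continuous_map_diff[OF assms], of "{0}"] by simp

lemma closedin_Collect_ball:
  assumes "\<And>i. i \<in> I \<Longrightarrow> closedin X {x \<in> topspace X. P i x}"
  shows "closedin X {x \<in> topspace X. \<forall>i\<in>I. P i x}"
proof (cases "I = {}")
  case False
  then have "{x \<in> topspace X. \<forall>i\<in>I. P i x} = (\<Inter>i\<in>I. {x \<in> topspace X. P i x})" by auto
  then show ?thesis using closedin_INT[OF False assms] by simp
qed simp

text \<open>Since elements vanish off \<open>D\<close>, the unit is the indicator function of
  \<open>D\<close>; this explains the form of the constants.\<close>

locale bounded_function_algebra =
  fixes D :: "'a set" and A :: "('a \<Rightarrow> complex) set"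
  assumes nonempty: "D \<noteq> {}"
    and add: "f \<in> A \<Longrightarrow> g \<in> A \<Longrightarrow> (\<lambda>z. f z + g z) \<in> A"
    and mult: "f \<in> A \<Longrightarrow> g \<in> A \<Longrightarrow> (\<lambda>z. f z * g z) \<in> A"
    and const: "(\<lambda>z. if z \<in> D then c else 0) \<in> A"
    and bounded: "f \<in> A \<Longrightarrow> \<exists>C. \<forall>z\<in>D. norm (f z) \<le> C"
    and vanish: "f \<in> A \<Longrightarrow> z \<notin> D \<Longrightarrow> f z = 0"
begin

lemma cmult: "f \<in> A \<Longrightarrow> (\<lambda>z. c * f z) \<in> A"
proof -
  assume f: "f \<in> A"
  have "(\<lambda>z. c * f z) = (\<lambda>z. (if z \<in> D then c else 0) * f z)" using vanish[OF f] by (auto simp: fun_eq_iff)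
  then show ?thesis using mult[OF const f] by simp
qed

context
  fixes \<phi> assumes \<phi>: "\<phi> \<in> characters D A"
begin

lemma char_add: "f \<in> A \<Longrightarrow> g \<in> A \<Longrightarrow> \<phi> (\<lambda>z. f z + g z) = \<phi> f + \<phi> g"
  using \<phi> unfolding characters_def by blast

lemma char_cmult: "f \<in> A \<Longrightarrow> \<phi> (\<lambda>z. c * f z) = c * \<phi> f"
  using \<phi> unfolding characters_def by blast

lemma char_mult: "f \<in> A \<Longrightarrow> g \<in> A \<Longrightarrow> \<phi> (\<lambda>z. f z * g z) = \<phi> f * \<phi> g"
  using \<phi> unfolding characters_def by blast

lemma char_const: "\<phi> (\<lambda>z. if z \<in> D then c else 0) = c"
proof -
  let ?one = "\<lambda>z. if z \<in> D then 1 else 0 :: complex"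
  obtain f where f: "f \<in> A" "\<phi> f \<noteq> 0" using \<phi> unfolding characters_def by blast
  have "(\<lambda>z. ?one z * f z) = f" using vanish[OF f(1)] by (auto simp: fun_eq_iff)
  then have "\<phi> f = \<phi> ?one * \<phi> f" using char_mult[OF const f(1), of 1] by simp
  then have one: "\<phi> ?one = 1" using f(2) by simp
  have "(\<lambda>z. if z \<in> D then c else 0) = (\<lambda>z. c * ?one z)" by auto
  then show ?thesis using char_cmult[OF const, of c 1] one by simp
qed

lemma char_diff: "f \<in> A \<Longrightarrow> g \<in> A \<Longrightarrow> \<phi> (\<lambda>z. f z + (- 1) * g z) = \<phi> f - \<phi> g"
  using char_add[OF _ cmult, of f g "- 1"] char_cmult[of g "- 1"] by simp

lemma char_power:
  assumes f: "f \<in> A"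
  shows "(\<lambda>z. if z \<in> D then f z ^ m else 0) \<in> A \<and> \<phi> (\<lambda>z. if z \<in> D then f z ^ m else 0) = \<phi> f ^ m"
proof (induction m)
  case 0
  show ?case unfolding power_0 using const[of 1] char_const[of 1] by blast
next
  case (Suc m)
  have "(\<lambda>z. f z * (if z \<in> D then f z ^ m else 0)) = (\<lambda>z. if z \<in> D then f z ^ Suc m else 0)" by auto
  then show ?case using mult[OF f, of "\<lambda>z. if z \<in> D then f z ^ m else 0"] char_mult[OF f, of "\<lambda>z. if z \<in> D then f z ^ m else 0"] Suc by simp
qed

text \<open>The spectral radius argument: applying boundedness to powers of \<open>f\<close> bounds
  the \<open>m\<close>-th power of the value by a fixed multiple of the \<open>m\<close>-th power of
  the supremum, so the constant \<open>K\<close> may be replaced by 1.\<close>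

lemma char_bound:
  assumes f: "f \<in> A" and C: "\<And>z. z \<in> D \<Longrightarrow> norm (f z) \<le> C"
  shows "norm (\<phi> f) \<le> C"
proof (rule ccontr)
  assume "\<not> ?thesis"
  then have gt: "C < norm (\<phi> f)" by simp
  obtain z0 where z0: "z0 \<in> D" using nonempty by blast
  have C0: "C \<ge> 0" using C[OF z0] order_trans[OF norm_ge_zero] by blast
  obtain K where K: "\<forall>f\<in>A. norm (\<phi> f) \<le> K * (SUP z\<in>D. norm (f z))" using \<phi> unfolding characters_def by blast
  \<comment> \<open>Strictly below the value of the character, and positive even when
    \<open>C = 0\<close>, so that the quotient is defined and exceeds 1.\<close>
  define C' where "C' = (C + norm (\<phi> f)) / 2"
  have C': "C \<le> C'" "0 < C'" "C' < norm (\<phi> f)" using gt C0 by (auto simp: C'_def)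
  have pow: "norm (\<phi> f) ^ m \<le> \<bar>K\<bar> * C' ^ m" for m
  proof -
    define g where "g = (\<lambda>z. if z \<in> D then f z ^ m else 0)"
    have g: "g \<in> A" "\<phi> g = \<phi> f ^ m" unfolding g_def using char_power[OF f] by blast+
    have gb: "norm (g z) \<le> C' ^ m" if "z \<in> D" for z
      unfolding g_def using that order_trans[OF C[OF that] C'(1)] by (simp add: norm_power power_mono)
    have "norm (g z0) \<le> (SUP z\<in>D. norm (g z))" using gb by (intro cSUP_upper[OF z0] bdd_aboveI2)
    then have pos: "(SUP z\<in>D. norm (g z)) \<ge> 0" using order_trans[OF norm_ge_zero] by blast
    have le: "(SUP z\<in>D. norm (g z)) \<le> C' ^ m" using gb by (intro cSUP_least nonempty)
    have "norm (\<phi> g) \<le> K * (SUP z\<in>D. norm (g z))" using K g(1) by blast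
    also have "\<dots> \<le> \<bar>K\<bar> * C' ^ m" using pos le C'(2) by (intro mult_mono) auto
    finally show ?thesis using g(2) by (simp add: norm_power)
  qed
  have q: "1 < norm (\<phi> f) / C'" using C' by simp
  obtain m where "\<bar>K\<bar> < (norm (\<phi> f) / C') ^ m" using real_arch_pow[OF q] by blast
  then have "\<bar>K\<bar> * C' ^ m < norm (\<phi> f) ^ m" using C'(2) by (simp add: power_divide field_simps)
  then show False using pow[of m] by simp
qed

text \<open>Multiplication by a high power of a function peaking where \<open>x\<close> is equal to \<open>\<zeta>\<close> does not
  change the value of the character.\<close>

lemma char_peak:
  assumes x: "x \<in> A" "\<And>z. z \<in> D \<Longrightarrow> norm (x z) \<le> 1" "\<phi> x = \<zeta>" "norm \<zeta> = 1"
    and f: "f \<in> A" and pos: "d > 0" "e > 0"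
  shows "\<exists>g\<in>A. \<phi> g = \<phi> f \<and> (\<forall>z\<in>D. norm (g z) \<le> norm (f z) \<and> (dist (x z) \<zeta> \<ge> d \<longrightarrow> norm (g z) \<le> e))"
proof -
  \<comment> \<open>The mean of the unit and of \<open>x\<close> rotated so that its peak value is
    1. The character takes the value 1 on \<open>h\<close>, while the parallelogram law keeps the
    modulus of \<open>h\<close> below a constant less than 1 where \<open>x\<close> is far from
    \<open>\<zeta>\<close>.\<close>
  define h where "h = (\<lambda>z. (1/2) * ((if z \<in> D then 1 else 0) + cnj \<zeta> * x z))"
  have hA: "h \<in> A" unfolding h_def by (intro cmult add const x)
  have "\<phi> h = (1/2) * (1 + cnj \<zeta> * \<zeta>)"
    unfolding h_def by (simp only: char_cmult[OF add[OF const cmult[OF x(1)]]] char_add[OF const cmult[OF x(1)]] char_const char_cmult[OF x(1)] x(3))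
  then have \<phi>h: "\<phi> h = 1" using x(4) by (simp add: complex_norm_square[symmetric] mult.commute[of "cnj \<zeta>"])
  have h2: "(norm (h z))\<^sup>2 \<le> 1 - (dist (x z) \<zeta>)\<^sup>2 / 4" if z: "z \<in> D" for z
  proof -
    define w where "w = cnj \<zeta> * x z"
    have nw: "norm w \<le> 1" using x(2)[OF z] x(4) by (simp add: w_def norm_mult)
    have d: "dist (x z) \<zeta> = norm (1 - w)"
    proof -
      have "\<zeta> * (1 - w) = \<zeta> - (\<zeta> * cnj \<zeta>) * x z" by (simp add: w_def algebra_simps)
      also have "\<dots> = \<zeta> - x z" using x(4) by (simp add: complex_norm_square[symmetric])
      finally have "norm (\<zeta> - x z) = norm \<zeta> * norm (1 - w)" by (metis norm_mult)
      then show ?thesis using x(4) by (simp add: dist_norm norm_minus_commute)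
    qed
    have "(norm (1 + w))\<^sup>2 + (norm (1 - w))\<^sup>2 = 2 + 2 * (norm w)\<^sup>2"
      unfolding cmod_power2 by (simp add: power2_eq_square algebra_simps)
    moreover have "(norm w)\<^sup>2 \<le> 1" using nw by (simp add: abs_square_le_1)
    moreover have "(norm (h z))\<^sup>2 = (norm (1 + w))\<^sup>2 / 4"
      using z by (simp add: h_def w_def norm_mult power_divide norm_divide)
    ultimately show ?thesis unfolding d by simp
  qed
  define q where "q = sqrt (max 0 (1 - d\<^sup>2 / 4))"
  have q: "0 \<le> q" "q < 1" using pos by (auto simp: q_def real_sqrt_lt_1_iff)
  have h1: "norm (h z) \<le> 1" if "z \<in> D" for z
  proof -
    have "(norm (h z))\<^sup>2 \<le> 1" using h2[OF that] zero_le_power2[of "dist (x z) \<zeta>"] by linarith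
    then show ?thesis by (simp add: abs_square_le_1)
  qed
  have hq: "norm (h z) \<le> q" if "z \<in> D" "dist (x z) \<zeta> \<ge> d" for z
  proof -
    have "d\<^sup>2 \<le> (dist (x z) \<zeta>)\<^sup>2" using that(2) pos by (intro power_mono) auto
    then have "(norm (h z))\<^sup>2 \<le> 1 - d\<^sup>2 / 4" using h2[OF that(1)] by simp
    then have "(norm (h z))\<^sup>2 \<le> max 0 (1 - d\<^sup>2 / 4)" by simp
    then show ?thesis unfolding q_def by (rule real_le_rsqrt)
  qed
  obtain M where M: "\<forall>z\<in>D. norm (f z) \<le> M" using bounded[OF f] by blast
  have "(\<lambda>m. \<bar>M\<bar> * q ^ m) \<longlonglongrightarrow> \<bar>M\<bar> * 0" using q by (intro tendsto_intros LIMSEQ_realpow_zero)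
  then have "\<forall>\<^sub>F m in sequentially. \<bar>M\<bar> * q ^ m < e" using pos by (intro order_tendstoD(2)) auto
  then obtain m where m: "\<bar>M\<bar> * q ^ m < e" by (auto simp: eventually_sequentially)
  define g where "g = (\<lambda>z. f z * (if z \<in> D then h z ^ m else 0))"
  have "g \<in> A" unfolding g_def using mult[OF f] char_power[OF hA, of m] by blast
  moreover have "\<phi> g = \<phi> f"
    unfolding g_def using char_mult[OF f] char_power[OF hA, of m] \<phi>h by simp
  moreover have "norm (g z) \<le> norm (f z)" if "z \<in> D" for z
    using h1[OF that] that by (simp add: g_def norm_mult norm_power mult_left_le power_le_one)
  moreover have "norm (g z) \<le> e" if "z \<in> D" "dist (x z) \<zeta> \<ge> d" for z
  proof -
    have "norm (g z) = norm (f z) * norm (h z) ^ m" using that by (simp add: g_def norm_mult norm_power)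
    also have "\<dots> \<le> \<bar>M\<bar> * q ^ m"
      using M that(1) hq[OF that] by (intro mult_mono power_mono) (auto intro: order_trans[OF bspec[OF M that(1)]])
    finally show ?thesis using m by simp
  qed
  ultimately show ?thesis by (intro bexI[of _ g]) auto
qed

end

lemma point_eval_characters:
  assumes z: "z \<in> D"
  shows "point_eval A z \<in> characters D A"
  unfolding characters_def
proof (intro CollectI conjI ballI allI)
  show "point_eval A z \<in> A \<rightarrow>\<^sub>E UNIV" by (simp add: point_eval_def)
  show "point_eval A z (\<lambda>x. f x + g x) = point_eval A z f + point_eval A z g" if "f \<in> A" "g \<in> A" for f g
    using that add[OF that] by (simp add: point_eval_def)
  show "point_eval A z (\<lambda>x. c * f x) = c * point_eval A z f" if "f \<in> A" for f c
    using that cmult[OF that] by (simp add: point_eval_def)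
  show "point_eval A z (\<lambda>x. f x * g x) = point_eval A z f * point_eval A z g" if "f \<in> A" "g \<in> A" for f g
    using that mult[OF that] by (simp add: point_eval_def)
  show "\<exists>f\<in>A. point_eval A z f \<noteq> 0"
    using z by (intro bexI[OF _ const[of 1]]) (simp add: point_eval_def const)
  show "\<exists>C. \<forall>f\<in>A. norm (point_eval A z f) \<le> C * (SUP z\<in>D. norm (f z))"
  proof (intro exI[of _ 1] ballI)
    fix f assume f: "f \<in> A"
    from bounded[OF f] obtain M where M: "\<forall>z\<in>D. norm (f z) \<le> M" by blast
    have "norm (f z) \<le> (SUP z\<in>D. norm (f z))" using M by (intro cSUP_upper[OF z] bdd_aboveI2[where M = M]) auto
    then show "norm (point_eval A z f) \<le> 1 * (SUP z\<in>D. norm (f z))" using f by (simp add: point_eval_def)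
  qed
qed

lemma topspace_max_ideal_space: "topspace (max_ideal_space D A) = characters D A"
  unfolding max_ideal_space_def characters_def by auto

lemma continuous_map_eval:
  "f \<in> A \<Longrightarrow> continuous_map (max_ideal_space D A) euclidean (\<lambda>\<phi>. \<phi> f)"
  unfolding max_ideal_space_def
  by (intro continuous_map_from_subtopology continuous_map_product_coordinates)

lemma Hausdorff_max_ideal_space: "Hausdorff_space (max_ideal_space D A)"
  unfolding max_ideal_space_def
  by (intro Hausdorff_space_subtopology) (auto simp: Hausdorff_space_product_topology)

text \<open>The characters form a closed subset of a compact product of discs. Not vanishing
  identically is no closed condition, so it is replaced by the value 1 at the unit.\<close>

lemma compact_max_ideal_space: "compact_space (max_ideal_space D A)"
proof -
  let ?X = "product_topology (\<lambda>f. euclidean :: complex topology) A"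
  define B where "B f = (SUP z\<in>D. norm (f z))" for f :: "'a \<Rightarrow> complex"
  have B: "norm (f z) \<le> B f" if f: "f \<in> A" and z: "z \<in> D" for f z
  proof -
    obtain M where "\<forall>z\<in>D. norm (f z) \<le> M" using bounded[OF f] by blast
    then show ?thesis unfolding B_def by (intro cSUP_upper[OF z] bdd_aboveI2[where M = M]) auto
  qed
  define K where "K = (\<Pi>\<^sub>E f\<in>A. cball 0 (B f) :: complex set)"
  define one where "one = (\<lambda>z. if z \<in> D then 1 else 0 :: complex)"
  have one: "one \<in> A" unfolding one_def by (rule const)
  let ?P = "{\<phi> \<in> topspace ?X. \<forall>f\<in>A. \<forall>g\<in>A. \<phi> (\<lambda>z. f z + g z) = \<phi> f + \<phi> g}"
  let ?Q = "{\<phi> \<in> topspace ?X. \<forall>f\<in>A. \<forall>c\<in>UNIV. \<phi> (\<lambda>z. c * f z) = c * \<phi> f}"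
  let ?R = "{\<phi> \<in> topspace ?X. \<forall>f\<in>A. \<forall>g\<in>A. \<phi> (\<lambda>z. f z * g z) = \<phi> f * \<phi> g}"
  let ?T = "{\<phi> \<in> topspace ?X. \<phi> one = 1}"
  have top: "topspace ?X = A \<rightarrow>\<^sub>E UNIV" by simp
  have eq: "characters D A = K \<inter> ?P \<inter> ?Q \<inter> ?R \<inter> ?T"
  proof (intro equalityI subsetI)
    fix \<phi> assume \<phi>: "\<phi> \<in> characters D A"
    have ext: "\<phi> \<in> A \<rightarrow>\<^sub>E UNIV" using \<phi> by (simp add: characters_def)
    then have "\<phi> \<in> K" unfolding K_def using char_bound[OF \<phi>] B by (auto simp: PiE_iff)
    moreover have "\<phi> one = 1" unfolding one_def by (rule char_const[OF \<phi>])
    ultimately show "\<phi> \<in> K \<inter> ?P \<inter> ?Q \<inter> ?R \<inter> ?T"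
      unfolding top using ext char_add[OF \<phi>] char_cmult[OF \<phi>] char_mult[OF \<phi>] by blast
  next
    fix \<phi> assume \<phi>: "\<phi> \<in> K \<inter> ?P \<inter> ?Q \<inter> ?R \<inter> ?T"
    have b: "\<forall>f\<in>A. norm (\<phi> f) \<le> 1 * (SUP z\<in>D. norm (f z))"
      using \<phi> by (auto simp: K_def PiE_iff B_def)
    show "\<phi> \<in> characters D A" unfolding characters_def
    proof (intro CollectI conjI)
      show "\<phi> \<in> A \<rightarrow>\<^sub>E UNIV" using \<phi> by (simp add: PiE_iff)
      show "\<exists>f\<in>A. \<phi> f \<noteq> 0" using \<phi> by (intro bexI[OF _ one]) simp
      show "\<exists>C. \<forall>f\<in>A. norm (\<phi> f) \<le> C * (SUP z\<in>D. norm (f z))" using b by blast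
    qed (use \<phi> in auto)
  qed
  have ev: "continuous_map ?X euclidean (\<lambda>\<phi>. \<phi> f)" if "f \<in> A" for f
    using that by (rule continuous_map_product_coordinates)
  have K: "compactin ?X K" unfolding K_def compactin_PiE by simp
  have P: "closedin ?X ?P"
    by (intro closedin_Collect_ball closedin_equalizer continuous_map_add ev add)
  have Q: "closedin ?X ?Q"
    by (intro closedin_Collect_ball closedin_equalizer continuous_map_complex_mult ev cmult) simp_all
  have R: "closedin ?X ?R"
    by (intro closedin_Collect_ball closedin_equalizer continuous_map_complex_mult ev mult)
  have T: "closedin ?X ?T"
    by (intro closedin_equalizer ev one) simp
  have "compactin ?X (characters D A)"
    unfolding eq by (intro compact_Int_closedin K P Q R T)
  then show ?thesis unfolding max_ideal_space_def by (rule compact_space_subtopology)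
qed

text \<open>A basic open set of the product topology constrains finitely many coordinates, so
  simultaneous approximation on finite sets of functions is enough.\<close>

lemma closure_of_point_eval:
  assumes \<phi>: "\<phi> \<in> characters D A" and X: "X \<subseteq> D"
    and approx: "\<And>F \<epsilon>. finite F \<Longrightarrow> F \<subseteq> A \<Longrightarrow> \<epsilon> > 0 \<Longrightarrow> \<exists>z\<in>X. \<forall>f\<in>F. norm (\<phi> f - f z) < \<epsilon>"
  shows "\<phi> \<in> max_ideal_space D A closure_of (point_eval A ` X)"
  unfolding in_closure_of topspace_max_ideal_space
proof (intro conjI allI impI)
  fix T assume T: "\<phi> \<in> T \<and> openin (max_ideal_space D A) T"
  then obtain U where U: "openin (product_topology (\<lambda>f. euclidean :: complex topology) A) U" "T = U \<inter> characters D A"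
    unfolding max_ideal_space_def openin_subtopology by blast
  then obtain V where V: "finite {f \<in> A. V f \<noteq> UNIV}" "\<forall>f\<in>A. open (V f)" "\<phi> \<in> Pi\<^sub>E A V" "Pi\<^sub>E A V \<subseteq> U"
    using T unfolding openin_product_topology_alt by auto
  define F where "F = {f \<in> A. V f \<noteq> UNIV}"
  have "\<forall>f\<in>F. \<exists>e>0. ball (\<phi> f) e \<subseteq> V f"
    using V(2,3) by (auto simp: F_def PiE_iff open_contains_ball)
  then obtain e where e: "\<forall>f\<in>F. e f > 0 \<and> ball (\<phi> f) (e f) \<subseteq> V f" by (auto simp: bchoice_iff)
  define \<epsilon> where "\<epsilon> = Min (insert 1 (e ` F))"
  have fin: "finite F" using V(1) by (simp add: F_def)
  have \<epsilon>: "\<epsilon> > 0" "\<And>f. f \<in> F \<Longrightarrow> \<epsilon> \<le> e f" using fin e by (auto simp: \<epsilon>_def)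
  obtain z where z: "z \<in> X" "\<forall>f\<in>F. norm (\<phi> f - f z) < \<epsilon>"
    using approx[OF fin _ \<epsilon>(1)] by (auto simp: F_def)
  have "f z \<in> V f" if f: "f \<in> A" for f
  proof (cases "f \<in> F")
    case True
    have "dist (\<phi> f) (f z) < e f" using z(2) \<epsilon>(2)[OF True] True by (auto simp: dist_norm intro: order_less_le_trans)
    then have "f z \<in> ball (\<phi> f) (e f)" by simp
    then show ?thesis using e True by blast
  qed (use f in \<open>simp add: F_def\<close>)
  then have "point_eval A z \<in> Pi\<^sub>E A V" by (simp add: point_eval_def)
  moreover have "point_eval A z \<in> characters D A" using z(1) X by (intro point_eval_characters) auto
  ultimately have "point_eval A z \<in> T" using V(4) U(2) by blast
  then show "\<exists>y. y \<in> point_eval A ` X \<and> y \<in> T" using z(1) by blast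
qed (rule \<phi>)

end

section \<open>Density of the disc\<close>

text \<open>The defect \<open>a x - x * a 1\<close> is multiplied by \<open>n\<close> when
  \<open>x\<close> is, yet it depends only on the fractional part of the argument and is thus at
  most \<open>2 * K\<close>; hence it is 0.\<close>

lemma additive_bounded_linear:
  fixes a :: "real \<Rightarrow> real"
  assumes add: "\<And>x y. a (x + y) = a x + a y" and bound: "\<And>x. \<bar>a x\<bar> \<le> K * \<bar>x\<bar>"
  shows "a x = x * a 1"
proof -
  have nat: "a (real n * y) = real n * a y" for n y
  proof (induction n)
    case 0
    show ?case using add[of 0 0] by simp
  next
    case (Suc n)
    have "a (real (Suc n) * y) = a (y + real n * y)" by (simp add: algebra_simps)
    then show ?case using Suc by (simp add: add algebra_simps)
  qed
  have neg: "a (- y) = - a y" for y using add[of y "- y"] add[of 0 0] by simp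
  have int: "a (of_int m) = of_int m * a 1" for m
  proof (cases "m \<ge> 0")
    case True
    then show ?thesis using nat[of "nat m" 1] by simp
  next
    case False
    then show ?thesis using nat[of "nat (- m)" 1] neg[of "of_int m"] by simp
  qed
  have K: "K \<ge> 0" using bound[of 1] abs_ge_zero[of "a 1"] by simp
  have "real n * \<bar>a x - x * a 1\<bar> \<le> 2 * K" for n
  proof -
    define y where "y = real n * x"
    have "a y = a (of_int \<lfloor>y\<rfloor>) + a (frac y)" using add[of "of_int \<lfloor>y\<rfloor>" "frac y"] by (simp add: frac_def)
    then have "a y - y * a 1 = a (frac y) - frac y * a 1" by (simp add: int frac_def algebra_simps)
    also have "\<bar>\<dots>\<bar> \<le> \<bar>a (frac y)\<bar> + \<bar>frac y * a 1\<bar>" by simp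
    also have "\<dots> \<le> K * 1 + 1 * K"
    proof (rule add_mono)
      have "K * \<bar>frac y\<bar> \<le> K * 1" using K frac_lt_1[of y] frac_ge_0[of y] by (intro mult_left_mono) auto
      then show "\<bar>a (frac y)\<bar> \<le> K * 1" using bound[of "frac y"] by linarith
      show "\<bar>frac y * a 1\<bar> \<le> 1 * K"
        unfolding abs_mult using bound[of 1] frac_lt_1[of y] frac_ge_0[of y] by (intro mult_mono) auto
    qed
    finally have "\<bar>real n * (a x - x * a 1)\<bar> \<le> 2 * K" unfolding y_def nat by (simp add: algebra_simps)
    then show ?thesis by (simp add: abs_mult)
  qed
  then have "\<bar>a x - x * a 1\<bar> = 0"
    using real_archimedian_rdiv_eq_0[where x = "\<bar>a x - x * a 1\<bar>" and c = "2 * K"] K by simp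
  then show ?thesis by simp
qed

text \<open>Kronecker's theorem: the mass of the Fejer kernel twisted by \<open>\<alpha>\<close> concentrates on the points \<open>x\<close>
  where \<open>cis (l * x)\<close> is close to \<open>\<alpha> l\<close>.\<close>

lemma Kronecker_homomorphism:
  fixes \<alpha> :: "real \<Rightarrow> complex"
  assumes hom: "\<And>l m. \<alpha> (l + m) = \<alpha> l * \<alpha> m" and unit: "\<And>l. norm (\<alpha> l) = 1"
    and fin: "finite \<Lambda>" and e: "e > 0"
  shows "\<exists>x>R. \<forall>l\<in>\<Lambda>. norm (cis (l * x) - \<alpha> l) \<le> e"
proof -
  \<comment> \<open>Small enough for the limiting mean of the kernel times the sum of squared
    distances to be at most \<open>e\<^sup>2 / 4\<close>.\<close>
  define \<eta> where "\<eta> = e\<^sup>2 / (8 * (real (card \<Lambda>) + 1))"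
  have \<eta>: "\<eta> > 0" using e by (simp add: \<eta>_def add_nonneg_pos)
  obtain E where E: "finite E" "E \<noteq> {}" "\<forall>l\<in>\<Lambda>. real (card (E \<inter> (+) l ` E)) \<ge> (1 - \<eta>) * real (card E)"
    using Folner_set[OF fin \<eta>] by blast
  have cE: "real (card E) > 0" using E by (simp add: card_gt_0_iff)
  define g where "g = fejer \<alpha> E"
  have g0: "g x \<ge> 0" for x unfolding g_def by (rule fejer_nonneg)
  note mean = fejer_mean[of \<alpha>, OF hom unit E(1), folded g_def]
  define d where "d x = (\<Sum>l\<in>\<Lambda>. (norm (cis (l * x) - \<alpha> l))\<^sup>2)" for x
  have d_eq: "(norm (cis (l * x) - \<alpha> l))\<^sup>2 = 2 - 2 * Re (cis (- l * x) * \<alpha> l)" for l x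
  proof -
    have "(norm (cis (l * x) - \<alpha> l))\<^sup>2 = (norm (cis (l * x)))\<^sup>2 + (norm (\<alpha> l))\<^sup>2 - 2 * Re (cnj (cis (l * x)) * \<alpha> l)"
      unfolding cmod_power2 by (simp add: power2_eq_square algebra_simps)
    then show ?thesis by (simp add: unit cis_cnj)
  qed
  show ?thesis
  proof (rule ccontr)
    \<comment> \<open>If no \<open>x > R\<close> served, \<open>d\<close> would be at least
      \<open>e\<^sup>2\<close> on the averaged range; with a kernel of mean above
      \<open>1 / 2\<close> its weighted mean would be at least \<open>e\<^sup>2 / 2\<close>, against
      the limit of at most \<open>e\<^sup>2 / 4\<close>.\<close>
    assume neg: "\<not> ?thesis"
    have big: "e\<^sup>2 \<le> d x" if x: "x > R" for x
    proof -
      obtain l where l: "l \<in> \<Lambda>" "\<not> norm (cis (l * x) - \<alpha> l) \<le> e" using neg x by blast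
      then have "e\<^sup>2 \<le> (norm (cis (l * x) - \<alpha> l))\<^sup>2" using e by (intro power_mono) auto
      also have "\<dots> \<le> d x" unfolding d_def using fin l(1) by (intro member_le_sum) auto
      finally show ?thesis .
    qed
    define M where "M N = avg N (\<lambda>x. of_real (g x))" for N
    define V where "V N l = avg N (\<lambda>x. of_real (g x) * (cis (- l * x) * \<alpha> l))" for N l
    have M1: "M \<longlonglongrightarrow> 1"
    proof -
      have "\<alpha> 0 = 1" by (rule unit_hom_0[of \<alpha>, OF hom unit])
      then show ?thesis using mean[of 0] cE unfolding M_def by simp
    qed
    have upper: "(\<lambda>N. \<Sum>l\<in>\<Lambda>. 2 * Re (M N) - 2 * Re (V N l)) \<longlonglongrightarrow>
       (\<Sum>l\<in>\<Lambda>. 2 * Re 1 - 2 * Re (of_nat (card (E \<inter> (+) l ` E)) / of_nat (card E)))"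
      unfolding V_def by (intro tendsto_intros M1 mean)
    have small: "(\<Sum>l\<in>\<Lambda>. 2 * Re 1 - 2 * Re (of_nat (card (E \<inter> (+) l ` E)) / of_nat (card E))) \<le> e\<^sup>2 / 4"
    proof -
      have "(\<Sum>l\<in>\<Lambda>. 2 * Re 1 - 2 * Re (of_nat (card (E \<inter> (+) l ` E)) / of_nat (card E))) \<le> (\<Sum>l\<in>\<Lambda>. 2 * \<eta>)"
      proof (rule sum_mono)
        fix l assume "l \<in> \<Lambda>"
        then have "1 - \<eta> \<le> real (card (E \<inter> (+) l ` E)) / real (card E)" using E(3) cE by (simp only: pos_le_divide_eq)
        moreover have "Re (of_nat (card (E \<inter> (+) l ` E)) / of_nat (card E)) = real (card (E \<inter> (+) l ` E)) / real (card E)"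
          by (metis Re_complex_of_real of_real_divide of_real_of_nat_eq)
        ultimately show "2 * Re 1 - 2 * Re (of_nat (card (E \<inter> (+) l ` E)) / of_nat (card E)) \<le> 2 * \<eta>" by simp
      qed
      also have "\<dots> = real (card \<Lambda>) * (2 * \<eta>)" by simp
      also have "\<dots> \<le> (real (card \<Lambda>) + 1) * (2 * \<eta>)" using \<eta> by (intro mult_right_mono) auto
      also have "\<dots> = e\<^sup>2 / 4"
      proof -
        have "c * (2 * (y / (8 * c))) = y / 4" if "c > 0" for c y :: real using that by simp
        then show ?thesis unfolding \<eta>_def by (simp only: add_nonneg_pos of_nat_0_le_iff zero_less_one)
      qed
      finally show ?thesis by simp
    qed
    have "\<forall>\<^sub>F N in sequentially. (\<Sum>l\<in>\<Lambda>. 2 * Re (M N) - 2 * Re (V N l)) < e\<^sup>2 / 2"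
      by (rule order_tendstoD(2)[OF upper]) (rule order_le_less_trans[OF small], use e in simp)
    moreover have "\<forall>\<^sub>F N in sequentially. Re (M N) > 1 / 2"
      using tendsto_Re[OF M1] by (rule order_tendstoD(1)) simp
    moreover have "\<forall>\<^sub>F N in sequentially. real N > R"
      using filterlim_real_sequentially by (simp add: filterlim_at_top_dense)
    moreover have "\<forall>\<^sub>F N in sequentially. N > 0" by (rule eventually_gt_at_top)
    ultimately have "\<forall>\<^sub>F N in sequentially. False"
    proof eventually_elim
      case (elim N)
      have "avg N (\<lambda>x. of_real (g x * d x)) = (\<Sum>l\<in>\<Lambda>. avg N (\<lambda>x. of_real (g x * (norm (cis (l * x) - \<alpha> l))\<^sup>2)))"
        unfolding d_def sum_distrib_left of_real_sum by (rule avg_sum)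
      moreover have "Re (avg N (\<lambda>x. of_real (g x * (norm (cis (l * x) - \<alpha> l))\<^sup>2))) = 2 * Re (M N) - 2 * Re (V N l)" for l
      proof -
        have Re_avg: "Re (avg N f) = (\<Sum>j<N\<^sup>2. Re (f (real N + real j / real N))) / real (N\<^sup>2)" for f
          by (simp add: avg_def Re_divide_of_nat del: of_nat_power)
        have eq: "Re (of_real (g x * (2 - 2 * Re w))) = 2 * Re (of_real (g x)) - 2 * Re (of_real (g x) * w)" for x and w :: complex
          by (simp add: algebra_simps)
        show ?thesis
          unfolding d_eq M_def V_def Re_avg eq sum_subtractf diff_divide_distrib by (simp only: sum_distrib_left times_divide_eq_right)
      qed
      ultimately have "Re (avg N (\<lambda>x. of_real (g x * d x))) < e\<^sup>2 / 2" using elim(1) by simp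
      moreover have "norm (avg N (\<lambda>x. of_real (e\<^sup>2 * g x))) \<le> Re (avg N (\<lambda>x. of_real (g x * d x)))"
      proof (rule avg_le[OF elim(4)])
        fix x :: real assume "x \<ge> real N"
        then have "e\<^sup>2 \<le> d x" using elim(3) by (intro big) simp
        then show "norm (complex_of_real (e\<^sup>2 * g x)) \<le> g x * d x"
          using g0[of x] by (simp add: mult.commute[of "g x"] mult_right_mono del: of_real_mult of_real_power)
      qed
      moreover have "avg N (\<lambda>x. of_real (e\<^sup>2 * g x)) = of_real (e\<^sup>2) * M N"
        unfolding M_def of_real_mult by (rule avg_mult)
      moreover have "norm (of_real (e\<^sup>2) * M N) \<ge> e\<^sup>2 * (1 / 2)"
      proof -
        have "1 / 2 \<le> norm (M N)" using elim(2) complex_Re_le_cmod[of "M N"] by linarith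
        then have "e\<^sup>2 * (1 / 2) \<le> e\<^sup>2 * norm (M N)" by (intro mult_left_mono) auto
        then show ?thesis by (simp only: norm_mult norm_of_real abs_power2)
      qed
      ultimately show False by simp
    qed
    then show False by simp
  qed
qed

text \<open>Logarithmic polar coordinates at \<open>\<zeta>\<close>, in which
  \<open>1 - cnj \<zeta> * z\<close> has modulus \<open>exp (- x)\<close> and argument
  \<open>\<theta>\<close>. The modulus of a power depends on \<open>\<theta>\<close> only, its phase
  on \<open>x\<close> only, so the two can be prescribed independently.\<close>

lemma log_power_polar:
  assumes \<zeta>: "norm \<zeta> = 1" and \<theta>: "\<bar>\<theta>\<bar> < pi / 2" and x: "exp (- x) < 2 * cos \<theta>"
    and z: "z = \<zeta> * (1 - of_real (exp (- x)) * cis \<theta>)"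
  shows "norm z < 1" "dist z \<zeta> = exp (- x)" "log_power \<zeta> l z = of_real (exp (- l * \<theta>)) * cis (- l * x)"
proof -
  define t where "t = exp (- x)"
  have t: "t > 0" "t < 2 * cos \<theta>" using x by (auto simp: t_def)
  have "(norm (1 - of_real t * cis \<theta>))\<^sup>2 = (1 - t * cos \<theta>)\<^sup>2 + (t * sin \<theta>)\<^sup>2"
    unfolding cmod_power2 by simp
  also have "\<dots> = 1 - 2 * t * cos \<theta> + t\<^sup>2 * ((cos \<theta>)\<^sup>2 + (sin \<theta>)\<^sup>2)" by algebra
  also have "\<dots> = 1 - t * (2 * cos \<theta> - t)" unfolding sin_cos_squared_add2 by (simp add: power2_eq_square algebra_simps)
  also have "\<dots> < 1" using t by simp
  finally show "norm z < 1" using \<zeta> by (simp add: z t_def norm_mult abs_square_less_1)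
  have "z - \<zeta> = - (\<zeta> * (of_real t * cis \<theta>))" by (simp add: z t_def algebra_simps)
  then have "norm (z - \<zeta>) = norm \<zeta> * norm (of_real t * cis \<theta>)" by (simp only: norm_minus_cancel norm_mult)
  then show "dist z \<zeta> = exp (- x)" using \<zeta> t by (simp add: dist_norm norm_mult t_def)
  have \<zeta>c: "cnj \<zeta> * \<zeta> = 1" using \<zeta> by (simp add: complex_norm_square[symmetric] mult.commute[of "cnj \<zeta>"])
  have "1 - cnj \<zeta> * z = 1 - (cnj \<zeta> * \<zeta>) * (1 - of_real (exp (- x)) * cis \<theta>)" by (simp only: z mult.assoc)
  also have "\<dots> = exp (Complex (- x) \<theta>)" unfolding \<zeta>c by (simp add: exp_eq_polar exp_of_real)
  finally have e: "1 - cnj \<zeta> * z = exp (Complex (- x) \<theta>)" .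
  have "Ln (exp (Complex (- x) \<theta>)) = Complex (- x) \<theta>" using \<theta> by (intro Ln_exp) auto
  then have "log_power \<zeta> l z = exp (\<i> * of_real l * Complex (- x) \<theta>)" unfolding log_power_def e by simp
  also have "\<i> * of_real l * Complex (- x) \<theta> = Complex (- l * \<theta>) (- l * x)"
    by (simp add: complex_eq_iff)
  also have "exp (Complex (- l * \<theta>) (- l * x)) = of_real (exp (- l * \<theta>)) * cis (- l * x)"
    by (simp add: exp_eq_polar exp_of_real)
  finally show "log_power \<zeta> l z = of_real (exp (- l * \<theta>)) * cis (- l * x)" .
qed

text \<open>The logarithm of the modulus of \<open>h\<close> is additive with a linear bound, hence
  linear, and determines an angle \<open>\<theta>\<close>. The phase is a unitary homomorphism, to
  which Kronecker's theorem applies at arbitrarily large \<open>x\<close>, that is, arbitrarily near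
  \<open>\<zeta>\<close>.\<close>

lemma log_power_homomorphism_approx:
  fixes h :: "real \<Rightarrow> complex"
  assumes \<zeta>: "norm \<zeta> = 1" and hom: "\<And>l m. h (l + m) = h l * h m" and one: "h 0 = 1"
    and bound: "\<And>l. norm (h l) \<le> exp (\<bar>l\<bar> * (pi / 2))"
    and fin: "finite \<Lambda>" and e: "e > 0" and d: "\<delta> > 0"
  shows "\<exists>z. norm z < 1 \<and> dist z \<zeta> < \<delta> \<and> (\<forall>l\<in>\<Lambda>. norm (log_power \<zeta> l z - h l) \<le> e)"
proof -
  have nz: "h l \<noteq> 0" for l using hom[of l "- l"] one by auto
  define a where "a l = ln (norm (h l))" for l
  have a_add: "a (l + m) = a l + a m" for l m
    unfolding a_def hom norm_mult using nz by (simp add: ln_mult)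
  have a_le: "a l \<le> pi / 2 * \<bar>l\<bar>" for l
  proof -
    have "ln (norm (h l)) \<le> ln (exp (\<bar>l\<bar> * (pi / 2)))" using nz[of l] bound[of l] by (simp del: ln_exp)
    then show ?thesis by (simp add: a_def mult.commute)
  qed
  have a_abs: "\<bar>a l\<bar> \<le> pi / 2 * \<bar>l\<bar>" for l
  proof -
    have "a l + a (- l) = 0" using a_add[of l "- l"] one by (simp add: a_def)
    then show ?thesis using a_le[of l] a_le[of "- l"] by simp
  qed
  define \<theta> where "\<theta> = - a 1"
  have \<theta>: "\<bar>\<theta>\<bar> \<le> pi / 2" using a_abs[of 1] by (simp add: \<theta>_def)
  have a_lin: "a l = - l * \<theta>" for l
    using additive_bounded_linear[of a "pi / 2", OF a_add a_abs, of l] by (simp add: \<theta>_def)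
  have nh: "norm (h l) = exp (- l * \<theta>)" for l
    using a_lin[of l] nz[of l] unfolding a_def by (metis exp_ln norm_eq_zero zero_less_norm_iff)
  \<comment> \<open>The phase of a power is \<open>cis (- l * x)\<close>, hence the reflected
    argument.\<close>
  define \<alpha> where "\<alpha> l = h (- l) / of_real (norm (h (- l)))" for l
  have \<alpha>: "\<alpha> (l + m) = \<alpha> l * \<alpha> m" "norm (\<alpha> l) = 1" for l m
    using hom[of "- l" "- m"] nz by (auto simp: \<alpha>_def norm_mult norm_divide)
  have h\<alpha>: "h l = of_real (exp (- l * \<theta>)) * \<alpha> (- l)" for l
  proof -
    have "of_real (norm (h l)) * (h (- (- l)) / of_real (norm (h (- (- l))))) = h l" using nz[of l] by simp
    then show ?thesis unfolding \<alpha>_def nh[of l] by (rule sym)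
  qed
  define B where "B = exp ((\<Sum>l\<in>\<Lambda>. \<bar>l\<bar>) * (pi / 2))"
  have B: "B > 0" by (simp add: B_def)
  have Bl: "exp (- l * \<theta>) \<le> B" if "l \<in> \<Lambda>" for l
  proof -
    have "\<bar>l\<bar> \<le> (\<Sum>l\<in>\<Lambda>. \<bar>l\<bar>)" using fin that by (intro member_le_sum) auto
    then have "\<bar>l\<bar> * \<bar>\<theta>\<bar> \<le> (\<Sum>l\<in>\<Lambda>. \<bar>l\<bar>) * (pi / 2)" using \<theta> by (intro mult_mono) auto
    moreover have "- l * \<theta> \<le> \<bar>l\<bar> * \<bar>\<theta>\<bar>" by (simp add: abs_ge_minus_self flip: abs_mult)
    ultimately show ?thesis unfolding B_def by simp
  qed
  have "\<forall>\<^sub>F t in at_left 1. \<forall>l\<in>\<Lambda>. dist (exp (- l * (t * \<theta>))) (exp (- l * (1 * \<theta>))) < e / 2"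
  proof (intro eventually_ball_finite fin ballI)
    fix l
    have "((\<lambda>t. exp (- l * (t * \<theta>))) \<longlongrightarrow> exp (- l * (1 * \<theta>))) (at_left 1)" by (intro tendsto_intros)
    then show "\<forall>\<^sub>F t in at_left 1. dist (exp (- l * (t * \<theta>))) (exp (- l * (1 * \<theta>))) < e / 2" using e by (intro tendstoD) auto
  qed
  then have "\<forall>\<^sub>F t in at_left (1::real). (0 < t \<and> t < 1) \<and> (\<forall>l\<in>\<Lambda>. dist (exp (- l * (t * \<theta>))) (exp (- l * (1 * \<theta>))) < e / 2)"
    using radial_eventually by eventually_elim blast
  then obtain t where t: "0 < t" "t < 1" "\<forall>l\<in>\<Lambda>. dist (exp (- l * (t * \<theta>))) (exp (- l * (1 * \<theta>))) < e / 2"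
    using eventually_happens trivial_limit_at_left_real by blast
  \<comment> \<open>\<open>\<theta>\<close> may be \<open>pi / 2\<close> or \<open>- pi / 2\<close>,
    directions in which no point of the disc is available. The factor \<open>t\<close> below 1
    brings the angle inside and moves the finitely many moduli by less than
    \<open>e / 2\<close>.\<close>
  define \<theta>' where "\<theta>' = t * \<theta>"
  have \<theta>': "\<bar>\<theta>'\<bar> < pi / 2"
  proof -
    have "\<bar>\<theta>'\<bar> \<le> t * (pi / 2)" using \<theta> t by (simp add: \<theta>'_def abs_mult)
    also have "\<dots> < 1 * (pi / 2)" using t by (intro mult_strict_right_mono) auto
    finally show ?thesis by simp
  qed
  have cpos: "cos \<theta>' > 0" using \<theta>' by (intro cos_gt_zero_pi) auto
  define \<delta>' where "\<delta>' = min \<delta> (2 * cos \<theta>')"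
  have \<delta>': "\<delta>' > 0" using d cpos by (simp add: \<delta>'_def)
  have e2: "e / (2 * B) > 0" using e B by simp
  obtain x where x: "x > - ln \<delta>'" "\<forall>l\<in>uminus ` \<Lambda>. norm (cis (l * x) - \<alpha> l) \<le> e / (2 * B)"
    using Kronecker_homomorphism[of \<alpha> "uminus ` \<Lambda>" "e / (2 * B)" "- ln \<delta>'", OF \<alpha> finite_imageI[OF fin] e2] by blast
  have ex: "exp (- x) < \<delta>'"
  proof -
    have "exp (- x) < exp (ln \<delta>')" using x(1) by simp
    then show ?thesis using \<delta>' by simp
  qed
  define z where "z = \<zeta> * (1 - of_real (exp (- x)) * cis \<theta>')"
  have ex': "exp (- x) < 2 * cos \<theta>'" using ex by (simp add: \<delta>'_def)
  note lp = log_power_polar[OF \<zeta> \<theta>' ex' z_def]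
  have "norm (log_power \<zeta> l z - h l) \<le> e" if l: "l \<in> \<Lambda>" for l
  proof -
    have "log_power \<zeta> l z - h l = of_real (exp (- l * \<theta>') - exp (- l * \<theta>)) * cis (- l * x)
        + of_real (exp (- l * \<theta>)) * (cis (- l * x) - \<alpha> (- l))"
      unfolding lp(3) h\<alpha>[of l] of_real_diff by (simp only: algebra_simps)
    also have "norm \<dots> \<le> \<bar>exp (- l * \<theta>') - exp (- l * \<theta>)\<bar> + exp (- l * \<theta>) * norm (cis (- l * x) - \<alpha> (- l))"
      by (rule order_trans[OF norm_triangle_ineq]) (simp only: norm_mult norm_of_real norm_cis abs_exp_cancel mult_1_right order_refl)
    also have "\<dots> \<le> e / 2 + B * (e / (2 * B))"
      using t(3) x(2) l Bl[OF l] B by (intro add_mono mult_mono) (auto simp: dist_real_def \<theta>'_def intro: less_imp_le)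
    also have "\<dots> = e" using B by simp
    finally show ?thesis .
  qed
  moreover have "dist z \<zeta> < \<delta>" using lp(2) ex by (simp add: \<delta>'_def)
  ultimately show ?thesis using lp(1) by (intro exI[of _ z]) auto
qed

text \<open>The disc is handled as the polydisc over the index type \<open>unit\<close>; there sums
  of monomials become finite sums over a set of exponents.\<close>

lemma power_sums_diagonal:
  fixes \<zeta> :: complex
  assumes "p \<in> power_sums (\<lambda>_::unit. \<zeta>) B"
  shows "\<exists>\<Lambda> c. finite \<Lambda> \<and> (\<forall>l\<in>\<Lambda>. B = {} \<longrightarrow> l = 0) \<and> (\<forall>z. p (\<lambda>_. z) = (\<Sum>l\<in>\<Lambda>. c l * log_power \<zeta> l z))"
  using assms
proof induction
  case (mono \<mu> c)
  show ?case
    using mono[of "()"] by (intro exI[of _ "{\<mu> ()}"] exI[of _ "\<lambda>_. c"]) (auto simp: UNIV_unit)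
next
  case (add p q)
  obtain \<Lambda> c where p: "finite \<Lambda>" "\<forall>l\<in>\<Lambda>. B = {} \<longrightarrow> l = 0" "\<forall>z. p (\<lambda>_. z) = (\<Sum>l\<in>\<Lambda>. c l * log_power \<zeta> l z)"
    using add.IH(1) by blast
  obtain \<Lambda>' c' where q: "finite \<Lambda>'" "\<forall>l\<in>\<Lambda>'. B = {} \<longrightarrow> l = 0" "\<forall>z. q (\<lambda>_. z) = (\<Sum>l\<in>\<Lambda>'. c' l * log_power \<zeta> l z)"
    using add.IH(2) by blast
  define C where "C l = (if l \<in> \<Lambda> then c l else 0)" for l
  define C' where "C' l = (if l \<in> \<Lambda>' then c' l else 0)" for l
  have "p (\<lambda>_. z) + q (\<lambda>_. z) = (\<Sum>l\<in>\<Lambda>\<union>\<Lambda>'. (C l + C' l) * log_power \<zeta> l z)" for z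
  proof -
    have "p (\<lambda>_. z) = (\<Sum>l\<in>\<Lambda>\<union>\<Lambda>'. C l * log_power \<zeta> l z)"
      unfolding p(3)[rule_format] using p(1) q(1) by (intro sum.mono_neutral_cong_left) (auto simp: C_def)
    moreover have "q (\<lambda>_. z) = (\<Sum>l\<in>\<Lambda>\<union>\<Lambda>'. C' l * log_power \<zeta> l z)"
      unfolding q(3)[rule_format] using p(1) q(1) by (intro sum.mono_neutral_cong_left) (auto simp: C'_def)
    ultimately show ?thesis by (simp add: distrib_right sum.distrib)
  qed
  then show ?case using p(1,2) q(1,2)
    by (intro exI[of _ "\<Lambda> \<union> \<Lambda>'"] exI[of _ "\<lambda>l. C l + C' l"]) auto
qed

section \<open>Characters of the algebra on the disc\<close>

lemma algebra_Hinf_SAP: "bounded_function_algebra (ball 0 1) (Hinf_SAP S0)"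
proof
  show "(\<lambda>z. if z \<in> ball 0 1 then c else 0) \<in> Hinf_SAP S0" for c
    using Hinf_SAP_const[of c S0] by simp
  show "\<exists>C. \<forall>z\<in>ball 0 1. norm (f z) \<le> C" if f: "f \<in> Hinf_SAP S0" for f
  proof -
    obtain C where "\<forall>z. norm z < 1 \<longrightarrow> norm (f z) \<le> C" using Hinf_SAP_D[OF f] by blast
    then show ?thesis by (intro exI[of _ C]) auto
  qed
  show "f z = 0" if "f \<in> Hinf_SAP S0" "z \<notin> ball 0 1" for f z
    using Hinf_SAP_D[OF that(1)] that(2) by auto
qed (auto intro: Hinf_SAP_add Hinf_SAP_mult)

lemma algebra_Hinf_SAPn: "bounded_function_algebra polydisc (Hinf_SAPn S)"
proof
  have "(\<lambda>_. 0) \<in> polydisc" by (simp add: polydisc_def)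
  then show "polydisc \<noteq> {}" by blast
  show "\<exists>C. \<forall>z\<in>polydisc. norm (f z) \<le> C" if "f \<in> Hinf_SAPn S" for f
    using Hinf_SAPn_D[OF that] by blast
  show "f z = 0" if "f \<in> Hinf_SAPn S" "z \<notin> polydisc" for f z
    using Hinf_SAPn_D[OF that(1)] that(2) by blast
qed (auto intro: Hinf_SAPn_add Hinf_SAPn_mult Hinf_SAPn_const)

definition disc_coordinate :: "complex \<Rightarrow> complex" where
  "disc_coordinate z = (if norm z < 1 then z else 0)"

lemma Hinf_SAP_disc_coordinate: "disc_coordinate \<in> Hinf_SAP S0"
  using Hinf_SAP_continuous[of "\<lambda>z. z" S0] by (simp add: disc_coordinate_def[abs_def])

lemma character_interior:
  assumes \<phi>: "\<phi> \<in> characters (ball 0 1) (Hinf_SAP S0)" and a: "\<phi> disc_coordinate = a" "norm a < 1"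
    and f: "f \<in> Hinf_SAP S0"
  shows "\<phi> f = f a"
proof -
  interpret A: bounded_function_algebra "ball 0 1" "Hinf_SAP S0" by (rule algebra_Hinf_SAP)
  obtain g where g: "g \<in> Hinf_SAP S0" "\<forall>z. norm z < 1 \<longrightarrow> f z - f a = (z - a) * g z"
    using Hinf_SAP_divide[OF f a(2)] by blast
  let ?c = "\<lambda>w z. if z \<in> ball 0 1 then w else 0 :: complex"
  have "f z + (- 1) * ?c (f a) z = (disc_coordinate z + (- 1) * ?c a z) * g z" for z
    using g(2) A.vanish[OF f, of z] A.vanish[OF g(1), of z] by (simp add: disc_coordinate_def)
  then have "\<phi> (\<lambda>z. f z + (- 1) * ?c (f a) z) = \<phi> (\<lambda>z. (disc_coordinate z + (- 1) * ?c a z) * g z)" by simp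
  also have "\<dots> = (\<phi> disc_coordinate - a) * \<phi> g"
    unfolding A.char_mult[OF \<phi> A.add[OF Hinf_SAP_disc_coordinate A.cmult[OF A.const]] g(1)]
      A.char_diff[OF \<phi> Hinf_SAP_disc_coordinate A.const] A.char_const[OF \<phi>] ..
  finally show ?thesis unfolding A.char_diff[OF \<phi> f A.const] A.char_const[OF \<phi>] using a(1) by simp
qed

lemma norm_character_disc_coordinate:
  assumes "\<phi> \<in> characters (ball 0 1) (Hinf_SAP S0)"
  shows "norm (\<phi> disc_coordinate) \<le> 1"
proof -
  interpret A: bounded_function_algebra "ball 0 1" "Hinf_SAP S0" by (rule algebra_Hinf_SAP)
  show ?thesis by (rule A.char_bound[OF assms Hinf_SAP_disc_coordinate]) (simp add: disc_coordinate_def)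
qed

text \<open>If \<open>\<zeta>\<close> is not in \<open>S0\<close>, local sums contain the exponent 0
  only, and the trivial homomorphism serves. The disjunction lets singular and regular boundary
  points be treated alike.\<close>

lemma character_log_power_homomorphism:
  assumes \<phi>: "\<phi> \<in> characters (ball 0 1) (Hinf_SAP S0)" and \<zeta>: "norm \<zeta> = 1"
  shows "\<exists>h. (\<forall>l m. h (l + m) = h l * h m) \<and> h 0 = 1 \<and> (\<forall>l. norm (h l) \<le> exp (\<bar>l\<bar> * (pi / 2))) \<and>
    (\<forall>l. \<zeta> \<in> S0 \<or> l = 0 \<longrightarrow> (\<lambda>z. if norm z < 1 then log_power \<zeta> l z else 0) \<in> Hinf_SAP S0 \<and>
      \<phi> (\<lambda>z. if norm z < 1 then log_power \<zeta> l z else 0) = h l)"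
proof -
  interpret A: bounded_function_algebra "ball 0 1" "Hinf_SAP S0" by (rule algebra_Hinf_SAP)
  have one: "\<phi> (\<lambda>z. if norm z < 1 then 1 else 0) = 1" using A.char_const[OF \<phi>, of 1] by simp
  show ?thesis
  proof (cases "\<zeta> \<in> S0")
    case True
    define u where "u l = (\<lambda>z. if norm z < 1 then log_power \<zeta> l z else 0)" for l
    have u: "u l \<in> Hinf_SAP S0" for l unfolding u_def by (rule Hinf_SAP_log_power[OF \<zeta> True])
    have "u (l + m) = (\<lambda>z. u l z * u m z)" for l m by (auto simp: u_def log_power_add)
    then have hom: "\<phi> (u (l + m)) = \<phi> (u l) * \<phi> (u m)" for l m using A.char_mult[OF \<phi> u u] by simp
    have bound: "norm (\<phi> (u l)) \<le> exp (\<bar>l\<bar> * (pi / 2))" for l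
    proof (rule A.char_bound[OF \<phi> u])
      fix z :: complex assume "z \<in> ball 0 1"
      then have "norm z < 1" "z \<noteq> \<zeta>" using \<zeta> by auto
      then show "norm (u l z) \<le> exp (\<bar>l\<bar> * (pi / 2))"
        unfolding u_def using norm_log_power_le[OF \<zeta>, of z l] by simp
    qed
    have "u 0 = (\<lambda>z. if norm z < 1 then 1 else 0)" by (auto simp: u_def)
    then have "\<phi> (u 0) = 1" using one by simp
    then show ?thesis using hom bound u True
      by (intro exI[of _ "\<lambda>l. \<phi> (u l)"]) (simp add: u_def[symmetric])
  next
    case False
    have "(\<lambda>z. if norm z < 1 then log_power \<zeta> 0 z else 0) = (\<lambda>z. if norm z < 1 then 1 else 0)" by auto
    then show ?thesis using False one Hinf_SAP_const[of 1 S0] by (intro exI[of _ "\<lambda>_. 1"]) auto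
  qed
qed

lemma local_power_sums_disc:
  assumes S0: "closed S0" "S0 \<subseteq> sphere 0 1" and f: "f \<in> Hinf_SAP S0" and \<zeta>: "norm \<zeta> = 1" and e: "\<epsilon> > 0"
  shows "\<exists>\<delta>>0. \<exists>\<Lambda> c. finite \<Lambda> \<and> (\<forall>l\<in>\<Lambda>. \<zeta> \<in> S0 \<or> l = 0) \<and>
    (\<forall>z. norm z < 1 \<and> dist z \<zeta> < \<delta> \<longrightarrow> norm (f z - (\<Sum>l\<in>\<Lambda>. c l * log_power \<zeta> l z)) \<le> \<epsilon>)"
proof -
  have "lift_component () f \<in> Hinf_SAPn (\<lambda>_::unit. S0)" by (rule Hinf_SAPn_lift[OF f])
  then obtain \<delta> p where p: "\<delta> > 0" "p \<in> power_sums (\<lambda>_::unit. \<zeta>) {k. \<zeta> \<in> S0}"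
      "\<forall>z\<in>polydisc. (\<forall>k. dist (z k) \<zeta> < \<delta>) \<longrightarrow> norm (lift_component () f z - p z) \<le> \<epsilon>"
    using Hinf_SAPn_local_power_sums[where S = "\<lambda>_::unit. S0" and \<zeta> = "\<lambda>_. \<zeta>" and f = "lift_component () f" and \<epsilon> = \<epsilon>] S0 \<zeta> e
    by (auto simp: eq_refl)
  obtain \<Lambda> c where c: "finite \<Lambda>" "\<forall>l\<in>\<Lambda>. {k::unit. \<zeta> \<in> S0} = {} \<longrightarrow> l = 0" "\<forall>z. p (\<lambda>_. z) = (\<Sum>l\<in>\<Lambda>. c l * log_power \<zeta> l z)"
    using power_sums_diagonal[OF p(2)] by blast
  have "norm (f z - (\<Sum>l\<in>\<Lambda>. c l * log_power \<zeta> l z)) \<le> \<epsilon>" if "norm z < 1 \<and> dist z \<zeta> < \<delta>" for z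
    using p(3)[rule_format, of "\<lambda>_. z"] that c(3) by (simp add: lift_component_def polydisc_def)
  then show ?thesis using p(1) c(1,2) by (intro exI[of _ \<delta>] conjI exI[of _ \<Lambda>] exI[of _ c]) auto
qed

lemma (in bounded_function_algebra) char_sum:
  assumes \<phi>: "\<phi> \<in> characters D A" and "finite I" "\<And>i. i \<in> I \<Longrightarrow> u i \<in> A"
  shows "(\<lambda>z. \<Sum>i\<in>I. c i * u i z) \<in> A \<and> \<phi> (\<lambda>z. \<Sum>i\<in>I. c i * u i z) = (\<Sum>i\<in>I. c i * \<phi> (u i))"
  using assms(2,3)
proof (induction I rule: finite_induct)
  case empty
  show ?case using const[of 0] char_const[OF \<phi>, of 0] by simp
next
  case (insert i I)
  then show ?case
    using add[OF cmult[of "u i" "c i"], of "\<lambda>z. \<Sum>i\<in>I. c i * u i z"] char_add[OF \<phi> cmult[of "u i" "c i"], of "\<lambda>z. \<Sum>i\<in>I. c i * u i z"]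
      char_cmult[OF \<phi>, of "u i" "c i"] by simp
qed

text \<open>A character over an interior point is an evaluation. Over a boundary point
  \<open>\<zeta>\<close>, a peak function at \<open>\<zeta>\<close> shows that its value at
  \<open>f\<close> nearly equals its value at the local sum of powers; there it is given by the
  homomorphism \<open>h\<close>, which a point of the disc near \<open>\<zeta>\<close> imitates on
  the finitely many exponents involved.\<close>

lemma Hinf_SAP_characters_approx:
  assumes S0: "closed S0" "S0 \<subseteq> sphere 0 1" and \<phi>: "\<phi> \<in> characters (ball 0 1) (Hinf_SAP S0)"
    and F: "finite F" "F \<subseteq> Hinf_SAP S0" and e: "e > 0"
  shows "\<exists>z\<in>ball 0 1. \<forall>f\<in>F. norm (\<phi> f - f z) < e"
proof (cases "norm (\<phi> disc_coordinate) < 1")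
  case True
  then show ?thesis
    using character_interior[OF \<phi> refl True] F(2) e by (intro bexI[of _ "\<phi> disc_coordinate"]) auto
next
  case False
  interpret A: bounded_function_algebra "ball 0 1" "Hinf_SAP S0" by (rule algebra_Hinf_SAP)
  define \<zeta> where "\<zeta> = \<phi> disc_coordinate"
  have \<zeta>: "norm \<zeta> = 1" using False norm_character_disc_coordinate[OF \<phi>] by (simp add: \<zeta>_def)
  obtain h where h: "\<forall>l m. h (l + m) = h l * h m" "h 0 = 1" "\<forall>l. norm (h l) \<le> exp (\<bar>l\<bar> * (pi / 2))"
    "\<forall>l. \<zeta> \<in> S0 \<or> l = 0 \<longrightarrow> (\<lambda>z. if norm z < 1 then log_power \<zeta> l z else 0) \<in> Hinf_SAP S0 \<and>
      \<phi> (\<lambda>z. if norm z < 1 then log_power \<zeta> l z else 0) = h l"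
    using character_log_power_homomorphism[OF \<phi> \<zeta>] by blast
  have e4: "e / 4 > 0" using e by simp
  have "\<forall>f\<in>F. \<exists>\<delta> \<Lambda> c. \<delta> > 0 \<and> finite \<Lambda> \<and> (\<forall>l\<in>\<Lambda>. \<zeta> \<in> S0 \<or> l = 0) \<and>
    (\<forall>z. norm z < 1 \<and> dist z \<zeta> < \<delta> \<longrightarrow> norm (f z - (\<Sum>l\<in>\<Lambda>. c l * log_power \<zeta> l z)) \<le> e / 4)"
  proof
    fix f assume "f \<in> F"
    then have "f \<in> Hinf_SAP S0" using F(2) by blast
    from local_power_sums_disc[OF S0 this \<zeta> e4] show "\<exists>\<delta> \<Lambda> c. \<delta> > 0 \<and> finite \<Lambda> \<and> (\<forall>l\<in>\<Lambda>. \<zeta> \<in> S0 \<or> l = 0) \<and>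
      (\<forall>z. norm z < 1 \<and> dist z \<zeta> < \<delta> \<longrightarrow> norm (f z - (\<Sum>l\<in>\<Lambda>. c l * log_power \<zeta> l z)) \<le> e / 4)" by blast
  qed
  then obtain \<delta> \<Lambda> c where L: "\<forall>f\<in>F. \<delta> f > 0 \<and> finite (\<Lambda> f) \<and> (\<forall>l\<in>\<Lambda> f. \<zeta> \<in> S0 \<or> l = 0) \<and>
    (\<forall>z. norm z < 1 \<and> dist z \<zeta> < \<delta> f \<longrightarrow> norm (f z - (\<Sum>l\<in>\<Lambda> f. c f l * log_power \<zeta> l z)) \<le> e / 4)"
    unfolding bchoice_iff by blast
  define \<delta>' where "\<delta>' = Min (insert 1 (\<delta> ` F))"
  have \<delta>': "\<delta>' > 0" "\<And>f. f \<in> F \<Longrightarrow> \<delta>' \<le> \<delta> f" using F(1) L by (auto simp: \<delta>'_def)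
  \<comment> \<open>Bounds the total coefficient mass of each local sum, so that an error
    \<open>e / (4 * C)\<close> at the single powers adds up to at most \<open>e / 4\<close>.\<close>
  define C where "C = 1 + (\<Sum>f\<in>F. \<Sum>l\<in>\<Lambda> f. norm (c f l))"
  have C: "C > 0" by (auto simp: C_def intro!: add_pos_nonneg sum_nonneg)
  have Cf: "(\<Sum>l\<in>\<Lambda> f. norm (c f l)) \<le> C" if "f \<in> F" for f
  proof -
    have "(\<Sum>l\<in>\<Lambda> f. norm (c f l)) \<le> (\<Sum>f\<in>F. \<Sum>l\<in>\<Lambda> f. norm (c f l))"
      using F(1) that by (intro member_le_sum[of f F "\<lambda>f. \<Sum>l\<in>\<Lambda> f. norm (c f l)"]) (auto intro: sum_nonneg)
    then show ?thesis by (simp add: C_def)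
  qed
  have eC: "e / (4 * C) > 0" using e C by simp
  have fin: "finite (\<Union>f\<in>F. \<Lambda> f)" using F(1) L by blast
  have "\<exists>z. norm z < 1 \<and> dist z \<zeta> < \<delta>' \<and> (\<forall>l\<in>(\<Union>f\<in>F. \<Lambda> f). norm (log_power \<zeta> l z - h l) \<le> e / (4 * C))"
    by (rule log_power_homomorphism_approx[where h = h, OF \<zeta> _ h(2) _ fin eC \<delta>'(1)]) (use h(1,3) in blast)+
  then obtain z where z: "norm z < 1" "dist z \<zeta> < \<delta>'" "\<forall>l\<in>(\<Union>f\<in>F. \<Lambda> f). norm (log_power \<zeta> l z - h l) \<le> e / (4 * C)"
    by blast
  have "norm (\<phi> f - f z) < e" if fF: "f \<in> F" for f
  proof -
    have fA: "f \<in> Hinf_SAP S0" using fF F(2) by blast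
    define u where "u l = (\<lambda>z. if norm z < 1 then log_power \<zeta> l z else 0)" for l
    have u: "u l \<in> Hinf_SAP S0" "\<phi> (u l) = h l" if "l \<in> \<Lambda> f" for l
      using h(4) L fF that unfolding u_def by blast+
    define p where "p = (\<lambda>z. \<Sum>l\<in>\<Lambda> f. c f l * u l z)"
    have finf: "finite (\<Lambda> f)" using L fF by blast
    have p: "p \<in> Hinf_SAP S0" "\<phi> p = (\<Sum>l\<in>\<Lambda> f. c f l * h l)"
      using A.char_sum[where c = "c f", OF \<phi> finf u(1)] u(2) by (simp_all add: p_def)
    have near: "norm (f w - p w) \<le> e / 4" if w: "norm w < 1" "dist w \<zeta> < \<delta>'" for w
    proof -
      have "dist w \<zeta> < \<delta> f" using w(2) \<delta>'(2)[OF fF] by linarith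
      then have "norm (f w - (\<Sum>l\<in>\<Lambda> f. c f l * log_power \<zeta> l w)) \<le> e / 4" using L fF w(1) by blast
      then show ?thesis using w(1) by (simp add: p_def u_def)
    qed
    define d where "d = (\<lambda>z. f z + (- 1) * p z)"
    have dA: "d \<in> Hinf_SAP S0" unfolding d_def by (intro A.add A.cmult fA p)
    \<comment> \<open>\<open>g\<close> has the same value under the character as \<open>d\<close>
      but is also small away from \<open>\<zeta>\<close>, where nothing is known about
      \<open>d\<close>.\<close>
    obtain g where g: "g \<in> Hinf_SAP S0" "\<phi> g = \<phi> d"
      "\<forall>z\<in>ball 0 1. norm (g z) \<le> norm (d z) \<and> (dist (disc_coordinate z) \<zeta> \<ge> \<delta>' \<longrightarrow> norm (g z) \<le> e / 4)"
      using A.char_peak[OF \<phi> Hinf_SAP_disc_coordinate _ \<zeta>_def[symmetric] \<zeta> dA \<delta>'(1) e4] by (auto simp: disc_coordinate_def)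
    have "norm (\<phi> g) \<le> e / 4"
    proof (rule A.char_bound[OF \<phi> g(1)])
      fix w :: complex assume w: "w \<in> ball 0 1"
      show "norm (g w) \<le> e / 4"
      proof (cases "dist w \<zeta> < \<delta>'")
        case True
        then have "norm (d w) \<le> e / 4" using near[of w] w by (simp add: d_def)
        moreover have "norm (g w) \<le> norm (d w)" using g(3) w by blast
        ultimately show ?thesis by linarith
      next
        case False
        then show ?thesis using g(3) w by (auto simp: disc_coordinate_def)
      qed
    qed
    then have 1: "norm (\<phi> f - \<phi> p) \<le> e / 4"
      using g(2) A.char_diff[OF \<phi> fA p(1)] by (simp add: d_def)
    have "\<phi> p - p z = (\<Sum>l\<in>\<Lambda> f. c f l * (h l - log_power \<zeta> l z))"
      unfolding p(2) using z(1) by (simp add: p_def u_def sum_subtractf right_diff_distrib)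
    also have "norm \<dots> \<le> (\<Sum>l\<in>\<Lambda> f. norm (c f l) * (e / (4 * C)))"
    proof (rule sum_norm_le)
      fix l assume "l \<in> \<Lambda> f"
      then have "norm (h l - log_power \<zeta> l z) \<le> e / (4 * C)" using z(3) fF by (auto simp: norm_minus_commute)
      then show "norm (c f l * (h l - log_power \<zeta> l z)) \<le> norm (c f l) * (e / (4 * C))"
        unfolding norm_mult by (intro mult_left_mono) auto
    qed
    also have "\<dots> = (\<Sum>l\<in>\<Lambda> f. norm (c f l)) * (e / (4 * C))" by (simp only: sum_distrib_right)
    also have "\<dots> \<le> C * (e / (4 * C))" using Cf[OF fF] eC by (intro mult_right_mono) auto
    also have "\<dots> = e / 4" using C by simp
    finally have 2: "norm (\<phi> p - p z) \<le> e / 4" .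
    have 3: "norm (f z - p z) \<le> e / 4" by (rule near[OF z(1,2)])
    have "norm (\<phi> f - f z) \<le> norm (\<phi> f - \<phi> p) + norm (\<phi> p - p z) + norm (f z - p z)"
      using norm_triangle_ineq[of "\<phi> f - \<phi> p" "\<phi> p - p z"] norm_triangle_ineq4[of "\<phi> f - p z" "f z - p z"] by simp
    then show ?thesis using 1 2 3 e by linarith
  qed
  then show ?thesis using z(1) by (intro bexI[of _ z]) auto
qed

section \<open>Restriction of characters to the coordinates\<close>

lemma lift_component_algebra:
  "lift_component k (\<lambda>z. f z + g z) = (\<lambda>z. lift_component k f z + lift_component k g z)"
  "lift_component k (\<lambda>z. c * f z) = (\<lambda>z. c * lift_component k f z)"
  "lift_component k (\<lambda>z. f z * g z) = (\<lambda>z. lift_component k f z * lift_component k g z)"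
  by (auto simp: lift_component_def fun_eq_iff)

abbreviation polydisc_characters :: "('n::finite \<Rightarrow> complex set) \<Rightarrow> ((('n \<Rightarrow> complex) \<Rightarrow> complex) \<Rightarrow> complex) set" where
  "polydisc_characters S \<equiv> characters polydisc (Hinf_SAPn S)"

definition component_character ::
    "('n::finite \<Rightarrow> complex set) \<Rightarrow> ((('n \<Rightarrow> complex) \<Rightarrow> complex) \<Rightarrow> complex) \<Rightarrow> 'n \<Rightarrow> (complex \<Rightarrow> complex) \<Rightarrow> complex" where
  "component_character S \<phi> k = (\<lambda>f\<in>Hinf_SAP (S k). \<phi> (lift_component k f))"

lemma component_character:
  fixes S :: "'n::finite \<Rightarrow> complex set"
  assumes \<phi>: "\<phi> \<in> polydisc_characters S"
  shows "component_character S \<phi> k \<in> characters (ball 0 1) (Hinf_SAP (S k))"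
proof -
  interpret A: bounded_function_algebra "ball 0 1" "Hinf_SAP (S k)" by (rule algebra_Hinf_SAP)
  interpret P: bounded_function_algebra polydisc "Hinf_SAPn S" by (rule algebra_Hinf_SAPn)
  note lift = Hinf_SAPn_lift[of _ S k]
  let ?R = "\<lambda>f\<in>Hinf_SAP (S k). \<phi> (lift_component k f)"
  show ?thesis unfolding characters_def component_character_def
  proof (intro CollectI conjI ballI allI)
    show "?R \<in> Hinf_SAP (S k) \<rightarrow>\<^sub>E UNIV" by simp
    fix f assume f: "f \<in> Hinf_SAP (S k)"
    show "?R (\<lambda>z. c * f z) = c * ?R f" for c
      using f A.cmult[OF f, of c] P.char_cmult[OF \<phi> lift[OF f], of c] by (simp add: lift_component_algebra)
    fix g assume g: "g \<in> Hinf_SAP (S k)"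
    show "?R (\<lambda>z. f z + g z)
        = ?R f + ?R g"
      using f g A.add[OF f g] P.char_add[OF \<phi> lift[OF f] lift[OF g]] by (simp add: lift_component_algebra)
    show "?R (\<lambda>z. f z * g z)
        = ?R f * ?R g"
      using f g A.mult[OF f g] P.char_mult[OF \<phi> lift[OF f] lift[OF g]] by (simp add: lift_component_algebra)
  next
    have one: "lift_component k (\<lambda>z. if z \<in> ball 0 1 then 1 else 0) = (\<lambda>z. if z \<in> polydisc then 1 else 0)"
      by (auto simp: lift_component_def polydisc_def)
    show "\<exists>f\<in>Hinf_SAP (S k). ?R f \<noteq> 0"
    proof (rule bexI[OF _ A.const[of 1]])
      show "?R (\<lambda>z. if z \<in> ball 0 1 then 1 else 0) \<noteq> 0"
        unfolding restrict_apply'[OF A.const] one P.char_const[OF \<phi>] by simp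
    qed
    show "\<exists>C. \<forall>f\<in>Hinf_SAP (S k). norm (?R f) \<le> C * (SUP z\<in>ball 0 1. norm (f z))"
    proof (intro exI[of _ 1] ballI)
      fix f assume f: "f \<in> Hinf_SAP (S k)"
      obtain M where M: "\<forall>z\<in>ball 0 1. norm (f z) \<le> M" using A.bounded[OF f] by blast
      have "norm (\<phi> (lift_component k f)) \<le> (SUP z\<in>ball 0 1. norm (f z))"
      proof (rule P.char_bound[OF \<phi> lift[OF f]])
        fix z :: "'n \<Rightarrow> complex" assume z: "z \<in> polydisc"
        then have "z k \<in> ball 0 1" by (simp add: polydisc_def)
        then have "norm (f (z k)) \<le> (SUP z\<in>ball 0 1. norm (f z))"
          using M by (intro cSUP_upper bdd_aboveI2[where M = M]) auto
        then show "norm (lift_component k f z) \<le> (SUP z\<in>ball 0 1. norm (f z))" using z by (simp add: lift_component_def)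
      qed
      then show "norm (?R f) \<le> 1 * (SUP z\<in>ball 0 1. norm (f z))"
        using f by simp
    qed
  qed
qed

text \<open>One coordinate at a time: a function and its slice at \<open>\<zeta> k\<close> differ by
  a multiple of \<open>z k - \<zeta> k\<close>, which the character annihilates.\<close>

lemma character_interior_coordinates:
  fixes S :: "'n::finite \<Rightarrow> complex set"
  assumes \<phi>: "\<phi> \<in> polydisc_characters S" and \<zeta>: "\<And>k. \<phi> (lift_component k disc_coordinate) = \<zeta> k"
    and f: "f \<in> Hinf_SAPn S" and B: "finite B" "\<And>k. k \<in> B \<Longrightarrow> norm (\<zeta> k) < 1"
  shows "(\<lambda>z. if z \<in> polydisc then f (\<lambda>k. if k \<in> B then \<zeta> k else z k) else 0) \<in> Hinf_SAPn S \<and>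
    \<phi> (\<lambda>z. if z \<in> polydisc then f (\<lambda>k. if k \<in> B then \<zeta> k else z k) else 0) = \<phi> f"
  using B
proof (induction B rule: finite_induct)
  interpret P: bounded_function_algebra polydisc "Hinf_SAPn S" by (rule algebra_Hinf_SAPn)
  case empty
  have "(\<lambda>z. if z \<in> polydisc then f (\<lambda>k. if k \<in> {} then \<zeta> k else z k) else 0) = f" using P.vanish[OF f] by (auto simp: fun_eq_iff)
  then show ?case using f by simp
next
  interpret P: bounded_function_algebra polydisc "Hinf_SAPn S" by (rule algebra_Hinf_SAPn)
  case (insert k B)
  define F where "F = (\<lambda>z. if z \<in> polydisc then f (\<lambda>k. if k \<in> B then \<zeta> k else z k) else 0)"
  have F: "F \<in> Hinf_SAPn S" "\<phi> F = \<phi> f" using insert.IH insert.prems unfolding F_def by blast+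
  have a: "norm (\<zeta> k) < 1" using insert.prems by blast
  define G where "G = (\<lambda>z. if z \<in> polydisc then F (z(k := \<zeta> k)) else 0)"
  have G: "G \<in> Hinf_SAPn S" unfolding G_def by (rule Hinf_SAPn_slice[OF F(1) a])
  have G_eq: "G = (\<lambda>z. if z \<in> polydisc then f (\<lambda>j. if j \<in> insert k B then \<zeta> j else z j) else 0)"
  proof
    fix z :: "'n \<Rightarrow> complex"
    have "z(k := \<zeta> k) \<in> polydisc" if "z \<in> polydisc" using that a by (simp add: polydisc_def)
    moreover have "(\<lambda>j. if j \<in> B then \<zeta> j else (z(k := \<zeta> k)) j) = (\<lambda>j. if j \<in> insert k B then \<zeta> j else z j)" by auto
    ultimately show "G z = (if z \<in> polydisc then f (\<lambda>j. if j \<in> insert k B then \<zeta> j else z j) else 0)"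
      by (simp add: G_def F_def)
  qed
  obtain g where g: "g \<in> Hinf_SAPn S" "\<forall>z\<in>polydisc. F z - F (z(k := \<zeta> k)) = (z k - \<zeta> k) * g z"
    using Hinf_SAPn_divide[OF F(1) a] by blast
  have l: "lift_component k disc_coordinate \<in> Hinf_SAPn S" by (rule Hinf_SAPn_lift[OF Hinf_SAP_disc_coordinate])
  let ?c = "\<lambda>z :: 'n \<Rightarrow> complex. if z \<in> polydisc then \<zeta> k else 0"
  have "F z + (- 1) * G z = (lift_component k disc_coordinate z + (- 1) * ?c z) * g z" for z
    using g(2) P.vanish[OF g(1), of z] P.vanish[OF F(1), of z]
    by (auto simp: G_def lift_component_def disc_coordinate_def polydisc_def)
  then have "\<phi> (\<lambda>z. F z + (- 1) * G z) = \<phi> (\<lambda>z. (lift_component k disc_coordinate z + (- 1) * ?c z) * g z)" by simp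
  also have "\<dots> = (\<phi> (lift_component k disc_coordinate) - \<zeta> k) * \<phi> g"
    unfolding P.char_mult[OF \<phi> P.add[OF l P.cmult[OF P.const]] g(1)] P.char_diff[OF \<phi> l P.const] P.char_const[OF \<phi>] ..
  finally have "\<phi> F = \<phi> G" unfolding P.char_diff[OF \<phi> F(1) G] using \<zeta> by simp
  then show ?case using G F(2) unfolding G_eq by simp
qed

text \<open>Each peak function removes one coordinate from the smallness hypothesis: after
  multiplication by it the function is at most \<open>\<epsilon>\<close> also where
  \<open>z k\<close> is far from \<open>\<zeta> k\<close>, and the value of the character is
  unchanged.\<close>

lemma character_boundary_coordinates:
  fixes S :: "'n::finite \<Rightarrow> complex set"
  assumes \<phi>: "\<phi> \<in> polydisc_characters S" and \<zeta>: "\<And>k. \<phi> (lift_component k disc_coordinate) = \<zeta> k"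
    and B: "finite B" "\<And>k. k \<in> B \<Longrightarrow> norm (\<zeta> k) = 1" and d: "\<delta> > 0" and e: "\<epsilon> > 0"
    and f: "f \<in> Hinf_SAPn S" "\<And>z. z \<in> polydisc \<Longrightarrow> (\<And>k. k \<in> B \<Longrightarrow> dist (z k) (\<zeta> k) < \<delta>) \<Longrightarrow> norm (f z) \<le> \<epsilon>"
  shows "norm (\<phi> f) \<le> \<epsilon>"
  using B f
proof (induction B arbitrary: f rule: finite_induct)
  interpret P: bounded_function_algebra polydisc "Hinf_SAPn S" by (rule algebra_Hinf_SAPn)
  case empty
  then show ?case by (intro P.char_bound[OF \<phi>]) auto
next
  interpret P: bounded_function_algebra polydisc "Hinf_SAPn S" by (rule algebra_Hinf_SAPn)
  case (insert k B)
  have l: "lift_component k disc_coordinate \<in> Hinf_SAPn S" by (rule Hinf_SAPn_lift[OF Hinf_SAP_disc_coordinate])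
  have l1: "norm (lift_component k disc_coordinate z) \<le> 1" if "z \<in> polydisc" for z :: "'n \<Rightarrow> complex"
    by (simp add: lift_component_def disc_coordinate_def)
  have nk: "norm (\<zeta> k) = 1" using insert.prems(1) by blast
  have "\<exists>g\<in>Hinf_SAPn S. \<phi> g = \<phi> f \<and>
    (\<forall>z\<in>polydisc. norm (g z) \<le> norm (f z) \<and> (dist (lift_component k disc_coordinate z) (\<zeta> k) \<ge> \<delta> \<longrightarrow> norm (g z) \<le> \<epsilon>))"
    by (rule P.char_peak[where x = "lift_component k disc_coordinate", OF \<phi> l l1 \<zeta>[of k] nk insert.prems(2) d e])
  then obtain g where g: "g \<in> Hinf_SAPn S" "\<phi> g = \<phi> f"
    "\<forall>z\<in>polydisc. norm (g z) \<le> norm (f z) \<and> (dist (lift_component k disc_coordinate z) (\<zeta> k) \<ge> \<delta> \<longrightarrow> norm (g z) \<le> \<epsilon>)"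
    by blast
  have "norm (\<phi> g) \<le> \<epsilon>"
  proof (rule insert.IH)
    show "norm (\<zeta> j) = 1" if "j \<in> B" for j using insert.prems(1) that by blast
    show "g \<in> Hinf_SAPn S" by (rule g(1))
    fix z :: "'n \<Rightarrow> complex" assume z: "z \<in> polydisc" and near: "\<And>j. j \<in> B \<Longrightarrow> dist (z j) (\<zeta> j) < \<delta>"
    have lz: "lift_component k disc_coordinate z = z k" using z by (simp add: lift_component_def disc_coordinate_def polydisc_def)
    show "norm (g z) \<le> \<epsilon>"
    proof (cases "dist (z k) (\<zeta> k) < \<delta>")
      case True
      have "norm (f z) \<le> \<epsilon>" by (rule insert.prems(3)[OF z]) (use True near in auto)
      moreover have "norm (g z) \<le> norm (f z)" using g(3) z by blast
      ultimately show ?thesis by linarith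
    next
      case False
      then show ?thesis using g(3) z lz by auto
    qed
  qed
  then show ?case using g(2) by simp
qed

text \<open>A monomial is a product of functions of one coordinate each, so a character is
  determined on it by its restrictions. Membership in the algebra is part of the same induction,
  because the rules for characters require it of every summand.\<close>

lemma characters_agree_on_power_sums:
  fixes S :: "'n::finite \<Rightarrow> complex set"
  assumes p: "p \<in> power_sums \<zeta> {k. \<zeta> k \<in> S k}" and \<zeta>: "\<And>k. \<zeta> k \<in> S k \<Longrightarrow> norm (\<zeta> k) = 1"
  shows "(\<lambda>z. if z \<in> polydisc then p z else 0) \<in> Hinf_SAPn S \<and>
    (\<forall>\<phi>\<in>polydisc_characters S. \<forall>\<psi>\<in>polydisc_characters S.
      (\<forall>k. \<forall>f\<in>Hinf_SAP (S k). \<phi> (lift_component k f) = \<psi> (lift_component k f)) \<longrightarrow>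
      \<phi> (\<lambda>z. if z \<in> polydisc then p z else 0) = \<psi> (\<lambda>z. if z \<in> polydisc then p z else 0))"
  using p
proof induction
  interpret P: bounded_function_algebra polydisc "Hinf_SAPn S" by (rule algebra_Hinf_SAPn)
  case (mono \<mu> c)
  define u where "u k = (\<lambda>z. if norm z < 1 then log_power (\<zeta> k) (\<mu> k) z else 0)" for k
  have u: "u k \<in> Hinf_SAP (S k)" for k
  proof (cases "\<zeta> k \<in> S k")
    case True
    then show ?thesis unfolding u_def by (intro Hinf_SAP_log_power \<zeta>)
  next
    case False
    then have "\<mu> k = 0" using mono by simp
    then have "u k = (\<lambda>z. if norm z < 1 then 1 else 0)" by (auto simp: u_def)
    then show ?thesis using Hinf_SAP_const[of 1 "S k"] by simp
  qed
  have lu: "lift_component k (u k) \<in> Hinf_SAPn S" for k by (rule Hinf_SAPn_lift[OF u])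
  have prods: "(\<lambda>z. if z \<in> polydisc then c * (\<Prod>k\<in>B. log_power (\<zeta> k) (\<mu> k) (z k)) else 0) \<in> Hinf_SAPn S \<and>
    (\<forall>\<phi>\<in>polydisc_characters S. \<phi> (\<lambda>z. if z \<in> polydisc then c * (\<Prod>k\<in>B. log_power (\<zeta> k) (\<mu> k) (z k)) else 0)
      = c * (\<Prod>k\<in>B. \<phi> (lift_component k (u k))))" if "finite B" for B
    using that
  proof (induction B rule: finite_induct)
    case empty
    show ?case unfolding prod.empty mult_1_right using P.const[of c] P.char_const[of _ c] by blast
  next
    case (insert j B)
    define q where "q = (\<lambda>z. if z \<in> polydisc then c * (\<Prod>k\<in>B. log_power (\<zeta> k) (\<mu> k) (z k)) else 0)"
    have eq: "(\<lambda>z. if z \<in> polydisc then c * (\<Prod>k\<in>insert j B. log_power (\<zeta> k) (\<mu> k) (z k)) else 0)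
       = (\<lambda>z. lift_component j (u j) z * q z)"
      using insert.hyps by (auto simp: fun_eq_iff q_def lift_component_def u_def polydisc_def)
    have "q \<in> Hinf_SAPn S" using insert.IH unfolding q_def by blast
    moreover have "\<phi> q = c * (\<Prod>k\<in>B. \<phi> (lift_component k (u k)))" if "\<phi> \<in> polydisc_characters S" for \<phi>
      using insert.IH that unfolding q_def by blast
    ultimately have q: "q \<in> Hinf_SAPn S" "\<And>\<phi>. \<phi> \<in> polydisc_characters S \<Longrightarrow> \<phi> q = c * (\<Prod>k\<in>B. \<phi> (lift_component k (u k)))"
      by blast+
    show ?case unfolding eq
    proof (intro conjI ballI)
      show "(\<lambda>z. lift_component j (u j) z * q z) \<in> Hinf_SAPn S" by (rule P.mult[OF lu q(1)])
      fix \<phi> assume \<phi>: "\<phi> \<in> polydisc_characters S"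
      show "\<phi> (\<lambda>z. lift_component j (u j) z * q z) = c * (\<Prod>k\<in>insert j B. \<phi> (lift_component k (u k)))"
        unfolding P.char_mult[OF \<phi> lu q(1)] q(2)[OF \<phi>] using insert.hyps by simp
    qed
  qed
  show ?case
  proof (intro conjI ballI impI)
    show "(\<lambda>z. if z \<in> polydisc then c * (\<Prod>k\<in>UNIV. log_power (\<zeta> k) (\<mu> k) (z k)) else 0) \<in> Hinf_SAPn S"
      using prods[of UNIV] by simp
    fix \<phi> \<psi> assume c: "\<phi> \<in> polydisc_characters S" "\<psi> \<in> polydisc_characters S"
      and agree: "\<forall>k. \<forall>f\<in>Hinf_SAP (S k). \<phi> (lift_component k f) = \<psi> (lift_component k f)"
    have "(\<Prod>k\<in>UNIV. \<phi> (lift_component k (u k))) = (\<Prod>k\<in>UNIV. \<psi> (lift_component k (u k)))"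
      using agree u by (intro prod.cong) auto
    then show "\<phi> (\<lambda>z. if z \<in> polydisc then c * (\<Prod>k\<in>UNIV. log_power (\<zeta> k) (\<mu> k) (z k)) else 0)
       = \<psi> (\<lambda>z. if z \<in> polydisc then c * (\<Prod>k\<in>UNIV. log_power (\<zeta> k) (\<mu> k) (z k)) else 0)"
      unfolding bspec[OF conjunct2[OF prods[OF finite]] c(1)] bspec[OF conjunct2[OF prods[OF finite]] c(2)] by (rule arg_cong)
  qed
next
  interpret P: bounded_function_algebra polydisc "Hinf_SAPn S" by (rule algebra_Hinf_SAPn)
  case (add p q)
  have eq: "(\<lambda>z. if z \<in> polydisc then p z + q z else 0)
    = (\<lambda>z. (if z \<in> polydisc then p z else 0) + (if z \<in> polydisc then q z else 0))" by auto
  note pq = conjunct1[OF add.IH(1)] conjunct1[OF add.IH(2)]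
  show ?case unfolding eq
  proof (intro conjI ballI impI)
    show "(\<lambda>z. (if z \<in> polydisc then p z else 0) + (if z \<in> polydisc then q z else 0)) \<in> Hinf_SAPn S" by (rule P.add[OF pq])
    fix \<phi> \<psi> assume c: "\<phi> \<in> polydisc_characters S" "\<psi> \<in> polydisc_characters S"
      and agree: "\<forall>k. \<forall>f\<in>Hinf_SAP (S k). \<phi> (lift_component k f) = \<psi> (lift_component k f)"
    show "\<phi> (\<lambda>z. (if z \<in> polydisc then p z else 0) + (if z \<in> polydisc then q z else 0))
      = \<psi> (\<lambda>z. (if z \<in> polydisc then p z else 0) + (if z \<in> polydisc then q z else 0))"
      unfolding P.char_add[OF c(1) pq] P.char_add[OF c(2) pq]
      by (rule arg_cong2[where f = "(+)"];
        rule mp[OF bspec[OF bspec[OF conjunct2[OF add.IH(1)] c(1)] c(2)] agree]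
          mp[OF bspec[OF bspec[OF conjunct2[OF add.IH(2)] c(1)] c(2)] agree])
  qed
qed

lemma power_sums_interior_coordinates:
  assumes "p \<in> power_sums \<zeta> B" and "\<And>k. k \<in> B \<Longrightarrow> k \<notin> I"
  shows "p (\<lambda>k. if k \<in> I then \<zeta> k else z k) = p z"
  using assms(1)
proof induction
  case (mono \<mu> c)
  have "log_power (\<zeta> k) (\<mu> k) (if k \<in> I then \<zeta> k else z k) = log_power (\<zeta> k) (\<mu> k) (z k)" for k
  proof (cases "k \<in> I")
    case True
    then have "\<mu> k = 0" using mono assms(2) by blast
    then show ?thesis by simp
  qed simp
  then show ?case by simp
qed simp

text \<open>Freezing the interior coordinates at \<open>\<zeta> k\<close> changes neither value at
  \<open>f\<close>. The difference to the local power sum is then small as soon as the boundary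
  coordinates alone are near \<open>\<zeta>\<close>, so both characters send \<open>f\<close> close
  to their common value on that sum.\<close>

lemma inj_on_component_character:
  fixes S :: "'n::finite \<Rightarrow> complex set"
  assumes S: "\<And>k. closed (S k)" "\<And>k. S k \<subseteq> sphere 0 1"
  shows "inj_on (component_character S) (polydisc_characters S)"
proof (rule inj_onI)
  fix \<phi> \<psi> assume \<phi>: "\<phi> \<in> polydisc_characters S" and \<psi>: "\<psi> \<in> polydisc_characters S"
    and eq: "component_character S \<phi> = component_character S \<psi>"
  interpret P: bounded_function_algebra polydisc "Hinf_SAPn S" by (rule algebra_Hinf_SAPn)
  have agree: "\<phi> (lift_component k f) = \<psi> (lift_component k f)" if "f \<in> Hinf_SAP (S k)" for k f
    using fun_cong[OF fun_cong[OF eq, of k], of f] that by (simp add: component_character_def)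
  define \<zeta> where "\<zeta> k = \<phi> (lift_component k disc_coordinate)" for k
  have z\<phi>: "\<phi> (lift_component k disc_coordinate) = \<zeta> k" and z\<psi>: "\<psi> (lift_component k disc_coordinate) = \<zeta> k" for k
    using agree[OF Hinf_SAP_disc_coordinate] by (auto simp: \<zeta>_def)
  have n\<zeta>: "norm (\<zeta> k) \<le> 1" for k unfolding \<zeta>_def
    by (rule P.char_bound[OF \<phi> Hinf_SAPn_lift[OF Hinf_SAP_disc_coordinate]]) (simp add: lift_component_def disc_coordinate_def)
  have n1: "norm (\<zeta> k) = 1" if "\<zeta> k \<in> S k" for k using that S(2)[of k] by auto
  define I where "I = {k. norm (\<zeta> k) < 1}"
  have close: "norm (\<phi> f - \<psi> f) \<le> 2 * \<epsilon>" if f: "f \<in> Hinf_SAPn S" and e: "\<epsilon> > 0" for f \<epsilon>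
  proof -
    obtain \<delta> p where p: "\<delta> > 0" "p \<in> power_sums \<zeta> {k. \<zeta> k \<in> S k}"
      "\<forall>z\<in>polydisc. (\<forall>k. dist (z k) (\<zeta> k) < \<delta>) \<longrightarrow> norm (f z - p z) \<le> \<epsilon>"
      using Hinf_SAPn_local_power_sums[where \<zeta> = \<zeta>, OF S f n\<zeta> e] by blast
    define F where "F = (\<lambda>z. if z \<in> polydisc then f (\<lambda>k. if k \<in> I then \<zeta> k else z k) else 0)"
    define q where "q = (\<lambda>z. if z \<in> polydisc then p z else 0)"
    have finI: "finite I" and I1: "norm (\<zeta> k) < 1" if "k \<in> I" for k using that by (auto simp: I_def)
    have finI: "finite I" by simp
    note interior = character_interior_coordinates[where \<zeta> = \<zeta>, OF _ _ f finI I1]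
    have F: "F \<in> Hinf_SAPn S" "\<phi> F = \<phi> f" "\<psi> F = \<psi> f"
      using interior[OF \<phi> z\<phi>] interior[OF \<psi> z\<psi>] unfolding F_def by blast+
    have q: "q \<in> Hinf_SAPn S" "\<phi> q = \<psi> q"
      using characters_agree_on_power_sums[OF p(2) n1] \<phi> \<psi> agree unfolding q_def by blast+
    have FqA: "(\<lambda>z. F z + (- 1) * q z) \<in> Hinf_SAPn S" by (intro P.add P.cmult F q)
    have near: "norm (F z + (- 1) * q z) \<le> \<epsilon>"
      if z: "z \<in> polydisc" and zk: "\<And>k. k \<in> - I \<Longrightarrow> dist (z k) (\<zeta> k) < \<delta>" for z
    proof -
      \<comment> \<open>Freezing puts the interior coordinates exactly at \<open>\<zeta> k\<close>,
        so closeness has to be assumed in the boundary coordinates only.\<close>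
      let ?z = "\<lambda>k. if k \<in> I then \<zeta> k else z k"
      have w1: "?z \<in> polydisc" using z by (auto simp: polydisc_def I_def)
      have w2: "\<forall>k. dist (?z k) (\<zeta> k) < \<delta>" using zk p(1) by auto
      have "norm (f ?z - p ?z) \<le> \<epsilon>" by (rule mp[OF bspec[OF p(3) w1] w2])
      moreover have "p ?z = p z" by (rule power_sums_interior_coordinates[OF p(2)]) (auto simp: I_def dest: n1)
      ultimately show ?thesis using z by (simp add: F_def q_def)
    qed
    have b1: "norm (\<zeta> k) = 1" if "k \<in> - I" for k using that n\<zeta>[of k] by (simp add: I_def)
    have fin: "finite (- I)" by simp
    have bound: "norm (\<Phi> f - \<Phi> q) \<le> \<epsilon>"
      if c: "\<Phi> \<in> polydisc_characters S" "\<And>k. \<Phi> (lift_component k disc_coordinate) = \<zeta> k" "\<Phi> F = \<Phi> f" for \<Phi>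
    proof -
      have "norm (\<Phi> (\<lambda>z. F z + (- 1) * q z)) \<le> \<epsilon>"
        by (rule character_boundary_coordinates[where B = "- I" and \<zeta> = \<zeta> and \<delta> = \<delta>, OF c(1,2) fin b1 p(1) e FqA near])
      then show ?thesis unfolding P.char_diff[OF c(1) F(1) q(1)] c(3) .
    qed
    have "norm (\<phi> f - \<phi> q) \<le> \<epsilon>" by (rule bound[OF \<phi> z\<phi> F(2)])
    moreover have "norm (\<psi> f - \<psi> q) \<le> \<epsilon>" by (rule bound[OF \<psi> z\<psi> F(3)])
    ultimately show ?thesis using q(2) norm_triangle_ineq4[of "\<phi> f - \<phi> q" "\<psi> f - \<psi> q"] by simp
  qed
  show "\<phi> = \<psi>"
  proof (rule PiE_ext)
    show "\<phi> \<in> Hinf_SAPn S \<rightarrow>\<^sub>E UNIV" "\<psi> \<in> Hinf_SAPn S \<rightarrow>\<^sub>E UNIV" using \<phi> \<psi> by (auto simp: characters_def)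
    fix f assume f: "f \<in> Hinf_SAPn S"
    have "norm (\<phi> f - \<psi> f) \<le> 0"
    proof (rule field_le_epsilon)
      fix e :: real assume "e > 0"
      then show "norm (\<phi> f - \<psi> f) \<le> 0 + e" using close[OF f, of "e / 2"] by simp
    qed
    then show "\<phi> f = \<psi> f" by simp
  qed
qed

theorem theorem1p11:
  fixes S :: "'n::finite \<Rightarrow> complex set"
  assumes "\<And>k. S k \<noteq> {}" and "\<And>k. closed (S k)" and "\<And>k. S k \<subseteq> sphere 0 1"
  shows "max_ideal_space polydisc (Hinf_SAPn S) homeomorphic_space
           product_topology (\<lambda>k. max_ideal_space (ball 0 1) (Hinf_SAP (S k))) UNIV
         \<and> point_eval (Hinf_SAPn S) ` polydisc
             \<subseteq> topspace (max_ideal_space polydisc (Hinf_SAPn S))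
         \<and> max_ideal_space polydisc (Hinf_SAPn S) closure_of (point_eval (Hinf_SAPn S) ` polydisc)
             = topspace (max_ideal_space polydisc (Hinf_SAPn S))"
proof -
  let ?M = "max_ideal_space polydisc (Hinf_SAPn S)"
  let ?N = "\<lambda>k. max_ideal_space (ball 0 1) (Hinf_SAP (S k))"
  let ?R = "component_character S"
  let ?E = "point_eval (Hinf_SAPn S) ` polydisc"
  interpret P: bounded_function_algebra polydisc "Hinf_SAPn S" by (rule algebra_Hinf_SAPn)
  have Nk: "bounded_function_algebra (ball 0 1) (Hinf_SAP (S k))" for k by (rule algebra_Hinf_SAP)
  have topN: "topspace (?N k) = characters (ball 0 1) (Hinf_SAP (S k))" for k
    by (rule bounded_function_algebra.topspace_max_ideal_space[OF Nk])
  have E: "?E \<subseteq> topspace ?M" unfolding P.topspace_max_ideal_space using P.point_eval_characters by blast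
  have inj: "inj_on ?R (topspace ?M)"
    unfolding P.topspace_max_ideal_space by (rule inj_on_component_character[OF assms(2,3)])
  have cont: "continuous_map ?M (product_topology ?N UNIV) ?R"
    unfolding continuous_map_componentwise_UNIV
  proof
    fix k
    have "continuous_map ?M (product_topology (\<lambda>f. euclidean) (Hinf_SAP (S k))) (\<lambda>\<phi>. ?R \<phi> k)"
      unfolding continuous_map_componentwise
    proof (intro conjI ballI)
      show "(\<lambda>\<phi>. ?R \<phi> k) ` topspace ?M \<subseteq> extensional (Hinf_SAP (S k))"
        by (auto simp: component_character_def)
      fix f assume f: "f \<in> Hinf_SAP (S k)"
      show "continuous_map ?M euclidean (\<lambda>\<phi>. ?R \<phi> k f)"
        using P.continuous_map_eval[OF Hinf_SAPn_lift[where S = S and k = k, OF f]] f by (simp add: component_character_def)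
    qed
    then show "continuous_map ?M (?N k) (\<lambda>\<phi>. ?R \<phi> k)"
      unfolding max_ideal_space_def[of "ball 0 1"] continuous_map_in_subtopology
      using component_character[of _ S k] by (auto simp: P.topspace_max_ideal_space)
  qed
  have haus: "Hausdorff_space (product_topology ?N UNIV)"
    unfolding Hausdorff_space_product_topology
    using bounded_function_algebra.Hausdorff_max_ideal_space[OF Nk] by blast
  have dense: "?N k closure_of (point_eval (Hinf_SAP (S k)) ` ball 0 1) = topspace (?N k)" for k
  proof (intro equalityI closure_of_subset_topspace subsetI)
    fix \<phi> assume "\<phi> \<in> topspace (?N k)"
    then have \<phi>: "\<phi> \<in> characters (ball 0 1) (Hinf_SAP (S k))" by (simp add: topN)
    show "\<phi> \<in> ?N k closure_of (point_eval (Hinf_SAP (S k)) ` ball 0 1)"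
      by (rule bounded_function_algebra.closure_of_point_eval[OF Nk \<phi> subset_refl])
         (rule Hinf_SAP_characters_approx[OF assms(2,3) \<phi>])
  qed
  \<comment> \<open>Every tuple of evaluations on the discs is therefore the restriction of one
    evaluation on the polydisc.\<close>
  have eval: "?R (point_eval (Hinf_SAPn S) z) = (\<lambda>k. point_eval (Hinf_SAP (S k)) (z k))" if "z \<in> polydisc" for z
    using that Hinf_SAPn_lift[of _ S]
    by (auto simp: fun_eq_iff component_character_def point_eval_def lift_component_def)
  define X where "X = ?M closure_of ?E"
  have X: "X \<subseteq> topspace ?M" "closedin ?M X" "?E \<subseteq> X"
    unfolding X_def using closure_of_subset[OF E] by (auto simp: closure_of_subset_topspace)
  have "compactin ?M X" by (rule closedin_compact_space[OF P.compact_max_ideal_space X(2)])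
  then have "compactin (product_topology ?N UNIV) (?R ` X)" by (rule image_compactin[OF _ cont])
  then have "closedin (product_topology ?N UNIV) (?R ` X)" by (rule compactin_imp_closedin[OF haus])
  moreover have "(\<Pi>\<^sub>E k\<in>UNIV. point_eval (Hinf_SAP (S k)) ` ball 0 1) \<subseteq> ?R ` X"
  proof
    fix y assume "y \<in> (\<Pi>\<^sub>E k\<in>UNIV. point_eval (Hinf_SAP (S k)) ` ball 0 1)"
    then have "y k \<in> point_eval (Hinf_SAP (S k)) ` ball 0 1" for k by (simp add: PiE_iff)
    then have "\<forall>k. \<exists>w. norm w < 1 \<and> y k = point_eval (Hinf_SAP (S k)) w" by (simp add: image_iff Bex_def)
    then obtain z where z: "\<forall>k. norm (z k) < 1 \<and> y k = point_eval (Hinf_SAP (S k)) (z k)" by metis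
    then have zp: "z \<in> polydisc" by (simp add: polydisc_def)
    have "y = ?R (point_eval (Hinf_SAPn S) z)" unfolding eval[OF zp] using z by auto
    then show "y \<in> ?R ` X" using X(3) zp by blast
  qed
  ultimately have "product_topology ?N UNIV closure_of (\<Pi>\<^sub>E k\<in>UNIV. point_eval (Hinf_SAP (S k)) ` ball 0 1) \<subseteq> ?R ` X"
    by (rule closure_of_minimal[rotated])
  \<comment> \<open>The closure of a product is the product of the closures, so density on each disc
    gives density in the product.\<close>
  then have top: "topspace (product_topology ?N UNIV) \<subseteq> ?R ` X"
    unfolding closure_of_product_topology dense topspace_product_topology .
  have RM: "?R ` topspace ?M \<subseteq> topspace (product_topology ?N UNIV)"
    by (rule continuous_map_image_subset_topspace[OF cont])
  then have surj: "?R ` topspace ?M = topspace (product_topology ?N UNIV)" using top X(1) by blast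
  \<comment> \<open>\<open>?R\<close> maps \<open>X\<close> onto the product already, so by
    injectivity no character is left outside the closure of the evaluations.\<close>
  have "topspace ?M \<subseteq> X"
  proof
    fix \<phi> assume \<phi>: "\<phi> \<in> topspace ?M"
    then have "?R \<phi> \<in> ?R ` X" using top RM by blast
    then obtain \<psi> where "\<psi> \<in> X" "?R \<phi> = ?R \<psi>" by blast
    then show "\<phi> \<in> X" using inj_onD[OF inj, of \<phi> \<psi>] \<phi> X(1) by blast
  qed
  then have "X = topspace ?M" using X(1) by blast
  moreover have "homeomorphic_map ?M (product_topology ?N UNIV) ?R"
    by (rule continuous_imp_homeomorphic_map[OF cont P.compact_max_ideal_space haus surj inj])
  ultimately show ?thesis using E by (auto simp: X_def homeomorphic_map_imp_homeomorphic_space)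
qed

end
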